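(* Let $K$ be a field of characteristic zero and let $\mathfrak{M}$ be one of the following varieties of algebras over $K$: (1) a Nielsen-Schreier variety of algebras; (2) the variety of all associative algebras; (3) the variety of all associative and commutative algebras; (4) the variety of all metabelian Lie algebras. Let $A=K_{\mathfrak{M}}\langle x_1,\ldots,x_n\rangle$ be the free algebra of $\mathfrak{M}$ on $x_1,\ldots,x_n$. If $H$ is a subgroup of $\mathrm{Aut}(A)$ containing $\mathrm{Gr}_n$, then the tangent algebra $T(H)$ is a subalgebra of the algebra $\widetilde{\mathrm{SDer}}(A)$ of derivations of $A$ with constant divergence.
   Context: A variety of algebras is Nielsen-Schreier if every subalgebra of any free algebra of the variety is free (in the variety). A Lie algebra is metabelian if it satisfies $[[x,y],[z,t]]=0$. Algebras are vector spaces over $K$ with a bilinear multiplication. If $\mathfrak{M}$ is a unitary variety, $A$ is taken to have an identity element $1$. Grading: $A=A_0\oplus A_1\oplus\cdots$, $A_k$ the linear span of monomials of degree $k$; $A_0=K\cdot1$ if $A$ is unital and $A_0=0$ otherwise. For $F=(f_1,\ldots,f_n)\in A^n$, $D_F=f_1\partial_1+\cdots+f_n\partial_n$ is the unique derivation of $A$ with $x_i\mapsto f_i$. $L=\mathrm{Der}(A)=L_{-1}\oplus L_0\oplus L_1\oplus\cdots$, where $L_i$ consists of all $D_F$ with all $f_j\in A_{i+1}$ ($L_{-1}=0$ if $A$ is not unital). Tangent algebra: $\mathrm{Gr}_n$ is the group $\mathrm{Aff}_n(K)$ of affine automorphisms if $A$ is unital and the group $GL_n(K)$ of linear automorphisms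 otherwise. For $k\ge1$, $\mathrm{IA}(k)$ is the group of automorphisms $\phi$ of $A$ with $\phi(x_j)-x_j\in A_{k+1}+A_{k+2}+\cdots$ for all $j$. If $\phi\in\mathrm{IA}(i)\setminus\mathrm{IA}(i+1)$ and $\phi(x_j)=x_j+f_j+F_j$ with $f_j\in A_{i+1}$, $F_j\in A_{i+2}+A_{i+3}+\cdots$, then $T(\phi)=f_1\partial_1+\cdots+f_n\partial_n\in L_i$. For $H\supseteq\mathrm{Gr}_n$ put $H_i=H\cap\mathrm{IA}(i)$, $V_i(H)=\{0\}\cup\{T(\phi)\mid\phi\in H_i\setminus H_{i+1}\}$ for $i\ge1$, and $T(H)=L_{-1}\oplus L_0\oplus V_1(H)\oplus V_2(H)\oplus\cdots$ (a graded Lie subalgebra of $\mathrm{Der}(A)$). Universal enveloping algebra and divergence: regard $A$ as the subalgebra generated by $x_1,\ldots,x_n$ in the free algebra $B=K_{\mathfrak{M}}\langle x_1,\ldots,x_n,y_1,\ldots,y_n\rangle$, and let $\Omega_A$ be the set of elements of $B$ homogeneous of degree $1$ in the set of variables $y_1,\ldots,y_n$. $U=U(A)$ is the associative algebra with identity generated by all operators $L_a,R_a:\Omega_A\to\Omega_A$, $L_a(w)=aw$, $R_a(w)=wa$, $a\in A$. $\Omega_A=Uy_1\oplus\cdots\oplus Uy_n$ is a free left $U$-module on $y_1,\ldots,y_n$. The universal derivation $\mathcal{D}:A\to\Omega_A$ is the linear map with $\mathcal{D}(x_i)=y_i$ and $\mathcal{D}(ab)=L_a\mathcal{D}(b)+R_b\mathcal{D}(a)$;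 writing $\mathcal{D}(a)=\sum_i u_iy_i$ with unique $u_i\in U$, the Fox derivatives are $\frac{\partial a}{\partial x_i}=u_i$. The divergence $\mathrm{div}(D_F)$ of $D_F$ is the image of $\frac{\partial f_1}{\partial x_1}+\cdots+\frac{\partial f_n}{\partial x_n}$ in the quotient space $U/([U,U]+R)$, where $[U,U]$ is the linear span of commutators $uv-vu$ and $R=\mathrm{Rad}(U)$ is the Jacobson radical of $U$. $\widetilde{\mathrm{SDer}}(A)=L_{-1}\oplus L_0\oplus S_1\oplus S_2\oplus\cdots$, where $S_k=\{D\in L_k\mid\mathrm{div}(D)=0\}$; this is the Lie algebra of derivations with constant divergence (divergence in the image of $K$). *)

theory Defs
  imports "HOL-Algebra.Bij" "HOL-Algebra.QuotRing" "HOL-Algebra.Module" "HOL-Library.Poly_Mapping" "HOL-Library.Infinite_Typeclass"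
begin

section \<open>Algebras\<close>

text \<open>
  Not necessarily associative algebras over a field \<open>'k\<close> are records of type
  \<open>('k, 'a) module\<close>: carrier, bilinear product, addition and scalar action. The Boolean
  parameter \<open>u\<close> says whether the identity element \<open>\<one>\<close> belongs to the signature; if \<open>u\<close> is
  false, the field \<open>one\<close> of the record is meaningless.
\<close>

definition alg_hom :: "bool \<Rightarrow> ('k, 'a) module \<Rightarrow> ('k, 'b) module \<Rightarrow> ('a \<Rightarrow> 'b) set" where
  "alg_hom u A C = {\<phi> \<in> hom A C \<inter> hom (add_monoid A) (add_monoid C).
     (\<forall>c. \<forall>a\<in>carrier A. \<phi> (c \<odot>\<^bsub>A\<^esub> a) = c \<odot>\<^bsub>C\<^esub> \<phi> a) \<and> (u \<longrightarrow> \<phi> \<one>\<^bsub>A\<^esub> = \<one>\<^bsub>C\<^esub>)}"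

definition subalg :: "bool \<Rightarrow> ('k, 'a) module \<Rightarrow> 'a set \<Rightarrow> bool" where
  "subalg u A S \<longleftrightarrow> S \<subseteq> carrier A \<and> \<zero>\<^bsub>A\<^esub> \<in> S \<and> (u \<longrightarrow> \<one>\<^bsub>A\<^esub> \<in> S) \<and>
     (\<forall>a\<in>S. \<forall>b\<in>S. a \<oplus>\<^bsub>A\<^esub> b \<in> S \<and> a \<otimes>\<^bsub>A\<^esub> b \<in> S) \<and> (\<forall>c. \<forall>a\<in>S. c \<odot>\<^bsub>A\<^esub> a \<in> S)"

definition alg_Aut :: "bool \<Rightarrow> ('k, 'a) module \<Rightarrow> ('a \<Rightarrow> 'a) monoid" where
  "alg_Aut u A = BijGroup (carrier A) \<lparr>carrier := alg_hom u A A \<inter> Bij (carrier A)\<rparr>"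

inductive_set lin_span :: "('k, 'a) module \<Rightarrow> 'a set \<Rightarrow> 'a set"
  for A :: "('k, 'a) module" and S :: "'a set" where
  zero: "\<zero>\<^bsub>A\<^esub> \<in> lin_span A S"
| base: "a \<in> S \<Longrightarrow> a \<in> lin_span A S"
| add: "a \<in> lin_span A S \<Longrightarrow> b \<in> lin_span A S \<Longrightarrow> a \<oplus>\<^bsub>A\<^esub> b \<in> lin_span A S"
| scale: "a \<in> lin_span A S \<Longrightarrow> c \<odot>\<^bsub>A\<^esub> a \<in> lin_span A S"

text \<open>The product of this algebra is the commutator of derivations; elements are extensional.\<close>

definition Der :: "('k, 'a) module \<Rightarrow> ('k, 'a \<Rightarrow> 'a) module" where
  "Der A = \<lparr>carrier = {D \<in> extensional (carrier A) \<inter> hom (add_monoid A) (add_monoid A).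
       (\<forall>c. \<forall>a\<in>carrier A. D (c \<odot>\<^bsub>A\<^esub> a) = c \<odot>\<^bsub>A\<^esub> D a) \<and>
       (\<forall>a\<in>carrier A. \<forall>b\<in>carrier A. D (a \<otimes>\<^bsub>A\<^esub> b) = (D a \<otimes>\<^bsub>A\<^esub> b) \<oplus>\<^bsub>A\<^esub> (a \<otimes>\<^bsub>A\<^esub> D b))},
     mult = (\<lambda>D E. \<lambda>a\<in>carrier A. D (E a) \<ominus>\<^bsub>A\<^esub> E (D a)),
     one = undefined,
     zero = (\<lambda>a\<in>carrier A. \<zero>\<^bsub>A\<^esub>),
     add = (\<lambda>D E. \<lambda>a\<in>carrier A. D a \<oplus>\<^bsub>A\<^esub> E a),
     smult = (\<lambda>c D. \<lambda>a\<in>carrier A. c \<odot>\<^bsub>A\<^esub> D a)\<rparr>"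

section \<open>The Jacobson radical\<close>

definition left_ideal :: "('a, 'm) ring_scheme \<Rightarrow> 'a set \<Rightarrow> bool" where
  "left_ideal R I \<longleftrightarrow> additive_subgroup I R \<and> (\<forall>r\<in>carrier R. \<forall>a\<in>I. r \<otimes>\<^bsub>R\<^esub> a \<in> I)"

definition maximal_left_ideal :: "('a, 'm) ring_scheme \<Rightarrow> 'a set \<Rightarrow> bool" where
  "maximal_left_ideal R I \<longleftrightarrow> left_ideal R I \<and> I \<noteq> carrier R \<and>
     (\<forall>J. left_ideal R J \<and> I \<subseteq> J \<longrightarrow> J = I \<or> J = carrier R)"

definition jacobson_radical :: "('a, 'm) ring_scheme \<Rightarrow> 'a set" where
  "jacobson_radical R = {r \<in> carrier R. \<forall>I. maximal_left_ideal R I \<longrightarrow> r \<in> I}"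

section \<open>Nonassociative polynomials\<close>

text \<open>
  A monomial is \<open>None\<close> (the empty monomial \<open>1\<close>) or \<open>Some t\<close>, with \<open>t\<close> a nonassociative word.
\<close>

datatype 'v mag = Gen 'v | Node "'v mag" "'v mag"

fun mon_mult :: "'v mag option \<Rightarrow> 'v mag option \<Rightarrow> 'v mag option" where
  "mon_mult None b = b"
| "mon_mult a None = a"
| "mon_mult (Some s) (Some t) = Some (Node s t)"

type_synonym ('v, 'k) npoly = "'v mag option \<Rightarrow>\<^sub>0 'k"

definition np_mult :: "('v, 'k::field) npoly \<Rightarrow> ('v, 'k) npoly \<Rightarrow> ('v, 'k) npoly"
  (infixl \<open>\<star>\<close> 70) where
  "f \<star> g = (\<Sum>a\<in>Poly_Mapping.keys f. \<Sum>b\<in>Poly_Mapping.keys g.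
     Poly_Mapping.single (mon_mult a b) (Poly_Mapping.lookup f a * Poly_Mapping.lookup g b))"

definition np_var :: "'v \<Rightarrow> ('v, 'k::field) npoly" where
  "np_var v = Poly_Mapping.single (Some (Gen v)) 1"

definition NPoly :: "bool \<Rightarrow> 'v set \<Rightarrow> ('k::field, ('v, 'k) npoly) module" where
  "NPoly u V = \<lparr>carrier = {f. \<forall>m\<in>Poly_Mapping.keys f. (\<Union>t\<in>set_option m. set_mag t) \<subseteq> V \<and>
       (\<not> u \<longrightarrow> m \<noteq> None)},
     mult = (\<star>), one = Poly_Mapping.single None 1, zero = 0, add = (+),
     smult = (\<lambda>c. Poly_Mapping.map ((*) c))\<rparr>"

fun mag_eval :: "('k, 'a) module \<Rightarrow> ('v \<Rightarrow> 'a) \<Rightarrow> 'v mag \<Rightarrow> 'a" where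
  "mag_eval A \<rho> (Gen v) = \<rho> v"
| "mag_eval A \<rho> (Node s t) = mag_eval A \<rho> s \<otimes>\<^bsub>A\<^esub> mag_eval A \<rho> t"

definition np_eval :: "('k::field, 'a) module \<Rightarrow> ('v \<Rightarrow> 'a) \<Rightarrow> ('v, 'k) npoly \<Rightarrow> 'a" where
  "np_eval A \<rho> f = (\<Oplus>\<^bsub>A\<^esub>m\<in>Poly_Mapping.keys f.
     Poly_Mapping.lookup f m \<odot>\<^bsub>A\<^esub> (case m of None \<Rightarrow> \<one>\<^bsub>A\<^esub> | Some t \<Rightarrow> mag_eval A \<rho> t))"

section \<open>Varieties and their free algebras\<close>

text \<open>
  A variety is given by a set of identities in countably many variables, together with the
  information whether the identity element belongs to the signature. For varieties with identity
  element, polynomials may have a constant term, and free algebras and subalgebras contain \<open>1\<close>.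
\<close>

record (overloaded) 'k variety =
  unital :: bool
  identities :: "(nat, 'k) npoly set"

definition is_variety :: "'k::field variety \<Rightarrow> bool" where
  "is_variety M \<longleftrightarrow> identities M \<subseteq> carrier (NPoly (unital M) UNIV)"

text \<open>The identities of \<open>M\<close> in the variables \<open>V\<close>: the ideal of all consequences.\<close>

inductive_set T_ideal :: "'k::field variety \<Rightarrow> 'v set \<Rightarrow> ('v, 'k) npoly set"
  for M :: "'k variety" and V :: "'v set" where
  inst: "g \<in> identities M \<Longrightarrow> (\<And>i. \<rho> i \<in> carrier (NPoly (unital M) V)) \<Longrightarrow>
     np_eval (NPoly (unital M) V) \<rho> g \<in> T_ideal M V"
| zero: "0 \<in> T_ideal M V"
| add: "f \<in> T_ideal M V \<Longrightarrow> g \<in> T_ideal M V \<Longrightarrow> f + g \<in> T_ideal M V"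
| scale: "f \<in> T_ideal M V \<Longrightarrow> Poly_Mapping.map ((*) c) f \<in> T_ideal M V"
| mult_left: "f \<in> T_ideal M V \<Longrightarrow> h \<in> carrier (NPoly (unital M) V) \<Longrightarrow> h \<star> f \<in> T_ideal M V"
| mult_right: "f \<in> T_ideal M V \<Longrightarrow> h \<in> carrier (NPoly (unital M) V) \<Longrightarrow> f \<star> h \<in> T_ideal M V"

definition cls :: "'k::field variety \<Rightarrow> 'v set \<Rightarrow> ('v, 'k) npoly \<Rightarrow> ('v, 'k) npoly set" where
  "cls M V f = T_ideal M V +>\<^bsub>NPoly (unital M) V\<^esub> f"

definition free_alg :: "'k::field variety \<Rightarrow> 'v set \<Rightarrow> ('k, ('v, 'k) npoly set) module" where
  "free_alg M V = ring.extend (NPoly (unital M) V Quot T_ideal M V)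
     (module.fields (\<lambda>c X. \<Union>f\<in>X. cls M V (c \<odot>\<^bsub>NPoly (unital M) V\<^esub> f)))"

definition gen :: "'k::field variety \<Rightarrow> 'v set \<Rightarrow> 'v \<Rightarrow> ('v, 'k) npoly set" where
  "gen M V v = cls M V (np_var v)"

text \<open>
  \<open>C\<close> is free in \<open>M\<close> if it has a subset \<open>Y\<close> for which the canonical homomorphism from the free
  algebra on the set \<open>Y\<close> to \<open>C\<close> exists and is bijective.
\<close>

definition free_in :: "'k::field variety \<Rightarrow> ('k, 'a) module \<Rightarrow> bool" where
  "free_in M C \<longleftrightarrow> (\<exists>Y\<subseteq>carrier C. \<exists>\<phi>\<in>alg_hom (unital M) (free_alg M Y) C.
     bij_betw \<phi> (carrier (free_alg M Y)) (carrier C) \<and> (\<forall>y\<in>Y. \<phi> (gen M Y y) = y))"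

text \<open>
  A formula cannot quantify over types, so the free generators are taken from a type \<open>'v\<close>, which
  may be any infinite type. As a hypothesis this is implied by the condition on free algebras of
  arbitrary rank.
\<close>

definition nielsen_schreier :: "'v::infinite itself \<Rightarrow> 'k::field variety \<Rightarrow> bool" where
  "nielsen_schreier _ M \<longleftrightarrow> (\<forall>(V :: 'v set) S. subalg (unital M) (free_alg M V) S \<longrightarrow>
     free_in M (free_alg M V \<lparr>carrier := S\<rparr>))"

definition associative_ids :: "(nat, 'k::field) npoly set" where
  "associative_ids = (let x = np_var 0; y = np_var 1; z = np_var 2 in
     {(x \<star> y) \<star> z - x \<star> (y \<star> z)})"

definition commutative_ids :: "(nat, 'k::field) npoly set" where
  "commutative_ids = (let x = np_var 0; y = np_var 1 in {x \<star> y - y \<star> x})"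

definition lie_ids :: "(nat, 'k::field) npoly set" where
  "lie_ids = (let x = np_var 0; y = np_var 1; z = np_var 2 in
     {x \<star> x, (x \<star> y) \<star> z + (y \<star> z) \<star> x + (z \<star> x) \<star> y})"

definition metabelian_ids :: "(nat, 'k::field) npoly set" where
  "metabelian_ids = (let x = np_var 0; y = np_var 1; z = np_var 2; t = np_var 3 in
     {(x \<star> y) \<star> (z \<star> t)})"

section \<open>Grading\<close>

fun mag_deg :: "('v \<Rightarrow> nat) \<Rightarrow> 'v mag \<Rightarrow> nat" where
  "mag_deg w (Gen v) = w v"
| "mag_deg w (Node s t) = mag_deg w s + mag_deg w t"

text \<open>The linear span of the monomials whose degree with respect to the weights \<open>w\<close> lies in \<open>I\<close>.\<close>

definition graded_part :: "'k::field variety \<Rightarrow> 'v set \<Rightarrow> ('v \<Rightarrow> nat) \<Rightarrow> nat set \<Rightarrow> ('v, 'k) npoly set set"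
  where
  "graded_part M V w I = lin_span (free_alg M V)
     {cls M V f | f m. f = Poly_Mapping.single m 1 \<and> f \<in> carrier (NPoly (unital M) V) \<and>
        (case m of None \<Rightarrow> 0 | Some t \<Rightarrow> mag_deg w t) \<in> I}"

text \<open>
  \<open>Fr M n\<close> is the free algebra \<open>A\<close> on \<open>x\<^sub>0, \<dots>, x\<^sub>n\<^sub>-\<^sub>1\<close>.
\<close>

abbreviation Fr :: "'k::field variety \<Rightarrow> nat \<Rightarrow> ('k, (nat, 'k) npoly set) module" where
  "Fr M n \<equiv> free_alg M {..<n}"

abbreviation xgen :: "'k::field variety \<Rightarrow> nat \<Rightarrow> nat \<Rightarrow> (nat, 'k) npoly set" where
  "xgen M n \<equiv> gen M {..<n}"

definition homog :: "'k::field variety \<Rightarrow> nat \<Rightarrow> nat \<Rightarrow> (nat, 'k) npoly set set" where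
  "homog M n k = graded_part M {..<n} (\<lambda>_. 1) {k}"

definition homog_ge :: "'k::field variety \<Rightarrow> nat \<Rightarrow> nat \<Rightarrow> (nat, 'k) npoly set set" where
  "homog_ge M n k = graded_part M {..<n} (\<lambda>_. 1) {k..}"

definition der_of :: "'k::field variety \<Rightarrow> nat \<Rightarrow> (nat \<Rightarrow> (nat, 'k) npoly set) \<Rightarrow>
    (nat, 'k) npoly set \<Rightarrow> (nat, 'k) npoly set" where
  "der_of M n F = (THE d. d \<in> carrier (Der (Fr M n)) \<and> (\<forall>j<n. d (xgen M n j) = F j))"

text \<open>\<open>Lpart M n i\<close> is meant for \<open>i \<ge> -1\<close>.\<close>

definition Lpart :: "'k::field variety \<Rightarrow> nat \<Rightarrow> int \<Rightarrow>
    ((nat, 'k) npoly set \<Rightarrow> (nat, 'k) npoly set) set" where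
  "Lpart M n i = {d \<in> carrier (Der (Fr M n)). \<forall>j<n. d (xgen M n j) \<in> homog M n (nat (i + 1))}"

text \<open>The sum of \<open>C i\<close> over all \<open>i \<ge> -1\<close>, consisting of finite sums of elements.\<close>

definition graded_sum :: "'k::field variety \<Rightarrow> nat \<Rightarrow>
    (int \<Rightarrow> ((nat, 'k) npoly set \<Rightarrow> (nat, 'k) npoly set) set) \<Rightarrow>
    ((nat, 'k) npoly set \<Rightarrow> (nat, 'k) npoly set) set" where
  "graded_sum M n C = {(\<Oplus>\<^bsub>Der (Fr M n)\<^esub>i\<in>{-1..N}. d i) | N d. \<forall>i\<in>{-1..N}. d i \<in> C i}"

section \<open>Tangent algebras\<close>

definition Gr :: "'k::field variety \<Rightarrow> nat \<Rightarrow> ((nat, 'k) npoly set \<Rightarrow> (nat, 'k) npoly set) set" where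
  "Gr M n = {\<phi> \<in> carrier (alg_Aut (unital M) (Fr M n)). \<forall>j<n. \<phi> (xgen M n j) \<in>
     (if unital M then homog M n 0 <+>\<^bsub>Fr M n\<^esub> homog M n 1 else homog M n 1)}"

definition IA :: "'k::field variety \<Rightarrow> nat \<Rightarrow> nat \<Rightarrow>
    ((nat, 'k) npoly set \<Rightarrow> (nat, 'k) npoly set) set" where
  "IA M n k = {\<phi> \<in> carrier (alg_Aut (unital M) (Fr M n)).
     \<forall>j<n. \<phi> (xgen M n j) \<ominus>\<^bsub>Fr M n\<^esub> xgen M n j \<in> homog_ge M n (k + 1)}"

text \<open>\<open>tangent M n i \<phi>\<close> is the derivation \<open>T(\<phi>)\<close> for \<open>\<phi>\<close> in \<open>IA M n i - IA M n (i + 1)\<close>.\<close>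

definition tangent :: "'k::field variety \<Rightarrow> nat \<Rightarrow> nat \<Rightarrow>
    ((nat, 'k) npoly set \<Rightarrow> (nat, 'k) npoly set) \<Rightarrow> (nat, 'k) npoly set \<Rightarrow> (nat, 'k) npoly set" where
  "tangent M n i \<phi> = der_of M n (\<lambda>j. THE f. f \<in> homog M n (i + 1) \<and>
     (\<exists>F\<in>homog_ge M n (i + 2). \<phi> (xgen M n j) = xgen M n j \<oplus>\<^bsub>Fr M n\<^esub> f \<oplus>\<^bsub>Fr M n\<^esub> F))"

definition tangent_comp :: "'k::field variety \<Rightarrow> nat \<Rightarrow>
    ((nat, 'k) npoly set \<Rightarrow> (nat, 'k) npoly set) set \<Rightarrow> nat \<Rightarrow>
    ((nat, 'k) npoly set \<Rightarrow> (nat, 'k) npoly set) set" where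
  "tangent_comp M n H i =
     {\<zero>\<^bsub>Der (Fr M n)\<^esub>} \<union> tangent M n i ` ((H \<inter> IA M n i) - (H \<inter> IA M n (i + 1)))"

definition tangent_alg :: "'k::field variety \<Rightarrow> nat \<Rightarrow>
    ((nat, 'k) npoly set \<Rightarrow> (nat, 'k) npoly set) set \<Rightarrow>
    ((nat, 'k) npoly set \<Rightarrow> (nat, 'k) npoly set) set" where
  "tangent_alg M n H =
     graded_sum M n (\<lambda>i. if i \<le> 0 then Lpart M n i else tangent_comp M n H (nat i))"

section \<open>Universal enveloping algebra and divergence\<close>

text \<open>
  \<open>Fr2 M n\<close> is the free algebra \<open>B\<close> on \<open>x\<^sub>0, \<dots>, x\<^sub>n\<^sub>-\<^sub>1\<close> (tagged \<open>Inl\<close>) and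
  \<open>y\<^sub>0, \<dots>, y\<^sub>n\<^sub>-\<^sub>1\<close> (tagged \<open>Inr\<close>), and \<open>emb M n\<close> is the embedding of \<open>A\<close> into \<open>B\<close>.
\<close>

definition vars2 :: "nat \<Rightarrow> (nat + nat) set" where
  "vars2 n = Inl ` {..<n} \<union> Inr ` {..<n}"

abbreviation Fr2 :: "'k::field variety \<Rightarrow> nat \<Rightarrow> ('k, (nat + nat, 'k) npoly set) module" where
  "Fr2 M n \<equiv> free_alg M (vars2 n)"

abbreviation ygen :: "'k::field variety \<Rightarrow> nat \<Rightarrow> nat \<Rightarrow> (nat + nat, 'k) npoly set" where
  "ygen M n i \<equiv> gen M (vars2 n) (Inr i)"

definition emb :: "'k::field variety \<Rightarrow> nat \<Rightarrow> (nat, 'k) npoly set \<Rightarrow> (nat + nat, 'k) npoly set" where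
  "emb M n = (THE \<phi>. \<phi> \<in> extensional (carrier (Fr M n)) \<inter> alg_hom (unital M) (Fr M n) (Fr2 M n) \<and>
     (\<forall>i<n. \<phi> (xgen M n i) = gen M (vars2 n) (Inl i)))"

definition Omega :: "'k::field variety \<Rightarrow> nat \<Rightarrow> (nat + nat, 'k) npoly set set" where
  "Omega M n = graded_part M (vars2 n) (case_sum (\<lambda>_. 0) (\<lambda>_. 1)) {1}"

definition op_L :: "'k::field variety \<Rightarrow> nat \<Rightarrow> (nat, 'k) npoly set \<Rightarrow>
    (nat + nat, 'k) npoly set \<Rightarrow> (nat + nat, 'k) npoly set" where
  "op_L M n a = (\<lambda>w\<in>Omega M n. emb M n a \<otimes>\<^bsub>Fr2 M n\<^esub> w)"

definition op_R :: "'k::field variety \<Rightarrow> nat \<Rightarrow> (nat, 'k) npoly set \<Rightarrow>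
    (nat + nat, 'k) npoly set \<Rightarrow> (nat + nat, 'k) npoly set" where
  "op_R M n a = (\<lambda>w\<in>Omega M n. w \<otimes>\<^bsub>Fr2 M n\<^esub> emb M n a)"

inductive_set U_carrier :: "'k::field variety \<Rightarrow> nat \<Rightarrow>
    ((nat + nat, 'k) npoly set \<Rightarrow> (nat + nat, 'k) npoly set) set"
  for M :: "'k variety" and n :: nat where
  one: "(\<lambda>w\<in>Omega M n. w) \<in> U_carrier M n"
| left: "a \<in> carrier (Fr M n) \<Longrightarrow> op_L M n a \<in> U_carrier M n"
| right: "a \<in> carrier (Fr M n) \<Longrightarrow> op_R M n a \<in> U_carrier M n"
| add: "p \<in> U_carrier M n \<Longrightarrow> q \<in> U_carrier M n \<Longrightarrow>
     (\<lambda>w\<in>Omega M n. p w \<oplus>\<^bsub>Fr2 M n\<^esub> q w) \<in> U_carrier M n"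
| scale: "p \<in> U_carrier M n \<Longrightarrow> (\<lambda>w\<in>Omega M n. c \<odot>\<^bsub>Fr2 M n\<^esub> p w) \<in> U_carrier M n"
| mult: "p \<in> U_carrier M n \<Longrightarrow> q \<in> U_carrier M n \<Longrightarrow> compose (Omega M n) p q \<in> U_carrier M n"

definition Uenv :: "'k::field variety \<Rightarrow> nat \<Rightarrow>
    ('k, (nat + nat, 'k) npoly set \<Rightarrow> (nat + nat, 'k) npoly set) module" where
  "Uenv M n = \<lparr>carrier = U_carrier M n,
     mult = compose (Omega M n),
     one = (\<lambda>w\<in>Omega M n. w),
     zero = (\<lambda>w\<in>Omega M n. \<zero>\<^bsub>Fr2 M n\<^esub>),
     add = (\<lambda>p q. \<lambda>w\<in>Omega M n. p w \<oplus>\<^bsub>Fr2 M n\<^esub> q w),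
     smult = (\<lambda>c p. \<lambda>w\<in>Omega M n. c \<odot>\<^bsub>Fr2 M n\<^esub> p w)\<rparr>"

definition univ_der :: "'k::field variety \<Rightarrow> nat \<Rightarrow>
    (nat, 'k) npoly set \<Rightarrow> (nat + nat, 'k) npoly set" where
  "univ_der M n = (THE d. d \<in> extensional (carrier (Fr M n)) \<inter> (carrier (Fr M n) \<rightarrow> Omega M n) \<and>
     d \<in> hom (add_monoid (Fr M n)) (add_monoid (Fr2 M n)) \<and>
     (\<forall>c. \<forall>a\<in>carrier (Fr M n). d (c \<odot>\<^bsub>Fr M n\<^esub> a) = c \<odot>\<^bsub>Fr2 M n\<^esub> d a) \<and>
     (\<forall>i<n. d (xgen M n i) = ygen M n i) \<and>
     (\<forall>a\<in>carrier (Fr M n). \<forall>b\<in>carrier (Fr M n).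
        d (a \<otimes>\<^bsub>Fr M n\<^esub> b) = op_L M n a (d b) \<oplus>\<^bsub>Fr2 M n\<^esub> op_R M n b (d a)))"

text \<open>\<open>fox M n a i\<close> is the Fox derivative of \<open>a\<close> with respect to \<open>x\<^sub>i\<close>.\<close>

definition fox :: "'k::field variety \<Rightarrow> nat \<Rightarrow> (nat, 'k) npoly set \<Rightarrow> nat \<Rightarrow>
    (nat + nat, 'k) npoly set \<Rightarrow> (nat + nat, 'k) npoly set" where
  "fox M n a = (THE p. p \<in> {..<n} \<rightarrow>\<^sub>E carrier (Uenv M n) \<and>
     univ_der M n a = (\<Oplus>\<^bsub>Fr2 M n\<^esub>i\<in>{..<n}. p i (ygen M n i)))"

definition comm_rad :: "'k::field variety \<Rightarrow> nat \<Rightarrow>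
    ((nat + nat, 'k) npoly set \<Rightarrow> (nat + nat, 'k) npoly set) set" where
  "comm_rad M n = lin_span (Uenv M n)
       {(p \<otimes>\<^bsub>Uenv M n\<^esub> q) \<ominus>\<^bsub>Uenv M n\<^esub> (q \<otimes>\<^bsub>Uenv M n\<^esub> p) | p q. p \<in> carrier (Uenv M n) \<and> q \<in> carrier (Uenv M n)}
     <+>\<^bsub>Uenv M n\<^esub> jacobson_radical (Uenv M n)"

text \<open>
  The divergence is an element of the quotient space \<open>U/([U,U] + Rad U)\<close>, that is, a coset; the
  zero of the quotient is \<open>comm_rad M n\<close> itself.
\<close>

definition divergence :: "'k::field variety \<Rightarrow> nat \<Rightarrow>
    ((nat, 'k) npoly set \<Rightarrow> (nat, 'k) npoly set) \<Rightarrow>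
    ((nat + nat, 'k) npoly set \<Rightarrow> (nat + nat, 'k) npoly set) set" where
  "divergence M n d = comm_rad M n +>\<^bsub>Uenv M n\<^esub> (\<Oplus>\<^bsub>Uenv M n\<^esub>i\<in>{..<n}. fox M n (d (xgen M n i)) i)"

definition SDer_tilde :: "'k::field variety \<Rightarrow> nat \<Rightarrow>
    ((nat, 'k) npoly set \<Rightarrow> (nat, 'k) npoly set) set" where
  "SDer_tilde M n = graded_sum M n
     (\<lambda>i. if i \<le> 0 then Lpart M n i else {d \<in> Lpart M n i. divergence M n d = comm_rad M n})"

end

theory Submission
 imports Defs "HOL-Library.Function_Algebras" "HOL-Library.Product_Plus" "Jordan_Normal_Form.Determinant"
begin

text \<open>
The tangent algebra is closed under the operations because leading terms of automorphisms add under
composition and bracket under commutators. Multiples of a leading term come from polynomial families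
of automorphisms, obtained by conjugation with homotheties, and stability under \<open>L\<^sub>0\<close> and \<open>L\<^sub>-\<^sub>1\<close>
from conjugation with affine maps; a Vandermonde argument recovers the coefficients of a family.

For the divergence, consider an automorphism \<open>x + g + \<dots>\<close> with \<open>g\<close> homogeneous of degree \<open>e + 1\<close>. Its
Jacobian matrix over \<open>U\<close> is invertible. So for every matrix representation of \<open>U\<close> the determinant of
\<open>1 + t\<^sup>e J(g) + \<dots>\<close> is an invertible polynomial in \<open>t\<close>, hence constant, and the trace of the divergence of
\<open>g\<close> vanishes. An element of \<open>U\<close> all of whose traces vanish lies in \<open>[U, U] + Rad U\<close>: in the Nielsen-Schreier
case \<open>U\<close> is a free associative algebra, and for associative algebras it is the tensor product of two such
algebras; walks around a labelled cycle give representations that detect every cyclic word. For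
commutative algebras \<open>U\<close> is a polynomial ring, for metabelian Lie algebras it is one up to a left ideal of
square zero, and characters suffice.
\<close>

section \<open>Linear maps and polynomial families\<close>

text \<open>\<open>H\<close> is an arbitrary subgroup, not a closed or algebraic one, so even the
  linearity of its spaces of leading terms needs proof. Conjugation by the homothety with factor
  \<open>s\<close> multiplies a leading term of degree \<open>e + 1\<close> only by
  \<open>s ^ e\<close>; finite differences in \<open>s\<close> turn these powers into all scalars.
  For \<open>L_{-1}\<close> the obstacle is that conjugation by a translation leaves the groups
  \<open>IA(k)\<close>: it creates constant, linear and other low terms. Modulo identities these are
  of second order in the translation parameter, so they can be cancelled by families that leave the
  first order, where the bracket sits, undisturbed.

  In a Nielsen-Schreier variety the freeness of \<open>U\<close> comes from applying the hypothesis
  to subalgebras generated by the x_i and by elements linear in y: elements of the augmentation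
  ideal that are independent modulo its square turn out to be free.

  The computations are done with nonassociative polynomials modulo the ideal \<open>T\<close> of
  identities. Cosets, derivations and operators on \<open>Omega\<close> are treated as images of
  polynomials, so that no choice of normal forms is involved.\<close>

definition lin :: "('k => 'a::ab_group_add => 'a) => ('k => 'b::ab_group_add => 'b) => ('a => 'b) => bool" where
 "lin s1 s2 F \<longleftrightarrow> (\<forall>x y. F (x + y) = F x + F y) \<and> (\<forall>c x. F (s1 c x) = s2 c (F x))"

lemma linI: "(\<And>x y. F (x + y) = F x + F y) ==> (\<And>c x. F (s1 c x) = s2 c (F x)) ==> lin s1 s2 F"
 by (simp add: lin_def)

context
 fixes s1 :: "'k::field => 'a::ab_group_add => 'a" and s2 :: "'k => 'b::ab_group_add => 'b" and F
 assumes F: "lin s1 s2 F"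
begin

lemma lin_add: "F (x + y) = F x + F y" and lin_scale: "F (s1 c x) = s2 c (F x)"
 using F by (auto simp: lin_def)

lemma lin_0: "F 0 = 0"
 by (metis add_cancel_right_right lin_add)

lemma lin_neg: "F (- x) = - F x"
 by (metis add.right_inverse add_eq_0_iff lin_0 lin_add)

lemma lin_diff: "F (x - y) = F x - F y"
 using lin_add[of x "- y"] lin_neg by simp

lemma lin_sum: "F (sum g A) = (\<Sum>x\<in>A. F (g x))"
 by (induction A rule: infinite_finite_induct) (auto simp: lin_0 lin_add)

end

lemma lin_comp: "lin s1 s2 F ==> lin s2 s3 G ==> lin s1 s3 (%x. G (F x))"
 by (simp add: lin_def)

text \<open>Polynomial functions of \<open>t\<close> with coefficients in \<open>S\<close>, in
  Horner form: an induction meets the constant coefficient first and handles neither exponents nor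
  degrees.\<close>

inductive pf :: "('k::field => 'e::ab_group_add => 'e) => 'e set => ('k => 'e) => bool"
 for s :: "'k => 'e => 'e" and S :: "'e set" where
 zero: "pf s S (%_. 0)"
| step: "a \<in> S ==> pf s S f ==> pf s S (%t. a + s t (f t))"

lemma pf_mono: "pf s S f ==> S <= S' ==> pf s S' f"
 by (induction rule: pf.induct) (auto intro: pf.intros)

lemma pf_lin:
 assumes "pf s S f" "lin s s' F" "\<And>a. a \<in> S ==> F a \<in> S'"
 shows "pf s' S' (%t. F (f t))"
 using assms(1)
proof induction
 case zero
 thus ?case using assms(2) lin_0 pf.zero by metis
next
 case (step a f)
 have "(%t. F (a + s t (f t))) = (%t. F a + s' t (F (f t)))"
  using assms(2) by (auto simp: lin_def)
 thus ?case using pf.step[OF assms(3)[OF step(1)] step.IH] by simp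
qed

context vector_space
begin

lemma lin_scale_right: "lin scale scale (scale c)"
 by (simp add: lin_def scale_right_distrib)

lemma pf_const: "a \<in> S ==> pf scale S (%_. a)"
 using pf.step[OF _ pf.zero, of a S scale] by simp

lemma pf_in:
 assumes "subspace S" "pf scale S f" shows "f t \<in> S"
 using assms(2) by induction (auto simp: assms subspace_0 subspace_add subspace_scale)

lemma pf_add:
 assumes S: "subspace S" and "pf scale S f" "pf scale S g"
 shows "pf scale S (%t. f t + g t)"
 using assms(2,3)
proof (induction arbitrary: g)
 case zero
 thus ?case by simp
next
 case (step a f)
 note st = step
 from st(4) show ?case
 proof cases
  case zero
  thus ?thesis using st pf.step by simp
 next
  case (step b g')
  have "(%t. a + scale t (f t) + g t) = (%t. (a + b) + scale t (f t + g' t))"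
   by (auto simp: step scale_right_distrib algebra_simps)
  thus ?thesis
   using pf.step[OF _ st(3)[OF step(3)]] subspace_add[OF S st(1) step(2)] by simp
 qed
qed

lemma pf_scale:
 assumes "subspace S" "pf scale S f" shows "pf scale S (%t. scale c (f t))"
 by (rule pf_lin[OF assms(2) lin_scale_right]) (use assms subspace_scale in auto)

lemma pf_diff:
 assumes "subspace S" "pf scale S f" "pf scale S g" shows "pf scale S (%t. f t - g t)"
 using pf_add[OF assms(1,2) pf_scale[OF assms(1,3), of "-1"]] by simp

lemma pf_sum:
 assumes "subspace S" "\<And>i. i \<in> I ==> pf scale S (f i)"
 shows "pf scale S (%t. \<Sum>i\<in>I. f i t)"
 using assms(2) by (induction I rule: infinite_finite_induct) (auto intro: pf.zero pf_add assms)

lemma pf_tscale: "subspace S ==> pf scale S f ==> pf scale S (%t. scale t (f t))"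
 using pf.step[of 0 S scale f] subspace_0 by simp

lemma pf_tpow: "subspace S ==> pf scale S f ==> pf scale S (%t. scale (t ^ k) (f t))"
proof (induction k)
 case (Suc k)
 thus ?case using pf_tscale[OF Suc(2), of "%t. scale (t ^ k) (f t)"] by simp
qed simp

lemma pf_cpow: "pf scale S f ==> subspace S ==> pf scale S (%t. f (c * t ^ k))"
proof (induction rule: pf.induct)
 case zero
 show ?case by (rule pf.zero)
next
 case (step a f)
 have "pf scale S (%t. scale c (scale (t ^ k) (f (c * t ^ k))))"
  using pf_scale[OF step(4) pf_tpow[OF step(4)]] step by blast
 thus ?case using pf_add[OF step(4) pf_const[OF step(1)]] by simp
qed

lemma pf_shift: "pf scale S f ==> subspace S ==> pf scale S (%t. f (t + c))"
proof (induction rule: pf.induct)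
 case zero
 show ?case by (rule pf.zero)
next
 case (step a f)
 have "pf scale S (%t. scale t (f (t + c)) + scale c (f (t + c)))"
  using pf_add[OF step(4) pf_tscale[OF step(4)] pf_scale[OF step(4)]] step by blast
 thus ?case using pf_add[OF step(4) pf_const[OF step(1)]]
  by (simp add: scale_left_distrib)
qed

lemma pf_coeffs:
 assumes "pf scale S f" "0 \<in> S"
 obtains N a where "\<And>k. a k \<in> S" "f = (%t. \<Sum>k<N. scale (t ^ k) (a k))"
proof -
 have "\<exists>N a. (\<forall>k. a k \<in> S) \<and> f = (%t. \<Sum>k<N. scale (t ^ k) (a k))"
  using assms(1)
 proof induction
  case zero
  show ?case by (rule exI[of _ 0], rule exI[of _ "%_. 0"]) (use assms in auto)
 next
  case (step b f)
  then obtain N a where a: "\<forall>k. a k \<in> S" "f = (%t. \<Sum>k<N. scale (t ^ k) (a k))" by blast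
  show ?case
  proof (intro exI conjI)
   show "\<forall>k. (case k of 0 => b | Suc k => a k) \<in> S"
    using a step by (auto split: nat.split)
   show "(%t. b + scale t (f t)) =
     (%t. \<Sum>k<Suc N. scale (t ^ k) (case k of 0 => b | Suc k => a k))"
    by (rule ext, subst sum.lessThan_Suc_shift) (simp add: a(2) scale_sum_right)
  qed
 qed
 thus ?thesis using that by blast
qed

lemma pf_of_coeffs:
 assumes "subspace S" "\<And>k. k < N ==> a k \<in> S"
 shows "pf scale S (%t. \<Sum>k<N. scale (t ^ k) (a k))"
 by (intro pf_sum assms pf_tpow pf_const) (use assms in auto)

end

text \<open>Doubling the parameter and subtracting eliminates the top coefficient.\<close>

lemma (in vector_space) vandermonde_coeffs:
 assumes two: "\<And>k. (of_nat (Suc k) :: 'a) \<noteq> 0" and S: "subspace S"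
  and "\<And>t. t \<noteq> 0 ==> (\<Sum>k<N. scale (t ^ k) (a k)) \<in> S"
 shows "k < N ==> a k \<in> S"
 using assms(3)
proof (induction N arbitrary: a k)
 case 0
 thus ?case by simp
next
 case (Suc N)
 have two0: "(2::'a) \<noteq> 0" using two[of 1] by simp
 \<comment> \<open>Characteristic zero enters here, in the shape of the assumption
   \<open>two\<close>: distinct powers of 2 stay distinct in the field.\<close>
 have d: "(2::'a) ^ k - 2 ^ N \<noteq> 0" if "k < N" for k
 proof -
  have "(2::nat) ^ N - 2 ^ k > 0" using that by simp
  then obtain m where m: "(2::nat) ^ N = 2 ^ k + Suc m"
   by (metis add.commute add_Suc_right less_iff_Suc_add zero_less_diff)
  have "(2::'a) ^ N = 2 ^ k + of_nat (Suc m)"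
   using arg_cong[OF m, of "of_nat :: nat => 'a"] by (simp only: of_nat_add of_nat_power of_nat_numeral)
  thus ?thesis using two[of m] by (metis add_cancel_right_right eq_iff_diff_eq_0)
 qed
 have "scale ((2::'a) ^ k - 2 ^ N) (a k) \<in> S" if "k < N" for k
 proof (rule Suc.IH[OF that])
  fix t :: 'a assume t: "t \<noteq> 0"
  have 1: "(\<Sum>k<Suc N. scale ((2 * t) ^ k) (a k)) \<in> S" using Suc.prems(2)[of "2 * t"] t two0 by simp
  have 2: "scale (2 ^ N) (\<Sum>k<Suc N. scale (t ^ k) (a k)) \<in> S"
   using Suc.prems(2)[OF t] S subspace_scale by blast
  have e: "scale ((2 * t) ^ k) (a k) - scale (2 ^ N) (scale (t ^ k) (a k)) = scale (t ^ k) (scale (2 ^ k - 2 ^ N) (a k))" for k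
   by (simp add: scale_left_diff_distrib power_mult_distrib mult.commute scale_right_diff_distrib)
  have "(\<Sum>k<Suc N. scale ((2 * t) ^ k) (a k)) - scale (2 ^ N) (\<Sum>k<Suc N. scale (t ^ k) (a k))
    = (\<Sum>k<Suc N. scale (t ^ k) (scale (2 ^ k - 2 ^ N) (a k)))"
   unfolding scale_sum_right e[symmetric] by (rule sum_subtractf[symmetric])
  also have "\<dots> = (\<Sum>k<N. scale (t ^ k) (scale (2 ^ k - 2 ^ N) (a k)))" by simp
  finally have "(\<Sum>k<Suc N. scale ((2 * t) ^ k) (a k)) - scale (2 ^ N) (\<Sum>k<Suc N. scale (t ^ k) (a k))
    = (\<Sum>k<N. scale (t ^ k) (scale (2 ^ k - 2 ^ N) (a k)))" .
  thus "(\<Sum>k<N. scale (t ^ k) (scale (2 ^ k - 2 ^ N) (a k))) \<in> S"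
   using subspace_diff[OF S 1 2] by simp
 qed
 hence *: "a k \<in> S" if "k < N" for k
  using subspace_scale[OF S, of _ "inverse (2 ^ k - 2 ^ N)"] d[OF that] that
  by (metis left_inverse scale_one scale_scale)
 have "(\<Sum>k<N. a k) + a N \<in> S" using Suc.prems(2)[of 1] by simp
 hence "a N \<in> S"
  using subspace_diff[OF S _ subspace_sum[OF S, of "{..<N}" a]] * by fastforce
 with * Suc.prems(1) show ?case using less_Suc_eq by blast
qed

text \<open>Membership in \<open>S\<close> is a condition on the coefficients, so it extends to the
  value at 0, about which the hypothesis says nothing. This replaces passing to a limit.\<close>

lemma (in vector_space) vandermonde:
 assumes two: "\<And>k. (of_nat (Suc k) :: 'a) \<noteq> 0" and S: "subspace S"
  and f: "pf scale UNIV f" and "\<And>t. t \<noteq> 0 ==> f t \<in> S"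
 shows "pf scale S f"
proof -
 obtain N a where a: "f = (%t. \<Sum>k<N. scale (t ^ k) (a k))" using pf_coeffs[OF f] by blast
 show ?thesis unfolding a
  by (rule pf_of_coeffs[OF S], rule vandermonde_coeffs[OF two S, rotated]) (use assms(4) a in auto)
qed

lemma (in vector_space) vandermonde2:
 assumes two: "\<And>k. (of_nat (Suc k) :: 'a) \<noteq> 0" and S: "subspace S"
  and r: "pf scale UNIV r" and f: "\<And>t. t \<noteq> 0 ==> a + scale t (b + scale t (r t)) \<in> S"
 shows "a \<in> S" "b \<in> S" "pf scale S r"
proof -
 obtain N c where c: "r = (%t. \<Sum>k<N. scale (t ^ k) (c k))" using pf_coeffs[OF r] by blast
 let ?a = "%k. case k of 0 => a | Suc k => (case k of 0 => b | Suc k => c k)"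
 have "(\<Sum>k<Suc (Suc N). scale (t ^ k) (?a k)) = a + scale t (b + scale t (r t))" for t
  unfolding sum.lessThan_Suc_shift by (simp add: c scale_sum_right scale_right_distrib)
 hence *: "k < Suc (Suc N) ==> ?a k \<in> S" for k
  using vandermonde_coeffs[where N = "Suc (Suc N)" and a = ?a, OF two S] f by simp
 show "a \<in> S" "b \<in> S" using *[of 0] *[of 1] by simp_all
 have "c k \<in> S" if "k < N" for k using *[of "Suc (Suc k)"] that by simp
 thus "pf scale S r" unfolding c by (intro pf_of_coeffs S)
qed

section \<open>Nonassociative polynomials\<close>

type_synonym 'k np2 = "(nat + nat, 'k) npoly"

abbreviation sc :: "'k::field => ('v, 'k) npoly => ('v, 'k) npoly" where
 "sc c \<equiv> Poly_Mapping.map ((*) c)"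

abbreviation "lk \<equiv> Poly_Mapping.lookup"
abbreviation "ks \<equiv> Poly_Mapping.keys"
abbreviation mon :: "'v mag option => ('v, 'k::field) npoly" where
 "mon m \<equiv> Poly_Mapping.single m 1"

lemma lookup_sc [simp]: "lk (sc c f) m = c * lk f m"
 by (simp add: Poly_Mapping.map.rep_eq when_def)

interpretation np: vector_space "sc :: 'k::field => ('v, 'k) npoly => ('v, 'k) npoly"
 by unfold_locales (auto intro!: poly_mapping_eqI simp: lookup_add algebra_simps)

text \<open>Linear extension of \<open>h\<close> from a basis. The index type is left open because
  words, not only monomials, will serve as a basis.\<close>

definition lext :: "('k::field => 'e::ab_group_add => 'e) => ('m => 'e) => ('m \<Rightarrow>\<^sub>0 'k) => 'e" where
 "lext s h f = (\<Sum>m\<in>ks f. s (lk f m) (h m))"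

context vector_space
begin

lemma lext_superset:
 assumes "finite S" "ks f <= S"
 shows "lext scale h f = (\<Sum>m\<in>S. scale (lk f m) (h m))"
 unfolding lext_def by (rule sum.mono_neutral_left[OF assms]) (auto simp: in_keys_iff)

lemma lext_add: "lext scale h (f + g) = lext scale h f + lext scale h g"
proof -
 let ?S = "ks f \<union> ks g"
 have "lext scale h (f + g) = (\<Sum>m\<in>?S. scale (lk (f + g) m) (h m))"
  by (rule lext_superset) (use keys_add[of f g] in auto)
 also have "\<dots> = (\<Sum>m\<in>?S. scale (lk f m) (h m)) + (\<Sum>m\<in>?S. scale (lk g m) (h m))"
  by (simp add: lookup_add scale_left_distrib sum.distrib)
 finally show ?thesis by (simp add: lext_superset[of ?S])
qed

lemma lext_map: "lext scale h (Poly_Mapping.map ((*) c) f) = scale c (lext scale h f)"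
proof -
 have "ks (Poly_Mapping.map ((*) c) f) <= ks f" by (auto simp: in_keys_iff Poly_Mapping.map.rep_eq when_def)
 hence "lext scale h (Poly_Mapping.map ((*) c) f) = (\<Sum>m\<in>ks f. scale (c * lk f m) (h m))"
  by (subst lext_superset[of "ks f"]) (auto simp: Poly_Mapping.map.rep_eq when_def in_keys_iff intro!: sum.cong)
 thus ?thesis by (simp add: lext_def scale_sum_right)
qed

lemma lext_single [simp]: "lext scale h (Poly_Mapping.single m c) = scale c (h m)"
 by (simp add: lext_def)

lemma lext_0 [simp]: "lext scale h 0 = 0"
 by (simp add: lext_def)

lemma lext_cong: "(\<And>m. m \<in> ks f ==> h m = h' m) ==> lext scale h f = lext scale h' f"
 by (simp add: lext_def)

lemma lin_lext: "lin sc scale (lext scale h)"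
 by (simp add: lin_def lext_add lext_map)

end

lemma lext_mon: "lext sc mon f = f"
proof (rule poly_mapping_eqI)
 fix m
 have "lk (lext sc mon f) m = (\<Sum>m'\<in>ks f. if m' = m then lk f m' else 0)"
  unfolding lext_def lookup_sum lookup_sc lookup_single when_def by (rule sum.cong) auto
 also have "\<dots> = lk f m" by (subst sum.delta) (simp_all add: in_keys_iff)
 finally show "lk (lext sc mon f) m = lk f m" .
qed

lemma np_sum: "(f :: ('v, 'k::field) npoly) = (\<Sum>m\<in>ks f. sc (lk f m) (mon m))"
 using lext_mon[of f] by (simp add: lext_def)

lemma lin_lext_eq:
 assumes F: "lin sc s F" shows "F f = lext s (%m. F (mon m)) f"
 by (subst np_sum) (simp only: lin_sum[OF F] lin_scale[OF F] lext_def)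

lemma lin_eqI:
 assumes "lin sc s F" "lin sc s G" "\<And>m. m \<in> ks f ==> F (mon m) = G (mon m)"
 shows "F f = G f"
proof -
 have "F f = lext s (%m. F (mon m)) f" by (rule lin_lext_eq[OF assms(1)])
 also have "\<dots> = lext s (%m. G (mon m)) f" using assms(3) by (simp add: lext_def)
 also have "\<dots> = G f" by (rule lin_lext_eq[OF assms(2), symmetric])
 finally show ?thesis .
qed

lemma np_subspaceI: "np.subspace S ==> (\<And>m. m \<in> ks f ==> mon m \<in> S) ==> f \<in> S"
 by (subst np_sum) (intro np.subspace_sum np.subspace_scale)

lemma np_mult_lext: "f \<star> g = lext sc (%a. lext sc (%b. mon (mon_mult a b)) g) f"
 unfolding np_mult_def lext_def np.scale_sum_right
 by (intro sum.cong refl poly_mapping_eqI) (simp add: lookup_single when_def)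

lemma lin_lext_fun:
 assumes "vector_space s" "\<And>m. lin s0 s (%x. h x m)"
 shows "lin s0 s (%x. lext s (h x) f)"
proof -
 interpret vector_space s by fact
 show ?thesis
  using assms(2) by (intro linI) (auto simp: lin_def lext_def scale_right_distrib sum.distrib scale_sum_right
    scale_scale mult.commute intro!: sum.cong)
qed

lemma lin_mult_left: "lin sc sc (%f. f \<star> g)"
 unfolding np_mult_lext by (rule np.lin_lext)

lemma lin_mult_right: "lin sc sc (%g. f \<star> g)"
 unfolding np_mult_lext by (intro lin_lext_fun np.lin_lext np.vector_space_axioms)

lemma mon_mult_mon [simp]: "mon a \<star> mon b = mon (mon_mult a b)"
 by (simp add: np_mult_lext)

lemmas mult_simps = lin_add[OF lin_mult_left] lin_add[OF lin_mult_right]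
 lin_scale[OF lin_mult_left] lin_scale[OF lin_mult_right]
 lin_diff[OF lin_mult_left] lin_diff[OF lin_mult_right]
 lin_0[OF lin_mult_left] lin_0[OF lin_mult_right]

lemma mon_mult_None [simp]: "mon_mult a None = a"
 by (cases a) auto

lemma one_mult [simp]: "mon None \<star> f = f"
 by (rule lin_eqI[OF lin_mult_right, where G = "%f. f"]) (auto simp: lin_def)

lemma mult_one [simp]: "f \<star> mon None = f"
 by (rule lin_eqI[OF lin_mult_left, where G = "%f. f"]) (auto simp: lin_def)

abbreviation PP :: "bool => 'v set => ('v, 'k::field) npoly set" where
 "PP u V \<equiv> carrier (NPoly u V)"

definition okm :: "bool => 'v set => 'v mag option => bool" where
 "okm u V m \<longleftrightarrow> (\<Union>t\<in>set_option m. set_mag t) <= V \<and> (\<not> u \<longrightarrow> m \<noteq> None)"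

lemma PP_def: "f \<in> PP u V \<longleftrightarrow> (\<forall>m\<in>ks f. okm u V m)"
 by (auto simp: NPoly_def okm_def)

lemma okm_simps [simp]: "okm u V None = u" "okm u V (Some t) \<longleftrightarrow> set_mag t <= V"
 by (auto simp: okm_def)

lemma okm_mult: "okm u V a ==> okm u V b ==> okm u V (mon_mult a b)"
 by (cases a; cases b) auto

lemma subspace_keys: "np.subspace {f. \<forall>m\<in>ks f. P m}"
proof (rule np.subspaceI, goal_cases)
 case (2 f g)
 thus ?case using keys_add[of f g] by auto
qed (auto simp: in_keys_iff)

lemma subspace_PP: "np.subspace (PP u V)" (is "np.subspace ?P")
proof -
 have "?P = {f. \<forall>m\<in>ks f. okm u V m}" by (auto simp: PP_def)
 thus ?thesis using subspace_keys[of "okm u V"] by simp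
qed

lemma mon_PP [simp]: "mon m \<in> PP u V \<longleftrightarrow> okm u V m"
 by (auto simp: PP_def)

lemma var_PP [simp]: "np_var v \<in> PP u V \<longleftrightarrow> v \<in> V"
 by (simp add: np_var_def)

lemma PP_mono: "f \<in> PP u V ==> V <= V' ==> f \<in> PP u V'"
 unfolding PP_def okm_def by blast

lemma PP_mon: "f \<in> PP u V ==> m \<in> ks f ==> mon m \<in> PP u V"
 by (simp add: PP_def)

lemma bilin_closed:
 assumes "np.subspace S" "\<And>a b. a \<in> ks f ==> b \<in> ks g ==> mon (mon_mult a b) \<in> S"
 shows "f \<star> g \<in> S"
 unfolding np_mult_lext lext_def
 by (intro np.subspace_sum np.subspace_scale assms)

lemma PP_mult: "f \<in> PP u V ==> g \<in> PP u V ==> f \<star> g \<in> PP u V"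
 by (rule bilin_closed[OF subspace_PP]) (auto simp: PP_def intro: okm_mult)

section \<open>Evaluation in algebras given by types\<close>

fun meval :: "('e => 'e => 'e) => ('v => 'e) => 'v mag => 'e" where
 "meval mu xi (Gen v) = xi v"
| "meval mu xi (Node a b) = mu (meval mu xi a) (meval mu xi b)"

definition ev :: "('k::field => 'e::ab_group_add => 'e) => ('e => 'e => 'e) => 'e => ('v => 'e) =>
  ('v, 'k) npoly => 'e" where
 "ev s mu e xi = lext s (%m. case m of None => e | Some t => meval mu xi t)"

locale nalg = vector_space s for s :: "'k::field => 'e::ab_group_add => 'e" +
 fixes mu :: "'e => 'e => 'e" and e :: 'e and u :: bool
 assumes lin_l: "lin s s (%a. mu a b)" and lin_r: "lin s s (%b. mu a b)"
  and unit: "u ==> mu e a = a" "u ==> mu a e = a"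
begin

abbreviation "evl \<equiv> ev s mu e"

lemma lin_ev: "lin sc s (evl xi)"
 unfolding ev_def by (rule lin_lext)

lemmas ev_add = lin_add[OF lin_ev] and ev_sc = lin_scale[OF lin_ev] and ev_diff = lin_diff[OF lin_ev]
 and ev_0 = lin_0[OF lin_ev] and ev_sum = lin_sum[OF lin_ev]

lemma ev_mon [simp]: "evl xi (mon None) = e" "evl xi (mon (Some t)) = meval mu xi t"
 by (simp_all add: ev_def)

lemma ev_var [simp]: "evl xi (np_var v) = xi v"
 by (simp add: np_var_def)

lemma ev_mult_mon: "okm u UNIV a ==> okm u UNIV b ==> evl xi (mon (mon_mult a b)) = mu (evl xi (mon a)) (evl xi (mon b))"
 by (cases a; cases b) (auto simp: unit)

text \<open>The restriction to \<open>PP u UNIV\<close> excludes constant terms unless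
  \<open>e\<close> is a unit; otherwise the value \<open>e\<close> of the empty monomial is
  arbitrary.\<close>

lemma ev_mult:
 assumes "f \<in> PP u UNIV" "g \<in> PP u UNIV"
 shows "evl xi (f \<star> g) = mu (evl xi f) (evl xi g)"
proof -
 have 1: "evl xi (mon a \<star> g) = mu (evl xi (mon a)) (evl xi g)" if a: "okm u UNIV a" for a
 proof (rule lin_eqI[of s "%g. evl xi (mon a \<star> g)" "%g. mu (evl xi (mon a)) (evl xi g)"])
  show "lin sc s (%g. evl xi (mon a \<star> g))" by (rule lin_comp[OF lin_mult_right lin_ev])
  show "lin sc s (%g. mu (evl xi (mon a)) (evl xi g))" by (rule lin_comp[OF lin_ev lin_r])
  fix m assume "m \<in> ks g"
  hence "okm u UNIV m" using assms(2) by (simp add: PP_def)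
  thus "evl xi (mon a \<star> mon m) = mu (evl xi (mon a)) (evl xi (mon m))"
   using a by (simp only: mon_mult_mon ev_mult_mon)
 qed
 show ?thesis
 proof (rule lin_eqI[of s "%f. evl xi (f \<star> g)" "%f. mu (evl xi f) (evl xi g)"])
  show "lin sc s (%f. evl xi (f \<star> g))" by (rule lin_comp[OF lin_mult_left lin_ev])
  show "lin sc s (%f. mu (evl xi f) (evl xi g))" by (rule lin_comp[OF lin_ev lin_l])
  fix m assume "m \<in> ks f"
  hence "okm u UNIV m" using assms(1) by (simp add: PP_def)
  thus "evl xi (mon m \<star> g) = mu (evl xi (mon m)) (evl xi g)" by (rule 1)
 qed
qed

lemma ev_cong:
 assumes "f \<in> PP w V" "\<And>v. v \<in> V ==> xi v = xi' v" shows "evl xi f = evl xi' f"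
proof -
 have "meval mu xi t = meval mu xi' t" if "set_mag t <= V" for t
  using that by (induction t) (auto simp: assms)
 thus ?thesis unfolding ev_def
  using assms(1) by (intro lext_cong) (auto simp: PP_def okm_def split: option.split)
qed

end

text \<open>Polynomials form a unital algebra whatever the signature of the variety, so substitution
  is multiplicative without side conditions.\<close>

interpretation np: nalg "sc :: 'k::field => ('v, 'k) npoly => _" "(\<star>)" "mon None" True
 by unfold_locales (simp_all add: lin_mult_left lin_mult_right)

abbreviation subst :: "('v => ('w, 'k::field) npoly) => ('v, 'k) npoly => ('w, 'k) npoly" where
 "subst \<equiv> ev sc (\<star>) (mon None)"

lemma PP_True [simp]: "f \<in> PP True UNIV"
 by (auto simp: PP_def okm_def)

lemma subst_mult [simp]: "subst ro (f \<star> g) = subst ro f \<star> subst ro g"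
 by (rule np.ev_mult) auto

lemma subst_PP:
 assumes "f \<in> PP u V" "\<And>v. v \<in> V ==> ro v \<in> PP u V'" shows "subst ro f \<in> PP u V'"
proof -
 have t: "meval (\<star>) ro t \<in> PP u V'" if "set_mag t <= V" for t
  using that by (induction t) (auto simp: assms PP_mult)
 have "subst ro (mon m) \<in> PP u V'" if "m \<in> ks f" for m
  using that assms(1) t by (cases m) (auto simp: PP_def[of f])
 thus ?thesis unfolding lin_lext_eq[OF np.lin_ev, of ro f] lext_def
  by (intro np.subspace_sum np.subspace_scale subspace_PP)
qed

context nalg
begin

lemma ev_subst:
 assumes "f \<in> PP u V" "\<And>v. v \<in> V ==> ro v \<in> PP u UNIV"
 shows "evl xi (subst ro f) = evl (%v. evl xi (ro v)) f"
proof (rule lin_eqI[of s "%f. evl xi (subst ro f)"])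
 show "lin sc s (%f. evl xi (subst ro f))" by (rule lin_comp[OF np.lin_ev lin_ev])
 fix m assume "m \<in> ks f"
 hence m: "okm u V m" using assms(1) by (simp add: PP_def)
 have t: "meval (\<star>) ro t \<in> PP u UNIV \<and> evl xi (meval (\<star>) ro t) = meval mu (%v. evl xi (ro v)) t" if "set_mag t <= V" for t
  using that by (induction t) (auto simp: assms PP_mult ev_mult)
 show "evl xi (subst ro (mon m)) = evl (%v. evl xi (ro v)) (mon m)"
  using m t by (cases m) auto
qed (rule lin_ev)

end

lemma subst_subst: "subst xi (subst ro f) = subst (%v. subst xi (ro v)) f"
 by (rule np.ev_subst[of f UNIV]) auto

lemma subst_var [simp]: "subst np_var f = f"
proof -
 have t: "meval (\<star>) np_var t = mon (Some t)" for t :: "'a mag"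
  by (induction t) (auto simp: np_var_def)
 have 1: "subst np_var (mon m) = mon m" for m :: "'a mag option"
  by (cases m) (simp_all only: np.ev_mon t)
 have 2: "lin sc sc (%f. f)" by (simp add: lin_def)
 show ?thesis by (rule lin_eqI[OF np.lin_ev 2]) (rule 1)
qed

section \<open>First-order Taylor expansions of families\<close>

definition jet :: "('k::field => 'e::ab_group_add => 'e) => 'e set => ('k => 'e) => 'e => 'e => bool" where
 "jet s S f a b \<longleftrightarrow> a \<in> S \<and> b \<in> S \<and> (\<exists>r. pf s S r \<and> (\<forall>t. f t = a + s t (b + s t (r t))))"

context vector_space
begin

lemma jet_pf: "subspace S ==> jet scale S f a b ==> pf scale S f"
proof -
 assume S: "subspace S" and j: "jet scale S f a b"
 then obtain r where r: "pf scale S r" "\<forall>t. f t = a + scale t (b + scale t (r t))" and ab: "a \<in> S" "b \<in> S"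
  by (auto simp: jet_def)
 have "f = (%t. a + scale t (b + scale t (r t)))" using r by auto
 moreover have "pf scale S (%t. a + scale t (b + scale t (r t)))" by (intro pf.step ab r)
 ultimately show ?thesis by simp
qed

lemma jet_of_pf:
 assumes S: "subspace S" and "pf scale S f" obtains a b where "jet scale S f a b"
proof -
 have *: "\<exists>a r. a \<in> S \<and> pf scale S r \<and> f = (%t. a + scale t (r t))" if "pf scale S f" for f
  using that
 proof cases
  case zero
  thus ?thesis using subspace_0[OF S] pf.zero by (intro exI[of _ 0] exI[of _ "%_. 0"]) auto
 qed blast
 obtain a r where "a \<in> S" "pf scale S r" "f = (%t. a + scale t (r t))" using *[OF assms(2)] by blast
 moreover obtain b r' where "b \<in> S" "pf scale S r'" "r = (%t. b + scale t (r' t))" using *[OF \<open>pf scale S r\<close>] by blast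
 ultimately have "jet scale S f a b" unfolding jet_def by blast
 thus ?thesis by (rule that)
qed

lemma jet_const: "subspace S ==> a \<in> S ==> jet scale S (%_. a) a 0"
 unfolding jet_def using subspace_0 pf.zero by (intro conjI exI[of _ "%_. 0"]) auto

lemma jet_add:
 assumes S: "subspace S" and "jet scale S f a b" "jet scale S g a' b'"
 shows "jet scale S (%t. f t + g t) (a + a') (b + b')"
proof -
 obtain r r' where "pf scale S r" "\<And>t. f t = a + scale t (b + scale t (r t))"
  "pf scale S r'" "\<And>t. g t = a' + scale t (b' + scale t (r' t))" "a \<in> S" "b \<in> S" "a' \<in> S" "b' \<in> S"
  using assms by (auto simp: jet_def)
 thus ?thesis unfolding jet_def
  by (intro conjI exI[of _ "%t. r t + r' t"] allI pf_add subspace_add S)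
   (simp_all add: scale_right_distrib ac_simps)
qed

lemma jet_scale:
 assumes S: "subspace S" and "jet scale S f a b"
 shows "jet scale S (%t. scale c (f t)) (scale c a) (scale c b)"
proof -
 obtain r where "pf scale S r" "\<And>t. f t = a + scale t (b + scale t (r t))" "a \<in> S" "b \<in> S"
  using assms by (auto simp: jet_def)
 thus ?thesis unfolding jet_def
  by (intro conjI exI[of _ "%t. scale c (r t)"] allI pf_scale subspace_scale S)
   (simp_all add: scale_right_distrib mult.commute)
qed

lemma jet_diff:
 assumes S: "subspace S" and "jet scale S f a b" "jet scale S g a' b'"
 shows "jet scale S (%t. f t - g t) (a - a') (b - b')"
 using jet_add[OF S assms(2) jet_scale[OF S assms(3), of "-1"]] by simp

lemma jet_sum:
 assumes S: "subspace S" and "\<And>i. i \<in> I ==> jet scale S (f i) (a i) (b i)"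
 shows "jet scale S (%t. \<Sum>i\<in>I. f i t) (\<Sum>i\<in>I. a i) (\<Sum>i\<in>I. b i)"
 using assms(2)
proof (induction I rule: infinite_finite_induct)
 case (insert x F)
 thus ?case using jet_add[OF S, of "f x" "a x" "b x"] by simp
qed (simp_all add: jet_const S subspace_0)

end

lemma jet_lin:
 assumes "jet s S f a b" "lin s s' F" "\<And>a. a \<in> S ==> F a \<in> S'"
 shows "jet s' S' (%t. F (f t)) (F a) (F b)"
proof -
 obtain r where "pf s S r" "\<And>t. f t = a + s t (b + s t (r t))" "a \<in> S" "b \<in> S"
  using assms by (auto simp: jet_def)
 moreover from this have "pf s' S' (%t. F (r t))" using assms pf_lin by blast
 ultimately show ?thesis unfolding jet_def
  by (intro conjI exI[of _ "%t. F (r t)"] allI)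
   (simp_all add: lin_add[OF assms(2)] lin_scale[OF assms(2)] assms(3))
qed

lemma pf_mult:
 assumes S: "np.subspace S''" "\<And>a b. a \<in> S ==> b \<in> S' ==> a \<star> b \<in> S''"
  and "pf sc S f" "pf sc S' g"
 shows "pf sc S'' (%t. f t \<star> g t)"
 using assms(3)
proof induction
 case zero
 thus ?case by (simp add: mult_simps pf.zero)
next
 case (step a f)
 have "pf sc S'' (%t. a \<star> g t)"
  by (rule pf_lin[OF assms(4) lin_mult_right]) (rule S(2)[OF step(1)])
 from np.pf_add[OF S(1) this np.pf_tscale[OF S(1) step.IH]] show ?case by (simp add: mult_simps)
qed

lemma jet_mult:
 assumes f: "jet sc (PP u V) f a b" and g: "jet sc (PP u V) g a' b'"
 shows "jet sc (PP u V) (%t. f t \<star> g t) (a \<star> a') (b \<star> a' + a \<star> b')"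
proof -
 note S = subspace_PP[of u V]
 obtain r where r: "pf sc (PP u V) r" "\<And>t. f t = a + sc t (b + sc t (r t))" "a \<in> PP u V" "b \<in> PP u V"
  using f by (auto simp: jet_def)
 obtain r' where r': "pf sc (PP u V) r'" "\<And>t. g t = a' + sc t (b' + sc t (r' t))" "a' \<in> PP u V" "b' \<in> PP u V"
  using g by (auto simp: jet_def)
 note pm = pf_mult[OF S PP_mult]
 show ?thesis unfolding jet_def
 proof (intro conjI exI allI)
  show "pf sc (PP u V) (%t. a \<star> r' t + r t \<star> a' + (b + sc t (r t)) \<star> (b' + sc t (r' t)))"
   using r r' S by (auto intro!: np.pf_add pm np.pf_const np.pf_tscale)
  show "f t \<star> g t = a \<star> a' + sc t (b \<star> a' + a \<star> b' +
    sc t (a \<star> r' t + r t \<star> a' + (b + sc t (r t)) \<star> (b' + sc t (r' t))))" for t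
   by (simp add: r r' mult_simps np.scale_right_distrib ac_simps)
  show "a \<star> a' \<in> PP u V" "b \<star> a' + a \<star> b' \<in> PP u V"
   by (intro np.subspace_add S PP_mult r r')+
 qed
qed

section \<open>Derivations along homomorphisms\<close>

fun dmag :: "('v => ('w, 'k::field) npoly) => ('v => ('w, 'k) npoly) => 'v mag => ('w, 'k) npoly" where
 "dmag xi F (Gen v) = F v"
| "dmag xi F (Node a b) = dmag xi F a \<star> meval (\<star>) xi b + meval (\<star>) xi a \<star> dmag xi F b"

text \<open>A derivation along the homomorphism \<open>subst xi\<close>. With
  \<open>xi = np_var\<close> it is an ordinary derivation, with \<open>xi = xv\<close> and values
  linear in the y variables a Fox differential, and when \<open>xi\<close> kills y it extracts the
  part linear in y.\<close>

definition der :: "('v => ('w, 'k::field) npoly) => ('v => ('w, 'k) npoly) => ('v, 'k) npoly => ('w, 'k) npoly" where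
 "der xi F = lext sc (%m. case m of None => 0 | Some t => dmag xi F t)"

lemma lin_der: "lin sc sc (der xi F)"
 unfolding der_def by (rule np.lin_lext)

lemmas der_add = lin_add[OF lin_der] and der_sc = lin_scale[OF lin_der] and der_diff = lin_diff[OF lin_der]
 and der_0 = lin_0[OF lin_der] and der_sum = lin_sum[OF lin_der]

lemma der_mon [simp]: "der xi F (mon None) = 0" "der xi F (mon (Some t)) = dmag xi F t"
 by (simp_all add: der_def)

lemma der_var [simp]: "der xi F (np_var v) = F v"
 by (simp add: np_var_def)

lemma der_mult: "der xi F (f \<star> g) = der xi F f \<star> subst xi g + subst xi f \<star> der xi F g"
proof -
 have 0: "der xi F (mon (mon_mult a b)) =
   der xi F (mon a) \<star> subst xi (mon b) + subst xi (mon a) \<star> der xi F (mon b)" for a b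
  by (cases a; cases b) (simp_all add: mult_simps)
 have 1: "der xi F (mon a \<star> g) = der xi F (mon a) \<star> subst xi g + subst xi (mon a) \<star> der xi F g" for a
 proof (rule lin_eqI[of sc "%g. der xi F (mon a \<star> g)"])
  show "lin sc sc (%g. der xi F (mon a \<star> g))" by (rule lin_comp[OF lin_mult_right lin_der])
  show "lin sc sc (%g. der xi F (mon a) \<star> subst xi g + subst xi (mon a) \<star> der xi F g)"
   by (rule linI) (simp_all add: mult_simps np.ev_add np.ev_sc der_add der_sc np.scale_right_distrib)
 qed (simp only: 0 mon_mult_mon)
 show ?thesis
 proof (rule lin_eqI[of sc "%f. der xi F (f \<star> g)"])
  show "lin sc sc (%f. der xi F (f \<star> g))" by (rule lin_comp[OF lin_mult_left lin_der])
  show "lin sc sc (%f. der xi F f \<star> subst xi g + subst xi f \<star> der xi F g)"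
   by (rule linI) (simp_all add: mult_simps np.ev_add np.ev_sc der_add der_sc np.scale_right_distrib)
 qed (rule 1)
qed

text \<open>Linear maps are compared on monomials; the empty monomial is treated separately because
 all the maps below preserve or kill it.\<close>

lemma lin_mag_eqI:
 assumes "lin sc sc F" "lin sc sc G" "f \<in> PP u V" "F (mon None) = G (mon None)"
  "\<And>v. v \<in> V ==> F (np_var v) = G (np_var v)"
  "\<And>a b. set_mag a <= V ==> set_mag b <= V ==> F (mon (Some a)) = G (mon (Some a)) ==> F (mon (Some b)) = G (mon (Some b)) ==>
   F (mon (Some a) \<star> mon (Some b)) = G (mon (Some a) \<star> mon (Some b))"
 shows "F f = G f"
proof (rule lin_eqI[OF assms(1,2)])
 have "set_mag t <= V ==> F (mon (Some t)) = G (mon (Some t))" for t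
 proof (induction t)
  case (Gen v)
  thus ?case using assms(5)[of v] by (simp add: np_var_def)
 next
  case (Node a b)
  thus ?case using assms(6)[of a b] by simp
 qed
 thus "F (mon m) = G (mon m)" if "m \<in> ks f" for m
  using that assms(3,4) by (cases m) (auto simp: PP_def)
qed

lemma der_cong:
 assumes "f \<in> PP u V" "\<And>v. v \<in> V ==> xi v = xi' v" "\<And>v. v \<in> V ==> F v = F' v"
 shows "der xi F f = der xi' F' f"
proof (rule lin_mag_eqI[OF lin_der lin_der assms(1)])
 fix a b assume V: "set_mag a <= V" "set_mag b <= V"
  and "der xi F (mon (Some a)) = der xi' F' (mon (Some a))" "der xi F (mon (Some b)) = der xi' F' (mon (Some b))"
 moreover have "subst xi (mon (Some a)) = subst xi' (mon (Some a))" "subst xi (mon (Some b)) = subst xi' (mon (Some b))"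
  using np.ev_cong[of "mon (Some a)" True V xi xi'] np.ev_cong[of "mon (Some b)" True V xi xi'] V assms(2)
  by auto
 ultimately show "der xi F (mon (Some a) \<star> mon (Some b)) = der xi' F' (mon (Some a) \<star> mon (Some b))"
  unfolding der_mult by simp
qed (use assms in simp_all)

lemma subst_der: "subst ro (der xi F f) = der (%v. subst ro (xi v)) (%v. subst ro (F v)) f"
 by (rule lin_mag_eqI[OF lin_comp[OF lin_der np.lin_ev] lin_der PP_True])
  (simp_all only: der_mult np.ev_add subst_mult subst_subst der_var der_mon np.ev_0)

text \<open>The chain rule, which later becomes the multiplicativity of Jacobian matrices.\<close>

lemma der_subst: "der xi F (subst ro f) = der (%v. subst xi (ro v)) (%v. der xi F (ro v)) f"
 by (rule lin_mag_eqI[OF lin_comp[OF np.lin_ev lin_der] lin_der PP_True])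
  (simp_all only: der_mult np.ev_var subst_mult subst_subst der_var np.ev_mon(1) der_mon(1))

lemma der_tuple_add: "der xi (%v. F v + G v) f = der xi F f + der xi G f"
proof (rule lin_mag_eqI[OF lin_der _ PP_True])
 show "lin sc sc (%f. der xi F f + der xi G f)"
  by (rule linI) (simp_all only: der_add der_sc np.scale_right_distrib ac_simps)
 show "der xi (%v. F v + G v) (mon None) = der xi F (mon None) + der xi G (mon None)" by simp
qed (simp_all only: der_mult der_var mult_simps ac_simps)

lemma der_tuple_sc: "der xi (%v. sc c (F v)) f = sc c (der xi F f)"
proof (rule lin_mag_eqI[OF lin_der _ PP_True])
 show "lin sc sc (%f. sc c (der xi F f))"
  by (rule linI) (simp_all add: der_add der_sc np.scale_right_distrib mult.commute)
 show "der xi (%v. sc c (F v)) (mon None) = sc c (der xi F (mon None))" by simp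
qed (simp_all only: der_mult der_var mult_simps np.scale_right_distrib)

lemma der_PP:
 assumes "f \<in> PP u V" "\<And>v. v \<in> V ==> xi v \<in> PP u V'" "\<And>v. v \<in> V ==> F v \<in> PP u V'"
 shows "der xi F f \<in> PP u V'"
proof -
 have e: "meval (\<star>) xi t \<in> PP u V'" if "set_mag t <= V" for t
  using subst_PP[of "mon (Some t)" u V xi V'] that assms by simp
 have "dmag xi F t \<in> PP u V'" if "set_mag t <= V" for t
  using that by (induction t) (auto intro!: np.subspace_add subspace_PP PP_mult e assms)
 hence "der xi F (mon m) \<in> PP u V'" if "m \<in> ks f" for m
  using that assms(1) np.subspace_0[OF subspace_PP] by (cases m) (auto simp: PP_def[of f])
 thus ?thesis unfolding lin_lext_eq[OF lin_der, of xi F f] lext_def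
  by (intro np.subspace_sum np.subspace_scale subspace_PP)
qed

text \<open>\<open>der\<close> is the derivative of substitution at \<open>xi\<close> in the
  direction \<open>F\<close>. Facts on derivations thereby reduce to facts on homomorphisms.\<close>

lemma jet_subst:
 assumes f: "f \<in> PP u V" and ro: "\<And>v. v \<in> V ==> jet sc (PP u V') (%t. ro t v) (xi v) (F v)"
 shows "jet sc (PP u V') (%t. subst (ro t) f) (subst xi f) (der xi F f)"
proof -
 note S = subspace_PP[of u V']
 have m: "jet sc (PP u V') (%t. meval (\<star>) (ro t) m) (meval (\<star>) xi m) (dmag xi F m)" if "set_mag m <= V" for m
  using that by (induction m) (simp_all add: ro jet_mult)
 have "jet sc (PP u V') (%t. subst (ro t) (mon m)) (subst xi (mon m)) (der xi F (mon m))" if "m \<in> ks f" for m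
 proof -
  have "okm u V m" using f that by (simp add: PP_def)
  thus ?thesis
   using np.jet_const[OF S, of "mon None"] by (cases m) (simp_all add: m)
 qed
 thus ?thesis
  unfolding lin_lext_eq[OF lin_der, of xi F f] lin_lext_eq[OF np.lin_ev, of _ f] lext_def
  by (intro np.jet_sum np.jet_scale S)
qed

lemma pf_subst:
 assumes f: "pf sc (PP u V) f" and ro: "\<And>v. v \<in> V ==> pf sc (PP u V') (%t. ro t v)"
 shows "pf sc (PP u V') (%t. subst (ro t) (f t))"
 using f
proof induction
 case zero
 thus ?case by (simp add: np.ev_0 pf.zero)
next
 case (step a f)
 note S = subspace_PP[of u V']
 have "\<forall>v\<in>V. \<exists>ab. jet sc (PP u V') (%t. ro t v) (fst ab) (snd ab)"
  using np.jet_of_pf[OF S ro] by (metis fst_conv snd_conv)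
 then obtain ab where "\<And>v. v \<in> V ==> jet sc (PP u V') (%t. ro t v) (fst (ab v)) (snd (ab v))"
  by metis
 hence "jet sc (PP u V') (%t. subst (ro t) a) (subst (fst \<circ> ab) a) (der (fst \<circ> ab) (snd \<circ> ab) a)"
  using jet_subst[OF step(1), of V' ro "fst \<circ> ab" "snd \<circ> ab"] by (simp add: comp_def)
 from np.jet_pf[OF S this] np.pf_tscale[OF S step.IH] np.pf_add[OF S]
 show ?case by (simp add: np.ev_add np.ev_sc)
qed

section \<open>Homogeneous components\<close>

definition mdeg :: "('v => nat) => 'v mag option => nat" where
 "mdeg w m = (case m of None => 0 | Some t => mag_deg w t)"

lemma mdeg_simps [simp]: "mdeg w None = 0" "mdeg w (Some t) = mag_deg w t"
 "mdeg w (mon_mult a b) = mdeg w a + mdeg w b"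
 by (simp_all add: mdeg_def) (cases a; cases b; simp)

definition cmp :: "('v => nat) => nat => ('v, 'k::field) npoly => ('v, 'k) npoly" where
 "cmp w k = lext sc (%m. if mdeg w m = k then mon m else 0)"

definition hom_deg :: "('v => nat) => nat => ('v, 'k::field) npoly => bool" where
 "hom_deg w k f \<longleftrightarrow> (\<forall>m\<in>ks f. mdeg w m = k)"

lemma lin_cmp: "lin sc sc (cmp w k)"
 unfolding cmp_def by (rule np.lin_lext)

lemmas cmp_add = lin_add[OF lin_cmp] and cmp_sc = lin_scale[OF lin_cmp] and cmp_diff = lin_diff[OF lin_cmp]
 and cmp_0 [simp] = lin_0[OF lin_cmp] and cmp_sum = lin_sum[OF lin_cmp]

lemma cmp_mon: "cmp w k (mon m) = (if mdeg w m = k then mon m else 0)"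
 by (simp add: cmp_def)

lemma subspace_hom: "np.subspace {f. hom_deg w k f}"
 unfolding hom_deg_def by (rule subspace_keys)

lemma hom_0 [simp]: "hom_deg w k 0"
 and hom_add: "hom_deg w k f ==> hom_deg w k g ==> hom_deg w k (f + g)"
 and hom_sc: "hom_deg w k f ==> hom_deg w k (sc c f)"
 and hom_diff: "hom_deg w k f ==> hom_deg w k g ==> hom_deg w k (f - g)"
 and hom_sum: "(\<And>i. i \<in> I ==> hom_deg w k (h i)) ==> hom_deg w k (\<Sum>i\<in>I. h i)"
 using np.subspace_0[OF subspace_hom, of w k] np.subspace_add[OF subspace_hom, of f w k g] np.subspace_scale[OF subspace_hom, of f w k c]
  np.subspace_diff[OF subspace_hom, of f w k g] np.subspace_sum[OF subspace_hom, of I h w k] by auto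

lemma hom_mon [simp]: "hom_deg w k (mon m) \<longleftrightarrow> mdeg w m = k"
 by (simp add: hom_deg_def)

lemma hom_var [simp]: "hom_deg w k (np_var v) \<longleftrightarrow> w v = k"
 by (simp add: np_var_def)

lemma hom_cmp [simp]: "hom_deg w k (cmp w k f)"
 unfolding cmp_def lext_def by (intro hom_sum hom_sc) simp

lemma cmp_hom: "hom_deg w k f ==> cmp w j f = (if j = k then f else 0)"
proof (cases "j = k")
 case True
 assume "hom_deg w k f"
 hence "cmp w j f = lext sc mon f" unfolding cmp_def using True
  by (intro np.lext_cong) (simp add: hom_deg_def)
 thus ?thesis using True by (simp add: lext_mon)
qed (auto simp: cmp_def lext_def hom_deg_def intro!: sum.neutral)

lemma hom_mult: "hom_deg w j f ==> hom_deg w k g ==> hom_deg w (j + k) (f \<star> g)"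
 using bilin_closed[OF subspace_hom, of f g w "j + k"] by (auto simp: hom_deg_def[of _ _ f] hom_deg_def[of _ _ g])

lemma cmp_PP: "f \<in> PP u V ==> cmp w k f \<in> PP u V"
 unfolding cmp_def lext_def
 by (intro np.subspace_sum np.subspace_scale subspace_PP) (use np.subspace_0[OF subspace_PP] in \<open>auto simp: PP_def[of f]\<close>)

lemma sum_cmp:
 assumes "\<And>m. m \<in> ks f ==> mdeg w m < N" shows "(\<Sum>k<N. cmp w k f) = f"
proof -
 have "(\<Sum>k<N. cmp w k f) = (\<Sum>m\<in>ks f. \<Sum>k<N. sc (lk f m) (if mdeg w m = k then mon m else 0))"
  unfolding cmp_def lext_def by (rule sum.swap)
 also have "\<dots> = (\<Sum>m\<in>ks f. sc (lk f m) (mon m))"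
  using assms by (intro sum.cong refl) (simp add: np.scale_sum_right[symmetric])
 finally show ?thesis using np_sum[of f] by simp
qed

definition dbound :: "('v => nat) => ('v, 'k::field) npoly => nat" where
 "dbound w f = Suc (Max (insert 0 (mdeg w ` ks f)))"

lemma mdeg_less_dbound: "m \<in> ks f ==> mdeg w m < dbound w f"
 unfolding dbound_def by (simp add: less_Suc_eq_le)

lemma sum_cmp_dbound: "dbound w f \<le> N ==> (\<Sum>k<N. cmp w k f) = f"
 by (rule sum_cmp) (meson mdeg_less_dbound order_less_le_trans)

lemma cmp_in_subspace: "np.subspace S ==> (\<And>k. cmp w k f \<in> S) ==> f \<in> S"
 using np.subspace_sum[of S "{..<dbound w f}" "%k. cmp w k f"] sum_cmp_dbound[of w f] by simp

lemma cmp_mult: "cmp w k (f \<star> g) = (\<Sum>i\<le>k. cmp w i f \<star> cmp w (k - i) g)"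
proof -
 have *: "cmp w k (mon a \<star> mon b) = (\<Sum>i\<le>k. cmp w i (mon a) \<star> cmp w (k - i) (mon b))" for a b :: "'a mag option"
 proof -
  have "(\<Sum>i\<le>k. cmp w i (mon a) \<star> cmp w (k - i) (mon b)) =
   (\<Sum>i\<le>k. if i = mdeg w a then (if mdeg w a + mdeg w b = k then mon a \<star> mon b else 0) else 0)"
   by (intro sum.cong refl) (auto simp: cmp_mon mult_simps)
  also have "\<dots> = cmp w k (mon a \<star> mon b)"
   by (subst sum.delta) (auto simp: cmp_mon)
  finally show ?thesis by (rule sym)
 qed
 have 1: "cmp w k (mon a \<star> g) = (\<Sum>i\<le>k. cmp w i (mon a) \<star> cmp w (k - i) g)" for a
 proof (rule lin_eqI[of sc "%g. cmp w k (mon a \<star> g)"])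
  show "lin sc sc (%g. cmp w k (mon a \<star> g))" by (rule lin_comp[OF lin_mult_right lin_cmp])
  show "lin sc sc (%g. \<Sum>i\<le>k. cmp w i (mon a) \<star> cmp w (k - i) g)"
   by (rule linI) (simp_all add: mult_simps cmp_add cmp_sc sum.distrib np.scale_sum_right)
 qed (rule *)
 show ?thesis
 proof (rule lin_eqI[of sc "%f. cmp w k (f \<star> g)"])
  show "lin sc sc (%f. cmp w k (f \<star> g))" by (rule lin_comp[OF lin_mult_left lin_cmp])
  show "lin sc sc (%f. \<Sum>i\<le>k. cmp w i f \<star> cmp w (k - i) g)"
   by (rule linI) (simp_all add: mult_simps cmp_add cmp_sc sum.distrib np.scale_sum_right)
 qed (rule 1)
qed

lemma hom_subst:
 assumes "\<And>v. v \<in> V ==> hom_deg w' (w v) (ro v)" "f \<in> PP u V" "hom_deg w k f" shows "hom_deg w' k (subst ro f)"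
proof -
 have "hom_deg w' (mag_deg w t) (meval (\<star>) ro t)" if "set_mag t <= V" for t
  using that by (induction t) (auto simp: assms hom_mult)
 hence "hom_deg w' k (subst ro (mon m))" if "m \<in> ks f" for m
 proof -
  have "mdeg w m = k" "okm u V m" using assms that by (auto simp: hom_deg_def PP_def)
  thus ?thesis using \<open>\<And>t. set_mag t <= V ==> _ t\<close> by (cases m) auto
 qed
 thus ?thesis unfolding lin_lext_eq[OF np.lin_ev, of ro f] lext_def by (intro hom_sum hom_sc)
qed

text \<open>The derivation shifts degrees by \<open>b - a\<close>, written with two natural numbers
  so that the shift may be negative.\<close>

lemma hom_der:
 assumes "\<And>v. v \<in> V ==> hom_deg w' (w v) (xi v)" "\<And>v. v \<in> V ==> \<exists>d. hom_deg w' d (F v) \<and> d + a = w v + b"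
  "f \<in> PP u V" "hom_deg w k f" "j + a = k + b"
 shows "hom_deg w' j (der xi F f)"
proof -
 have e: "hom_deg w' (mag_deg w t) (meval (\<star>) xi t)" if "set_mag t <= V" for t
  using that by (induction t) (auto simp: assms hom_mult)
 have d: "\<exists>d. hom_deg w' d (dmag xi F t) \<and> d + a = mag_deg w t + b" if "set_mag t <= V" for t
  using that
 proof (induction t)
  case (Gen v)
  thus ?case using assms(2) by simp
 next
  case (Node s t)
  then obtain d1 d2 where d: "hom_deg w' d1 (dmag xi F s)" "d1 + a = mag_deg w s + b"
   "hom_deg w' d2 (dmag xi F t)" "d2 + a = mag_deg w t + b" by auto
  have "mag_deg w s + d2 = d1 + mag_deg w t" using d by simp
  hence "hom_deg w' (d1 + mag_deg w t) (meval (\<star>) xi s \<star> dmag xi F t)"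
   using hom_mult[OF e[of s] d(3)] Node.prems by simp
  thus ?case using d hom_mult[OF d(1) e[of t]] Node.prems
   by (intro exI[of _ "d1 + mag_deg w t"]) (auto intro!: hom_add)
 qed
 have "hom_deg w' j (der xi F (mon m))" if "m \<in> ks f" for m
 proof -
  have m: "mdeg w m = k" "okm u V m" using assms that by (auto simp: hom_deg_def PP_def)
  show ?thesis
  proof (cases m)
   case (Some t)
   then obtain d where "hom_deg w' d (dmag xi F t)" "d + a = mag_deg w t + b" using d m by auto
   moreover have "d = j" using calculation m Some assms(5) by simp
   ultimately show ?thesis using Some by simp
  qed simp
 qed
 thus ?thesis unfolding lin_lext_eq[OF lin_der, of xi F f] lext_def by (intro hom_sum hom_sc)
qed

text \<open>The homothety with weights \<open>w\<close> acts on the component of degree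
  \<open>k\<close> as \<open>t ^ k\<close>, which makes components accessible to a Vandermonde
  argument.\<close>

lemma subst_scale_vars: "subst (%v. sc (t ^ w v) (np_var v)) f = (\<Sum>k<dbound w f. sc (t ^ k) (cmp w k f))"
proof -
 have p: "t ^ (a + b) = t ^ b * t ^ a" for a b by (simp add: power_add mult.commute)
 have m: "meval (\<star>) (%v. sc (t ^ w v) (np_var v)) m = sc (t ^ mag_deg w m) (mon (Some m))" for m :: "'a mag"
  by (induction m) (simp_all only: meval.simps mag_deg.simps np_var_def mult_simps p np.scale_scale mon_mult_mon mon_mult.simps)
 have h: "subst (%v. sc (t ^ w v) (np_var v)) f = sc (t ^ k) f" if "hom_deg w k f" for k f
 proof -
  have "subst (%v. sc (t ^ w v) (np_var v)) f = lext sc (%m. sc (t ^ k) (mon m)) f"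
   unfolding ev_def using that by (intro np.lext_cong) (auto simp: m hom_deg_def split: option.split)
  also have "\<dots> = sc (t ^ k) (lext sc mon f)"
   unfolding lext_def by (simp add: np.scale_sum_right mult.commute)
  finally show ?thesis by (simp add: lext_mon)
 qed
 have "subst (%v. sc (t ^ w v) (np_var v)) f = (\<Sum>k<dbound w f. subst (%v. sc (t ^ w v) (np_var v)) (cmp w k f))"
  unfolding np.ev_sum[symmetric] by (simp add: sum_cmp_dbound)
 thus ?thesis by (simp add: h[OF hom_cmp])
qed

section \<open>Ideals of identities\<close>

lemma NPoly_add_monoid: "comm_monoid (add_monoid (NPoly u V :: ('k::field, ('v, 'k) npoly) module))"
proof (unfold_locales, goal_cases)
 case (1 x y)
 thus ?case using np.subspace_add[OF subspace_PP, of x u V y] by (simp add: NPoly_def)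
next
 case 3
 thus ?case using np.subspace_0[OF subspace_PP, of u V] by (simp add: NPoly_def)
qed (auto simp: NPoly_def add.assoc add.commute)

lemma NPoly_sel [simp]:
 "\<zero>\<^bsub>NPoly u V\<^esub> = 0" "f \<oplus>\<^bsub>NPoly u V\<^esub> g = f + g" "f \<otimes>\<^bsub>NPoly u V\<^esub> g = f \<star> g"
 "\<one>\<^bsub>NPoly u V\<^esub> = mon None" "c \<odot>\<^bsub>NPoly u V\<^esub> f = sc c f"
 by (simp_all add: NPoly_def)

lemma finsum_NPoly:
 fixes F :: "'i => ('v, 'k::field) npoly"
 assumes "\<And>i. i \<in> I ==> F i \<in> PP u V"
 shows "finsum (NPoly u V) F I = (\<Sum>i\<in>I. F i)"
proof -
 interpret abelian_monoid "NPoly u V :: ('k, ('v, 'k) npoly) module"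
  by (rule abelian_monoid.intro) (rule NPoly_add_monoid)
 show ?thesis
  using assms
  by (induction I rule: infinite_finite_induct) (simp_all add: finsum_infinite finsum_insert)
qed

definition d1 :: "'v => nat" where "d1 = (%_. 1)"

lemma d1_simp: "d1 v = 1" by (simp add: d1_def)

lemma meval_var: "meval (\<star>) np_var t = mon (Some t)"
 by (induction t) (simp_all add: np_var_def)

locale nsvar =
 fixes M :: "'k::field_char_0 variety"
 assumes isvar: "is_variety M"
begin

abbreviation PV :: "'v set => ('v, 'k) npoly set" where "PV V \<equiv> PP (unital M) V"
abbreviation T :: "'v set => ('v, 'k) npoly set" where "T V \<equiv> T_ideal M V"

lemma of_nat_ne: "of_nat (Suc k) \<noteq> (0::'k)"
 by (rule of_nat_neq_0)

lemmas vand = np.vandermonde2[OF of_nat_ne]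

lemma identities_PP: "g \<in> identities M ==> g \<in> PP (unital M) UNIV"
 using isvar by (auto simp: is_variety_def)

lemma np_eval_NPoly:
 assumes "g \<in> PV UNIV" "\<And>i. ro i \<in> PV V"
 shows "np_eval (NPoly (unital M) V) ro g = subst ro g"
proof -
 have e: "mag_eval (NPoly (unital M) V) ro t = meval (\<star>) ro t" for t
  by (induction t) simp_all
 have "np_eval (NPoly (unital M) V) ro g = (\<Oplus>\<^bsub>NPoly (unital M) V\<^esub>m\<in>ks g.
   sc (lk g m) (case m of None => mon None | Some t => meval (\<star>) ro t))"
  unfolding np_eval_def e NPoly_sel ..
 also have "\<dots> = (\<Sum>m\<in>ks g. sc (lk g m) (case m of None => mon None | Some t => meval (\<star>) ro t))"
 proof (rule finsum_NPoly)
  fix m assume "m \<in> ks g"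
  hence "mon m \<in> PV UNIV" using assms PP_mon by blast
  hence "subst ro (mon m) \<in> PV V" using assms(2) by (intro subst_PP[of _ _ UNIV]) auto
  thus "sc (lk g m) (case m of None => mon None | Some t => meval (\<star>) ro t) \<in> PV V"
   by (intro np.subspace_scale subspace_PP) (cases m; simp)
 qed
 finally show ?thesis by (simp add: ev_def lext_def)
qed

lemma T_inst: "g \<in> identities M ==> (\<And>i. ro i \<in> PV V) ==> subst ro g \<in> T V"
 using T_ideal.inst[of g M ro V] np_eval_NPoly[of g ro V] identities_PP by simp

lemma subspace_T: "np.subspace (T V)"
 by (intro np.subspaceI) (auto intro: T_ideal.intros)

lemmas T_0 = T_ideal.zero[of M] and T_add = np.subspace_add[OF subspace_T] and T_sc = np.subspace_scale[OF subspace_T]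
 and T_diff = np.subspace_diff[OF subspace_T] and T_sum = np.subspace_sum[OF subspace_T]
 and T_left = T_ideal.mult_left[of _ M] and T_right = T_ideal.mult_right[of _ M]
lemmas PV_0 = np.subspace_0[OF subspace_PP[of "unital M"]]
 and PV_add = np.subspace_add[OF subspace_PP[of "unital M"]]
 and PV_sc = np.subspace_scale[OF subspace_PP[of "unital M"]]
 and PV_diff = np.subspace_diff[OF subspace_PP[of "unital M"]]
 and PV_sum = np.subspace_sum[OF subspace_PP[of "unital M"]]

lemma T_swap: "f - g \<in> T V ==> g - f \<in> T V"
 using T_sc[of "f - g" V "-1"] by simp

lemma T_trans: "f - g \<in> T V ==> g - h \<in> T V ==> f - h \<in> T V"
 using T_add[of "f - g" V "g - h"] by simp

lemma T_PV: "f \<in> T V ==> f \<in> PV V"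
proof (induction rule: T_ideal.induct)
 case (inst g ro)
 thus ?case using identities_PP by (auto simp: np_eval_NPoly intro!: subst_PP[of _ _ UNIV])
qed (auto intro: PV_0 PV_add PV_sc PP_mult)

lemma T_subst:
 assumes "f \<in> T V" "\<And>v. v \<in> V ==> ro v \<in> PV V'" shows "subst ro f \<in> T V'"
 using assms(1)
proof induction
 case (inst g si)
 have "subst (%i. subst ro (si i)) g \<in> T V'"
  using inst assms(2) by (intro T_inst subst_PP[of _ _ V]) auto
 thus ?case using inst identities_PP by (simp add: np_eval_NPoly subst_subst)
qed (auto simp: np.ev_add np.ev_sc np.ev_0 intro: T_0 T_add T_sc T_left T_right subst_PP assms(2))

text \<open>The means of detecting that an element of a free algebra is nonzero: an algebra
  satisfying the defining identities satisfies all their consequences.\<close>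

lemma T_eval_0:
 assumes "nalg s mu e (unital M)" and id: "\<And>g \<zeta>. g \<in> identities M ==> ev s mu e \<zeta> g = 0"
  and "f \<in> T V"
 shows "ev s mu e \<zeta> f = 0"
proof -
 interpret nalg s mu e "unital M" by fact
 show ?thesis
  using assms(3)
 proof induction
  case (inst g ro)
  thus ?case using identities_PP id ev_subst[of g UNIV ro]
   by (simp add: np_eval_NPoly) (metis PP_mono UNIV_I subset_UNIV)
 next
  case (mult_left f h)
  hence "f \<in> PP (unital M) UNIV" "h \<in> PP (unital M) UNIV" using T_PV PP_mono by blast+
  thus ?case using mult_left by (simp add: ev_mult lin_0[OF lin_r])
 next
  case (mult_right f h)
  hence "f \<in> PP (unital M) UNIV" "h \<in> PP (unital M) UNIV" using T_PV PP_mono by blast+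
  thus ?case using mult_right by (simp add: ev_mult lin_0[OF lin_l])
 qed (simp_all add: ev_add ev_sc ev_0)
qed

lemma T_subst_diff:
 assumes "f - g \<in> T V" "\<And>v. v \<in> V ==> ro v \<in> PV V'" shows "subst ro f - subst ro g \<in> T V'"
 using T_subst[OF assms] by (simp add: np.ev_diff)

lemma T_mult_diff:
 assumes "f - f' \<in> T V" "g - g' \<in> T V" "f \<in> PV V" "g' \<in> PV V"
 shows "f \<star> g - f' \<star> g' \<in> T V"
proof -
 have "f \<star> g - f' \<star> g' = f \<star> (g - g') + (f - f') \<star> g'" by (simp add: mult_simps)
 thus ?thesis using T_add[OF T_left[OF assms(2,3)] T_right[OF assms(1,4)]] by simp
qed

lemma subst_tuple_cong:
 assumes "\<And>v. v \<in> V ==> ro v - ro' v \<in> T V'" "\<And>v. v \<in> V ==> ro v \<in> PV V'" "\<And>v. v \<in> V ==> ro' v \<in> PV V'" "f \<in> PV V"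
 shows "subst ro f - subst ro' f \<in> T V'"
proof -
 have t: "meval (\<star>) ro t - meval (\<star>) ro' t \<in> T V' \<and> meval (\<star>) ro t \<in> PV V' \<and> meval (\<star>) ro' t \<in> PV V'"
  if "set_mag t <= V" for t
  using that by (induction t) (auto simp: assms intro!: T_mult_diff PP_mult)
 have "subst ro (mon m) - subst ro' (mon m) \<in> T V'" if "m \<in> ks f" for m
  using that assms(4) t T_0 by (cases m) (auto simp: PP_def[of f])
 thus ?thesis
  unfolding lin_lext_eq[OF np.lin_ev, of ro f] lin_lext_eq[OF np.lin_ev, of ro' f] lext_def sum_subtractf[symmetric]
   np.scale_right_diff_distrib[symmetric]
  by (intro T_sum T_sc)
qed

text \<open>The homomorphisms \<open>xi + t F\<close> map \<open>f\<close> to an identity for every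
  scalar \<open>t\<close>, and the coefficient of \<open>t\<close> in the result is the
  derivative.\<close>

lemma T_der:
 assumes "f \<in> T V" "\<And>v. v \<in> V ==> xi v \<in> PV V'" "\<And>v. v \<in> V ==> F v \<in> PV V'"
 shows "der xi F f \<in> T V'"
proof -
 have "jet sc (PV V') (%t. xi v + sc t (F v)) (xi v) (F v)" if "v \<in> V" for v
  unfolding jet_def using assms that by (intro conjI exI[of _ "%_. 0"]) (auto intro: pf.zero)
 hence "jet sc (PV V') (%t. subst (%v. xi v + sc t (F v)) f) (subst xi f) (der xi F f)"
  by (rule jet_subst[OF T_PV[OF assms(1)]])
 then obtain r where r: "pf sc (PV V') r"
   "\<And>t. subst (%v. xi v + sc t (F v)) f = subst xi f + sc t (der xi F f + sc t (r t))"
  unfolding jet_def by blast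
 have "subst (%v. xi v + sc t (F v)) f \<in> T V'" for t
  by (rule T_subst[OF assms(1)]) (auto intro: PV_add PV_sc assms)
 hence "subst xi f + sc t (der xi F f + sc t (r t)) \<in> T V'" for t using r(2) by simp
 thus ?thesis by (rule vand(2)[OF subspace_T pf_mono[OF r(1) subset_UNIV]])
qed

lemma der_tuple_cong:
 assumes "\<And>v. v \<in> V ==> F v - F' v \<in> T V'" "\<And>v. v \<in> V ==> xi v \<in> PV V'" "f \<in> PV V"
 shows "der xi F f - der xi F' f \<in> T V'"
proof -
 have e: "meval (\<star>) xi t \<in> PV V'" if "set_mag t <= V" for t
  using that by (induction t) (auto simp: assms intro!: PP_mult)
 have t: "dmag xi F t - dmag xi F' t \<in> T V'" if "set_mag t <= V" for t
  using that
 proof (induction t)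
  case (Node a b)
  have "dmag xi F (Node a b) - dmag xi F' (Node a b) =
   (dmag xi F a - dmag xi F' a) \<star> meval (\<star>) xi b + meval (\<star>) xi a \<star> (dmag xi F b - dmag xi F' b)"
   by (simp add: mult_simps)
  thus ?case using Node e[of a] e[of b] by (simp only:) (intro T_add T_left T_right; simp)
 qed (simp add: assms)
 have "der xi F (mon m) - der xi F' (mon m) \<in> T V'" if "m \<in> ks f" for m
  using that assms(3) t T_0 by (cases m) (auto simp: PP_def[of f])
 thus ?thesis
  unfolding lin_lext_eq[OF lin_der, of xi F f] lin_lext_eq[OF lin_der, of xi F' f] lext_def sum_subtractf[symmetric]
   np.scale_right_diff_distrib[symmetric]
  by (intro T_sum T_sc)
qed

text \<open>Over an infinite field the ideal of identities is homogeneous for every weight: weighted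
  homotheties preserve it, and a Vandermonde system isolates the components.\<close>

lemma T_cmp:
 assumes "f \<in> T V" shows "cmp w k f \<in> T V"
proof (cases "k < dbound w f")
 case True
 have "(\<Sum>k<dbound w f. sc (t ^ k) (cmp w k f)) \<in> T V" for t
  unfolding subst_scale_vars[symmetric] by (rule T_subst[OF assms]) (auto intro: PV_sc)
 thus ?thesis by (rule np.vandermonde_coeffs[OF of_nat_ne subspace_T]) (rule True)
next
 case False
 hence "cmp w k f = 0" unfolding cmp_def lext_def using mdeg_less_dbound[of _ f w]
  by (intro sum.neutral) auto
 thus ?thesis using T_0 by simp
qed

lemma cmp_T_diff: "f - g \<in> T V ==> cmp w k f - cmp w k g \<in> T V"
 using T_cmp[of "f - g" V w k] by (simp add: cmp_diff)

text \<open>\<open>G V k\<close> is the preimage of the part of the free algebra of degree at least \<open>k\<close>.\<close>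

definition G :: "'v set => nat => ('v, 'k) npoly set" where
 "G V k = {f \<in> PV V. \<forall>j<k. cmp d1 j f \<in> T V}"

lemma subspace_G: "np.subspace (G V k)"
 unfolding G_def by (rule np.subspaceI) (auto simp: cmp_add cmp_sc PV_0 T_0 intro: PV_add PV_sc T_add T_sc)

lemmas G_add = np.subspace_add[OF subspace_G] and G_sc = np.subspace_scale[OF subspace_G]
 and G_diff = np.subspace_diff[OF subspace_G] and G_sum = np.subspace_sum[OF subspace_G] and G_0 = np.subspace_0[OF subspace_G]

lemma G_PV: "f \<in> G V k ==> f \<in> PV V" by (simp add: G_def)
lemma T_G: "f \<in> T V ==> f \<in> G V k" by (simp add: G_def T_PV T_cmp)
lemma PV_G0: "f \<in> PV V ==> f \<in> G V 0" by (simp add: G_def)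
lemma G_mono: "f \<in> G V k ==> j \<le> k ==> f \<in> G V j" by (simp add: G_def)
lemma hom_G: "hom_deg d1 k f ==> f \<in> PV V ==> f \<in> G V k" by (simp add: G_def cmp_hom T_0)
lemma var_G: "v \<in> V ==> np_var v \<in> G V 1" by (rule hom_G) (simp_all add: d1_simp)
lemma G_cmp: "f \<in> G V k ==> j < k ==> cmp d1 j f \<in> T V" by (simp add: G_def)

lemma G_mult:
 assumes "f \<in> G V i" "g \<in> G V j" shows "f \<star> g \<in> G V (i + j)"
proof -
 have fg: "f \<in> PV V" "g \<in> PV V" using assms G_PV by auto
 have "cmp d1 k (f \<star> g) \<in> T V" if "k < i + j" for k
  unfolding cmp_mult
 proof (rule T_sum)
  fix a assume "a \<in> {..k}"
  hence "a < i \<or> k - a < j" using that by simp linarith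
  then consider "a < i" | "k - a < j" by blast
  thus "cmp d1 a f \<star> cmp d1 (k - a) g \<in> T V"
  proof cases
   case 1
   thus ?thesis using T_right[OF G_cmp[OF assms(1)] cmp_PP[OF fg(2)]] by blast
  next
   case 2
   thus ?thesis using T_left[OF G_cmp[OF assms(2)] cmp_PP[OF fg(1)]] by blast
  qed
 qed
 thus ?thesis using PP_mult fg by (simp add: G_def)
qed

lemma G_Suc: "f \<in> G V k ==> f - cmp d1 k f \<in> G V (Suc k)"
 unfolding G_def by (auto simp: cmp_diff cmp_hom[OF hom_cmp] less_Suc_eq cmp_PP T_0 intro!: PV_diff)

lemma G_SucI: "f \<in> G V k ==> cmp d1 k f \<in> T V ==> f \<in> G V (Suc k)"
 by (auto simp: G_def less_Suc_eq)

lemma G_all_T: "f \<in> PV V ==> (\<And>k. f \<in> G V k) ==> f \<in> T V"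
 by (rule cmp_in_subspace[OF subspace_T, of d1]) (auto intro: G_cmp)

text \<open>Components below degree \<open>k\<close> are identities and are disposed of by the
  second premise; the others are spanned by monomials, on which alone the degree estimate has to be
  checked.\<close>

lemma filtered_lin:
 assumes F: "lin sc sc F" and "\<And>f. f \<in> T V ==> F f \<in> T V'"
  and "\<And>m. okm (unital M) V m ==> F (mon m) \<in> G V' (mdeg d1 m + e)" and f: "f \<in> G V k"
 shows "F f \<in> G V' (k + e)"
proof -
 have "F (cmp d1 j f) \<in> G V' (k + e)" for j
 proof (cases "j < k")
  case True
  thus ?thesis using f assms(2) by (auto intro: T_G G_cmp)
 next
  case False
  have c: "cmp d1 j f \<in> PV V" "hom_deg d1 j (cmp d1 j f)" using f by (auto intro: cmp_PP G_PV)
  have "F (mon m) \<in> G V' (k + e)" if "m \<in> ks (cmp d1 j f)" for m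
   using that c False G_mono[OF assms(3), of m "k + e"] by (simp add: PP_def hom_deg_def)
  thus ?thesis unfolding lin_lext_eq[OF F, of "cmp d1 j f"] lext_def by (intro G_sum G_sc)
 qed
 hence "F (\<Sum>j<dbound d1 f. cmp d1 j f) \<in> G V' (k + e)" unfolding lin_sum[OF F] by (intro G_sum)
 thus ?thesis by (simp add: sum_cmp_dbound)
qed

lemma der_G:
 assumes "\<And>v. v \<in> V ==> g v \<in> G V (e + 1)" "f \<in> G V k" shows "der np_var g f \<in> G V (k + e)"
proof (rule filtered_lin[OF lin_der _ _ assms(2)])
 fix m assume m: "okm (unital M) V m"
 have "dmag np_var g t \<in> G V (mag_deg d1 t + e)" if "set_mag t <= V" for t
  using that
 proof (induction t)
  case (Node a b)
  have ab: "mon (Some a) \<in> G V (mag_deg d1 a)" "mon (Some b) \<in> G V (mag_deg d1 b)"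
   using Node.prems by (simp_all add: hom_G)
  have 1: "dmag np_var g a \<in> G V (mag_deg d1 a + e)" and 2: "dmag np_var g b \<in> G V (mag_deg d1 b + e)"
   using Node by simp_all
  show ?case unfolding dmag.simps meval_var mag_deg.simps
   using G_add[OF G_mult[OF 1 ab(2)], of "mon (Some a) \<star> dmag np_var g b"] G_mult[OF ab(1) 2]
   by (simp only: ac_simps)
 next
  case (Gen v)
  thus ?case using assms(1)[of v] by (simp add: d1_simp)
 qed
 thus "der np_var g (mon m) \<in> G V (mdeg d1 m + e)" using m G_0 by (cases m) simp_all
next
 fix f assume "f \<in> T V"
 thus "der np_var g f \<in> T V" by (rule T_der) (simp, rule G_PV[OF assms(1)])
qed

lemma subst_G:
 assumes "\<And>v. v \<in> V ==> Phi v \<in> PV V" "\<And>v. v \<in> V ==> Phi v - np_var v \<in> G V (e + 1)" "f \<in> G V k"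
 shows "subst Phi f - f \<in> G V (k + e)"
proof (rule filtered_lin[OF _ _ _ assms(3), where F = "%f. subst Phi f - f"])
 show "lin sc sc (%f. subst Phi f - f)"
  by (rule linI) (simp_all add: np.ev_add np.ev_sc np.scale_right_diff_distrib)
next
 fix m assume m: "okm (unital M) V m"
 have "meval (\<star>) Phi t - mon (Some t) \<in> G V (mag_deg d1 t + e)" if "set_mag t <= V" for t
  using that
 proof (induction t)
  case (Gen v)
  thus ?case using assms(2)[of v] by (simp add: np_var_def d1_simp)
 next
  case (Node a b)
  have ab: "mon (Some a) \<in> G V (mag_deg d1 a)" "mon (Some b) \<in> G V (mag_deg d1 b)" using Node by (auto intro: hom_G)
  have 1: "meval (\<star>) Phi a - mon (Some a) \<in> G V (mag_deg d1 a + e)"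
   and 2: "meval (\<star>) Phi b - mon (Some b) \<in> G V (mag_deg d1 b + e)" using Node by simp_all
  have 3: "meval (\<star>) Phi b \<in> G V (mag_deg d1 b)"
   using G_add[OF G_mono[OF 2, of "mag_deg d1 b"] ab(2)] by simp
  have "(meval (\<star>) Phi a - mon (Some a)) \<star> meval (\<star>) Phi b + mon (Some a) \<star> (meval (\<star>) Phi b - mon (Some b))
    \<in> G V (mag_deg d1 (Node a b) + e)"
   unfolding mag_deg.simps using G_add[OF G_mult[OF 1 3], of "mon (Some a) \<star> (meval (\<star>) Phi b - mon (Some b))"] G_mult[OF ab(1) 2]
   by (simp only: ac_simps)
  thus ?case by (simp add: mult_simps)
 qed
 thus "subst Phi (mon m) - mon m \<in> G V (mdeg d1 m + e)" using m G_0 by (cases m) simp_all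
next
 fix f assume "f \<in> T V"
 thus "subst Phi f - f \<in> T V" using assms(1) by (intro T_diff T_subst) simp_all
qed

lemma subst_lead:
 assumes e: "e \<ge> 1" and Phi: "\<And>v. v \<in> V ==> Phi v \<in> PV V" "\<And>v. v \<in> V ==> Phi v - np_var v - g v \<in> G V (e + 2)"
  and g: "\<And>v. v \<in> V ==> g v \<in> G V (e + 1)" and f: "f \<in> G V k"
 shows "subst Phi f - f - der np_var g f \<in> G V (k + (e + 1))"
proof -
 have Phi': "Phi v - np_var v \<in> G V (e + 1)" if "v \<in> V" for v
  using G_add[OF G_mono[OF Phi(2)[OF that], of "e + 1"] g[OF that]] by simp
 show ?thesis
proof (rule filtered_lin[OF _ _ _ f, where F = "%f. subst Phi f - f - der np_var g f"])
 show "lin sc sc (%f. subst Phi f - f - der np_var g f)"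
  by (rule linI) (simp_all add: np.ev_add np.ev_sc der_add der_sc np.scale_right_diff_distrib)
next
 fix m assume m: "okm (unital M) V m"
 have "meval (\<star>) Phi t - mon (Some t) - dmag np_var g t \<in> G V (mag_deg d1 t + (e + 1))" if "set_mag t <= V" for t
  using that
 proof (induction t)
  case (Gen v)
  thus ?case using Phi(2)[of v] by (simp add: np_var_def d1_simp)
 next
  case (Node a b)
  let ?A = "mag_deg d1 a" and ?B = "mag_deg d1 b"
  have ab: "mon (Some a) \<in> G V ?A" "mon (Some b) \<in> G V ?B" using Node by (auto intro: hom_G)
  have b1: "meval (\<star>) Phi b - mon (Some b) \<in> G V (?B + e)" using subst_G[OF Phi(1) Phi' ab(2)] by simp
  have b2: "meval (\<star>) Phi b \<in> G V ?B" using G_add[OF G_mono[OF b1, of ?B] ab(2)] by simp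
  have da: "dmag np_var g a \<in> G V (?A + e)" using der_G[OF g ab(1)] by simp
  have 1: "(meval (\<star>) Phi a - mon (Some a) - dmag np_var g a) \<star> meval (\<star>) Phi b \<in> G V (?A + (e + 1) + ?B)"
   by (intro G_mult b2) (use Node in auto)
  \<comment> \<open>A term quadratic in the perturbation gains \<open>2 * e\<close> in degree, which
    is at least \<open>e + 1\<close> because \<open>e \<ge> 1\<close>.\<close>
  have 2: "dmag np_var g a \<star> (meval (\<star>) Phi b - mon (Some b)) \<in> G V (?A + e + (?B + e))"
   by (intro G_mult b1 da)
  have 3: "mon (Some a) \<star> (meval (\<star>) Phi b - mon (Some b) - dmag np_var g b) \<in> G V (?A + (?B + (e + 1)))"
   by (intro G_mult ab) (use Node in auto)
  have "meval (\<star>) Phi (Node a b) - mon (Some (Node a b)) - dmag np_var g (Node a b) =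
    (meval (\<star>) Phi a - mon (Some a) - dmag np_var g a) \<star> meval (\<star>) Phi b
    + dmag np_var g a \<star> (meval (\<star>) Phi b - mon (Some b))
    + mon (Some a) \<star> (meval (\<star>) Phi b - mon (Some b) - dmag np_var g b)"
   by (simp add: mult_simps meval_var)
  moreover have "\<dots> \<in> G V (mag_deg d1 (Node a b) + (e + 1))"
   by (intro G_add; rule G_mono[OF 1] G_mono[OF 2] G_mono[OF 3]) (use e in auto)
  ultimately show ?case by metis
 qed
 thus "subst Phi (mon m) - mon m - der np_var g (mon m) \<in> G V (mdeg d1 m + (e + 1))"
  using m G_0 by (cases m) simp_all
next
 fix f assume "f \<in> T V"
 thus "subst Phi f - f - der np_var g f \<in> T V" using Phi(1) G_PV[OF g] by (intro T_diff T_subst T_der) simp_all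
qed
qed

end

lemma cmp_big:
 assumes "dbound w f \<le> k" shows "cmp w k f = 0"
 unfolding cmp_def lext_def
proof (intro sum.neutral ballI)
 fix m assume "m \<in> ks f"
 from mdeg_less_dbound[OF this, of w] assms show "sc (lk f m) (if mdeg w m = k then mon m else 0) = 0" by auto
qed

section \<open>Leading terms of groups of automorphisms\<close>

abbreviation (input) tsc :: "'k::field => ('i => ('v, 'k) npoly) => 'i => ('v, 'k) npoly" where
 "tsc c g \<equiv> %j. sc c (g j)"

interpretation tp: vector_space "tsc :: 'k::field => ('i => ('v, 'k) npoly) => _"
 by unfold_locales (auto simp: fun_eq_iff np.scale_right_distrib np.scale_left_distrib)

text \<open>Tuples are functions on all natural numbers; cutting them off at \<open>n\<close> makes
  the family a finite sum of families concentrated in one entry.\<close>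

lemma pf_tuple:
 assumes "\<And>l. l < n ==> pf sc S (%t. r t l)" "0 \<in> S"
 shows "pf tsc UNIV (%t l. if l < (n::nat) then r t l else 0)"
proof -
 have "pf tsc UNIV (%t j. if j = l then r t l else 0)" if "l < n" for l
  by (rule pf_lin[OF assms(1)[OF that], where F = "%a j. if j = l then a else 0"]) (auto simp: lin_def fun_eq_iff)
 hence "pf tsc UNIV (%t. \<Sum>l<n. (%j. if j = l then r t l else 0))"
  by (intro tp.pf_sum) auto
 moreover have "(\<Sum>l<n. (%j. if j = l then r t l else 0)) = (%l. if l < n then r t l else 0)" for t
 proof
  fix j
  have "(\<Sum>l<m. (%j. if j = l then r t l else 0)) j = (\<Sum>l<m. if j = l then r t l else 0)" for m
   by (induction m) auto
  thus "(\<Sum>l<n. (%j. if j = l then r t l else 0)) j = (if j < n then r t j else 0)" by simp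
 qed
 ultimately show ?thesis by simp
qed

text \<open>\<open>HH\<close> consists of all polynomial tuples representing automorphisms of the
  group, hence \<open>HH_cong\<close>. Only its affine members are known to exist. Without identity
  element \<open>PP\<close> admits no constant terms, and \<open>HH_aff\<close> then speaks of
  linear automorphisms.\<close>

locale autgrp = nsvar M for M :: "'k::field_char_0 variety" +
 fixes n :: nat and HH :: "(nat => (nat, 'k) npoly) set"
 assumes HH_PV: "Phi \<in> HH ==> j < n ==> Phi j \<in> PP (unital M) {..<n}"
  and HH_comp: "Phi \<in> HH ==> Psi \<in> HH ==> (%j. subst Phi (Psi j)) \<in> HH"
  and HH_inv: "Phi \<in> HH ==> \<exists>Psi\<in>HH. \<forall>j<n. subst Phi (Psi j) - np_var j \<in> T_ideal M {..<n} \<and>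
   subst Psi (Phi j) - np_var j \<in> T_ideal M {..<n}"
  and HH_cong: "Phi \<in> HH ==> (\<And>j. j < n ==> Psi j \<in> PP (unital M) {..<n}) ==>
   (\<And>j. j < n ==> Psi j - Phi j \<in> T_ideal M {..<n}) ==> Psi \<in> HH"
  and HH_aff: "(\<And>j. j < n ==> Phi j \<in> PP (unital M) {..<n} \<and> (\<forall>m\<in>ks (Phi j). mdeg d1 m \<le> 1)) ==>
   (\<And>j. j < n ==> Psi j \<in> PP (unital M) {..<n}) ==>
   (\<And>j. j < n ==> subst Phi (Psi j) - np_var j \<in> T_ideal M {..<n} \<and>
    subst Psi (Phi j) - np_var j \<in> T_ideal M {..<n}) ==> Phi \<in> HH"
begin

abbreviation "X \<equiv> {..<n}"

lemma HH_id: "np_var \<in> HH"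
 by (rule HH_aff[of np_var np_var]) (auto simp: T_0 np_var_def d1_simp)

lemma subst_G_HH: "Phi \<in> HH ==> (\<And>l. l < n ==> Phi l - np_var l \<in> G X (e + 1)) ==> f \<in> G X k ==> subst Phi f - f \<in> G X (k + e)"
 by (rule subst_G) (auto simp: HH_PV)

text \<open>\<open>g\<close> matters modulo degree \<open>e + 2\<close> only, need not be
  homogeneous and may vanish. This slack makes the leading terms of products and inverses easy to
  name.\<close>

definition lead :: "nat => (nat => (nat, 'k) npoly) => (nat => (nat, 'k) npoly) => bool" where
 "lead e Phi g \<longleftrightarrow> Phi \<in> HH \<and> (\<forall>j<n. g j \<in> G X (e + 1) \<and> Phi j - np_var j - g j \<in> G X (e + 2))"

definition W :: "nat => (nat => (nat, 'k) npoly) set" where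
 "W e = {g. \<exists>Phi. lead e Phi g}"

lemma lead_HH: "lead e Phi g ==> Phi \<in> HH" by (simp add: lead_def)
lemma lead_G: "lead e Phi g ==> j < n ==> g j \<in> G X (e + 1)" by (simp add: lead_def)
lemma lead_2: "lead e Phi g ==> j < n ==> Phi j - np_var j - g j \<in> G X (e + 2)" by (simp add: lead_def)
lemma lead_1: "lead e Phi g ==> j < n ==> Phi j - np_var j \<in> G X (e + 1)"
 using G_add[OF G_mono[OF lead_2[of e Phi g j], of "e + 1"] lead_G[of e Phi g j]] by simp

lemma lead_self: "Phi \<in> HH ==> (\<And>j. j < n ==> Phi j - np_var j \<in> G X (e + 1)) ==> lead e Phi (%j. Phi j - np_var j)"
 by (simp add: lead_def G_0)

lemma lead_cong: "lead e Phi g ==> (\<And>j. j < n ==> g' j - g j \<in> G X (e + 2)) ==> lead e Phi g'"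
 unfolding lead_def
proof (intro conjI allI impI, goal_cases)
 case (2 j)
 thus ?case using G_add[OF G_mono[OF 2(2), of j "e + 1"], of "g j"] by simp
next
 case (3 j)
 thus ?case using G_diff[of "Phi j - np_var j - g j" X "e + 2" "g' j - g j"] by simp
qed auto

lemma W_cong: "g \<in> W e ==> (\<And>j. j < n ==> g' j - g j \<in> G X (e + 2)) ==> g' \<in> W e"
 unfolding W_def using lead_cong by blast

lemma W_G: "g \<in> W e ==> j < n ==> g j \<in> G X (e + 1)"
 unfolding W_def using lead_G by blast

lemma W_0: "(%_. 0) \<in> W e"
 unfolding W_def lead_def using HH_id G_0 by (intro CollectI exI[of _ np_var]) auto

lemma lead_comp:
 assumes e: "e \<ge> 1" and Phi: "lead e Phi g" and Psi: "lead e Psi h"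
 shows "lead e (%j. subst Phi (Psi j)) (%j. g j + h j)"
 unfolding lead_def
proof (intro conjI allI impI HH_comp lead_HH[OF Phi] lead_HH[OF Psi] G_add lead_G[OF Phi] lead_G[OF Psi])
 fix j assume j: "j < n"
 have "subst Phi (Psi j - np_var j) - (Psi j - np_var j) \<in> G X (e + 1 + e)"
  by (rule subst_G_HH[OF lead_HH[OF Phi] lead_1[OF Phi] lead_1[OF Psi j]])
 hence "subst Phi (Psi j - np_var j) - (Psi j - np_var j) \<in> G X (e + 2)"
  by (rule G_mono) (use e in simp)
 from G_add[OF G_add[OF this lead_2[OF Phi j]] lead_2[OF Psi j]]
 show "subst Phi (Psi j) - np_var j - (g j + h j) \<in> G X (e + 2)" by (simp add: np.ev_diff algebra_simps)
qed

lemma lead_inv: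
 assumes e: "e \<ge> 1" and Phi: "lead e Phi g" and Psi: "Psi \<in> HH" "\<And>j. j < n ==> subst Phi (Psi j) - np_var j \<in> T X"
 shows "lead e Psi (%j. - g j)"
 unfolding lead_def
proof (intro conjI allI impI Psi(1))
 fix j assume j: "j < n"
 note s = subst_G_HH[OF lead_HH[OF Phi] lead_1[OF Phi]]
 show "- g j \<in> G X (e + 1)" using G_sc[OF lead_G[OF Phi j], of "-1"] by simp
 \<comment> \<open>A priori \<open>Psi\<close> may have constant terms. The estimate is
   bootstrapped: \<open>Psi j\<close> lies in degree at least 0, hence
   \<open>Psi j - np_var j\<close> in degree at least 1, hence in degree at least
   \<open>e + 1\<close>.\<close>
 have t: "subst Phi (Psi j) - np_var j \<in> G X k" for k using Psi(2)[OF j] by (rule T_G)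
 have "subst Phi (Psi j) - Psi j \<in> G X (0 + e)" by (rule s[OF _ PV_G0[OF HH_PV[OF Psi(1) j]]])
 from G_mono[OF G_diff[OF t this], of 1] e have "Psi j - np_var j \<in> G X 1" by simp
 hence "Psi j \<in> G X 1" using G_add[OF _ var_G[of j X]] j by fastforce
 from G_diff[OF t s[OF _ this]] have 1: "Psi j - np_var j \<in> G X (e + 1)" by (simp add: add.commute)
 have "subst Phi (Psi j - np_var j) - (Psi j - np_var j) \<in> G X (e + 2)"
  by (rule G_mono[OF s[OF _ 1]]) (use e in auto)
 from G_add[OF this lead_2[OF Phi j]] have "subst Phi (Psi j) - Psi j - g j \<in> G X (e + 2)"
  by (simp add: np.ev_diff algebra_simps)
 from G_diff[OF t this] show "Psi j - np_var j - - g j \<in> G X (e + 2)" by (simp add: algebra_simps)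
qed

lemma W_add: "e \<ge> 1 ==> g \<in> W e ==> h \<in> W e ==> (%j. g j + h j) \<in> W e"
 unfolding W_def using lead_comp by blast

lemma W_neg: "e \<ge> 1 ==> g \<in> W e ==> (%j. - g j) \<in> W e"
 unfolding W_def using lead_inv HH_inv lead_HH by blast

lemma lead_bracket:
 assumes e: "a \<ge> 1" "b \<ge> 1" and Phi: "lead a Phi g" and Psi: "lead b Psi h"
 shows "(%l. der np_var g (h l) - der np_var h (g l)) \<in> W (a + b)"
proof -
 obtain Phi' where Phi': "Phi' \<in> HH" "\<And>j. j < n ==> subst Phi (Phi' j) - np_var j \<in> T X"
  using HH_inv[OF lead_HH[OF Phi]] by blast
 obtain Psi' where Psi': "Psi' \<in> HH" "\<And>j. j < n ==> subst Psi (Psi' j) - np_var j \<in> T X"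
  using HH_inv[OF lead_HH[OF Psi]] by blast
 note L' = lead_inv[OF e(1) Phi Phi'] lead_inv[OF e(2) Psi Psi']
 let ?C = "%l. subst Phi (subst Psi (subst Phi' (Psi' l)))"
 let ?E = "%f. subst Phi (subst Psi f) - subst Psi (subst Phi f)"
 let ?D = "%f. der np_var g (der np_var h f) - der np_var h (der np_var g f)"
 let ?p = "%f. subst Phi f - f - der np_var g f" and ?q = "%f. subst Psi f - f - der np_var h f"
 have p: "?p f \<in> G X (k + (a + 1))" if "f \<in> G X k" for f k
  by (rule subst_lead[OF e(1) _ _ _ that]) (use Phi HH_PV lead_HH in \<open>auto simp: lead_def\<close>)
 have q: "?q f \<in> G X (k + (b + 1))" if "f \<in> G X k" for f k
  by (rule subst_lead[OF e(2) _ _ _ that]) (use Psi HH_PV lead_HH in \<open>auto simp: lead_def\<close>)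
 have dg: "der np_var g f \<in> G X (k + a)" if "f \<in> G X k" for f k
  by (rule der_G[OF _ that]) (use Phi in \<open>auto simp: lead_def\<close>)
 have dh: "der np_var h f \<in> G X (k + b)" if "f \<in> G X k" for f k
  by (rule der_G[OF _ that]) (use Psi in \<open>auto simp: lead_def\<close>)
 have D: "?D f \<in> G X (k + (a + b))" if "f \<in> G X k" for f k
  using dg[OF dh[OF that]] dh[OF dg[OF that]] by (intro G_diff) (simp_all add: ac_simps)
 have E: "?E f - ?D f \<in> G X (k + (a + b + 1))" if f: "f \<in> G X k" for f k
 proof -
  \<comment> \<open>With the two substitutions written as \<open>1 + g + p\<close> and
    \<open>1 + h + q\<close>, their commutator expands bilinearly and the identity map drops
    out.\<close>
  have e0: "?E f - ?D f = (der np_var g (?q f) - ?q (der np_var g f)) + (?p (der np_var h f) - der np_var h (?p f)) + (?p (?q f) - ?q (?p f))"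
   by (simp add: np.ev_diff der_diff)
  have e1: "der np_var g (?q f) - ?q (der np_var g f) \<in> G X (k + (a + b + 1))"
   by (rule G_diff[OF G_mono[OF dg[OF q[OF f]]] G_mono[OF q[OF dg[OF f]]]]) simp_all
  have e2: "?p (der np_var h f) - der np_var h (?p f) \<in> G X (k + (a + b + 1))"
   by (rule G_diff[OF G_mono[OF p[OF dh[OF f]]] G_mono[OF dh[OF p[OF f]]]]) simp_all
  have e3: "?p (?q f) - ?q (?p f) \<in> G X (k + (a + b + 1))"
   by (rule G_diff[OF G_mono[OF p[OF q[OF f]]] G_mono[OF q[OF p[OF f]]]]) simp_all
  show ?thesis unfolding e0 by (rule G_add[OF G_add[OF e1 e2] e3])
 qed
 have C: "?C l - np_var l - (der np_var g (h l) - der np_var h (g l)) \<in> G X (a + b + 2)" if l: "l < n" for l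
 proof -
  \<comment> \<open>The group commutator at \<open>l\<close> is \<open>?E ?y\<close> plus
    \<open>subst Psi (subst Phi ?y)\<close>, and the latter is \<open>np_var l\<close> modulo
    identities. Since \<open>?D\<close> raises degrees by \<open>a + b\<close>, it is enough to know
    \<open>?y\<close> modulo degree 2.\<close>
  let ?y = "subst Phi' (Psi' l)"
  have yPV: "?y \<in> PV X" using HH_PV[OF HH_comp[OF Phi'(1) Psi'(1)] l] .
  have 0: "Psi' l - np_var l \<in> G X 2" using G_mono[OF lead_1[OF L'(2) l], of 2] e by simp
  have "Psi' l \<in> G X 1" using G_add[OF G_mono[OF 0, of 1] var_G[of l X]] l by simp
  hence "?y - Psi' l \<in> G X (1 + a)" using subst_G_HH[OF Phi'(1) lead_1[OF L'(1)]] by blast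
  hence "?y - Psi' l \<in> G X 2" by (rule G_mono) (use e in simp)
  moreover note \<open>Psi' l - np_var l \<in> G X 2\<close>
  ultimately have y: "?y - np_var l \<in> G X 2" using G_add by fastforce
  hence y1: "?y \<in> G X 1" using G_add[OF G_mono[OF y, of 1] var_G[of l X]] l by simp
  have "subst Phi ?y - Psi' l \<in> T X"
  proof -
   have "subst (%v. subst Phi (Phi' v)) (Psi' l) - subst np_var (Psi' l) \<in> T X"
    by (rule subst_tuple_cong[where V = X])
     (auto simp: Phi' HH_PV[OF Psi'(1) l] HH_PV[OF HH_comp[OF lead_HH[OF Phi] Phi'(1)]])
   thus ?thesis by (simp add: subst_subst)
  qed
  hence "subst Psi (subst Phi ?y) - subst Psi (Psi' l) \<in> T X"
   by (rule T_subst_diff) (simp add: HH_PV[OF lead_HH[OF Psi]])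
  hence "subst Psi (subst Phi ?y) - np_var l \<in> T X" by (rule T_trans) (rule Psi'(2)[OF l])
  hence 1: "subst Psi (subst Phi ?y) - np_var l \<in> G X (a + b + 2)" by (rule T_G)
  have 2: "?E ?y - ?D ?y \<in> G X (a + b + 2)" by (rule G_mono[OF E[OF y1]]) simp
  have "?D (?y - np_var l) \<in> G X (a + b + 2)" by (rule G_mono[OF D[OF y]]) simp
  hence 3: "?D ?y - (der np_var g (h l) - der np_var h (g l)) \<in> G X (a + b + 2)"
   by (simp add: der_diff algebra_simps)
  from G_add[OF G_add[OF 1 2] 3] show ?thesis by (simp add: algebra_simps)
 qed
 have "lead (a + b) ?C (%l. der np_var g (h l) - der np_var h (g l))"
  unfolding lead_def
 proof (intro conjI allI impI C)
  show "?C \<in> HH" by (intro HH_comp lead_HH[OF Phi] lead_HH[OF Psi] Phi' Psi')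
  fix l assume l: "l < n"
  show "der np_var g (h l) - der np_var h (g l) \<in> G X (a + b + 1)"
   using dg[OF lead_G[OF Psi l]] dh[OF lead_G[OF Phi l]] by (intro G_diff) (simp_all add: ac_simps)
 qed
 thus ?thesis unfolding W_def by blast
qed

lemma W_bracket: "a \<ge> 1 ==> b \<ge> 1 ==> g \<in> W a ==> h \<in> W b ==> (%l. der np_var g (h l) - der np_var h (g l)) \<in> W (a + b)"
 unfolding W_def using lead_bracket by (fastforce simp: W_def)

section \<open>Scalar multiples of leading terms\<close>

definition fam :: "nat => (nat => (nat, 'k) npoly) => 'k poly => bool" where
 "fam e g p \<longleftrightarrow> (\<exists>psi. (\<forall>j<n. pf sc (PV X) (%s. psi s j)) \<and> (\<forall>s. lead e (psi s) (%j. sc (poly p s) (g j))))"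

lemma fam_add: "e \<ge> 1 ==> fam e g p ==> fam e g q ==> fam e g (p + q)"
 unfolding fam_def
proof (elim exE conjE, goal_cases)
 case (1 psi psi')
 show ?case
 proof (rule exI[of _ "%s j. subst (psi s) (psi' s j)"], intro conjI allI impI)
  fix j assume "j < n"
  thus "pf sc (PV X) (%s. subst (psi s) (psi' s j))" using 1 by (intro pf_subst) auto
 next
  fix s
  show "lead e (%j. subst (psi s) (psi' s j)) (%j. sc (poly (p + q) s) (g j))"
   using lead_comp[OF 1(1), of "psi s" _ "psi' s"] 1 by (simp add: np.scale_left_distrib)
 qed
qed

lemma fam_shift: "fam e g p ==> fam e g (pcompose p [:1, 1:])"
 unfolding fam_def
proof (elim exE conjE, goal_cases)
 case (1 psi)
 thus ?case
  by (intro exI[of _ "%s. psi (s + 1)"]) (auto simp: poly_pcompose add.commute intro!: np.pf_shift subspace_PP)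
qed

text \<open>Conjugation by the homotheties \<open>x\<^sub>l \<mapsto> s x\<^sub>l\<close>, continued polynomially to \<open>s = 0\<close>.\<close>

lemma fam_base:
 assumes e: "e \<ge> 1" and g: "g \<in> W e" shows "fam e g (monom 1 e)"
proof -
 obtain Phi where Phi: "lead e Phi g" using g by (auto simp: W_def)
 define D where "D l = Phi l - np_var l" for l
 define N where "N l = dbound d1 (D l) + e + 2" for l
 have D: "D l \<in> G X (e + 1)" if "l < n" for l unfolding D_def by (rule lead_1[OF Phi that])
 have cP: "cmp d1 k (D l) \<in> PV X" if "l < n" for k l by (rule cmp_PP[OF G_PV[OF D[OF that]]])
 \<comment> \<open>Conjugation multiplies the component of degree \<open>k\<close> by
   \<open>s ^ (k - 1)\<close>. The components of degree at most \<open>e\<close>, which are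
   identities, are dropped, so that \<open>psi\<close> is the identity at
   \<open>s = 0\<close>.\<close>
 define psi where "psi s l = np_var l + (\<Sum>k\<in>{Suc e..<N l}. sc (s ^ (k - 1)) (cmp d1 k (D l)))" for s l
 have psiP: "psi s l \<in> PV X" if "l < n" for s l
  unfolding psi_def using that by (intro PV_add PV_sum PV_sc cP) auto
 have HH: "psi s \<in> HH" for s
 proof (cases "s = 0")
  case True
  have "psi s l = np_var l" for l unfolding psi_def True using e by (auto simp: power_0_left intro!: sum.neutral)
  thus ?thesis by (intro HH_cong[OF HH_id psiP]) (auto simp: T_0)
 next
  case False
  define c where "c t l = sc t (np_var l :: (nat, 'k) npoly)" for t l
  have kc: "mdeg d1 m \<le> 1" if "m \<in> ks (c t l)" for m t l
   using that unfolding c_def np_var_def by (auto simp: in_keys_iff lookup_single when_def d1_simp split: if_splits)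
  have cc: "c t \<in> HH" if t: "t \<noteq> 0" for t
   by (rule HH_aff[of "c t" "c (inverse t)"])
    (use t kc in \<open>auto simp: c_def np.ev_sc T_0 simp del: map_single intro!: PV_sc\<close>)
  have comp: "(%l. subst (c s) (subst Phi (c (inverse s) l))) \<in> HH"
   using HH_comp[OF cc[OF False] HH_comp[OF lead_HH[OF Phi] cc[of "inverse s"]]] False by simp
  show ?thesis
  proof (rule HH_cong[OF comp psiP])
   fix l assume l: "l < n"
   have c1: "c s = (%v. sc (s ^ d1 v) (np_var v))" by (rule ext) (simp add: c_def d1_simp)
   have "subst (c s) (D l) = (\<Sum>k<dbound d1 (D l). sc (s ^ k) (cmp d1 k (D l)))"
    unfolding c1 by (rule subst_scale_vars)
   also have "\<dots> = (\<Sum>k<N l. sc (s ^ k) (cmp d1 k (D l)))"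
   proof (rule sum.mono_neutral_left)
    show "\<forall>k\<in>{..<N l} - {..<dbound d1 (D l)}. sc (s ^ k) (cmp d1 k (D l)) = 0"
    proof
     fix k assume "k \<in> {..<N l} - {..<dbound d1 (D l)}"
     hence "cmp d1 k (D l) = 0" by (intro cmp_big) simp
     thus "sc (s ^ k) (cmp d1 k (D l)) = 0" by simp
    qed
   qed (auto simp: N_def)
   also have "\<dots> = (\<Sum>k<Suc e. sc (s ^ k) (cmp d1 k (D l))) + (\<Sum>k\<in>{Suc e..<N l}. sc (s ^ k) (cmp d1 k (D l)))"
   proof -
    have "Suc e \<le> N l" by (simp add: N_def)
    hence "{..<N l} = {..<Suc e} \<union> {Suc e..<N l}" by auto
    thus ?thesis using sum.union_disjoint[of "{..<Suc e}" "{Suc e..<N l}"] by fastforce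
   qed
   finally have sD: "subst (c s) (D l) - (\<Sum>k\<in>{Suc e..<N l}. sc (s ^ k) (cmp d1 k (D l))) \<in> T X"
    using G_cmp[OF D[OF l]] by (simp only: add_diff_cancel_right') (intro T_sum T_sc; simp)
   have "sc (inverse s) (\<Sum>k\<in>{Suc e..<N l}. sc (s ^ k) (cmp d1 k (D l))) = psi s l - np_var l"
    unfolding psi_def np.scale_sum_right np.scale_scale add_diff_cancel_left'
    using False by (intro sum.cong) (auto simp: power_diff field_simps)
   moreover have "subst (c s) (subst Phi (c (inverse s) l)) = np_var l + sc (inverse s) (subst (c s) (D l))"
    using False by (simp add: c_def D_def np.ev_sc np.ev_diff np.scale_right_diff_distrib)
   ultimately have "subst (c s) (subst Phi (c (inverse s) l)) - psi s l =
     sc (inverse s) (subst (c s) (D l) - (\<Sum>k\<in>{Suc e..<N l}. sc (s ^ k) (cmp d1 k (D l))))"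
    by (simp add: np.scale_right_diff_distrib)
   hence "subst (c s) (subst Phi (c (inverse s) l)) - psi s l \<in> T X" using T_sc[OF sD, of "inverse s"] by simp
   thus "psi s l - subst (c s) (subst Phi (c (inverse s) l)) \<in> T X" by (rule T_swap)
  qed
 qed
 show ?thesis unfolding fam_def
 proof (rule exI[of _ psi], intro conjI allI impI)
  fix l assume l: "l < n"
  show "pf sc (PV X) (%s. psi s l)" unfolding psi_def
   by (intro np.pf_add np.pf_sum np.pf_tpow np.pf_const subspace_PP cP l) (use l in auto)
 next
  fix s
  show "lead e (psi s) (%j. sc (poly (monom 1 e) s) (g j))"
   unfolding lead_def
  proof (intro conjI allI impI HH)
   fix l assume l: "l < n"
   show "sc (poly (monom 1 e) s) (g l) \<in> G X (e + 1)" by (rule G_sc[OF lead_G[OF Phi l]])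
   have "{Suc e..<N l} = insert (Suc e) {e + 2..<N l}" by (auto simp: N_def)
   hence "psi s l - np_var l - sc (s ^ e) (g l) = sc (s ^ e) (cmp d1 (e + 1) (D l) - g l) +
     (\<Sum>k\<in>{e + 2..<N l}. sc (s ^ (k - 1)) (cmp d1 k (D l)))"
    unfolding psi_def by (simp add: np.scale_right_diff_distrib)
   moreover have "cmp d1 (e + 1) (D l) - g l \<in> G X (e + 2)"
   proof -
    have "D l - cmp d1 (e + 1) (D l) \<in> G X (e + 2)" using G_Suc[OF D[OF l]] by simp
    from G_diff[OF lead_2[OF Phi l] this] show ?thesis by (simp add: D_def algebra_simps)
   qed
   moreover have "cmp d1 k (D l) \<in> G X (e + 2)" if "k \<in> {e + 2..<N l}" for k
    by (rule G_mono[OF hom_G[OF hom_cmp cP[OF l]]]) (use that in auto)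
   ultimately show "psi s l - np_var l - sc (poly (monom 1 e) s) (g l) \<in> G X (e + 2)"
    by (auto simp: poly_monom intro!: G_add G_sum G_sc)
  qed
 qed
qed

text \<open>Replacing \<open>p(s)\<close> by \<open>p(s + 1) - p(s)\<close> lowers the degree until \<open>p\<close> is linear.\<close>

lemma fam_linear:
 assumes e: "e \<ge> 1" and g: "g \<in> W e"
 obtains a b where "a \<noteq> 0" "fam e g [:b, a:]"
proof -
 \<comment> \<open>Asking for \<open>p\<close> and \<open>- p\<close> together makes the property
   pass to the difference of \<open>p\<close> and its shift.\<close>
 let ?P = "%p. fam e g p \<and> fam e g (- p) \<and> degree p \<ge> 1"
 have neg: "fam e g (- monom 1 e)"
  using fam_base[OF e W_neg[OF e g]] unfolding fam_def by simp
 have "?P (monom 1 e)" using fam_base[OF e g] neg e by (simp add: degree_monom_eq)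
 then obtain p where p: "?P p" and min: "\<And>q. ?P q ==> degree p \<le> degree q"
  using ex_has_least_nat[of ?P _ degree] by blast
 define q where "q = pcompose p [:1, 1:] - p"
 have dp: "degree (pcompose p [:1, 1:]) = degree p" by (simp add: degree_pcompose)
 have lp: "coeff (pcompose p [:1, 1:]) (degree p) = coeff p (degree p)"
  using lead_coeff_comp[of "[:1, 1:]" p] dp by simp
 have dq: "degree q < degree p"
 proof (rule ccontr)
  assume "\<not> degree q < degree p"
  moreover have "degree q \<le> degree p" unfolding q_def using dp by (intro degree_diff_le) auto
  ultimately have "degree q = degree p" by simp
  hence "coeff q (degree q) = 0" using lp by (simp add: q_def)
  hence "q = 0" by simp
  thus False using p \<open>degree q = degree p\<close> by simp
 qed
 have "fam e g q" "fam e g (- q)"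
  using fam_add[OF e fam_shift, of g p "- p"] fam_add[OF e fam_shift, of g "- p" p] p
  by (auto simp: q_def pcompose_uminus)
 hence "degree q = 0" using min[of q] dq by fastforce
 then obtain c where c: "q = [:c:]" by (rule degree_eq_zeroE)
 \<comment> \<open>The difference is a constant \<open>c\<close>, so \<open>p\<close> is affine on
   the natural numbers, which are infinitely many points in characteristic zero.\<close>
 have "poly p (of_nat k) = poly [:poly p 0, c:] (of_nat k)" for k
 proof (induction k)
  case (Suc k)
  have "poly p (of_nat (Suc k)) = poly p (of_nat k) + poly q (of_nat k)"
   by (simp add: q_def poly_pcompose)
  thus ?case using Suc c by (simp add: algebra_simps)
 qed simp
 hence "(of_nat k :: 'k) \<in> {x. poly (p - [:poly p 0, c:]) x = 0}" for k by simp
 hence "range (of_nat :: nat => 'k) <= {x. poly (p - [:poly p 0, c:]) x = 0}" by blast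
 hence "infinite {x. poly (p - [:poly p 0, c:]) x = 0}"
 proof (rule infinite_super)
  have "inj (of_nat :: nat => 'k)" by (auto simp: inj_on_def)
  thus "infinite (range (of_nat :: nat => 'k))" by (rule range_inj_infinite)
 qed
 hence "p - [:poly p 0, c:] = 0" using poly_roots_finite by blast
 hence pe: "p = [:poly p 0, c:]" by simp
 moreover have "c \<noteq> 0" using p pe by (metis One_nat_def degree_pCons_0 not_one_le_zero pCons_0_0)
 ultimately show ?thesis using that[of c "poly p 0"] p by metis
qed

text \<open>Composing with the inverse of the member at parameter 0 removes the constant
  \<open>b\<close> of \<open>fam_linear\<close>, and the parameter \<open>c / a * t ^ m\<close>
  adjusts the scalar. The deviation from the identity is then divisible by \<open>t ^ m\<close>,
  which \<open>pf_kill\<close> relies on.\<close>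

lemma fam_scaled:
 assumes e: "e \<ge> 1" and g: "g \<in> W e" and m: "m \<ge> 1"
 obtains r where "\<And>j. j < n ==> pf sc (PV X) (%t. r t j)"
  "\<And>t. lead e (%j. np_var j + sc (t ^ m) (r t j)) (%j. sc (c * t ^ m) (g j))"
proof -
 obtain a b where a: "a \<noteq> 0" and "fam e g [:b, a:]" by (rule fam_linear[OF e g])
 then obtain psi where psi: "\<And>j. j < n ==> pf sc (PV X) (%s. psi s j)" "\<And>s. lead e (psi s) (%j. sc (b + s * a) (g j))"
  by (auto simp: fam_def)
 obtain psi0 where psi0: "psi0 \<in> HH" "\<And>j. j < n ==> subst (psi 0) (psi0 j) - np_var j \<in> T X"
  using HH_inv[OF lead_HH[OF psi(2)[of 0]]] by blast
 have l0: "lead e psi0 (%j. - sc b (g j))"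
  using lead_inv[OF e psi(2)[of 0] psi0] by simp
 define th where "th s j = subst (psi s) (psi0 j)" for s j
 have th: "lead e (th s) (%j. sc (s * a) (g j))" for s
  using lead_comp[OF e psi(2)[of s] l0] unfolding th_def by (simp add: np.scale_left_distrib)
 have thp: "pf sc (PV X) (%s. th s j)" if "j < n" for j
  unfolding th_def by (rule pf_subst[where V = X, OF np.pf_const]) (auto simp: HH_PV[OF psi0(1) that] psi)
 have "\<exists>r. pf sc (PV X) r \<and> (\<forall>s. th s j = th 0 j + sc s (r s))" if "j < n" for j
  using thp[OF that]
 proof cases
  case zero
  thus ?thesis by (intro exI[of _ "%_. 0"]) (auto intro: pf.zero simp: fun_eq_iff)
 next
  case (step a f)
  thus ?thesis by (intro exI[of _ f]) (auto simp: fun_eq_iff)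
 qed
 then obtain r where r: "\<And>j. j < n ==> pf sc (PV X) (r j)" "\<And>j s. j < n ==> th s j = th 0 j + sc s (r j s)"
  by metis
 let ?c = "c / a"
 show ?thesis
 proof (rule that[of "%t j. sc ?c (r j (?c * t ^ m))"])
  fix j assume "j < n"
  thus "pf sc (PV X) (%t. sc ?c (r j (?c * t ^ m)))"
   by (intro np.pf_scale np.pf_cpow subspace_PP r)
 next
  fix t
  let ?s = "?c * t ^ m" and ?Phi = "%j. np_var j + sc (t ^ m) (sc ?c (r j (?c * t ^ m)))"
  have eq: "?Phi j - th ?s j \<in> T X" if "j < n" for j
   using T_swap[OF psi0(2)[OF that]] r(2)[OF that, of ?s] by (simp add: th_def mult.commute)
  have P: "?Phi j \<in> PV X" if "j < n" for j
   using np.pf_in[OF subspace_PP r(1)[OF that]] that by (intro PV_add PV_sc) auto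
  have H: "?Phi \<in> HH" by (rule HH_cong[OF lead_HH[OF th] P eq])
  have "?s * a = c * t ^ m" using a by simp
  hence L: "lead e (th ?s) (%j. sc (c * t ^ m) (g j))" using th[of ?s] by simp
  show "lead e ?Phi (%j. sc (c * t ^ m) (g j))"
   unfolding lead_def
  proof (intro conjI allI impI H lead_G[OF L])
   fix j assume j: "j < n"
   from G_add[OF T_G[OF eq[OF j]] lead_2[OF L j]]
   show "?Phi j - np_var j - sc (c * t ^ m) (g j) \<in> G X (e + 2)" by simp
  qed
 qed
qed

lemma W_scale: "e \<ge> 1 ==> g \<in> W e ==> (%j. sc c (g j)) \<in> W e"
proof (rule fam_scaled[of e g 1 c])
 fix r assume "\<And>t. lead e (%j. np_var j + sc (t ^ 1) (r t j)) (%j. sc (c * t ^ 1) (g j))"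
 from this[of 1] show ?thesis unfolding W_def by auto
qed auto

lemma subspace_W: "e \<ge> 1 ==> tp.subspace (W e)"
proof (rule tp.subspaceI, goal_cases)
 case 1
 thus ?case using W_0 by (simp add: zero_fun_def)
next
 case (2 g h)
 thus ?case using W_add by (simp add: plus_fun_def)
qed (rule W_scale)

lemmas tvand = tp.vandermonde2[OF of_nat_ne]

text \<open>\<open>W e\<close> is a linear space, so a polynomial family in it has its value and its
  derivative at 0 there too. Applied to conjugations, the derivative is a bracket.\<close>

lemma W_jet:
 assumes e: "e \<ge> 1" and j: "\<And>l. l < n ==> jet sc (PV X) (%t. f t l) (a l) (b l)" and f: "\<And>t. t \<noteq> 0 ==> f t \<in> W e"
 shows "a \<in> W e" "b \<in> W e"
proof -
 have "\<forall>l. \<exists>r. l < n \<longrightarrow> pf sc (PV X) r \<and> (\<forall>t. f t l = a l + sc t (b l + sc t (r t)))"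
  using j unfolding jet_def by blast
 then obtain r where r: "\<And>l. l < n ==> pf sc (PV X) (r l)" "\<And>l t. l < n ==> f t l = a l + sc t (b l + sc t (r l t))"
  by metis
 have p: "pf tsc UNIV (%t l. if l < n then r l t else 0)"
  by (rule pf_tuple[OF r(1)]) (auto simp: PV_0)
 have "a + tsc t (b + tsc t (%l. if l < n then r l t else 0)) \<in> W e" if "t \<noteq> 0" for t
  by (rule W_cong[OF f[OF that]]) (simp add: r(2) G_0)
 thus "a \<in> W e" "b \<in> W e" using tvand[OF subspace_W[OF e] p] by blast+
qed

end

section \<open>Families of polynomials modulo second order\<close>

context nsvar
begin

lemma subst_G1:
 assumes "\<And>v. v \<in> V ==> ro v \<in> G V' 1" "f \<in> G V k" shows "subst ro f \<in> G V' k"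
proof -
 have "subst ro f \<in> G V' (k + 0)"
 proof (rule filtered_lin[OF np.lin_ev _ _ assms(2)])
  fix m assume m: "okm (unital M) V m"
  have "meval (\<star>) ro t \<in> G V' (mag_deg d1 t)" if "set_mag t <= V" for t
   using that by (induction t) (use assms(1) G_mult in \<open>auto simp: d1_simp\<close>)
  thus "subst ro (mon m) \<in> G V' (mdeg d1 m + 0)" using m PV_G0[of "mon None" V'] by (cases m) simp_all
 next
  fix f assume "f \<in> T V"
  thus "subst ro f \<in> T V'" by (rule T_subst) (rule G_PV[OF assms(1)])
 qed
 thus ?thesis by simp
qed

lemma der_tuple_0 [simp]: "der xi (%_. 0) f = 0"
 using der_tuple_sc[of xi 0 "%_. 0" f] by simp

lemma der_const_G:
 assumes F: "\<And>v. v \<in> V ==> F v \<in> PV V \<and> hom_deg d1 0 (F v)" and f: "f \<in> G V (k + 1)"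
 shows "der np_var F f \<in> G V k"
proof -
 have "der np_var F (cmp d1 j f) \<in> G V k" for j
 proof (cases "j < k + 1")
  case True
  thus ?thesis using F G_cmp[OF f] by (intro T_G T_der) auto
 next
  case False
  then obtain i where j: "j = Suc i" by (cases j) auto
  have "hom_deg d1 i (der np_var F (cmp d1 j f))"
  proof (rule hom_der[where a = 1 and b = 0])
   show "\<And>v. v \<in> V ==> \<exists>d. hom_deg d1 d (F v) \<and> d + 1 = d1 v + 0" using F by (auto simp: d1_simp)
   show "cmp d1 j f \<in> PV V" by (rule cmp_PP[OF G_PV[OF f]])
  qed (auto simp: j)
  moreover have "der np_var F (cmp d1 j f) \<in> PV V"
   by (rule der_PP[OF cmp_PP[OF G_PV[OF f]]]) (use F in auto)
  ultimately show ?thesis using False j by (intro G_mono[OF hom_G]) auto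
 qed
 hence "(\<Sum>j<dbound d1 f. der np_var F (cmp d1 j f)) \<in> G V k" by (intro G_sum)
 thus ?thesis by (simp add: der_sum[symmetric] sum_cmp_dbound)
qed

text \<open>Congruence modulo \<open>t ^ 2\<close> to a family in \<open>S\<close>. With
  \<open>S\<close> the identities this is triviality to first order; with \<open>S\<close> a step of
  the filtration it is triviality to first order in low degrees.\<close>

definition near :: "'v set => ('v, 'k) npoly set => ('k => ('v, 'k) npoly) => bool" where
 "near V S f \<longleftrightarrow> (\<exists>r s. pf sc (PV V) r \<and> pf sc S s \<and> (\<forall>t. f t = sc (t ^ 2) (r t) + s t))"

lemma near_add: "np.subspace S ==> near V S f ==> near V S g ==> near V S (%t. f t + g t)"
 unfolding near_def
proof (elim exE conjE, goal_cases)
 case (1 r r' s s')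
 thus ?case
  by (intro exI[of _ "%t. r t + r' t"] exI[of _ "%t. s t + s' t"])
   (auto intro!: np.pf_add subspace_PP simp: np.scale_right_distrib)
qed

lemma near_scale: "np.subspace S ==> near V S f ==> near V S (%t. sc c (f t))"
 unfolding near_def
proof (elim exE conjE, goal_cases)
 case (1 r s)
 thus ?case
  by (intro exI[of _ "%t. sc c (r t)"] exI[of _ "%t. sc c (s t)"])
   (auto intro!: np.pf_scale subspace_PP simp: np.scale_right_distrib mult.commute)
qed

lemma near_diff: "np.subspace S ==> near V S f ==> near V S g ==> near V S (%t. f t - g t)"
 using near_add[of S V f "%t. sc (-1) (g t)"] near_scale[of S V g "-1"] by simp

lemma near_tscale: "np.subspace S ==> near V S f ==> near V S (%t. sc t (f t))"
 unfolding near_def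
proof (elim exE conjE, goal_cases)
 case (1 r s)
 thus ?case
  by (intro exI[of _ "%t. sc t (r t)"] exI[of _ "%t. sc t (s t)"])
   (auto intro!: np.pf_tscale subspace_PP simp: np.scale_right_distrib mult.commute)
qed

lemma near_pf: "pf sc S f ==> near V S f"
 unfolding near_def by (intro exI[of _ "%_. 0"] exI[of _ f]) (auto intro: pf.zero)

lemma near_t2: "pf sc (PV V) r ==> near V S (%t. sc (t ^ 2) (r t))"
 unfolding near_def by (intro exI[of _ r] exI[of _ "%_. 0"]) (auto intro: pf.zero)

lemma near_jet:
 assumes "jet sc (PV V) f a b" "a \<in> S" "b \<in> S" shows "near V S f"
proof -
 obtain r where r: "pf sc (PV V) r" "\<And>t. f t = a + sc t (b + sc t (r t))"
  using assms(1) by (auto simp: jet_def)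
 have "pf sc S (%t. a + sc t (b + sc t 0))" by (intro pf.step assms pf.zero)
 thus ?thesis unfolding near_def
  using r by (intro exI[of _ r] exI[of _ "%t. a + sc t b"]) (auto simp: np.scale_right_distrib power2_eq_square)
qed

text \<open>To first order the effect of \<open>ro\<close> is a substitution together with a
  derivation, both with data that are trivial modulo identities.\<close>

lemma near_subst:
 assumes ro: "\<And>v. v \<in> V ==> near V (T V) (%t. ro t v - np_var v)" and h: "pf sc (PV V) h"
 shows "near V (T V) (%t. subst (ro t) (h t) - h t)"
proof -
 have "T V <= PV V" using T_PV by auto
 note TPV = pf_mono[OF _ this]
 have "\<forall>v. \<exists>a b. v \<in> V \<longrightarrow> jet sc (PV V) (%t. ro t v) (np_var v + a) b \<and> a \<in> T V \<and> b \<in> T V"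
 proof (intro allI)
  fix v
  show "\<exists>a b. v \<in> V \<longrightarrow> jet sc (PV V) (%t. ro t v) (np_var v + a) b \<and> a \<in> T V \<and> b \<in> T V"
  proof (cases "v \<in> V")
   case True
   then obtain r s where rs: "pf sc (PV V) r" "pf sc (T V) s" "\<And>t. ro t v - np_var v = sc (t ^ 2) (r t) + s t"
    using ro[OF True] by (auto simp: near_def)
   obtain a b where ab: "jet sc (T V) s a b" by (rule np.jet_of_pf[OF subspace_T rs(2)])
   then obtain r' where r': "pf sc (T V) r'" "\<And>t. s t = a + sc t (b + sc t (r' t))" "a \<in> T V" "b \<in> T V"
    by (auto simp: jet_def)
   have "ro t v = (np_var v + a) + sc t (b + sc t (r t + r' t))" for t
    using rs(3)[of t] r'(2)[of t] by (simp add: algebra_simps np.scale_right_distrib power2_eq_square)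
   moreover have "pf sc (PV V) (%t. r t + r' t)" by (intro np.pf_add subspace_PP rs TPV r')
   moreover have "np_var v + a \<in> PV V" using True r'(3) by (simp add: PV_add T_PV)
   ultimately have "jet sc (PV V) (%t. ro t v) (np_var v + a) b"
    unfolding jet_def using T_PV[OF r'(4)] by blast
   thus ?thesis using r' by blast
  qed simp
 qed
 then obtain a b where ab: "\<And>v. v \<in> V ==> jet sc (PV V) (%t. ro t v) (np_var v + a v) (b v)"
  "\<And>v. v \<in> V ==> a v \<in> T V" "\<And>v. v \<in> V ==> b v \<in> T V" by metis
 show ?thesis
  using h
 proof induction
  case zero
  thus ?case by (simp add: np.ev_0 near_pf pf.zero)
 next
  case (step c f)
  have j: "jet sc (PV V) (%t. subst (ro t) c) (subst (%v. np_var v + a v) c) (der (%v. np_var v + a v) b c)"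
   by (rule jet_subst[OF step(1) ab(1)])
  have P: "np_var v + a v \<in> PV V" if "v \<in> V" for v using that ab by (simp add: PV_add T_PV)
  have 1: "subst (%v. np_var v + a v) c - c \<in> T V"
   using subst_tuple_cong[of V "%v. np_var v + a v" np_var V c] ab(2) P step(1) by simp
  have 2: "der (%v. np_var v + a v) b c \<in> T V"
   using der_tuple_cong[of V b "%_. 0" V "%v. np_var v + a v" c] ab(3) P step(1) by simp
  have "near V (T V) (%t. subst (ro t) c - c)"
   by (rule near_jet[OF np.jet_diff[OF subspace_PP j np.jet_const[OF subspace_PP step(1)]]]) (use 1 2 in simp_all)
  from near_add[OF subspace_T this near_tscale[OF subspace_T step.IH]]
  show ?case by (simp add: np.ev_add np.ev_sc np.scale_right_diff_distrib algebra_simps)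
 qed
qed

end

section \<open>Brackets of leading terms with linear derivations\<close>

context autgrp
begin

text \<open>Substitutions without constant terms do not lower degrees, so the estimate for
  \<open>Phi\<close> survives the conjugation. Translations violate this and are treated in
  \<open>W_trans\<close>.\<close>

lemma lead_conj:
 assumes e: "e \<ge> 1" and Phi: "lead e Phi g" and \<Sigma>: "\<Sigma> \<in> HH" "\<Sigma>' \<in> HH" "\<And>l. l < n ==> subst \<Sigma> (\<Sigma>' l) - np_var l \<in> T X"
  and G1: "\<And>l. l < n ==> \<Sigma> l \<in> G X 1" "\<And>l. l < n ==> \<Sigma>' l \<in> G X 1"
 shows "(%l. subst \<Sigma> (der np_var g (\<Sigma>' l))) \<in> W e"
proof -
 have "lead e (%l. subst \<Sigma> (subst Phi (\<Sigma>' l))) (%l. subst \<Sigma> (der np_var g (\<Sigma>' l)))"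
  unfolding lead_def
 proof (intro conjI allI impI HH_comp lead_HH[OF Phi] \<Sigma>)
  fix l assume l: "l < n"
  have S: "subst \<Sigma> f \<in> G X k" if "f \<in> G X k" for f k by (rule subst_G1[OF _ that]) (use G1 in auto)
  have "der np_var g (\<Sigma>' l) \<in> G X (1 + e)" by (rule der_G[OF _ G1(2)[OF l]]) (use lead_G[OF Phi] in auto)
  thus "subst \<Sigma> (der np_var g (\<Sigma>' l)) \<in> G X (e + 1)" using S by simp
  have "subst Phi (\<Sigma>' l) - \<Sigma>' l - der np_var g (\<Sigma>' l) \<in> G X (1 + (e + 1))"
   by (rule subst_lead[OF e _ _ _ G1(2)[OF l]]) (use Phi HH_PV lead_HH in \<open>auto simp: lead_def\<close>)
  hence "subst \<Sigma> (subst Phi (\<Sigma>' l) - \<Sigma>' l - der np_var g (\<Sigma>' l)) \<in> G X (e + 2)"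
   using S by simp
  from G_add[OF this T_G[OF \<Sigma>(3)[OF l]]]
  show "subst \<Sigma> (subst Phi (\<Sigma>' l)) - np_var l - subst \<Sigma> (der np_var g (\<Sigma>' l)) \<in> G X (e + 2)"
   by (simp add: np.ev_diff np.ev_add algebra_simps)
 qed
 thus ?thesis unfolding W_def by blast
qed

lemma ks_var: "ks (np_var v :: (nat, 'k) npoly) = {Some (Gen v)}"
 by (simp add: np_var_def)

lemma keys_lin: "m \<in> ks (sc a (np_var i) + sc b (np_var j) :: (nat, 'k) npoly) ==> mdeg d1 m \<le> 1"
proof -
 assume "m \<in> ks (sc a (np_var i) + sc b (np_var j) :: (nat, 'k) npoly)"
 hence "m \<in> ks (np_var i :: (nat, 'k) npoly) \<union> ks (np_var j :: (nat, 'k) npoly)"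
  using keys_add[of "sc a (np_var i)" "sc b (np_var j)"] by (auto simp: in_keys_iff)
 thus ?thesis by (auto simp: ks_var d1_simp)
qed

text \<open>The conjugation by \<open>\<Sigma> t\<close>, which adds \<open>t\<close> times the
  variable \<open>i\<close> to the variable \<open>j\<close>, is differentiated at
  \<open>t = 0\<close>. For \<open>i \<noteq> j\<close> the inverse is again polynomial in
  \<open>t\<close>. For \<open>i = j\<close> it involves the inverse of \<open>1 + t\<close>;
  multiplying by this scalar clears the denominator at the price of an extra summand
  \<open>g\<close>, which is subtracted at the end.\<close>

lemma W_E:
 assumes e: "e \<ge> 1" and g: "g \<in> W e" and ij: "i < n" "j < n"
 shows "(%l. der np_var (%v. if v = j then np_var i else 0) (g l) - der np_var g (if l = j then np_var i else 0)) \<in> W e"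
proof -
 obtain Phi where Phi: "lead e Phi g" using g by (auto simp: W_def)
 define F :: "nat => (nat, 'k) npoly" where "F v = (if v = j then np_var i else 0)" for v
 have gP: "g l \<in> PV X" if "l < n" for l using G_PV[OF lead_G[OF Phi that]] .
 have F: "F v \<in> PV X" for v using ij by (auto simp: F_def PV_0)
 define \<Sigma> where "\<Sigma> t l = np_var l + sc t (F l)" for t l
 have jS: "jet sc (PV X) (%t. \<Sigma> t v) (np_var v) (F v)" if "v \<in> X" for v
  unfolding jet_def \<Sigma>_def using that F by (intro conjI exI[of _ "%_. 0"]) (auto intro: pf.zero)
 have jg: "jet sc (PV X) (%t. subst (\<Sigma> t) (g l)) (g l) (der np_var F (g l))" if "l < n" for l
 proof -
  have "jet sc (PV X) (%t. subst (\<Sigma> t) (g l)) (subst np_var (g l)) (der np_var F (g l))"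
   by (rule jet_subst[OF gP[OF that] jS])
  thus ?thesis by simp
 qed
 have G1: "\<Sigma> t l \<in> G X 1" if "l < n" for t l
  unfolding \<Sigma>_def F_def using that ij var_G[of _ X] by (intro G_add G_sc) (auto simp: G_0)
 have S1: "\<Sigma> t l \<in> PV X" if "l < n" for t l using G_PV[OF G1[OF that]] .
 have deg: "m \<in> ks (\<Sigma> t l) ==> mdeg d1 m \<le> Suc 0" for m t l
  using keys_lin[of m 1 l "if l = j then t else 0" i] by (simp add: \<Sigma>_def F_def split: if_splits)
 have WF: "(%l. der np_var F (g l) - der np_var g (F l)) \<in> W e"
 proof (cases "i = j")
  case False
  have inv: "subst (\<Sigma> t) (\<Sigma> (- t) l) = np_var l" for t l
   using False by (auto simp: \<Sigma>_def F_def np.ev_add np.ev_sc np.ev_0 np.ev_diff)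
  have HH: "\<Sigma> t \<in> HH" for t
   using inv[of t] inv[of "- t"] by (intro HH_aff[of "\<Sigma> t" "\<Sigma> (- t)"]) (auto simp: S1 deg T_0)
  have Wf: "(%l. subst (\<Sigma> t) (der np_var g (\<Sigma> (- t) l))) \<in> W e" for t
   by (rule lead_conj[OF e Phi HH HH _ G1 G1]) (auto simp: inv T_0)
  have J: "jet sc (PV X) (%t. subst (\<Sigma> t) (der np_var g (\<Sigma> (- t) l))) (g l) (der np_var F (g l) - der np_var g (F l))"
   if l: "l < n" for l
  proof (cases "l = j")
   case True
   have gi: "jet sc (PV X) (%t. sc t (subst (\<Sigma> t) (g i))) 0 (g i)"
   proof -
    obtain r where r: "pf sc (PV X) r" "\<And>t. subst (\<Sigma> t) (g i) = g i + sc t (der np_var F (g i) + sc t (r t))"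
     "der np_var F (g i) \<in> PV X"
     using jg[OF ij(1)] unfolding jet_def by blast
    show ?thesis unfolding jet_def
     using r gP[OF ij(1)] by (intro conjI exI[of _ "%t. der np_var F (g i) + sc t (r t)"] pf.step)
      (auto simp: PV_0 np.scale_right_distrib)
   qed
   have "(%t. subst (\<Sigma> t) (der np_var g (\<Sigma> (- t) l))) = (%t. subst (\<Sigma> t) (g l) - sc t (subst (\<Sigma> t) (g i)))"
    using True by (auto simp: \<Sigma>_def F_def der_add der_sc der_diff np.ev_diff np.ev_add np.ev_sc fun_eq_iff)
   thus ?thesis using np.jet_diff[OF subspace_PP jg[OF l] gi] True by (simp add: F_def)
  next
   case False
   thus ?thesis using jg[OF l] by (simp add: \<Sigma>_def F_def der_0)
  qed
  show ?thesis by (rule W_jet(2)[OF e J Wf])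
 next
  case True
  define \<Theta> where "\<Theta> s = \<Sigma> (s - 1)" for s
  have \<Theta>: "\<Theta> s l = (if l = j then sc s (np_var l) else np_var l)" for s l
   using True by (simp add: \<Theta>_def \<Sigma>_def F_def np.scale_left_diff_distrib)
  have inv: "subst (\<Theta> s) (\<Theta> (inverse s) l) = np_var l" if "s \<noteq> 0" for s l
   using that by (simp add: \<Theta> np.ev_sc)
  have G1\<Theta>: "l < n ==> \<Theta> s l \<in> G X 1" for s l unfolding \<Theta>_def by (rule G1)
  have HH: "\<Theta> s \<in> HH" if "s \<noteq> 0" for s
   using inv[of s] inv[of "inverse s"] that
   by (intro HH_aff[of "\<Theta> s" "\<Theta> (inverse s)"]) (auto simp: S1 deg T_0 \<Theta>_def)
  define f where "f s l = sc (if l = j then 1 else s) (subst (\<Theta> s) (g l))" for s l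
  have f: "f s \<in> W e" if s: "s \<noteq> 0" for s
  proof -
   have "(%l. subst (\<Theta> s) (der np_var g (\<Theta> (inverse s) l))) \<in> W e"
    by (rule lead_conj[OF e Phi HH[OF s] HH[of "inverse s"]]) (simp_all add: s inv T_0 G1\<Theta> del: One_nat_def)
   from W_scale[OF e this, of s] have "(%l. sc s (subst (\<Theta> s) (der np_var g (\<Theta> (inverse s) l)))) \<in> W e" .
   thus ?thesis by (rule W_cong) (use s in \<open>auto simp: f_def \<Theta> der_sc np.ev_sc G_0\<close>)
  qed
  have "pf sc (PV X) (%s. f s l)" if l: "l < n" for l
  proof -
   have "pf sc (PV X) (%s. \<Theta> s v)" if "v \<in> X" for v
    using np.pf_shift[OF np.jet_pf[OF subspace_PP jS[OF that]] subspace_PP, of "-1"] by (simp add: \<Theta>_def)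
   hence "pf sc (PV X) (%s. subst (\<Theta> s) (g l))" by (rule pf_subst[OF np.pf_const[OF gP[OF l]]])
   from this np.pf_tscale[OF subspace_PP this] show ?thesis by (cases "l = j") (simp_all add: f_def)
  qed
  hence pf': "pf tsc UNIV (%s l. if l < n then f s l else 0)" by (intro pf_tuple[of n "PV X"]) (auto simp: PV_0)
  \<comment> \<open>At \<open>s = 0\<close> no automorphism stands behind \<open>f s\<close>, but
    the shifted parameter \<open>t = s - 1\<close> used below meets this value at
    \<open>t = - 1\<close>.\<close>
  have "pf tsc (W e) (%s l. if l < n then f s l else 0)"
   by (rule tp.vandermonde[OF of_nat_ne subspace_W[OF e] pf'], rule W_cong[OF f]) (auto simp: G_0)
  hence "(%l. if l < n then f s l else 0) \<in> W e" for s by (rule tp.pf_in[OF subspace_W[OF e]])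
  hence Wf: "(%l. if l < n then f (t + 1) l else 0) \<in> W e" for t by blast
  have J: "jet sc (PV X) (%t. if l < n then f (t + 1) l else 0) (g l)
    (if l = j then der np_var F (g l) else der np_var F (g l) + g l)" if l: "l < n" for l
  proof (cases "l = j")
   case True
   thus ?thesis using jg[OF l] l by (simp add: f_def \<Theta>_def)
  next
   case False
   obtain r where r: "pf sc (PV X) r" "\<And>t. subst (\<Sigma> t) (g l) = g l + sc t (der np_var F (g l) + sc t (r t))"
     "der np_var F (g l) \<in> PV X"
     using jg[OF l] unfolding jet_def by blast
   have p: "pf sc (PV X) (%t. (der np_var F (g l) + sc t (r t)) + r t)"
    by (intro np.pf_add pf.step subspace_PP r)
   have "sc (t + 1) (subst (\<Sigma> t) (g l)) = g l + sc t ((der np_var F (g l) + g l) + sc t ((der np_var F (g l) + sc t (r t)) + r t))" for t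
    by (simp add: r np.scale_right_distrib np.scale_left_distrib algebra_simps)
   thus ?thesis using False l p r(3) gP[OF l]
    unfolding jet_def by (auto simp: f_def \<Theta>_def intro!: PV_add exI[of _ "%t. (der np_var F (g l) + sc t (r t)) + r t"])
  qed
  have "(%l. if l = j then der np_var F (g l) else der np_var F (g l) + g l) \<in> W e"
   by (rule W_jet(2)[OF e J Wf])
  from W_add[OF e this W_neg[OF e g]] show ?thesis
   by (rule W_cong) (use True in \<open>auto simp: F_def der_0 G_0\<close>)
 qed
 thus ?thesis by (simp add: F_def[abs_def])
qed

text \<open>The bracket is linear in \<open>a\<close>, and \<open>a\<close> is a combination of
  tuples with a single monomial in a single entry.\<close>

lemma W_brk_sum:
 assumes e: "e \<ge> 1" and g: "\<And>l. l < n ==> g l \<in> PV X" and a: "\<And>l. l < n ==> a l \<in> S"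
  and S: "np.subspace S" and SP: "S <= PV X"
  and *: "\<And>j m. j < n ==> m \<in> (\<Union>f\<in>S. ks f) ==> mon m \<in> S \<and>
   (%l. der np_var (%v. if v = j then mon m else 0) (g l) - der np_var g (if l = j then mon m else 0)) \<in> W e"
 shows "(%l. der np_var a (g l) - der np_var g (a l)) \<in> W e"
proof -
 let ?b = "%j f l. der np_var (%v. if v = j then f else 0) (g l) - der np_var g (if l = j then f else 0)"
 have 1: "?b j f \<in> W e" if j: "j < n" and f: "f \<in> S" for j f
 proof -
  have add: "?b j (f + h) = (%l. ?b j f l + ?b j h l)" for f h
  proof
   fix l
   have "(%v. if v = j then f + h else 0) = (%v. (if v = j then f else 0) + (if v = j then h else 0))" by auto
   thus "?b j (f + h) l = ?b j f l + ?b j h l" by (simp only: der_tuple_add) (simp add: der_add der_0)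
  qed
  have scl: "?b j (sc c f) = (%l. sc c (?b j f l))" for c f
  proof
   fix l
   have "(%v. if v = j then sc c f else 0) = (%v. sc c (if v = j then f else 0))" by auto
   thus "?b j (sc c f) l = sc c (?b j f l)"
    by (simp only: der_tuple_sc) (simp add: der_sc der_0 np.scale_right_diff_distrib)
  qed
  have "np.subspace {f. ?b j f \<in> W e}"
  proof (rule np.subspaceI, goal_cases)
   case 1
   show ?case using W_0[of e] by (simp add: der_0)
  next
   case (2 f h)
   thus ?case using W_add[OF e] by (simp only: mem_Collect_eq add)
  next
   case (3 f c)
   thus ?case using W_scale[OF e] by (simp only: mem_Collect_eq scl)
  qed
  hence "f \<in> {f. ?b j f \<in> W e}" by (rule np_subspaceI) (use * j f in blast)
  thus ?thesis by simp
 qed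
 have "(%l. \<Sum>j<m. ?b j (a j) l) \<in> W e" if "m \<le> n" for m
  using that by (induction m) (auto simp: W_0 intro!: W_add e 1 a)
 hence "(%l. \<Sum>j<n. ?b j (a j) l) \<in> W e" by simp
 thus ?thesis
 proof (rule W_cong)
  fix l assume l: "l < n"
  have "der np_var (%v. \<Sum>j<m. if v = j then a j else 0) (g l) = (\<Sum>j<m. der np_var (%v. if v = j then a j else 0) (g l))" for m
  proof (induction m)
   case 0
   thus ?case by simp
  qed (simp add: der_tuple_add)
  moreover have "der np_var a (g l) = der np_var (%v. \<Sum>j<n. if v = j then a j else 0) (g l)"
   by (rule der_cong[OF g[OF l]]) auto
  moreover have "(\<Sum>j<n. der np_var g (if l = j then a j else 0)) = der np_var g (a l)"
   using l by (simp add: if_distrib[of "der np_var g"] der_0 cong: if_cong)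
  ultimately show "der np_var a (g l) - der np_var g (a l) - (\<Sum>j<n. ?b j (a j) l) \<in> G X (e + 2)"
   by (simp add: sum_subtractf G_0)
 qed
qed

lemma W_L0:
 assumes e: "e \<ge> 1" and g: "g \<in> W e" and a: "\<And>l. l < n ==> a l \<in> PV X \<and> hom_deg d1 1 (a l)"
 shows "(%l. der np_var a (g l) - der np_var g (a l)) \<in> W e"
proof (rule W_brk_sum[OF e, where S = "{f \<in> PV X. hom_deg d1 1 f}"])
 have "np.subspace (PV X \<inter> {f. hom_deg d1 1 f})" by (intro np.subspace_inter subspace_PP subspace_hom)
 thus "np.subspace {f \<in> PV X. hom_deg d1 1 f}" by (simp add: Int_def)
 fix j m assume j: "j < n" and "m \<in> (\<Union>f\<in>{f \<in> PV X. hom_deg d1 1 f}. ks f)"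
 hence m: "okm (unital M) X m" "mdeg d1 m = 1" by (auto simp: PP_def hom_deg_def)
 have deg1: "mag_deg d1 t \<ge> 1" for t :: "nat mag" by (induction t) (auto simp: d1_simp)
 obtain i where i: "m = Some (Gen i)" "i < n"
 proof (cases m)
  case (Some t)
  thus ?thesis
  proof (cases t)
   case (Node s s')
   thus ?thesis using Some m deg1[of s] deg1[of s'] by simp
  qed (use Some m that in auto)
 qed (use m in simp)
 thus "mon m \<in> {f \<in> PV X. hom_deg d1 1 f} \<and>
   (%l. der np_var (%v. if v = j then mon m else 0) (g l) - der np_var g (if l = j then mon m else 0)) \<in> W e"
 proof -
  have mi: "(mon m :: (nat, 'k) npoly) = np_var i" by (simp add: i np_var_def)
  show ?thesis unfolding mi using i W_E[OF e g i(2) j] by (simp add: d1_simp)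
 qed
qed (use a G_PV[OF W_G[OF g]] in auto)

end

section \<open>Brackets of leading terms with constant derivations\<close>

context autgrp
begin

text \<open>The proof follows the Horner form of \<open>r\<close>: each coefficient is realized by
  \<open>fam_scaled\<close> with a growing power of \<open>t\<close>. Because
  \<open>k \<ge> 2\<close>, the composite differs from the identity only in order
  \<open>t ^ 2\<close>, so it can correct a family without changing its derivative at 0.\<close>

lemma pf_kill:
 assumes e: "e \<ge> 1" and r: "pf tsc (W e) r" and k: "k \<ge> 2"
 shows "\<exists>q. (\<forall>l<n. pf sc (PV X) (%t. q t l)) \<and>
  (\<forall>t. lead e (%l. np_var l + sc (t ^ 2) (q t l)) (%l. sc (t ^ k) (r t l)))"
 using r k
proof (induction arbitrary: k)
 case zero
 have "lead e (%l. np_var l + sc (t ^ 2) 0) (%l. sc (t ^ k) 0)" for t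
  by (simp add: lead_def G_0 HH_id)
 thus ?case by (intro exI[of _ "%_ _. 0"]) (auto intro: pf.zero simp: zero_fun_def)
next
 case (step a f)
 obtain p where p: "\<And>j. j < n ==> pf sc (PV X) (%t. p t j)"
  "\<And>t. lead e (%j. np_var j + sc (t ^ k) (p t j)) (%j. sc (1 * t ^ k) (a j))"
  by (rule fam_scaled[OF e step(1), of k 1]) (use step(4) in auto)
 obtain q where q: "\<And>l. l < n ==> pf sc (PV X) (%t. q t l)"
  "\<And>t. lead e (%l. np_var l + sc (t ^ 2) (q t l)) (%l. sc (t ^ Suc k) (f t l))"
  using step.IH[of "Suc k"] step(4) by auto
 let ?P = "%t j. np_var j + sc (t ^ k) (p t j)"
 have Pp: "pf sc (PV X) (%t. ?P t v)" if "v \<in> X" for v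
  using that by (intro np.pf_add np.pf_const np.pf_tpow p subspace_PP) auto
 let ?q = "%t l. sc (t ^ (k - 2)) (p t l) + subst (?P t) (q t l)"
 have eq: "subst (?P t) (np_var l + sc (t ^ 2) (q t l)) = np_var l + sc (t ^ 2) (?q t l)" for t l
 proof -
  have "k = 2 + (k - 2)" using step(4) by simp
  hence "t ^ k = t ^ 2 * t ^ (k - 2)" by (metis power_add)
  thus ?thesis by (simp add: np.ev_add np.ev_sc np.scale_right_distrib)
 qed
 show ?case
 proof (intro exI[of _ ?q] conjI allI impI)
  fix l assume "l < n"
  thus "pf sc (PV X) (%t. ?q t l)"
   by (intro np.pf_add np.pf_tpow p subspace_PP pf_subst[OF q(1) Pp])
 next
  fix t
  show "lead e (%l. np_var l + sc (t ^ 2) (?q t l)) (%l. sc (t ^ k) ((a + tsc t (f t)) l))"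
   using lead_comp[OF e p(2)[of t] q(2)[of t]] unfolding eq by (simp add: np.scale_right_distrib mult.commute)
 qed
qed

text \<open>If a family of automorphisms equals \<open>x + t b\<close> up to \<open>t\<^sup>2\<close> and terms of degree
 greater than \<open>i\<close>, its components of degree below \<open>i\<close> can be removed by families that are
 trivial modulo \<open>t\<^sup>2\<close>; then \<open>b\<close> becomes a leading term.\<close>

lemma family_lead:
 assumes i: "i \<ge> 2" and b: "\<And>l. l < n ==> b l \<in> G X i"
  and \<alpha>: "\<And>l. l < n ==> pf sc (PV X) (%t. \<alpha> t l)" "\<And>t. \<alpha> t \<in> HH" "\<And>t l. l < n ==> \<alpha> t l - np_var l \<in> G X 2"
   "\<And>l. l < n ==> near X (G X (i + 1)) (%t. \<alpha> t l - np_var l - sc t (b l))"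
 shows "b \<in> W (i - 1)"
proof -
 have step: "\<exists>\<alpha>. (\<forall>l<n. pf sc (PV X) (%t. \<alpha> t l)) \<and> (\<forall>t. \<alpha> t \<in> HH) \<and> (\<forall>t. \<forall>l<n. \<alpha> t l - np_var l \<in> G X (e + 1)) \<and>
   (\<forall>l<n. near X (G X (i + 1)) (%t. \<alpha> t l - np_var l - sc t (b l)))" if "1 \<le> e" "e \<le> i - 1" for e
  using that
 proof (induction e rule: dec_induct)
  case base
  thus ?case using \<alpha> by (intro exI[of _ \<alpha>]) (auto simp: numeral_2_eq_2)
 next
  case (step e)
  then obtain \<alpha> where A: "\<And>l. l < n ==> pf sc (PV X) (%t. \<alpha> t l)" "\<And>t. \<alpha> t \<in> HH"
   "\<And>t l. l < n ==> \<alpha> t l - np_var l \<in> G X (e + 1)"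
   "\<And>l. l < n ==> near X (G X (i + 1)) (%t. \<alpha> t l - np_var l - sc t (b l))" by auto
  have e1: "1 \<le> e" and ei: "e + 2 \<le> i" using step(1,4) i by linarith+
  have "\<forall>l. \<exists>r s. l < n \<longrightarrow> pf sc (PV X) r \<and> pf sc (G X (i + 1)) s \<and>
    (\<forall>t. \<alpha> t l - np_var l - sc t (b l) = sc (t ^ 2) (r t) + s t)"
   using A(4) unfolding near_def by blast
  then obtain r s where rs: "\<And>l. l < n ==> pf sc (PV X) (r l)" "\<And>l. l < n ==> pf sc (G X (i + 1)) (s l)"
   "\<And>l t. l < n ==> \<alpha> t l - np_var l - sc t (b l) = sc (t ^ 2) (r l t) + s l t" by metis
  define R where "R t l = (if l < n then - r l t else 0)" for t l
  have L: "lead e (\<alpha> t) (%l. \<alpha> t l - np_var l)" for t by (rule lead_self[OF A(2,3)])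
  \<comment> \<open>In degree \<open>e + 1\<close> only terms divisible by \<open>t ^ 2\<close>
    survive: \<open>b\<close> starts in degree \<open>i\<close> and \<open>s\<close> in degree
    \<open>i + 1\<close>, both at least \<open>e + 2\<close>.\<close>
  have small: "\<alpha> t l - np_var l - sc (t ^ 2) (r l t) \<in> G X (e + 2)" if l: "l < n" for t l
  proof -
   have "sc t (b l) + s l t \<in> G X (e + 2)"
    by (intro G_add G_sc G_mono[OF b[OF l]] G_mono[OF np.pf_in[OF subspace_G rs(2)[OF l]]]) (use ei in auto)
   thus ?thesis using rs(3)[OF l, of t] by (simp add: algebra_simps)
  qed
  have W': "(%l. sc (t ^ 2) (r l t)) \<in> W e" for t
  proof (rule W_cong)
   show "(%l. \<alpha> t l - np_var l) \<in> W e" using L W_def by blast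
   show "sc (t ^ 2) (r j t) - (\<alpha> t j - np_var j) \<in> G X (e + 2)" if "j < n" for j
    using G_sc[OF small[OF that], of "-1" t] by (simp add: algebra_simps)
  qed
  \<comment> \<open>Division by \<open>t ^ 2\<close> requires \<open>t \<noteq> 0\<close>;
    \<open>vandermonde\<close> then puts all coefficients of \<open>R\<close> into
    \<open>W e\<close>, as \<open>pf_kill\<close> demands.\<close>
  have RW: "R t \<in> W e" if "t \<noteq> 0" for t
  proof (rule W_cong[OF W_scale[OF e1 W'[of t], of "- inverse (t ^ 2)"]])
   show "R t j - sc (- inverse (t ^ 2)) (sc (t ^ 2) (r j t)) \<in> G X (e + 2)" if "j < n" for j
    using that \<open>t \<noteq> 0\<close> by (simp add: R_def G_0)
  qed
  have "pf tsc UNIV R"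
   unfolding R_def[abs_def] by (rule pf_tuple[of n "PV X" "%t l. - r l t"])
    (use np.pf_scale[OF subspace_PP rs(1), of _ "-1"] in \<open>auto simp: PV_0\<close>)
  hence "pf tsc (W e) R"
   by (rule tp.vandermonde[OF of_nat_ne subspace_W[OF e1] _ RW])
  then obtain q where q: "\<And>l. l < n ==> pf sc (PV X) (%t. q t l)"
   "\<And>t. lead e (%l. np_var l + sc (t ^ 2) (q t l)) (%l. sc (t ^ 2) (R t l))"
   using pf_kill[OF e1, of R 2] by auto
  let ?\<beta> = "%t l. subst (\<alpha> t) (np_var l + sc (t ^ 2) (q t l))"
  have bp: "pf sc (PV X) (%t. np_var l + sc (t ^ 2) (q t l))" if "l < n" for l
   using that by (intro np.pf_add np.pf_const np.pf_tpow q subspace_PP) auto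
  have LB: "lead e (?\<beta> t) (%l. (\<alpha> t l - np_var l) + sc (t ^ 2) (R t l))" for t
   by (rule lead_comp[OF e1 L q(2)])
  show ?case
  proof (intro exI[of _ ?\<beta>] conjI allI impI)
   fix l assume l: "l < n"
   show "pf sc (PV X) (%t. ?\<beta> t l)" by (rule pf_subst[OF bp[OF l] A(1)]) simp
   have "near X (G X (i + 1)) (%t. (\<alpha> t l - np_var l - sc t (b l)) + sc (t ^ 2) (subst (\<alpha> t) (q t l)))"
    by (intro near_add subspace_G A(4) l near_t2 pf_subst[OF q(1)[OF l] A(1)]) simp
   thus "near X (G X (i + 1)) (%t. ?\<beta> t l - np_var l - sc t (b l))"
    by (simp add: np.ev_add np.ev_sc algebra_simps)
  next
   fix t
   show "?\<beta> t \<in> HH" by (rule lead_HH[OF LB])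
   fix l assume l: "l < n"
   have "(\<alpha> t l - np_var l) + sc (t ^ 2) (R t l) \<in> G X (e + 2)"
    using small[OF l, of t] l by (simp add: R_def)
   thus "?\<beta> t l - np_var l \<in> G X (Suc e + 1)"
    using G_add[OF lead_2[OF LB[of t] l]] by fastforce
  qed
 qed
 obtain \<alpha> where A: "\<And>t. \<alpha> t \<in> HH" "\<And>t l. l < n ==> \<alpha> t l - np_var l \<in> G X (i - 1 + 1)"
   "\<And>l. l < n ==> near X (G X (i + 1)) (%t. \<alpha> t l - np_var l - sc t (b l))"
 proof -
  have "1 \<le> i - 1" using i by simp
  from step[OF this order_refl] show ?thesis using that by blast
 qed
 have "\<forall>l. \<exists>r s. l < n \<longrightarrow> pf sc (PV X) r \<and> pf sc (G X (i + 1)) s \<and>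
   (\<forall>t. \<alpha> t l - np_var l - sc t (b l) = sc (t ^ 2) (r t) + s t)"
  using A(3) unfolding near_def by blast
 then obtain r s where rs: "\<And>l. l < n ==> pf sc (PV X) (r l)" "\<And>l. l < n ==> pf sc (G X (i + 1)) (s l)"
  "\<And>l t. l < n ==> \<alpha> t l - np_var l - sc t (b l) = sc (t ^ 2) (r l t) + s l t" by metis
 \<comment> \<open>All degrees below \<open>i\<close> have been cleared, so \<open>t\<close> times
   \<open>b + t r\<close> is a leading term for every \<open>t\<close>, and \<open>b\<close> is its
   derivative at 0.\<close>
 have Wf: "(%l. 0 + sc t (b l + sc t (r l t))) \<in> W (i - 1)" for t
 proof (rule W_cong)
  show "(%l. \<alpha> t l - np_var l) \<in> W (i - 1)"
   unfolding W_def using lead_self[OF A(1,2), of t] by blast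
  fix l assume l: "l < n"
  have "s l t \<in> G X (i + 1)" by (rule np.pf_in[OF subspace_G rs(2)[OF l]])
  hence "- s l t \<in> G X (i - 1 + 2)" using G_sc[of "s l t" X "i + 1" "-1"] i by (simp add: Suc_diff_Suc numeral_2_eq_2)
  moreover have "0 + sc t (b l + sc t (r l t)) - (\<alpha> t l - np_var l) = - s l t"
   using rs(3)[OF l, of t] by (simp add: np.scale_right_distrib power2_eq_square algebra_simps)
  ultimately show "0 + sc t (b l + sc t (r l t)) - (\<alpha> t l - np_var l) \<in> G X (i - 1 + 2)" by simp
 qed
 have J: "jet sc (PV X) (%t. 0 + sc t (b l + sc t (r l t))) 0 (b l)" if "l < n" for l
  unfolding jet_def using rs(1)[OF that] G_PV[OF b[OF that]] by (auto simp: PV_0)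
 show ?thesis by (rule W_jet(2)[OF _ J Wf]) (use i in auto)
qed

lemma hom0_const: "hom_deg d1 0 (f :: (nat, 'k) npoly) ==> f = sc (lk f None) (mon None)"
proof -
 assume h: "hom_deg d1 0 f"
 have deg1: "mag_deg d1 t \<ge> 1" for t :: "nat mag" by (induction t) (auto simp: d1_simp)
 have "m = None" if "m \<in> ks f" for m
 proof (cases m)
  case (Some t)
  thus ?thesis using h that deg1[of t] by (auto simp: hom_deg_def)
 qed
 hence "ks f <= {None}" by auto
 hence "lext sc mon f = (\<Sum>m\<in>{None}. sc (lk f m) (mon m))" by (intro np.lext_superset) auto
 thus ?thesis by (simp only: lext_mon) simp
qed

lemma subst_hom0 [simp]: "hom_deg d1 0 (f :: (nat, 'k) npoly) ==> subst ro f = f"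
 using hom0_const[of f] np.ev_sc[of ro "lk f None" "mon None"] by simp

text \<open>A shift of the variable \<open>j\<close> by \<open>t\<close> turns the part
  \<open>D\<close> of \<open>Phi\<close>, of degree above \<open>i\<close>, into
  \<open>D + t b + ...\<close>, where \<open>b\<close> is a partial derivative of \<open>D\<close>
  and has degree at least \<open>i\<close>. Terms of lower degree arise at order
  \<open>t ^ 2\<close> only. The constant ones are removed by a translation (\<open>c\<close>), the
  linear ones by a linear map (\<open>L'\<close>), the rest by \<open>family_lead\<close>. Each
  correction has to depend polynomially on \<open>t\<close>.\<close>

lemma W_trans:
 assumes u: "unital M" and i: "i \<ge> 2" and g: "g \<in> W i" and j: "j < n"
 shows "(%l. der np_var (%v. if v = j then mon None else 0) (g l)) \<in> W (i - 1)"
proof -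
 obtain Phi where Phi: "lead i Phi g" using g by (auto simp: W_def)
 obtain Phi' where Phi': "Phi' \<in> HH" "\<And>l. l < n ==> subst Phi (Phi' l) - np_var l \<in> T X" "\<And>l. l < n ==> subst Phi' (Phi l) - np_var l \<in> T X"
  using HH_inv[OF lead_HH[OF Phi]] by blast
 define F :: "nat => (nat, 'k) npoly" where "F v = (if v = j then mon None else 0)" for v
 have F0: "hom_deg d1 0 (F v)" for v by (simp add: F_def)
 have FP: "F v \<in> PV X" for v using u PV_0[of X] by (cases "v = j") (simp_all add: F_def)
 define \<Sigma> where "\<Sigma> t l = np_var l + sc t (F l)" for t l
 have SP: "\<Sigma> t l \<in> PV X" if "l < n" for t l unfolding \<Sigma>_def using that by (intro PV_add PV_sc FP) simp
 have jS: "jet sc (PV X) (%t. \<Sigma> t v) (np_var v) (F v)" if "v \<in> X" for v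
  unfolding jet_def \<Sigma>_def using that FP by (intro conjI exI[of _ "%_. 0"]) (auto intro: pf.zero)
 have Spf: "pf sc (PV X) (%t. \<Sigma> t v)" if "v \<in> X" for v by (rule np.jet_pf[OF subspace_PP jS[OF that]])
 have shift: "(%l. np_var l + a l) \<in> HH" if a: "\<And>l. hom_deg d1 0 (a l)" "\<And>l. l < n ==> a l \<in> PV X" for a
 proof (rule HH_aff[of _ "%l. np_var l - a l"])
  fix l assume l: "l < n"
  have "m \<in> ks (np_var l + a l) ==> mdeg d1 m \<le> 1" for m
   using keys_add[of "np_var l" "a l"] a(1)[of l] by (auto simp: hom_deg_def ks_var d1_simp)
  thus "np_var l + a l \<in> PV X \<and> (\<forall>m\<in>ks (np_var l + a l). mdeg d1 m \<le> 1)" using a l by (auto intro!: PV_add)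
  show "np_var l - a l \<in> PV X" using a l by (auto intro!: PV_diff)
  show "subst (%l. np_var l + a l) (np_var l - a l) - np_var l \<in> T X \<and>
    subst (%l. np_var l - a l) (np_var l + a l) - np_var l \<in> T X"
   using a by (simp add: np.ev_add np.ev_diff T_0)
 qed
 have SH: "\<Sigma> t \<in> HH" for t
  using shift[of "%l. sc t (F l)"] FP F0 by (simp add: \<Sigma>_def[abs_def] hom_sc PV_sc)
 define f where "f t l = subst (\<Sigma> t) (Phi l)" for t l
 \<comment> \<open>The constant term contains the shift \<open>t\<close> itself, so subtracting it
   also undoes the translation.\<close>
 define c where "c t l = (if l < n then cmp d1 0 (f t l) else 0)" for t l
 have fPf: "pf sc (PV X) (%t. f t l)" if "l < n" for l
  unfolding f_def by (rule pf_subst[OF np.pf_const[OF HH_PV[OF lead_HH[OF Phi] that]] Spf])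
 have fP: "f t l \<in> PV X" if "l < n" for t l by (rule np.pf_in[OF subspace_PP fPf[OF that]])
 have c0: "hom_deg d1 0 (c t l)" for t l by (simp add: c_def)
 have cpf: "pf sc (PV X) (%t. c t l)" if "l < n" for l
  using pf_lin[OF fPf[OF that] lin_cmp cmp_PP] that by (simp add: c_def)
 have cP: "c t l \<in> PV X" if "l < n" for t l by (rule np.pf_in[OF subspace_PP cpf[OF that]])
 define \<beta> where "\<beta> t l = f t l - c t l" for t l
 have bpf: "pf sc (PV X) (%t. \<beta> t l)" if "l < n" for l
  unfolding \<beta>_def by (intro np.pf_diff subspace_PP fPf cpf that)
 have bP: "\<beta> t l \<in> PV X" if "l < n" for t l by (rule np.pf_in[OF subspace_PP bpf[OF that]])
 have kap: "(%l. np_var l - c t l) \<in> HH" for t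
 proof -
  have "(%l. np_var l + sc (-1) (c t l)) \<in> HH" by (intro shift hom_sc c0 PV_sc cP)
  thus ?thesis by simp
 qed
 have bH: "\<beta> t \<in> HH" for t
 proof -
  have "(%l. subst (%l. subst (\<Sigma> t) (Phi l)) (np_var l - c t l)) \<in> HH"
   by (intro HH_comp[OF HH_comp[OF SH lead_HH[OF Phi]]] kap)
  thus ?thesis using c0 by (simp add: \<beta>_def[abs_def] f_def np.ev_diff)
 qed
 have b1: "\<beta> t l \<in> G X 1" if "l < n" for t l
  using bP[OF that] that by (auto simp: G_def \<beta>_def c_def cmp_diff cmp_hom[OF hom_cmp] T_0)
 \<comment> \<open>The inverse of \<open>\<beta> t\<close> is written down from \<open>Phi'\<close>
   in order to be polynomial in \<open>t\<close>; the mere existence of inverses in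
   \<open>HH\<close> would not give this.\<close>
 define \<beta>' where "\<beta>' t l = subst (%l. np_var l + c t l) (Phi' l) - sc t (F l)" for t l
 have b'pf: "pf sc (PV X) (%t. \<beta>' t l)" if "l < n" for l
  unfolding \<beta>'_def
  by (intro np.pf_diff np.pf_tscale np.pf_const subspace_PP FP pf_subst[OF np.pf_const[OF HH_PV[OF Phi'(1) that]]] np.pf_add cpf)
   auto
 have b'P: "\<beta>' t l \<in> PV X" if "l < n" for t l by (rule np.pf_in[OF subspace_PP b'pf[OF that]])
 have inv1: "subst (\<beta> t) (\<beta>' t l) - np_var l \<in> T X" if l: "l < n" for t l
 proof -
  have "subst (\<beta> t) (\<beta>' t l) = subst (f t) (Phi' l) - sc t (F l)"
   unfolding \<beta>'_def using c0 F0
   by (simp add: np.ev_diff subst_subst np.ev_add \<beta>_def hom_sc)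
  also have "subst (f t) (Phi' l) = subst (\<Sigma> t) (subst Phi (Phi' l))" by (simp add: f_def[abs_def] subst_subst)
  finally have "subst (\<beta> t) (\<beta>' t l) - np_var l = subst (\<Sigma> t) (subst Phi (Phi' l)) - subst (\<Sigma> t) (np_var l)"
   by (simp add: \<Sigma>_def)
  thus ?thesis using T_subst_diff[OF Phi'(2)[OF l], of "\<Sigma> t" X] SP by simp
 qed
 have inv2: "subst (\<beta>' t) (\<beta> t l) - np_var l \<in> T X" if l: "l < n" for t l
 proof -
  let ?K = "%l. np_var l + c t l"
  have e1: "subst (\<beta>' t) (\<Sigma> t v) = subst ?K (Phi' v)" for v
   using F0 by (simp add: \<Sigma>_def np.ev_add hom_sc \<beta>'_def)
  have "subst (\<beta>' t) (\<beta> t l) = subst (%v. subst (\<beta>' t) (\<Sigma> t v)) (Phi l) - c t l"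
   using c0 by (simp add: \<beta>_def np.ev_diff f_def subst_subst)
  also have "\<dots> = subst ?K (subst Phi' (Phi l)) - c t l" unfolding e1 by (simp add: subst_subst)
  finally have eq: "subst (\<beta>' t) (\<beta> t l) - np_var l = subst ?K (subst Phi' (Phi l)) - subst ?K (np_var l)" by simp
  show ?thesis unfolding eq by (rule T_subst_diff[OF Phi'(3)[OF l]]) (simp add: PV_add cP)
 qed
 have b'1: "\<beta>' t l \<in> G X 1" if l: "l < n" for t l
 proof -
  have q: "\<beta>' t l - cmp d1 0 (\<beta>' t l) \<in> G X 1" using G_Suc[OF PV_G0[OF b'P[OF l]], of t] by simp
  have "subst (\<beta> t) (\<beta>' t l - cmp d1 0 (\<beta>' t l)) \<in> G X 1"
   by (rule subst_G1[OF _ q]) (simp add: b1 del: One_nat_def)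
  hence "subst (\<beta> t) (\<beta>' t l) - cmp d1 0 (\<beta>' t l) \<in> G X 1" by (simp add: np.ev_diff)
  from G_diff[OF G_add[OF T_G[OF inv1[OF l, of t]] var_G[of l X]] this] l
  have "cmp d1 0 (\<beta>' t l) \<in> G X 1" by simp
  hence "cmp d1 0 (cmp d1 0 (\<beta>' t l)) \<in> T X" by (rule G_cmp) simp
  thus ?thesis using G_SucI[OF PV_G0[OF b'P[OF l]], of t] by (simp add: cmp_hom[OF hom_cmp])
 qed
 define L where "L t l = cmp d1 1 (\<beta> t l)" for t l
 define L' where "L' t l = cmp d1 1 (\<beta>' t l)" for t l
 have LP: "L t l \<in> PV X" "L' t l \<in> PV X" if "l < n" for t l unfolding L_def L'_def using that by (auto intro: cmp_PP bP b'P)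
 have Lh: "hom_deg d1 1 (L t l)" "hom_deg d1 1 (L' t l)" for t l by (auto simp: L_def L'_def)
 \<comment> \<open>The linear part of an inverse is the inverse of the linear part, and it inherits
   the polynomial dependence on \<open>t\<close>.\<close>
 have Linv: "subst P (Q l) - np_var l \<in> T X"
  if l: "l < n" and A: "\<And>v. v < n ==> A v \<in> G X 1" "B l \<in> G X 1" "subst A (B l) - np_var l \<in> T X"
   and P: "\<And>v. P v = cmp d1 1 (A v)" "\<And>v. Q v = cmp d1 1 (B v)" for A B P Q l
 proof -
  have AP: "A v - P v \<in> G X 2" if "v < n" for v using G_Suc[OF A(1)[OF that]] by (simp add: P numeral_2_eq_2)
  have PG: "P v \<in> G X 1" if "v < n" for v using G_diff[OF A(1)[OF that] G_mono[OF AP[OF that], of 1]] by simp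
  have QG: "Q l \<in> PV X" unfolding P by (rule cmp_PP[OF G_PV[OF A(2)]])
  have BQ: "B l - Q l \<in> G X 2" using G_Suc[OF A(2)] by (simp add: P numeral_2_eq_2)
  have "subst A (B l - Q l) \<in> G X 2" by (rule subst_G1[OF _ BQ]) (use A in auto)
  from G_diff[OF T_G[OF A(3)] this] have 1: "subst A (Q l) - np_var l \<in> G X 2" by (simp add: np.ev_diff)
  have 2: "subst A (Q l) - subst P (Q l) \<in> G X 2"
  proof -
   have "mon m \<in> {f. subst A f - subst P f \<in> G X 2}" if "m \<in> ks (Q l)" for m
   proof -
    have m: "mdeg d1 m = 1" "okm (unital M) X m"
     using that hom_cmp[of d1 1 "B l"] QG by (auto simp: P hom_deg_def PP_def)
    have deg1: "mag_deg d1 t \<ge> 1" for t :: "nat mag" by (induction t) (auto simp: d1_simp)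
    obtain v where "m = Some (Gen v)" "v < n"
    proof (cases m)
     case (Some t)
     thus ?thesis
     proof (cases t)
      case (Node s s')
      thus ?thesis using Some m deg1[of s] deg1[of s'] by simp
     qed (use Some m that in auto)
    qed (use m in simp)
    thus ?thesis using AP[of v] by simp
   qed
   moreover have "np.subspace {f. subst A f - subst P f \<in> G X 2}"
   proof (rule np.subspaceI, goal_cases)
    case (2 x y)
    thus ?case using G_add[of "subst A x - subst P x" X 2 "subst A y - subst P y"] by (simp add: np.ev_add algebra_simps)
   next
    case (3 k x)
    thus ?case using G_sc[of "subst A x - subst P x" X 2 k] by (simp add: np.ev_sc np.scale_right_diff_distrib)
   qed (simp add: np.ev_0 G_0)
   ultimately show ?thesis using np_subspaceI[of "{f. subst A f - subst P f \<in> G X 2}" "Q l"] by blast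
  qed
  have "subst P (Q l) - np_var l \<in> G X 2" using G_diff[OF 1 2] by simp
  moreover have "hom_deg d1 1 (subst P (Q l) - np_var l)"
   by (intro hom_diff hom_subst[of X _ d1 _ _ "unital M"] QG) (auto simp: P d1_simp)
  ultimately show ?thesis using G_cmp[of _ X 2 1] cmp_hom by (metis one_less_numeral_iff semiring_norm(76))
 qed
 have LL: "subst (L t) (L' t l) - np_var l \<in> T X" if "l < n" for t l
  by (rule Linv[of l "\<beta> t" "\<beta>' t" "L t" "L' t", OF that b1 b'1[OF that] inv1[OF that] L_def L'_def])
 have LL': "subst (L' t) (L t l) - np_var l \<in> T X" if "l < n" for t l
  by (rule Linv[of l "\<beta>' t" "\<beta> t" "L' t" "L t", OF that b'1 b1[OF that] inv2[OF that] L'_def L_def])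
 have L'H: "L' t \<in> HH" for t
  by (rule HH_aff[of _ "L t"]) (use LP Lh LL LL' in \<open>auto simp: hom_deg_def\<close>)
 define \<alpha> where "\<alpha> t l = subst (\<beta> t) (L' t l)" for t l
 have aH: "\<alpha> t \<in> HH" for t unfolding \<alpha>_def[abs_def] by (rule HH_comp[OF bH L'H])
 have L'pf: "pf sc (PV X) (%t. L' t l)" if "l < n" for l
  unfolding L'_def by (rule pf_lin[OF b'pf[OF that] lin_cmp cmp_PP])
 have apf: "pf sc (PV X) (%t. \<alpha> t l)" if "l < n" for l
  unfolding \<alpha>_def by (rule pf_subst[OF L'pf[OF that] bpf]) simp
 have a2: "\<alpha> t l - np_var l \<in> G X 2" if l: "l < n" for t l
 proof -
  have "\<beta>' t l - L' t l \<in> G X 2" using G_Suc[OF b'1[OF l, of t]] by (simp add: L'_def numeral_2_eq_2)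
  hence "subst (\<beta> t) (\<beta>' t l - L' t l) \<in> G X 2" by (rule subst_G1[rotated]) (use b1 in auto)
  from G_diff[OF T_G[OF inv1[OF l, of t]] this] show ?thesis by (simp add: np.ev_diff \<alpha>_def)
 qed
 define D where "D l = Phi l - np_var l" for l
 have DG: "D l \<in> G X (i + 1)" if "l < n" for l unfolding D_def by (rule lead_1[OF Phi that])
 define b where "b l = der np_var F (D l)" for l
 have bG: "b l \<in> G X i" if "l < n" for l
  unfolding b_def using DG[OF that] FP F0 by (intro der_const_G) auto
 have sG: "np.subspace (G X (i + 1))" by (rule subspace_G)
 have nb: "near X (G X (i + 1)) (%t. \<beta> t l - np_var l - sc t (b l))" if l: "l < n" for l
 proof -
  have jD: "jet sc (PV X) (%t. subst (\<Sigma> t) (D l)) (D l) (b l)"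
  proof -
   have "jet sc (PV X) (%t. subst (\<Sigma> t) (D l)) (subst np_var (D l)) (der np_var F (D l))"
    by (rule jet_subst[OF G_PV[OF DG[OF l]] jS])
   thus ?thesis by (simp add: b_def)
  qed
  have jc: "jet sc (PV X) (%t. cmp d1 0 (subst (\<Sigma> t) (D l))) (cmp d1 0 (D l)) (cmp d1 0 (b l))"
   by (rule jet_lin[OF jD lin_cmp cmp_PP])
  have "near X (T X) (%t. cmp d1 0 (subst (\<Sigma> t) (D l)))"
   by (rule near_jet[OF jc G_cmp[OF DG[OF l]] G_cmp[OF bG[OF l]]]) (use i in auto)
  hence n1: "near X (G X (i + 1)) (%t. cmp d1 0 (subst (\<Sigma> t) (D l)))"
   unfolding near_def using pf_mono[of sc "T X" _ "G X (i + 1)"] T_G by blast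
  obtain r where r: "pf sc (PV X) r" "\<And>t. subst (\<Sigma> t) (D l) = D l + sc t (b l + sc t (r t))"
   using jD by (auto simp: jet_def)
  have n2: "near X (G X (i + 1)) (%t. D l + sc (t ^ 2) (r t))"
   by (intro near_add sG near_pf np.pf_const DG l near_t2 r)
  have "\<beta> t l - np_var l - sc t (b l) = (D l + sc (t ^ 2) (r t)) - cmp d1 0 (subst (\<Sigma> t) (D l))" for t
  proof -
   have "f t l = np_var l + sc t (F l) + subst (\<Sigma> t) (D l)"
    by (simp add: f_def D_def np.ev_diff \<Sigma>_def)
   moreover from this have "c t l = sc t (F l) + cmp d1 0 (subst (\<Sigma> t) (D l))"
    using l F0[of l] by (simp add: c_def cmp_add cmp_sc cmp_hom[of d1 0] cmp_hom[of d1 1] d1_simp)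
   ultimately show ?thesis using r(2)[of t]
    by (simp add: \<beta>_def np.scale_right_distrib power2_eq_square algebra_simps)
  qed
  thus ?thesis using near_diff[OF sG n2 n1] by simp
 qed
 \<comment> \<open>Neither \<open>b\<close> nor the remainder \<open>s\<close> has a linear part
   modulo identities, because \<open>i \<ge> 2\<close>; hence the linear part of
   \<open>\<beta>\<close> is trivial modulo \<open>t ^ 2\<close>.\<close>
 have nL: "near X (T X) (%t. L t l - np_var l)" if l: "l < n" for l
 proof -
  obtain r s where rs: "pf sc (PV X) r" "pf sc (G X (i + 1)) s"
   "\<And>t. \<beta> t l - np_var l - sc t (b l) = sc (t ^ 2) (r t) + s t" using nb[OF l] by (auto simp: near_def)
  have "L t l - np_var l = sc t (cmp d1 1 (b l)) + sc (t ^ 2) (cmp d1 1 (r t)) + cmp d1 1 (s t)" for t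
  proof -
   have "\<beta> t l = np_var l + sc t (b l) + sc (t ^ 2) (r t) + s t" using rs(3)[of t] by (simp add: algebra_simps)
   thus ?thesis by (simp add: L_def cmp_add cmp_sc cmp_hom[of d1 1] d1_simp)
  qed
  moreover have "cmp d1 1 (b l) \<in> T X" using G_cmp[OF bG[OF l]] i by simp
  moreover have "pf sc (T X) (%t. cmp d1 1 (s t))"
   by (rule pf_lin[OF rs(2) lin_cmp]) (use i in \<open>auto intro: G_cmp\<close>)
  ultimately have e: "(%t. L t l - np_var l) = (%t. sc t (cmp d1 1 (b l)) + sc (t ^ 2) (cmp d1 1 (r t)) + cmp d1 1 (s t))"
   and bT: "cmp d1 1 (b l) \<in> T X" and s: "pf sc (T X) (%t. cmp d1 1 (s t))" by blast+
  have "near X (T X) (%t. sc t (cmp d1 1 (b l)))"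
   by (intro near_tscale subspace_T near_pf np.pf_const bT)
  from near_add[OF subspace_T near_add[OF subspace_T this near_t2[OF pf_lin[OF rs(1) lin_cmp cmp_PP]]] near_pf[OF s]]
  show ?thesis unfolding e .
 qed
 \<comment> \<open>\<open>L'\<close> is compared with its image under \<open>L\<close>: by
   \<open>near_subst\<close> the substitution \<open>L\<close> changes nothing to first order. No
   matrix over the polynomials in \<open>t\<close> has to be inverted.\<close>
 have nL': "near X (T X) (%t. L' t l - np_var l)" if l: "l < n" for l
 proof -
  have Lpf: "pf sc (PV X) (%t. L t v)" if "v \<in> X" for v
   unfolding L_def by (rule pf_lin[OF bpf lin_cmp cmp_PP]) (use that in auto)
  have m: "pf sc (PV X) (%t. L' t l - np_var l)"
   by (intro np.pf_diff subspace_PP L'pf l np.pf_const) (use l in simp)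
  have 1: "near X (T X) (%t. subst (L t) (L' t l - np_var l) - (L' t l - np_var l))"
   by (rule near_subst[OF _ m]) (use nL in simp)
  have "pf sc (PV X) (%t. subst (L t) (L' t l) - np_var l)"
   by (intro np.pf_diff subspace_PP pf_subst[OF L'pf[OF l] Lpf] np.pf_const) (use l in simp_all)
  hence "pf sc UNIV (%t. subst (L t) (L' t l) - np_var l)" by (rule pf_mono) simp
  hence "pf sc (T X) (%t. subst (L t) (L' t l) - np_var l)"
   by (rule np.vandermonde[OF of_nat_ne subspace_T]) (rule LL[OF l])
  from near_diff[OF subspace_T near_diff[OF subspace_T near_pf[OF this] 1] nL[OF l]]
  show ?thesis by (simp add: np.ev_diff algebra_simps)
 qed
 have na: "near X (G X (i + 1)) (%t. \<alpha> t l - np_var l - sc t (b l))" if l: "l < n" for l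
 proof -
  obtain r s where rs: "pf sc (PV X) r" "pf sc (T X) s" "\<And>t. L' t l - np_var l = sc (t ^ 2) (r t) + s t"
   using nL'[OF l] by (auto simp: near_def)
  have "T X <= PV X" using T_PV by auto
  hence "pf sc (PV X) (%t. subst (\<beta> t) (s t))" by (intro pf_subst[OF pf_mono[OF rs(2)] bpf]) auto
  hence "pf sc (T X) (%t. subst (\<beta> t) (s t))"
  proof (rule np.vandermonde[OF of_nat_ne subspace_T pf_mono[OF _ subset_UNIV]])
   show "subst (\<beta> t) (s t) \<in> T X" for t by (rule T_subst[OF np.pf_in[OF subspace_T rs(2)]]) (use bP in auto)
  qed
  hence "pf sc (G X (i + 1)) (%t. subst (\<beta> t) (s t))" by (rule pf_mono) (auto intro: T_G)
  moreover have "pf sc (PV X) (%t. subst (\<beta> t) (r t))" by (rule pf_subst[OF rs(1) bpf]) simp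
  ultimately have 1: "near X (G X (i + 1)) (%t. (\<beta> t l - np_var l - sc t (b l)) + (sc (t ^ 2) (subst (\<beta> t) (r t)) + subst (\<beta> t) (s t)))"
   by (intro near_add sG nb l near_t2 near_pf)
  have eq: "\<alpha> t l - np_var l - sc t (b l) = (\<beta> t l - np_var l - sc t (b l)) + (sc (t ^ 2) (subst (\<beta> t) (r t)) + subst (\<beta> t) (s t))" for t
  proof -
   have "L' t l = np_var l + (sc (t ^ 2) (r t) + s t)" using rs(3)[of t] by (simp add: algebra_simps)
   thus ?thesis by (simp add: \<alpha>_def np.ev_add np.ev_sc)
  qed
  show ?thesis unfolding eq by (rule 1)
 qed
 have "b \<in> W (i - 1)" by (rule family_lead[OF i bG apf aH a2 na])
 thus ?thesis
 proof (rule W_cong)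
  fix l assume l: "l < n"
  have "der np_var F (D l - g l) \<in> G X (i + 1)"
   by (rule der_const_G) (use FP F0 lead_2[OF Phi l] in \<open>auto simp: D_def\<close>)
  from G_sc[OF this, of "-1"] have "der np_var F (g l) - b l \<in> G X (i + 1)" by (simp add: b_def der_diff)
  thus "der np_var (%v. if v = j then mon None else 0) (g l) - b l \<in> G X (i - 1 + 2)"
   using i by (simp add: F_def[abs_def] Suc_diff_Suc numeral_2_eq_2)
 qed
qed

lemma W_Lm1:
 assumes i: "i \<ge> 2" and g: "g \<in> W i" and a: "\<And>l. l < n ==> a l \<in> PV X \<and> hom_deg d1 0 (a l)"
 shows "(%l. der np_var a (g l) - der np_var g (a l)) \<in> W (i - 1)"
proof (rule W_brk_sum[where S = "{f \<in> PV X. hom_deg d1 0 f}"])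
 have "np.subspace (PV X \<inter> {f. hom_deg d1 0 f})" by (intro np.subspace_inter subspace_PP subspace_hom)
 thus "np.subspace {f \<in> PV X. hom_deg d1 0 f}" by (simp add: Int_def)
 fix j m assume j: "j < n" and "m \<in> (\<Union>f\<in>{f \<in> PV X. hom_deg d1 0 f}. ks f)"
 hence m: "okm (unital M) X m" "mdeg d1 m = 0" by (auto simp: PP_def hom_deg_def)
 have deg1: "mag_deg d1 t \<ge> 1" for t :: "nat mag" by (induction t) (auto simp: d1_simp)
 have m0: "m = None"
 proof (cases m)
  case (Some t)
  thus ?thesis using m deg1[of t] by simp
 qed
 have d: "(%l. der np_var g (if l = j then mon None else 0)) = (%l. 0)" by (auto simp: der_0)
 show "mon m \<in> {f \<in> PV X. hom_deg d1 0 f} \<and>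
   (%l. der np_var (%v. if v = j then mon m else 0) (g l) - der np_var g (if l = j then mon m else 0)) \<in> W (i - 1)"
  unfolding m0 using m m0 W_trans[OF _ i g j] fun_cong[OF d] by simp
qed (use a G_PV[OF W_G[OF g]] i in auto)

end

section \<open>Traces of Jacobian matrices\<close>

lemma prod_one_plus:
 fixes x :: "'r::comm_ring_1"
 assumes "finite S"
 shows "\<exists>R. (\<Prod>i\<in>S. 1 + x * C i) = 1 + x * (\<Sum>i\<in>S. C i) + x * (x * R)"
 using assms
proof induction
 case empty
 show ?case by (intro exI[of _ 0]) simp
next
 case (insert y S)
 then obtain R where R: "(\<Prod>i\<in>S. 1 + x * C i) = 1 + x * (\<Sum>i\<in>S. C i) + x * (x * R)" by blast
 show ?case
  by (intro exI[of _ "R + C y * (\<Sum>i\<in>S. C i) + x * C y * R"])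
   (simp add: insert(1,2) R algebra_simps)
qed

text \<open>The index \<open>P\<close> of a block matrix stands for position \<open>P mod d\<close>
  in block \<open>P div d\<close>.\<close>

lemma sum_div_mod: "(\<Sum>P<(n::nat) * d. f (P div d) (P mod d)) = (\<Sum>j<n. \<Sum>a<d. f j a)"
proof -
 have "(\<Sum>P<n * d. f (P div d) (P mod d)) = (\<Sum>j<n. \<Sum>P\<in>{j * d..<j * d + d}. f (P div d) (P mod d))"
  by (rule sum.nat_group[symmetric])
 also have "\<dots> = (\<Sum>j<n. \<Sum>a<d. f j a)"
 proof (rule sum.cong[OF refl])
  fix j
  have "(\<Sum>P\<in>{j * d..<j * d + d}. f (P div d) (P mod d)) = (\<Sum>a\<in>{0..<d}. f ((a + j * d) div d) ((a + j * d) mod d))"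
   using sum.shift_bounds_nat_ivl[of "%P. f (P div d) (P mod d)" 0 "j * d" d] by (simp add: add.commute)
  also have "\<dots> = (\<Sum>a<d. f j a)" by (intro sum.cong) auto
  finally show "(\<Sum>P\<in>{j * d..<j * d + d}. f (P div d) (P mod d)) = (\<Sum>a<d. f j a)" .
 qed
 finally show ?thesis .
qed

text \<open>The determinant of an invertible polynomial matrix is constant; for a matrix
 \<open>1 + t\<^sup>e N + \<dots>\<close> its coefficient at \<open>t\<^sup>e\<close> is the trace of \<open>N\<close>.\<close>

lemma invertible_trace_0:
 fixes A B :: "'k::field poly mat"
 assumes A: "A \<in> carrier_mat N N" and B: "B \<in> carrier_mat N N" and BA: "B * A = 1\<^sub>m N" and e: "e \<ge> 1"
  and c0: "\<And>i j. i < N ==> j < N ==> coeff (A $$ (i, j)) 0 = (if i = j then 1 else 0)"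
  and c: "\<And>i j k. i < N ==> j < N ==> 0 < k ==> k < e ==> coeff (A $$ (i, j)) k = 0"
 shows "(\<Sum>i<N. coeff (A $$ (i, i)) e) = 0"
proof -
 define C where "C i j = poly_shift e (A $$ (i, j))" for i j
 have AC: "A $$ (i, j) = (if i = j then 1 else 0) + monom 1 e * C i j" if "i < N" "j < N" for i j
 proof (rule poly_eqI)
  fix k
  show "coeff (A $$ (i, j)) k = coeff ((if i = j then 1 else 0) + monom 1 e * C i j) k"
   using c0[OF that] c[OF that, of k] e
   by (cases "k = 0"; cases "k < e") (auto simp: coeff_monom_mult C_def coeff_poly_shift)
 qed
 have "det B * det A = 1" using det_mult[OF B A] BA by simp
 hence "det A dvd 1" by (metis dvd_triv_right)
 moreover from this have "det A \<noteq> 0" by auto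
 ultimately have "degree (det A) = 0" using is_unit_iff_degree by blast
 hence 0: "coeff (det A) e = 0" using e by (simp add: coeff_eq_0)
 let ?t = "%p. signof p * (\<Prod>i = 0..<N. A $$ (i, p i))"
 have "det A = (\<Sum>p\<in>{p. p permutes {0..<N}}. ?t p)" by (rule det_def'[OF A])
 also have "\<dots> = ?t id + (\<Sum>p\<in>{p. p permutes {0..<N}} - {id}. ?t p)"
  by (rule sum.remove) (auto simp: finite_permutations permutes_id)
 finally have d: "coeff (det A) e = coeff (?t id) e + (\<Sum>p\<in>{p. p permutes {0..<N}} - {id}. coeff (?t p) e)"
  by (simp add: coeff_sum)
 have "coeff (?t p) e = 0" if p: "p \<in> {p. p permutes {0..<N}} - {id}" for p
 proof -
  have perm: "p permutes {0..<N}" using p by simp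
  obtain i where i: "p i \<noteq> i" using p by (auto simp: fun_eq_iff)
  have iN: "i \<in> {0..<N}" using i perm by (metis permutes_not_in)
  have jN: "p i \<in> {0..<N}" using permutes_in_image[OF perm] iN by simp
  have pj: "p (p i) \<noteq> p i" using i permutes_inj[OF perm] by (metis injD)
  \<comment> \<open>A permutation other than the identity moves both \<open>i\<close> and
    \<open>p i\<close>. This gives two off-diagonal factors, each divisible by
    \<open>monom 1 e\<close>, and the product starts in degree \<open>2 * e > e\<close>.\<close>
  have "(\<Prod>k = 0..<N. A $$ (k, p k)) = A $$ (i, p i) * (A $$ (p i, p (p i)) * (\<Prod>k\<in>{0..<N} - {i} - {p i}. A $$ (k, p k)))"
   using iN jN i by (subst prod.remove[of _ i], simp, simp, subst prod.remove[of _ "p i"]) auto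
  also have "\<dots> = monom 1 (2 * e) * (C i (p i) * C (p i) (p (p i)) * (\<Prod>k\<in>{0..<N} - {i} - {p i}. A $$ (k, p k)))"
  proof -
   have pN: "p (p i) \<in> {0..<N}" using permutes_in_image[OF perm] jN by simp
   have "monom 1 (2 * e) = monom 1 e * (monom 1 e :: 'k poly)" by (simp add: mult_monom mult_2)
   thus ?thesis using AC[of i "p i"] AC[of "p i" "p (p i)"] iN jN pN i pj by (simp add: algebra_simps)
  qed
  finally show ?thesis using e by (simp add: sign_def coeff_monom_mult)
 qed
 hence "coeff (det A) e = coeff (\<Prod>i = 0..<N. A $$ (i, i)) e" unfolding d by simp
 also have "(\<Prod>i = 0..<N. A $$ (i, i)) = (\<Prod>i = 0..<N. 1 + monom 1 e * C i i)"
  by (intro prod.cong) (auto simp: AC)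
 also obtain R where "\<dots> = 1 + monom 1 e * (\<Sum>i = 0..<N. C i i) + monom 1 e * (monom 1 e * R)"
  using prod_one_plus[of "{0..<N}" "monom 1 e" "%i. C i i"] by auto
 also have "coeff \<dots> e = (\<Sum>i = 0..<N. coeff (A $$ (i, i)) e)"
  using e by (simp add: coeff_monom_mult coeff_sum C_def coeff_poly_shift)
 finally show ?thesis using 0 by (simp add: lessThan_atLeast0)
qed

lemma der_tuple_sum: "der xi (%v. \<Sum>l\<in>A. F l v) f = (\<Sum>l\<in>A. der xi (F l) f)"
 using der_tuple_sc[of xi 0 "%_. 0" f]
 by (induction A rule: infinite_finite_induct) (simp_all add: der_tuple_add)

text \<open>Elements of the universal enveloping algebra are represented by polynomials \<open>p\<close>, linear in
 \<open>y = y\<^sub>0\<close>: they act by \<open>w \<mapsto> p[y := w]\<close>.\<close>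

abbreviation xv :: "nat => 'k::field np2" where "xv i \<equiv> np_var (Inl i)"
abbreviation yv :: "'k::field np2" where "yv \<equiv> np_var (Inr 0)"

definition wx :: "nat + nat => nat" where "wx = case_sum (%_. 1) (%_. 0)"
definition wy :: "nat + nat => nat" where "wy = case_sum (%_. 0) (%_. 1)"

lemma w_simps [simp]: "wx (Inl i) = 1" "wx (Inr i) = 0" "wy (Inl i) = 0" "wy (Inr i) = 1"
 by (simp_all add: wx_def wy_def)

definition sub :: "'k::field np2 => 'k np2 => 'k np2" where
 "sub q = subst (case_sum xv (%_. q))"

definition Dx :: "nat => (nat, 'k::field) npoly => 'k np2" where
 "Dx i = der xv (%j. if j = i then yv else 0)"

definition V1 :: "nat => (nat + nat) set" where "V1 n = insert (Inr 0) (Inl ` {..<n})"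

lemma lin_sub: "lin sc sc (sub q)" unfolding sub_def by (rule np.lin_ev)
lemmas sub_add = lin_add[OF lin_sub] and sub_sc = lin_scale[OF lin_sub] and sub_diff = lin_diff[OF lin_sub]
 and sub_0 [simp] = lin_0[OF lin_sub] and sub_sum = lin_sum[OF lin_sub]

lemma lin_Dx: "lin sc sc (Dx i)" unfolding Dx_def by (rule lin_der)
lemmas Dx_diff = lin_diff[OF lin_Dx]
 and Dx_0 = lin_0[OF lin_Dx] and Dx_sum = lin_sum[OF lin_Dx]

lemma sub_x [simp]: "sub q (xv i) = xv i" and sub_y [simp]: "sub q yv = q"
 by (simp_all add: sub_def)

text \<open>Associativity of the product of \<open>U\<close>: as \<open>p\<close> acts by
  \<open>w \<mapsto> sub w p\<close>, the product of \<open>p\<close> and \<open>q\<close> is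
  \<open>sub q p\<close>, with the arguments in reversed order.\<close>

lemma sub_sub: "sub r (sub q p) = sub (sub r q) p"
 unfolding sub_def subst_subst by (rule arg_cong[where f = "%ro. subst ro p"]) (auto split: sum.split)

lemma sub_yv: "p \<in> PP u (V1 n) ==> sub yv p = p"
proof -
 assume "p \<in> PP u (V1 n)"
 hence "sub yv p = subst np_var p" unfolding sub_def by (rule np.ev_cong) (auto simp: V1_def)
 thus ?thesis by simp
qed

text \<open>For \<open>p\<close> linear in y, replacing y by \<open>q\<close> is the derivative of
  \<open>p\<close> at y = 0 in the direction \<open>q\<close>. Linearity in \<open>q\<close> and
  compatibility with identities then follow from the facts on \<open>der\<close>.\<close>

lemma sub_der:
 assumes "hom_deg wy 1 p"
 shows "sub q p = der (case_sum xv (%_. 0)) (case_sum (%_. 0) (%_. q)) p"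
proof (rule lin_eqI[OF lin_sub lin_der])
 let ?s = "case_sum xv (%_. q)" and ?xi = "case_sum xv (%_. 0) :: _ => 'a np2"
  and ?F = "case_sum (%_. 0) (%_. q)"
 have 0: "mag_deg wy t = 0 ==> meval (\<star>) ?s t = meval (\<star>) ?xi t \<and> dmag ?xi ?F t = 0" for t
 proof (induction t)
  case (Gen v)
  thus ?case by (cases v) auto
 qed (simp_all add: mult_simps)
 have pos: "mag_deg wy t \<ge> 1 ==> meval (\<star>) ?xi t = 0" for t
 proof (induction t)
  case (Gen v)
  thus ?case by (cases v) auto
 next
  case (Node a b)
  hence "mag_deg wy a \<ge> 1 \<or> mag_deg wy b \<ge> 1" by auto
  thus ?case using Node by (auto simp: mult_simps)
 qed
 have 1: "mag_deg wy t = 1 ==> meval (\<star>) ?s t = dmag ?xi ?F t" for t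
 proof (induction t)
  case (Gen v)
  thus ?case by (cases v) auto
 next
  case (Node a b)
  hence "(mag_deg wy a = 1 \<and> mag_deg wy b = 0) \<or> (mag_deg wy a = 0 \<and> mag_deg wy b = 1)" by auto
  thus ?case
  proof (elim disjE conjE)
   assume "mag_deg wy a = 1" "mag_deg wy b = 0"
   thus ?thesis using Node.IH(1) 0[of b] pos[of a] by (simp add: mult_simps)
  next
   assume "mag_deg wy a = 0" "mag_deg wy b = 1"
   thus ?thesis using Node.IH(2) 0[of a] pos[of b] by (simp add: mult_simps)
  qed
 qed
 fix m assume "m \<in> ks p"
 hence "mdeg wy m = 1" using assms by (simp add: hom_deg_def)
 thus "sub q (mon m) = der ?xi ?F (mon m)" using 1 by (cases m) (auto simp: sub_def)
qed

lemma lin_sub_left: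
 assumes "hom_deg wy 1 p" shows "lin sc sc (%q. sub q p)"
proof (rule linI)
 have *: "case_sum (%_. 0) (%_. q + r) = (%v. case_sum (%_. 0) (%_. q) v + case_sum (%_. 0) (%_. r) v)"
  "case_sum (%_. 0) (%_. sc c q) = (%v. sc c (case_sum (%_. 0) (%_. q) v))" for q r :: "'a np2" and c
  by (auto simp: fun_eq_iff split: sum.split)
 show "sub (q + r) p = sub q p + sub r p" "sub (sc c q) p = sc c (sub q p)" for q r c
  unfolding sub_der[OF assms] * by (rule der_tuple_add, rule der_tuple_sc)
qed

lemma hom_sub:
 assumes p: "hom_deg wy 1 p" "hom_deg wx k p" and q: "hom_deg wx j q" shows "hom_deg wx (k + j) (sub q p)"
 unfolding sub_der[OF p(1)]
proof (rule hom_der[where a = 0 and b = j, OF _ _ _ p(2)])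
 show "p \<in> PP True UNIV" by simp
 show "\<exists>d. hom_deg wx d (case_sum (%_. 0) (%_. q) v) \<and> d + 0 = wx v + j" for v
  using q by (cases v) auto
 show "hom_deg wx (wx v) (case_sum xv (%_. 0) v)" for v by (cases v) auto
qed simp

lemma hom_sub_wy: "hom_deg wy 1 p ==> hom_deg wy 1 q ==> hom_deg wy 1 (sub q p)"
 unfolding sub_der
proof (rule hom_der[where a = 1 and b = 1])
 show "p \<in> PP True UNIV" by simp
 show "hom_deg wy (wy v) (case_sum xv (%_. 0) v)" for v by (cases v) auto
 assume "hom_deg wy 1 q"
 thus "\<exists>d. hom_deg wy d (case_sum (%_. 0) (%_. q) v) \<and> d + 1 = wy v + 1" for v
  by (cases v) auto
qed auto

lemma mag_deg0: "mag_deg (%_. 0) t = 0"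
 by (induction t) auto

text \<open>With zero weights every polynomial is homogeneous, so \<open>hom_der\<close> and
  \<open>hom_subst\<close> can be used to find the degree in y of images of arbitrary polynomials in
  x.\<close>

lemma hom_weight0: "hom_deg (%_. 0) 0 f"
 by (auto simp: hom_deg_def mdeg_def mag_deg0 split: option.split)

lemma hom_Dx_wx: "hom_deg d1 (Suc k) f ==> hom_deg wx k (Dx i f)"
 unfolding Dx_def
 by (rule hom_der[where a = 1 and b = 0 and f = f and V = UNIV and u = True]) (auto simp: d1_simp)

lemma hom_Dx_wy: "hom_deg wy 1 (Dx i f)"
 unfolding Dx_def
 by (rule hom_der[where a = 0 and b = 1 and w = "%_. 0" and k = 0 and V = UNIV and u = True])
  (auto simp: hom_weight0)

lemma cmp_Dx: "cmp wx k (Dx i f) = Dx i (cmp d1 (Suc k) f)"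
proof -
 let ?N = "max (dbound d1 f) (Suc (Suc k))"
 have c: "cmp wx k (Dx i (cmp d1 j f)) = (if j = Suc k then Dx i (cmp d1 j f) else 0)" for j
 proof (cases j)
  case 0
  have "der xv F h = 0" if "hom_deg d1 0 (h :: (nat, 'a) npoly)" for F h
  proof -
   have deg1: "mag_deg d1 t \<ge> 1" for t :: "nat mag" by (induction t) (auto simp: d1_simp)
   show ?thesis unfolding der_def lext_def
   proof (rule sum.neutral, rule ballI)
    fix m assume m: "m \<in> ks h"
    show "sc (lk h m) (case m of None => 0 | Some t => dmag xv F t) = 0"
    proof (cases m)
     case (Some t)
     hence "mag_deg d1 t = 0" using that m by (auto simp: hom_deg_def)
     thus ?thesis using deg1[of t] by simp
    qed simp
   qed
  qed
  thus ?thesis using 0 by (simp add: Dx_def)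
 next
  case (Suc j')
  thus ?thesis using cmp_hom[OF hom_Dx_wx[OF hom_cmp[of d1 "Suc j'" f]]] by auto
 qed
 have "Dx i f = (\<Sum>j<?N. Dx i (cmp d1 j f))"
  unfolding Dx_sum[symmetric] by (subst sum_cmp_dbound) auto
 hence "cmp wx k (Dx i f) = (\<Sum>j<?N. if j = Suc k then Dx i (cmp d1 j f) else 0)"
  by (simp add: cmp_sum c)
 thus ?thesis by (simp add: less_max_iff_disj)
qed

text \<open>The Jacobian matrix of a composite is a product in \<open>U\<close>: the left factor is
  the Jacobian of the outer tuple with \<open>Phi\<close> substituted into its entries, the right
  factor the Jacobian of \<open>Phi\<close>.\<close>

lemma Dx_chain:
 assumes "f \<in> PP u {..<n}"
 shows "Dx i (subst Phi f) = (\<Sum>l<n. sub (Dx i (Phi l)) (subst (case_sum (%v. subst xv (Phi v)) (%_. yv)) (Dx l f)))"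
proof -
 let ?xi = "%v. subst xv (Phi v)"
 have fx: "sub q (subst xv h) = subst xv h" for q :: "'a np2" and h
  by (simp add: sub_def subst_subst)
 have s: "sub q (subst (case_sum ?xi (%_. yv)) (Dx l f)) = der ?xi (%v. if v = l then q else 0) f" for q l
 proof -
  have "(%v. subst (case_sum xv (%_. q)) (if v = l then yv else 0)) = (%v. if v = l then q else 0)"
   by (auto simp: np.ev_0)
  moreover have "(%v. subst (case_sum ?xi (%_. yv)) (if v = l then yv else 0)) = (%v. if v = l then yv else (0 :: 'a np2))"
   by (auto simp: np.ev_0)
  ultimately show ?thesis
   using fx[unfolded sub_def] by (simp add: sub_def Dx_def subst_der)
 qed
 have "Dx i (subst Phi f) = der ?xi (%v. Dx i (Phi v)) f" unfolding Dx_def by (rule der_subst)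
 also have "\<dots> = der ?xi (%v. \<Sum>l<n. if v = l then Dx i (Phi l) else 0) f"
  by (rule der_cong[OF assms]) auto
 also have "\<dots> = (\<Sum>l<n. sub (Dx i (Phi l)) (subst (case_sum ?xi (%_. yv)) (Dx l f)))"
  unfolding der_tuple_sum by (intro sum.cong refl) (simp add: s)
 finally show ?thesis .
qed

section \<open>Matrix representations of the universal enveloping algebra\<close>

context nsvar
begin

definition One :: "nat => 'k np2 set" where
 "One n = {p \<in> PV (V1 n). hom_deg wy 1 p}"

lemma subspace_One: "np.subspace (One n)"
proof -
 have "np.subspace (PV (V1 n) \<inter> {f. hom_deg wy 1 f})" by (intro np.subspace_inter subspace_PP subspace_hom)
 thus ?thesis by (simp add: Int_def One_def)
qed

lemmas One_add = np.subspace_add[OF subspace_One] and One_sc = np.subspace_scale[OF subspace_One]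
 and One_diff = np.subspace_diff[OF subspace_One] and One_sum = np.subspace_sum[OF subspace_One]
 and One_0 = np.subspace_0[OF subspace_One]

lemma One_PV: "p \<in> One n ==> p \<in> PV (V1 n)" and One_hom: "p \<in> One n ==> hom_deg wy 1 p"
 by (simp_all add: One_def)

lemma yv_One: "yv \<in> One n" by (simp add: One_def V1_def)

lemma One_cmp: "p \<in> One n ==> cmp w k p \<in> One n"
proof -
 assume p: "p \<in> One n"
 have "mdeg wy m = 1" if "m \<in> ks (cmp w k p)" for m
 proof -
  have "ks (cmp w k p) <= ks p"
  proof
   fix m assume "m \<in> ks (cmp w k p)"
   moreover have "lk (cmp w k p) m = (\<Sum>m'\<in>ks p. lk p m' * (if mdeg w m' = k \<and> m' = m then 1 else 0))"
    unfolding cmp_def lext_def lookup_sum by (intro sum.cong refl) (auto simp: lookup_single when_def)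
   moreover have "(\<Sum>m'\<in>ks p. lk p m' * (if mdeg w m' = k \<and> m' = m then 1 else 0)) = 0" if "m \<notin> ks p"
    using that by (intro sum.neutral) auto
   ultimately show "m \<in> ks p" by (metis in_keys_iff)
  qed
  thus ?thesis using that One_hom[OF p] by (auto simp: hom_deg_def)
 qed
 thus ?thesis using cmp_PP[OF One_PV[OF p]] by (simp add: One_def hom_deg_def)
qed

lemma sub_One: "p \<in> One n ==> q \<in> One n ==> sub q p \<in> One n"
 using hom_sub_wy[of p q]
 by (auto simp: One_def) (auto simp: sub_def V1_def intro!: subst_PP[where V = "V1 n"] split: sum.split)

lemma sub_PV: "p \<in> PV (V1 n) ==> q \<in> PV V ==> Inl ` {..<n} <= V ==> sub q p \<in> PV V"
 unfolding sub_def by (rule subst_PP[where V = "V1 n"]) (auto simp: V1_def)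

lemma T_sub: "p \<in> T (V1 n) ==> q \<in> PV V ==> Inl ` {..<n} <= V ==> sub q p \<in> T V"
 unfolding sub_def by (rule T_subst[where V = "V1 n"]) (auto simp: V1_def)

lemma T_sub_right:
 assumes p: "p \<in> One n" and q: "q \<in> T V" and V: "Inl ` {..<n} <= V" shows "sub q p \<in> T V"
proof -
 have "der (case_sum xv (%_. 0)) (case_sum (%_. 0) (%_. q)) p - der (case_sum xv (%_. 0)) (%_. 0) p \<in> T V"
  by (rule der_tuple_cong[OF _ _ One_PV[OF p]]) (use q V PV_0 T_0 in \<open>auto simp: V1_def split: sum.split\<close>)
 thus ?thesis by (simp add: sub_der[OF One_hom[OF p]])
qed

lemma Dx_One: "f \<in> PV {..<n} ==> Dx i f \<in> One n"
 unfolding One_def using hom_Dx_wy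
 by (auto simp: Dx_def V1_def PV_0 intro!: der_PP[where V = "{..<n}"])

lemma T_Dx: "f \<in> T {..<n} ==> Dx i f \<in> T (V1 n)"
 unfolding Dx_def by (rule T_der) (auto simp: V1_def PV_0)

lemma cmp_sub:
 assumes p: "p \<in> One n" and q: "q \<in> One n"
 shows "cmp wx k (sub q p) = (\<Sum>i\<le>k. sub (cmp wx (k - i) q) (cmp wx i p))"
proof -
 let ?N = "Suc k + dbound wx p + dbound wx q"
 note l = lin_sub_left[OF One_hom[OF One_cmp[OF p]]]
 have h: "cmp wx k (sub (cmp wx j q) (cmp wx i p)) = (if i + j = k then sub (cmp wx j q) (cmp wx i p) else 0)" for i j
  using cmp_hom[OF hom_sub[OF One_hom[OF One_cmp[OF p]] hom_cmp hom_cmp]] by auto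
 have "sub q p = (\<Sum>i<?N. sub q (cmp wx i p))" unfolding sub_sum[symmetric] by (subst sum_cmp_dbound) auto
 also have "\<dots> = (\<Sum>i<?N. \<Sum>j<?N. sub (cmp wx j q) (cmp wx i p))"
  unfolding lin_sum[OF l, symmetric] by (subst sum_cmp_dbound) auto
 finally have "cmp wx k (sub q p) = (\<Sum>i<?N. \<Sum>j<?N. if i + j = k then sub (cmp wx j q) (cmp wx i p) else 0)"
  by (simp only: cmp_sum h)
 also have "\<dots> = (\<Sum>i<?N. if i \<le> k then sub (cmp wx (k - i) q) (cmp wx i p) else 0)"
 proof (intro sum.cong refl)
  fix i
  have "(\<Sum>j<?N. if i + j = k then sub (cmp wx j q) (cmp wx i p) else 0) =
   (\<Sum>j<?N. if j = k - i then (if i \<le> k then sub (cmp wx j q) (cmp wx i p) else 0) else 0)"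
   by (intro sum.cong refl) auto
  also have "\<dots> = (if i \<le> k then sub (cmp wx (k - i) q) (cmp wx i p) else 0)"
   by (subst sum.delta) auto
  finally show "(\<Sum>j<?N. if i + j = k then sub (cmp wx j q) (cmp wx i p) else 0) = (if i \<le> k then sub (cmp wx (k - i) q) (cmp wx i p) else 0)" .
 qed
 also have "\<dots> = (\<Sum>i\<in>{..<?N} \<inter> {..k}. sub (cmp wx (k - i) q) (cmp wx i p))"
  by (simp add: sum.inter_restrict)
 also have "{..<?N} \<inter> {..k} = {..k}" by auto
 finally show ?thesis .
qed

text \<open>A matrix representation of \<open>U\<close> over the ground field, given on polynomials:
  \<open>ro p a b\<close> are the entries, and identities go to 0. Arbitrary finite index sets allow
  pairs of positions on two cycles as indices.\<close>

definition rep :: "nat => 'i set => ('k np2 => 'i => 'i => 'k) => bool" where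
 "rep n I ro \<longleftrightarrow> finite I \<and>
  (\<forall>p\<in>One n. \<forall>q\<in>One n. \<forall>a\<in>I. \<forall>b\<in>I. ro (p + q) a b = ro p a b + ro q a b \<and>
    ro (sub q p) a b = (\<Sum>c\<in>I. ro p a c * ro q c b)) \<and>
  (\<forall>p\<in>One n. \<forall>k. \<forall>a\<in>I. \<forall>b\<in>I. ro (sc k p) a b = k * ro p a b) \<and>
  (\<forall>p\<in>One n \<inter> T (V1 n). \<forall>a\<in>I. \<forall>b\<in>I. ro p a b = 0) \<and>
  (\<forall>a\<in>I. \<forall>b\<in>I. ro yv a b = (if a = b then 1 else 0))"

context
 fixes n :: nat and I :: "'i set" and ro
 assumes rep: "rep n I ro"
begin

lemma rep_fin: "finite I" using rep by (simp add: rep_def)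
lemma rep_add: "p \<in> One n ==> q \<in> One n ==> a \<in> I ==> b \<in> I ==> ro (p + q) a b = ro p a b + ro q a b"
 using rep by (simp add: rep_def)
lemma rep_sub: "p \<in> One n ==> q \<in> One n ==> a \<in> I ==> b \<in> I ==> ro (sub q p) a b = (\<Sum>c\<in>I. ro p a c * ro q c b)"
 using rep by (simp add: rep_def)
lemma rep_sc: "p \<in> One n ==> a \<in> I ==> b \<in> I ==> ro (sc k p) a b = k * ro p a b"
 using rep by (simp add: rep_def)
lemma rep_T: "p \<in> One n ==> p \<in> T (V1 n) ==> a \<in> I ==> b \<in> I ==> ro p a b = 0"
 using rep by (simp add: rep_def)
lemma rep_y: "a \<in> I ==> b \<in> I ==> ro yv a b = (if a = b then 1 else 0)"
 using rep by (simp add: rep_def)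
lemma rep_0: "a \<in> I ==> b \<in> I ==> ro 0 a b = 0"
 by (rule rep_T[OF One_0 T_0])
lemma rep_sum: "(\<And>i. i \<in> A ==> p i \<in> One n) ==> a \<in> I ==> b \<in> I ==> ro (\<Sum>i\<in>A. p i) a b = (\<Sum>i\<in>A. ro (p i) a b)"
 by (induction A rule: infinite_finite_induct) (simp_all add: rep_0 rep_add One_sum)
lemma rep_T_diff: "p \<in> One n ==> q \<in> One n ==> p - q \<in> T (V1 n) ==> a \<in> I ==> b \<in> I ==> ro p a b = ro q a b"
 using rep_add[of "p - q" q a b] rep_T[of "p - q" a b] One_diff[of p n q] by simp

text \<open>The representation twisted by the grading, as if each variable x_i were multiplied by an
  indeterminate t: degree in x becomes degree in t.\<close>

definition rt :: "'k np2 => 'i => 'i => 'k poly" where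
 "rt p a b = (\<Sum>k<dbound wx p. monom (ro (cmp wx k p) a b) k)"

lemma coeff_rt: "a \<in> I ==> b \<in> I ==> coeff (rt p a b) k = ro (cmp wx k p) a b"
 by (cases "k < dbound wx p") (simp_all add: rt_def coeff_sum coeff_monom cmp_big rep_0)

lemma rt_eqI: "p \<in> One n ==> q \<in> One n ==> p - q \<in> T (V1 n) ==> a \<in> I ==> b \<in> I ==> rt p a b = rt q a b"
 by (rule poly_eqI) (simp add: coeff_rt rep_T_diff One_cmp cmp_T_diff)

lemma rt_sum: "(\<And>i. i \<in> A ==> p i \<in> One n) ==> a \<in> I ==> b \<in> I ==> rt (\<Sum>i\<in>A. p i) a b = (\<Sum>i\<in>A. rt (p i) a b)"
 by (rule poly_eqI) (simp add: coeff_rt coeff_sum cmp_sum rep_sum One_cmp)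

lemma rt_sub: "p \<in> One n ==> q \<in> One n ==> a \<in> I ==> b \<in> I ==> rt (sub q p) a b = (\<Sum>c\<in>I. rt p a c * rt q c b)"
proof (rule poly_eqI)
 fix k assume *: "p \<in> One n" "q \<in> One n" "a \<in> I" "b \<in> I"
 have "coeff (rt (sub q p) a b) k = (\<Sum>i\<le>k. \<Sum>c\<in>I. ro (cmp wx i p) a c * ro (cmp wx (k - i) q) c b)"
  using * by (simp add: coeff_rt cmp_sub rep_sum sub_One One_cmp rep_sub)
 also have "\<dots> = coeff (\<Sum>c\<in>I. rt p a c * rt q c b) k"
  unfolding coeff_sum coeff_mult using * by (subst sum.swap) (simp add: coeff_rt)
 finally show "coeff (rt (sub q p) a b) k = coeff (\<Sum>c\<in>I. rt p a c * rt q c b) k" .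
qed

text \<open>The representation turns the Jacobian of \<open>Phi\<close> into a matrix
  \<open>A\<close> of polynomials in t with blocks of size \<open>card I\<close>, and the chain rule
  provides \<open>B\<close> with \<open>B * A = 1\<close>. As \<open>Dx\<close> lowers the degree by
  one, the lowest nonconstant coefficient of \<open>A\<close> sits at degree \<open>e\<close> and
  comes from \<open>g\<close>, so \<open>invertible_trace_0\<close> applies.\<close>

lemma trace_Dx_0:
 assumes P: "\<And>j. j < n ==> Phi j \<in> PV {..<n}" "\<And>j. j < n ==> Psi j \<in> PV {..<n}"
  and inv: "\<And>j. j < n ==> subst Phi (Psi j) - np_var j \<in> T {..<n}"
  and e: "e \<ge> 1" and g: "\<And>j. j < n ==> g j \<in> PV {..<n} \<and> hom_deg d1 (e + 1) (g j)"
  and lead: "\<And>j. j < n ==> Phi j - np_var j - g j \<in> G {..<n} (e + 2)"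
 shows "(\<Sum>i<n. \<Sum>a\<in>I. ro (Dx i (g i)) a a) = 0"
proof -
 define d where "d = card I"
 obtain h where "bij_betw h {0..<d} I" unfolding d_def using ex_bij_betw_nat_finite[OF rep_fin] by blast
 hence h: "bij_betw h {..<d} I" by (simp add: lessThan_atLeast0)
 have hI: "h a \<in> I" if "a < d" for a using h that by (auto simp: bij_betw_def)
 have hinj: "h a = h b \<longleftrightarrow> a = b" if "a < d" "b < d" for a b
  using h that by (auto simp: bij_betw_def inj_on_eq_iff)
 note sumI = sum.reindex_bij_betw[OF h, symmetric]
 have dm: "P div d < n" "P mod d < d" if "P < n * d" for P
 proof -
  have "d > 0" using that by (cases "d = 0") auto
  thus "P div d < n" "P mod d < d" using that by (auto simp: less_mult_imp_div_less)
 qed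
 \<comment> \<open>The entries of the Jacobian of \<open>Psi\<close> with \<open>Phi\<close>
   substituted for the variables, that is, the left factor in the chain rule.\<close>
 define kk where "kk j l = subst (case_sum (%v. subst xv (Phi v)) (%_. yv)) (Dx l (Psi j))" for j l
 have k1: "kk j l \<in> One n" if "j < n" for j l
 proof -
  have D: "Dx l (Psi j) \<in> One n" by (rule Dx_One[OF P(2)[OF that]])
  have "kk j l \<in> PV (V1 n)"
   unfolding kk_def
  proof (rule subst_PP[OF One_PV[OF D]])
   fix v assume "v \<in> V1 n"
   thus "case_sum (%v. subst xv (Phi v)) (%_. yv) v \<in> PV (V1 n)"
    using P(1) by (auto simp: V1_def intro!: subst_PP[where V = "{..<n}"])
  qed
  moreover have "hom_deg wy 1 (kk j l)"
   unfolding kk_def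
  proof (rule hom_subst[OF _ One_PV[OF D] One_hom[OF D]])
   fix v assume "v \<in> V1 n"
   have "hom_deg wy 0 (subst xv f)" for f :: "(nat, 'k) npoly"
    by (rule hom_subst[where w = "%_. 0" and V = UNIV and u = True]) (auto simp: hom_weight0)
   thus "hom_deg wy (wy v) (case_sum (%v. subst xv (Phi v)) (%_. yv) v)" by (cases v) auto
  qed
  ultimately show ?thesis by (simp add: One_def)
 qed
 have D1: "Dx i (Phi l) \<in> One n" if "l < n" for i l by (rule Dx_One[OF P(1)[OF that]])
 define A where "A = mat (n * d) (n * d) (%(P, Q). rt (Dx (Q div d) (Phi (P div d))) (h (P mod d)) (h (Q mod d)))"
 define B where "B = mat (n * d) (n * d) (%(P, Q). rt (kk (P div d) (Q div d)) (h (P mod d)) (h (Q mod d)))"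
 have BA: "B * A = 1\<^sub>m (n * d)"
 proof (rule eq_matI)
  fix P Q assume "P < dim_row (1\<^sub>m (n * d))" "Q < dim_col (1\<^sub>m (n * d))"
  hence PQ: "P < n * d" "Q < n * d" by simp_all
  let ?j = "P div d" and ?i = "Q div d" and ?a = "h (P mod d)" and ?b = "h (Q mod d)"
  note ij = dm[OF PQ(1)] dm[OF PQ(2)]
  have "(B * A) $$ (P, Q) = (\<Sum>R<n * d. B $$ (P, R) * A $$ (R, Q))"
   using PQ by (simp add: A_def B_def scalar_prod_def lessThan_atLeast0)
  also have "\<dots> = (\<Sum>R<n * d. rt (kk ?j (R div d)) ?a (h (R mod d)) * rt (Dx ?i (Phi (R div d))) (h (R mod d)) ?b)"
   using PQ by (intro sum.cong refl) (simp add: A_def B_def)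
  also have "\<dots> = (\<Sum>l<n. \<Sum>c<d. rt (kk ?j l) ?a (h c) * rt (Dx ?i (Phi l)) (h c) ?b)"
   by (rule sum_div_mod)
  also have "\<dots> = (\<Sum>l<n. rt (sub (Dx ?i (Phi l)) (kk ?j l)) ?a ?b)"
   using ij k1 D1 hI by (intro sum.cong refl) (simp add: rt_sub sumI)
  also have "\<dots> = rt (\<Sum>l<n. sub (Dx ?i (Phi l)) (kk ?j l)) ?a ?b"
   using ij k1 D1 hI by (subst rt_sum) (auto intro!: sub_One)
  also have "(\<Sum>l<n. sub (Dx ?i (Phi l)) (kk ?j l)) = Dx ?i (subst Phi (Psi ?j))"
   unfolding kk_def by (rule Dx_chain[OF P(2)[OF ij(1)], symmetric])
  also have "rt \<dots> ?a ?b = rt (Dx ?i (np_var ?j)) ?a ?b"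
  proof (rule rt_eqI)
   show "Dx ?i (subst Phi (Psi ?j)) \<in> One n"
    using P ij by (intro Dx_One subst_PP[where V = "{..<n}"]) auto
   show "Dx ?i (np_var ?j) \<in> One n" using ij by (intro Dx_One) simp
   show "Dx ?i (subst Phi (Psi ?j)) - Dx ?i (np_var ?j) \<in> T (V1 n)"
    unfolding Dx_diff[symmetric] by (rule T_Dx[OF inv[OF ij(1)]])
  qed (use ij hI in auto)
  also have "\<dots> = (if P = Q then 1 else 0)"
  proof -
   have "Dx ?i (np_var ?j) = (if ?j = ?i then yv else (0 :: 'k np2))" by (simp add: Dx_def)
   moreover have "rt yv ?a ?b = (if ?a = ?b then 1 else 0)"
   proof (rule poly_eqI)
    fix k
    have "cmp wx k yv = (if k = 0 then yv else (0 :: 'k np2))" by (rule cmp_hom) simp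
    thus "coeff (rt yv ?a ?b) k = coeff (if ?a = ?b then 1 else 0) k"
     using ij hI by (auto simp: coeff_rt rep_y rep_0)
   qed
   moreover have "rt 0 ?a ?b = 0" using ij hI by (intro poly_eqI) (simp add: coeff_rt rep_0)
   moreover have "P = Q \<longleftrightarrow> ?j = ?i \<and> ?a = ?b"
    using hinj[OF ij(2) ij(4)] by (metis div_mult_mod_eq)
   ultimately show ?thesis by auto
  qed
  finally show "(B * A) $$ (P, Q) = 1\<^sub>m (n * d) $$ (P, Q)" using PQ by simp
 qed (simp_all add: A_def B_def)
 have cA: "coeff (A $$ (P, Q)) k = ro (Dx (Q div d) (cmp d1 (Suc k) (Phi (P div d)))) (h (P mod d)) (h (Q mod d))"
  if "P < n * d" "Q < n * d" for P Q k
  using that dm[of P] dm[of Q] hI by (simp add: A_def coeff_rt cmp_Dx)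
 have eqT: "ro (Dx i f) a b = ro (Dx i f') a b" if "f - f' \<in> T {..<n}" "f \<in> PV {..<n}" "f' \<in> PV {..<n}" "a \<in> I" "b \<in> I" for i f f' a b
  using that T_Dx[OF that(1)] by (intro rep_T_diff Dx_One) (auto simp: Dx_diff)
 have low: "cmp d1 (Suc k) (Phi j) - cmp d1 (Suc k) (np_var j + g j) \<in> T {..<n}" if "j < n" "k \<le> e" for j k
  using G_cmp[OF lead[OF that(1)], of "Suc k"] that by (simp add: cmp_diff cmp_add diff_diff_eq)
 have cg: "cmp d1 (Suc k) (np_var j + g j) = (if k = 0 then np_var j else if k = e then g j else 0)" if "j < n" "k \<le> e" for j k
  using that e g[of j] cmp_hom[of d1 "e + 1" "g j"] cmp_hom[of d1 1 "np_var j" "Suc k"] by (auto simp: cmp_add d1_simp)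
 have coef: "coeff (A $$ (P, Q)) k = ro (Dx (Q div d) (if k = 0 then np_var (P div d) else if k = e then g (P div d) else 0)) (h (P mod d)) (h (Q mod d))"
  if "P < n * d" "Q < n * d" "k \<le> e" for P Q k
  unfolding cA[OF that(1,2)] using low[of "P div d" k] that dm[of P] dm[of Q] hI P g
  by (intro eqT) (auto simp: cg PV_0 intro!: cmp_PP)
 have "(\<Sum>P<n * d. coeff (A $$ (P, P)) e) = 0"
 proof (rule invertible_trace_0[OF _ _ BA e])
  fix P Q assume PQ: "P < n * d" "Q < n * d"
  have "P = Q \<longleftrightarrow> P div d = Q div d \<and> h (P mod d) = h (Q mod d)"
   using hinj[OF dm(2)[OF PQ(1)] dm(2)[OF PQ(2)]] by (metis div_mult_mod_eq)
  thus "coeff (A $$ (P, Q)) 0 = (if P = Q then 1 else 0)"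
   using coef[OF PQ, of 0] dm[OF PQ(1)] dm[OF PQ(2)] hI by (auto simp: Dx_def rep_y rep_0)
  fix k assume "0 < k" "k < e"
  thus "coeff (A $$ (P, Q)) k = 0"
   using coef[OF PQ, of k] dm[OF PQ(1)] dm[OF PQ(2)] hI by (simp add: Dx_0 rep_0)
 qed (simp_all add: A_def B_def)
 moreover have "(\<Sum>P<n * d. coeff (A $$ (P, P)) e) = (\<Sum>P<n * d. ro (Dx (P div d) (g (P div d))) (h (P mod d)) (h (P mod d)))"
  using e by (intro sum.cong refl) (simp add: coef)
 moreover have "\<dots> = (\<Sum>i<n. \<Sum>a<d. ro (Dx i (g i)) (h a) (h a))" by (rule sum_div_mod)
 ultimately show ?thesis by (simp add: sumI)
qed

end

end

section \<open>Elements of trace zero in algebras spanned by words\<close>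

text \<open>Walks of a word around the cycle labelled by \<open>v\<close>; for \<open>v = []\<close> only \<open>s = 0\<close> is meaningful.\<close>

definition clen :: "'a list => nat" where "clen v = max 1 (length v)"

lemma clen_pos [simp]: "clen v > 0" and clen_Nil [simp]: "clen [] = 1" and clen_ne: "v \<noteq> [] ==> clen v = length v"
 by (auto simp: clen_def max_def Suc_le_eq)

definition cyc :: "'a list => 'k::field => 'a list => nat => nat => 'k" where
 "cyc v s w p q = (if q = (p + length w) mod clen v \<and> (\<forall>i<length w. w ! i = v ! ((p + i) mod clen v))
   then s ^ length w else 0)"

lemma cyc_append:
 assumes "p < clen v"
 shows "cyc v s (w @ w') p q = (\<Sum>r<clen v. cyc v s w p r * cyc v s w' r q)"
proof -
 let ?m = "clen v" and ?r = "(p + length w) mod clen v"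
 have m: "?m > 0" by simp
 have 1: "(\<forall>i<length (w @ w'). (w @ w') ! i = v ! ((p + i) mod ?m)) \<longleftrightarrow>
   (\<forall>i<length w. w ! i = v ! ((p + i) mod ?m)) \<and> (\<forall>i<length w'. w' ! i = v ! ((?r + i) mod ?m))" (is "?L \<longleftrightarrow> ?A \<and> ?B")
 proof
  assume L: ?L
  have "w ! i = v ! ((p + i) mod ?m)" if "i < length w" for i
   using L[rule_format, of i] that by (simp add: nth_append)
  moreover have "w' ! i = v ! ((?r + i) mod ?m)" if "i < length w'" for i
   using L[rule_format, of "length w + i"] that by (simp add: nth_append mod_add_left_eq add.assoc)
  ultimately show "?A \<and> ?B" by blast
 next
  assume AB: "?A \<and> ?B"
  have "(w @ w') ! i = v ! ((p + i) mod ?m)" if i: "i < length (w @ w')" for i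
  proof (cases "i < length w")
   case True
   thus ?thesis using AB by (simp add: nth_append)
  next
   case False
   then obtain j where j: "i = length w + j" using le_Suc_ex not_less by blast
   hence "w' ! j = v ! ((?r + j) mod ?m)" using AB i by simp
   thus ?thesis using j by (simp add: nth_append mod_add_left_eq add.assoc)
  qed
  thus ?L by blast
 qed
 have "(\<Sum>r<?m. cyc v s w p r * cyc v s w' r q) = (\<Sum>r<?m. if r = ?r then cyc v s w p ?r * cyc v s w' ?r q else 0)"
  by (intro sum.cong) (auto simp: cyc_def)
 also have "\<dots> = cyc v s w p ?r * cyc v s w' ?r q" using m by (subst sum.delta) auto
 also have "\<dots> = cyc v s (w @ w') p q"
 proof -
  have e: "(p + length (w @ w')) mod ?m = (?r + length w') mod ?m" by (simp add: mod_add_left_eq add.assoc)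
  show ?thesis unfolding cyc_def 1 e by (auto simp add: power_add)
 qed
 finally show ?thesis by simp
qed

lemma cyc_Nil: "p < clen v ==> cyc v s [] p q = (if p = q then 1 else 0)"
 by (auto simp: cyc_def)

lemma cyc_0: "w \<noteq> [] ==> cyc v 0 w p q = 0"
 by (auto simp: cyc_def power_0_left)

definition ctr :: "'a list => 'k::field => 'a list => 'k" where
 "ctr v s w = (\<Sum>p<clen v. cyc v s w p p)"

text \<open>The contribution of the empty word is removed by subtracting the trace of the zero
 representation of the same dimension.\<close>

definition ctr' :: "'a list => 'a list => 'k::field" where
 "ctr' v w = (if v = [] then ctr v 0 w else ctr v 1 w - ctr v 0 w)"

text \<open>A closed walk has length divisible by that of the cycle, so a nonempty word not longer
  than \<open>v\<close> goes around exactly once and reads off a rotation of \<open>v\<close>. The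
  subtraction in \<open>ctr'\<close> excludes the empty word on a nonempty cycle.\<close>

lemma ctr'_rot:
 assumes "ctr' v w \<noteq> (0::'k::field)" and len: "length w \<le> length v \<or> w = []"
 shows "\<exists>p. w = rotate p v \<and> p \<le> length v"
proof (cases "v = []")
 case True
 hence "w = []" using assms by (auto simp: ctr'_def ctr_def cyc_def power_0_left split: if_splits)
 thus ?thesis using True by auto
next
 case False
 hence m: "clen v = length v" "length v > 0" by (auto simp: clen_ne)
 have w: "w \<noteq> []"
 proof
  assume "w = []"
  thus False using assms False by (simp add: ctr'_def ctr_def cyc_def)
 qed
 hence c0: "ctr v (0::'k) w = 0" by (simp add: ctr_def cyc_0)
 hence "ctr v (1::'k) w \<noteq> 0" using assms False by (simp add: ctr'_def)
 then obtain p where p: "p < clen v" "cyc v (1::'k) w p p \<noteq> 0"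
  unfolding ctr_def by (meson lessThan_iff sum.not_neutral_contains_not_neutral)
 hence q: "p = (p + length w) mod length v" and *: "\<forall>i<length w. w ! i = v ! ((p + i) mod length v)"
  by (auto simp: cyc_def m split: if_splits)
 have "length w \<le> length v" using len w by simp
 have "(p + length w) mod length v = p mod length v" using q p m by simp
 hence "length w mod length v = 0"
  by (metis add_diff_cancel_left' dvd_imp_mod_0 le_add1 mod_eq_dvd_iff_nat)
 hence "length w = length v" using \<open>length w \<le> length v\<close> w m by (metis le_neq_implies_less length_0_conv mod_less)
 hence "w = rotate p v" using * by (intro nth_equalityI) (simp_all add: nth_rotate)
 thus ?thesis using p m by auto
qed

text \<open>For nonempty \<open>v\<close> the trace counts the rotations that fix \<open>v\<close>.
  This is a positive integer, hence nonzero in characteristic zero.\<close>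

lemma ctr'_self: "ctr' v v \<noteq> (0::'k::field_char_0)"
proof (cases "v = []")
 case True
 thus ?thesis by (simp add: ctr'_def ctr_def cyc_def)
next
 case False
 hence m: "clen v = length v" "length v > 0" by (auto simp: clen_ne)
 have "ctr v (1::'k) v = (\<Sum>p<clen v. of_nat (if \<forall>i<length v. v ! i = v ! ((p + i) mod clen v) then 1 else 0))"
  unfolding ctr_def by (intro sum.cong refl) (simp add: cyc_def m)
 also have "\<dots> = of_nat (\<Sum>p<clen v. if \<forall>i<length v. v ! i = v ! ((p + i) mod clen v) then 1 else 0)" (is "_ = of_nat ?N")
  by simp
 finally have c: "ctr v (1::'k) v = of_nat ?N" .
 have "(1::nat) \<le> ?N"
 proof -
  have "(1::nat) = (\<Sum>p\<in>{0}. if \<forall>i<length v. v ! i = v ! ((p + i) mod clen v) then 1 else 0)" using m by simp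
  also have "\<dots> \<le> ?N" using m by (intro sum_mono2) auto
  finally show ?thesis .
 qed
 hence "?N \<noteq> 0" by linarith
 hence "of_nat ?N \<noteq> (0::'k)" unfolding of_nat_eq_0_iff .
 moreover have "ctr v (0::'k) v = 0" using False by (simp add: ctr_def cyc_0)
 ultimately show ?thesis using False c by (simp add: ctr'_def)
qed

section \<open>The trace criterion for sums of commutators\<close>

context nsvar
begin

definition Cm :: "nat => 'k np2 set" where
 "Cm n = np.span {sub q p - sub p q | p q. p \<in> One n \<and> q \<in> One n}"

text \<open>A left ideal of \<open>U\<close> whose square is zero modulo identities; the multiple of
  \<open>a\<close> by \<open>p\<close> from the left is \<open>sub a p\<close>. Such ideals lie in
  the Jacobson radical, see \<open>sqz_radical\<close>.\<close>

definition sqz :: "nat => 'k np2 set => bool" where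
 "sqz n N \<longleftrightarrow> np.subspace N \<and> N <= One n \<and> (\<forall>a\<in>N. \<forall>p\<in>One n. sub a p \<in> N) \<and>
   (\<forall>a\<in>N. \<forall>b\<in>N. sub b a \<in> T (V1 n))"

definition CR :: "nat => 'k np2 => bool" where
 "CR n p \<longleftrightarrow> (\<exists>c\<in>Cm n. \<exists>N. sqz n N \<and> (\<exists>\<nu>\<in>N. p - c - \<nu> \<in> T (V1 n)))"

lemma Cm_One: "Cm n <= One n"
 unfolding Cm_def by (rule np.span_minimal[OF _ subspace_One]) (auto intro!: One_diff sub_One)

lemma CR_Cm: "c \<in> Cm n ==> p - c \<in> T (V1 n) ==> CR n p"
 unfolding CR_def by (intro bexI[of _ c] exI[of _ "{0}"])
  (auto simp: sqz_def One_0 T_0 lin_0[OF lin_sub_left[OF One_hom]])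

lemma rep_tr_Cm:
 assumes r: "rep n I ro" and c: "c \<in> Cm n" shows "(\<Sum>a\<in>I. ro c a a) = 0"
proof -
 let ?S = "{c \<in> One n. (\<Sum>a\<in>I. ro c a a) = 0}"
 have "Cm n <= ?S"
  unfolding Cm_def
 proof (rule np.span_minimal)
  show "np.subspace ?S"
   by (rule np.subspaceI)
    (auto simp: One_0 rep_0[OF r] rep_add[OF r] rep_sc[OF r] sum.distrib sum_distrib_left[symmetric] intro: One_add One_sc)
  have d: "ro (p - q) a b = ro p a b - ro q a b" if "p \<in> One n" "q \<in> One n" "a \<in> I" "b \<in> I" for p q a b
   using rep_add[OF r, of "p - q" q a b] that by (simp add: One_diff)
  show "{sub q p - sub p q | p q. p \<in> One n \<and> q \<in> One n} <= ?S"
  proof clarify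
   fix p q assume pq: "p \<in> One n" "q \<in> One n"
   have "(\<Sum>a\<in>I. \<Sum>c\<in>I. ro p a c * ro q c a) = (\<Sum>a\<in>I. \<Sum>c\<in>I. ro q a c * ro p c a)"
    by (subst sum.swap) (simp add: mult.commute)
   thus "sub q p - sub p q \<in> One n \<and> (\<Sum>a\<in>I. ro (sub q p - sub p q) a a) = 0"
    using pq by (simp add: One_diff sub_One d rep_sub[OF r] sum_subtractf)
  qed
 qed
 thus ?thesis using c by auto
qed

text \<open>The index type is fixed because a definition cannot quantify over types; pairs of
  numbers accommodate positions on two cycles.\<close>

definition alltr :: "nat => 'k np2 => bool" where
 "alltr n p \<longleftrightarrow> (\<forall>(I :: (nat \<times> nat) set) ro. rep n I ro \<longrightarrow> (\<Sum>a\<in>I. ro p a a) = 0)"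

text \<open>The \<open>E v w\<close> span \<open>U\<close> and multiply like pairs of words. Write
  \<open>p\<close> modulo commutators with the fewest terms; then no two terms are rotations of each
  other, since rotations differ by commutators. If a term is left, take one whose first word is
  longest and, among those, whose second word is longest: the trace on its pair of cycles vanishes
  on all other terms but not on this one.\<close>

lemma word_system:
 fixes E :: "'a list => 'b list => 'k np2"
 assumes E1: "\<And>v w. v \<in> LA ==> w \<in> LB ==> E v w \<in> One n"
  and W1: "\<And>p. p \<in> One n ==> \<exists>S c. finite S \<and> S <= LA \<times> LB \<and> p - (\<Sum>x\<in>S. sc (c x) (E (fst x) (snd x))) \<in> T (V1 n)"
  and W2: "\<And>V W s s'. V \<in> LA ==> W \<in> LB ==> \<exists>ro. rep n ({..<clen V} \<times> {..<clen W}) ro \<and>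
   (\<forall>v\<in>LA. \<forall>w\<in>LB. \<forall>a<clen V. \<forall>b<clen V. \<forall>a'<clen W. \<forall>b'<clen W. ro (E v w) (a, a') (b, b') = cyc V s v a b * cyc W s' w a' b')"
  and W3: "\<And>v v' w w'. v \<in> LA ==> v' \<in> LA ==> w \<in> LB ==> w' \<in> LB ==> sub (E v' w') (E v w) - E (v @ v') (w @ w') \<in> T (V1 n)"
  and L: "\<And>v v'. v @ v' \<in> LA \<longleftrightarrow> v \<in> LA \<and> v' \<in> LA" "\<And>w w'. w @ w' \<in> LB \<longleftrightarrow> w \<in> LB \<and> w' \<in> LB"
  and p: "p \<in> One n" and tr: "alltr n p"
 shows "CR n p"
proof -
 let ?E = "%x. E (fst x) (snd x)"
 let ?P = "%S c k. finite S \<and> S <= LA \<times> LB \<and> k \<in> Cm n \<and> p - k - (\<Sum>x\<in>S. sc (c x) (?E x)) \<in> T (V1 n)"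
 define Q where "Q S \<longleftrightarrow> (\<exists>c k. ?P S c k)" for S
 have QI: "Q S" if "finite S" "S <= LA \<times> LB" "k \<in> Cm n" "p - k - (\<Sum>x\<in>S. sc (c x) (?E x)) \<in> T (V1 n)" for S c k
  unfolding Q_def using that by (intro exI[of _ c] exI[of _ k]) simp
 obtain S0 c0 where "finite S0" "S0 <= LA \<times> LB" "p - (\<Sum>x\<in>S0. sc (c0 x) (?E x)) \<in> T (V1 n)" using W1[OF p] by auto
 hence "Q S0" by (intro QI[of _ 0]) (simp_all add: Cm_def np.span_zero)
 from ex_has_least_nat[of Q S0 card, OF this]
 obtain S where S: "Q S" and min: "\<And>S'. Q S' ==> card S \<le> card S'" by blast
 from S obtain c k where fin: "finite S" "S <= LA \<times> LB" and kC: "k \<in> Cm n"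
  and ckT: "p - k - (\<Sum>x\<in>S. sc (c x) (?E x)) \<in> T (V1 n)" unfolding Q_def by blast
 note ck = fin kC ckT
 have c0: "c x \<noteq> 0" if x: "x \<in> S" for x
 proof
  assume "c x = 0"
  hence "(\<Sum>x\<in>S - {x}. sc (c x) (?E x)) = (\<Sum>x\<in>S. sc (c x) (?E x))" using fin x by (simp add: sum_diff1)
  hence "Q (S - {x})" using ckT fin kC by (intro QI[of _ k c]) auto
  hence "card S \<le> card (S - {x})" by (rule min)
  thus False using x ck card_Diff1_less[of S x] by auto
 qed
 have neq: "x = x'" if x: "x \<in> S" and x': "x' \<in> S" and rot: "fst x' = rotate i (fst x)" "snd x' = rotate j (snd x)" "i \<le> length (fst x)" "j \<le> length (snd x)" for x x' i j
 proof (rule ccontr)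
  assume ne: "x \<noteq> x'"
  have "fst x' = drop (i mod length (fst x)) (fst x) @ take (i mod length (fst x)) (fst x)"
   "snd x' = drop (j mod length (snd x)) (snd x) @ take (j mod length (snd x)) (snd x)"
   using rot by (simp_all add: rotate_drop_take)
  then obtain v1 v2 w1 w2 where e: "v1 @ v2 = fst x" "v2 @ v1 = fst x'" "w1 @ w2 = snd x" "w2 @ w1 = snd x'"
   by (metis append_take_drop_id)
  have xL: "v1 @ v2 \<in> LA" "w1 @ w2 \<in> LB" unfolding e using x ck by auto
  hence l: "v1 \<in> LA" "v2 \<in> LA" "w1 \<in> LB" "w2 \<in> LB" using L by simp_all
  \<comment> \<open>A single commutator rotates both words simultaneously, by independent
    amounts.\<close>
  define ka where "ka = sub (E v1 w1) (E v2 w2) - sub (E v2 w2) (E v1 w1)"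
  have ka: "ka \<in> Cm n" unfolding Cm_def ka_def using E1[OF l(1,3)] E1[OF l(2,4)] by (intro np.span_base) blast
  have "(ka - (?E x' - ?E x)) \<in> T (V1 n)"
  proof -
   have "sub (E v1 w1) (E v2 w2) - ?E x' \<in> T (V1 n)" "sub (E v2 w2) (E v1 w1) - ?E x \<in> T (V1 n)"
    using W3[OF l(2,1,4,3)] W3[OF l(1,2,3,4)] by (simp_all only: e)
   from T_diff[OF this] show ?thesis by (simp add: ka_def algebra_simps)
  qed
  hence \<tau>: "sc (c x') (ka - (?E x' - ?E x)) \<in> T (V1 n)" by (rule T_sc)
  let ?c = "c(x := c x + c x')"
  have "(\<Sum>z\<in>S. sc (c z) (?E z)) = sc (c x') (?E x') + (sc (c x) (?E x) + (\<Sum>z\<in>S - {x'} - {x}. sc (c z) (?E z)))"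
   using x x' ne ck by (subst sum.remove[of _ x'], simp, simp, subst sum.remove[of _ x]) auto
  moreover have "(\<Sum>z\<in>S - {x'}. sc (?c z) (?E z)) = sc (c x + c x') (?E x) + (\<Sum>z\<in>S - {x'} - {x}. sc (c z) (?E z))"
   using x ne ck by (subst sum.remove[of _ x]) (auto intro!: sum.cong)
  ultimately have eq: "p - (k + sc (c x') ka) - (\<Sum>z\<in>S - {x'}. sc (?c z) (?E z)) =
    (p - k - (\<Sum>z\<in>S. sc (c z) (?E z))) - sc (c x') (ka - (?E x' - ?E x))"
   by (simp add: np.scale_right_diff_distrib np.scale_left_distrib algebra_simps)
  have "p - (k + sc (c x') ka) - (\<Sum>z\<in>S - {x'}. sc (?c z) (?E z)) \<in> T (V1 n)"
   unfolding eq by (rule T_diff[OF ckT \<tau>])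
  moreover have "k + sc (c x') ka \<in> Cm n" using ck ka unfolding Cm_def by (intro np.span_add np.span_scale) auto
  ultimately have "Q (S - {x'})" using fin by (intro QI[of _ "k + sc (c x') ka" ?c]) auto
  hence "card S \<le> card (S - {x'})" by (rule min)
  thus False using x' ck card_Diff1_less[of S x'] by auto
 qed
 have "S = {}"
 proof (rule ccontr)
  assume "S \<noteq> {}"
  let ?L = "Max ((%x. length (fst x)) ` S)"
  let ?S = "{x \<in> S. length (fst x) = ?L}"
  have "?L \<in> (%x. length (fst x)) ` S" using ck \<open>S \<noteq> {}\<close> by (intro Max_in) auto
  hence "?S \<noteq> {}" by auto
  let ?L' = "Max ((%x. length (snd x)) ` ?S)"
  have "?L' \<in> (%x. length (snd x)) ` ?S" using ck \<open>?S \<noteq> {}\<close> by (intro Max_in) auto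
  then obtain x where x: "x \<in> S" "length (fst x) = ?L" "length (snd x) = ?L'" by auto
  have m1: "length (fst z) \<le> length (fst x)" if "z \<in> S" for z using x that ck by simp
  have m2: "length (snd z) \<le> length (snd x)" if "z \<in> S" "length (fst z) = length (fst x)" for z
   unfolding x(3) using x(2) that ck by (intro Max_ge) auto
  let ?V = "fst x" and ?W = "snd x"
  have VW: "?V \<in> LA" "?W \<in> LB" using x ck by auto
  have sum0: "(\<Sum>z\<in>S. c z * (ctr ?V s (fst z) * ctr ?W s' (snd z))) = 0" for s s'
  proof -
   let ?I = "{..<clen ?V} \<times> {..<clen ?W}"
   obtain ro where ro: "rep n ?I ro" and roE: "\<forall>v\<in>LA. \<forall>w\<in>LB. \<forall>a<clen ?V. \<forall>b<clen ?V. \<forall>a'<clen ?W. \<forall>b'<clen ?W.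
     ro (E v w) (a, a') (b, b') = cyc ?V s v a b * cyc ?W s' w a' b'"
    using W2[OF VW] by blast
   have zE: "?E z \<in> One n" "fst z \<in> LA" "snd z \<in> LB" if "z \<in> S" for z using E1 ck that by auto
   have Es: "(\<Sum>z\<in>S. sc (c z) (?E z)) \<in> One n" by (intro One_sum One_sc zE)
   have kO: "k \<in> One n" using ck Cm_One by blast
   have eq: "ro p a a = ro k a a + ro (\<Sum>z\<in>S. sc (c z) (?E z)) a a" if "a \<in> ?I" for a
   proof -
    have "ro p a a = ro (k + (\<Sum>z\<in>S. sc (c z) (?E z))) a a"
     by (rule rep_T_diff[OF ro p One_add[OF kO Es] _ that that]) (use ck in \<open>simp add: diff_diff_eq\<close>)
    thus ?thesis using rep_add[OF ro kO Es that that] by simp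
   qed
   have "0 = (\<Sum>a\<in>?I. ro p a a)" using tr ro unfolding alltr_def by metis
   also have "\<dots> = (\<Sum>a\<in>?I. ro k a a) + (\<Sum>a\<in>?I. ro (\<Sum>z\<in>S. sc (c z) (?E z)) a a)"
    by (simp add: eq sum.distrib)
   also have "(\<Sum>a\<in>?I. ro k a a) = 0" using rep_tr_Cm[OF ro] ck by blast
   also have "(\<Sum>a\<in>?I. ro (\<Sum>z\<in>S. sc (c z) (?E z)) a a) = (\<Sum>a\<in>?I. \<Sum>z\<in>S. c z * ro (?E z) a a)"
    by (intro sum.cong refl) (simp add: rep_sum[OF ro] rep_sc[OF ro] zE One_sc)
   also have "\<dots> = (\<Sum>z\<in>S. c z * (\<Sum>a\<in>?I. ro (?E z) a a))"
    by (subst sum.swap) (simp add: sum_distrib_left)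
   also have "\<dots> = (\<Sum>z\<in>S. c z * (ctr ?V s (fst z) * ctr ?W s' (snd z)))"
   proof (intro sum.cong refl arg_cong[where f = "(*) _"])
    fix z assume z: "z \<in> S"
    have "(\<Sum>a\<in>?I. ro (?E z) a a) = (\<Sum>a<clen ?V. \<Sum>a'<clen ?W. ro (?E z) (a, a') (a, a'))"
     by (simp add: sum.cartesian_product)
    also have "\<dots> = (\<Sum>a<clen ?V. \<Sum>a'<clen ?W. cyc ?V s (fst z) a a * cyc ?W s' (snd z) a' a')"
     using roE zE[OF z] by (intro sum.cong refl) simp
    finally show "(\<Sum>a\<in>?I. ro (?E z) a a) = ctr ?V s (fst z) * ctr ?W s' (snd z)"
     by (simp add: ctr_def sum_product)
   qed
   finally show ?thesis by simp
  qed
  have sum1: "(\<Sum>z\<in>S. c z * (ctr' ?V (fst z) * ctr ?W s' (snd z))) = 0" for s'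
  proof (cases "?V = []")
   case True
   hence "ctr' ?V w = ctr ?V (0::'k) w" for w by (simp add: ctr'_def)
   thus ?thesis using sum0[of 0 s'] by (simp only:)
  next
   case False
   hence "ctr' ?V w = ctr ?V (1::'k) w - ctr ?V 0 w" for w by (simp add: ctr'_def)
   thus ?thesis by (simp only: right_diff_distrib left_diff_distrib sum_subtractf sum0) simp
  qed
  have sum2: "(\<Sum>z\<in>S. c z * (ctr' ?V (fst z) * ctr' ?W (snd z))) = 0"
  proof (cases "?W = []")
   case True
   hence "ctr' ?W w = ctr ?W (0::'k) w" for w by (simp add: ctr'_def)
   thus ?thesis using sum1[of 0] by (simp only:)
  next
   case False
   hence "ctr' ?W w = ctr ?W (1::'k) w - ctr ?W 0 w" for w by (simp add: ctr'_def)
   thus ?thesis by (simp only: right_diff_distrib sum_subtractf sum1) simp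
  qed
  \<comment> \<open>The order of the two traces matters: the bound on the second word is available
    only after the first word is known to be a rotation, hence of maximal length.\<close>
  have "ctr' ?V (fst z) * ctr' ?W (snd z) = (0::'k)" if z: "z \<in> S" and "z \<noteq> x" for z
  proof (rule ccontr)
   assume "ctr' ?V (fst z) * ctr' ?W (snd z) \<noteq> (0::'k)"
   hence nz: "ctr' ?V (fst z) \<noteq> (0::'k)" "ctr' ?W (snd z) \<noteq> (0::'k)" by auto
   obtain i where i: "fst z = rotate i ?V" "i \<le> length ?V" using ctr'_rot[OF nz(1)] m1[OF z] by auto
   hence "length (snd z) \<le> length ?W" using m2[OF z] by simp
   then obtain j where j: "snd z = rotate j ?W" "j \<le> length ?W" using ctr'_rot[OF nz(2)] by auto
   show False using neq[OF x(1) z i(1) j(1) i(2) j(2)] that by simp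
  qed
  hence "(\<Sum>z\<in>S. c z * (ctr' ?V (fst z) * ctr' ?W (snd z))) = (\<Sum>z\<in>S. if z = x then c x * (ctr' ?V ?V * ctr' ?W ?W) else 0)"
   by (intro sum.cong) auto
  also have "\<dots> = c x * (ctr' ?V ?V * ctr' ?W ?W)" using x ck by simp
  finally show False using sum2 c0[OF x(1)] ctr'_self[of ?V, where 'k = 'k] ctr'_self[of ?W, where 'k = 'k] by simp
 qed
 thus ?thesis using ck CR_Cm[of k n p] by simp
qed

end

section \<open>Associative algebras\<close>

text \<open>With concatenation as addition, the convolution product on
  \<open>'a list \<Rightarrow>\<^sub>0 'k\<close> is that of the free associative algebra.\<close>

instantiation list :: (type) monoid_add
begin
definition zero_list :: "'a list" where "zero_list = []"
definition plus_list :: "'a list => 'a list => 'a list" where "plus_list = (@)"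
instance by standard (simp_all add: zero_list_def plus_list_def)
end

fun mwd :: "'v mag => 'v list" where
 "mwd (Gen v) = [v]"
| "mwd (Node a b) = mwd a @ mwd b"

lemma pm_sum_single: "(p :: 'm \<Rightarrow>\<^sub>0 'k::comm_monoid_add) = (\<Sum>m\<in>ks p. Poly_Mapping.single m (lk p m))"
proof (rule poly_mapping_eqI)
 fix m
 have "lk (\<Sum>m\<in>ks p. Poly_Mapping.single m (lk p m)) m = (\<Sum>m'\<in>ks p. if m' = m then lk p m' else 0)"
  unfolding lookup_sum lookup_single when_def ..
 also have "\<dots> = lk p m" by (subst sum.delta) (simp_all add: in_keys_iff)
 finally show "lk p m = lk (\<Sum>m\<in>ks p. Poly_Mapping.single m (lk p m)) m" by simp
qed

lemma single_central: "p * Poly_Mapping.single 0 c = Poly_Mapping.single 0 (c :: 'k::field) * (p :: 'm::monoid_add \<Rightarrow>\<^sub>0 'k)"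
proof -
 have "(\<Sum>m\<in>ks p. Poly_Mapping.single m (lk p m)) * Poly_Mapping.single 0 c =
   Poly_Mapping.single 0 c * (\<Sum>m\<in>ks p. Poly_Mapping.single m (lk p m))"
  by (simp add: sum_distrib_left sum_distrib_right mult_single mult.commute)
 thus ?thesis using pm_sum_single[of p] by simp
qed

abbreviation lsc :: "'k::field => ('a list \<Rightarrow>\<^sub>0 'k) => 'a list \<Rightarrow>\<^sub>0 'k" where
 "lsc c \<equiv> Poly_Mapping.map ((*) c)"

lemma lsc_mult: "lsc c f * g = lsc c (f * g)" "f * lsc c g = lsc c (f * g)"
proof -
 show "lsc c f * g = lsc c (f * g)" by (simp add: mult_map_scale_conv_mult mult.assoc)
 have "f * (Poly_Mapping.single 0 c * g) = (Poly_Mapping.single 0 c * f) * g"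
  using single_central[of f c] by (simp add: mult.assoc[symmetric])
 thus "f * lsc c g = lsc c (f * g)" by (simp add: mult_map_scale_conv_mult mult.assoc)
qed

lemma lookup_map_mult: "lk (Poly_Mapping.map ((*) c) f) m = (c :: 'k::field) * lk f m"
 by (simp add: Poly_Mapping.map.rep_eq when_def)

lemma vector_space_lsc: "vector_space (lsc :: 'k::field => ('a list \<Rightarrow>\<^sub>0 'k) => _)"
 by unfold_locales (auto intro!: poly_mapping_eqI simp: lookup_map_mult lookup_add algebra_simps)

lemma nalg_list: "nalg (lsc :: 'k::field => ('a list \<Rightarrow>\<^sub>0 'k) => _) (*) 1 u"
proof (rule nalg.intro[OF vector_space_lsc], unfold_locales)
 show "lin lsc lsc (%a. a * b)" "lin lsc lsc (%a. b * a)" for b :: "'a list \<Rightarrow>\<^sub>0 'k"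
  by (simp_all add: lin_def lsc_mult algebra_simps)
qed simp_all

lemma lalg_mag: "meval (*) (%v. Poly_Mapping.single [v] (1::'k::field)) t = Poly_Mapping.single (mwd t) 1"
 by (induction t) (simp_all add: mult_single plus_list_def)

interpretation kf: vector_space "(*) :: 'k::field => 'k => 'k"
 by unfold_locales (simp_all add: algebra_simps)

declare kf.scale_scale [simp del] \<comment> \<open>loops with associativity\<close>

primrec Lm :: "nat list => (nat + nat) mag => (nat + nat) mag" where
 "Lm [] t = t"
| "Lm (i # v) t = Node (Gen (Inl i)) (Lm v t)"

primrec Rm :: "nat list => (nat + nat) mag => (nat + nat) mag" where
 "Rm [] t = t"
| "Rm (j # w) t = Node (Rm w t) (Gen (Inl j))"

primrec Lw :: "nat list => 'k::field np2 => 'k np2" where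
 "Lw [] h = h"
| "Lw (i # v) h = xv i \<star> Lw v h"

text \<open>As in \<open>Lw\<close>, the first letter is the outermost factor, so both turn
  concatenation into composition. A word acting from the right therefore appears reversed in the
  monomial.\<close>

primrec Rw :: "nat list => 'k::field np2 => 'k np2" where
 "Rw [] h = h"
| "Rw (j # w) h = Rw w h \<star> xv j"

lemma Lw_mon: "Lw v (mon (Some t)) = mon (Some (Lm v t))" and Rw_mon: "Rw v (mon (Some t)) = mon (Some (Rm v t))"
 by (induction v) (simp_all add: np_var_def)

lemma Lw_append: "Lw (v @ w) h = Lw v (Lw w h)" and Rw_append: "Rw (v @ w) h = Rw v (Rw w h)"
 by (induction v) simp_all

lemma Lw_diff: "Lw v (h - h') = Lw v h - Lw v h'" and Rw_diff: "Rw v (h - h') = Rw v h - Rw v h'"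
 by (induction v) (simp_all add: mult_simps)

lemma sub_Lw: "sub q (Lw v h) = Lw v (sub q h)" and sub_Rw: "sub q (Rw v h) = Rw v (sub q h)"
 by (induction v) (simp_all add: sub_def)

abbreviation yg :: "(nat + nat) mag" where "yg \<equiv> Gen (Inr 0)"

definition xw :: "(nat + nat) mag => nat list" where "xw t = map projl (mwd t)"

text \<open>The words to the left and to the right of y in a monomial of degree one in y, the right
  one reversed to match \<open>Rm\<close>.\<close>

fun lr :: "(nat + nat) mag => nat list \<times> nat list" where
 "lr (Gen v) = ([], [])"
| "lr (Node a b) = (if mag_deg wy a = 0 then (xw a @ fst (lr b), snd (lr b))
   else (fst (lr a), rev (xw b) @ snd (lr a)))"

fun sbm :: "(nat + nat) mag => (nat + nat) mag => (nat + nat) mag" where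
 "sbm t' (Gen (Inl i)) = Gen (Inl i)"
| "sbm t' (Gen (Inr i)) = t'"
| "sbm t' (Node a b) = Node (sbm t' a) (sbm t' b)"

lemma sub_mon: "sub (mon (Some t')) (mon (Some t)) = mon (Some (sbm t' t))"
proof -
 have "meval (\<star>) (case_sum xv (%_. mon (Some t'))) t = mon (Some (sbm t' t))"
  by (induction t' t rule: sbm.induct) (simp_all add: np_var_def)
 thus ?thesis by (simp add: sub_def)
qed

lemma sbm_free: "mag_deg wy t = 0 ==> sbm t' t = t"
 by (induction t' t rule: sbm.induct) simp_all

lemma deg_sbm: "mag_deg wy t = 1 ==> mag_deg wy t' = 1 ==> mag_deg wy (sbm t' t) = 1"
proof (induction t)
 case (Gen v)
 thus ?case by (cases v) simp_all
next
 case (Node a b)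
 hence "(mag_deg wy a = 1 \<and> mag_deg wy b = 0) \<or> (mag_deg wy a = 0 \<and> mag_deg wy b = 1)" by auto
 thus ?case using Node by (auto simp: sbm_free)
qed

lemma lr_sbm: "mag_deg wy t = 1 ==> mag_deg wy t' = 1 ==>
  lr (sbm t' t) = (fst (lr t) @ fst (lr t'), snd (lr t) @ snd (lr t'))"
proof (induction t)
 case (Gen v)
 thus ?case by (cases v) simp_all
next
 case (Node a b)
 hence "(mag_deg wy a = 1 \<and> mag_deg wy b = 0) \<or> (mag_deg wy a = 0 \<and> mag_deg wy b = 1)" by auto
 thus ?case using Node deg_sbm[of a t'] by (auto simp: sbm_free)
qed

lemma lr_Rm: "lr (Rm w yg) = ([], w) \<and> mag_deg wy (Rm w yg) = 1"
 by (induction w) (auto simp: xw_def)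

lemma lr_Lm: "lr (Lm v (Rm w yg)) = (v, w) \<and> mag_deg wy (Lm v (Rm w yg)) = 1"
 using lr_Rm[of w] by (induction v) (auto simp: xw_def)

lemma mwd_free: "mag_deg wy t = 0 ==> mwd t = map Inl (xw t)"
proof (induction t)
 case (Gen v)
 thus ?case by (cases v) (simp_all add: xw_def)
qed (simp add: xw_def)

lemma mwd_lr: "mag_deg wy t = 1 ==> set_mag t <= V1 n ==> mwd t = map Inl (fst (lr t)) @ [Inr 0] @ rev (map Inl (snd (lr t)))"
proof (induction t)
 case (Gen v)
 thus ?case by (cases v) (auto simp: V1_def)
next
 case (Node a b)
 hence "(mag_deg wy a = 1 \<and> mag_deg wy b = 0) \<or> (mag_deg wy a = 0 \<and> mag_deg wy b = 1)" by auto
 thus ?case using Node by (auto simp: mwd_free rev_map)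
qed

lemma set_mwd [simp]: "set (mwd t) = set_mag t"
 by (induction t) auto

lemma set_xw: "mag_deg wy t = 0 ==> set_mag t <= V1 n ==> set (xw t) <= {..<n}"
proof -
 assume a: "mag_deg wy t = 0" "set_mag t <= V1 n"
 hence "Inl ` set (xw t) = set_mag t" using mwd_free[OF a(1)] by (metis list.set_map set_mwd)
 thus ?thesis using a(2) by (auto simp: V1_def)
qed

lemma set_lr: "mag_deg wy t = 1 ==> set_mag t <= V1 n ==> set (fst (lr t)) <= {..<n} \<and> set (snd (lr t)) <= {..<n}"
proof -
 assume a: "mag_deg wy t = 1" "set_mag t <= V1 n"
 hence "set_mag t = Inl ` set (fst (lr t)) \<union> {Inr 0} \<union> Inl ` set (snd (lr t))"
  using mwd_lr[OF a] by (metis (no_types, lifting) Un_assoc list.set_map list.simps(15) empty_set set_append set_mwd set_rev)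
 thus ?thesis using a(2) by (auto simp: V1_def)
qed

lemma set_Lm: "set_mag (Lm v t) = Inl ` set v \<union> set_mag t" and set_Rm: "set_mag (Rm v t) = Inl ` set v \<union> set_mag t"
 by (induction v) auto

context nsvar
begin

lemma One_mon: "mon (Some t) \<in> One n \<longleftrightarrow> set_mag t <= V1 n \<and> mag_deg wy t = 1"
 by (auto simp: One_def)

lemma One_keys: "p \<in> One n ==> m \<in> ks p ==> \<exists>t. m = Some t \<and> set_mag t <= V1 n \<and> mag_deg wy t = 1"
 by (cases m) (auto 0 3 simp: One_def PP_def hom_deg_def okm_def)

lemma Lw_PV: "set v <= {..<n} ==> h \<in> PV (V1 n) ==> Lw v h \<in> PV (V1 n)"
 and Rw_PV: "set v <= {..<n} ==> h \<in> PV (V1 n) ==> Rw v h \<in> PV (V1 n)"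
 by (induction v) (auto intro!: PP_mult simp: V1_def)

lemma Lw_T: "set v <= {..<n} ==> h \<in> T (V1 n) ==> Lw v h \<in> T (V1 n)"
 by (induction v) (auto intro!: T_left simp: V1_def)

lemma Rw_T: "set v <= {..<n} ==> h \<in> T (V1 n) ==> Rw v h \<in> T (V1 n)"
 by (induction v) (auto intro!: T_right simp: V1_def)

text \<open>The tensor product of two cycle representations: the left word walks on
  \<open>V\<close>, the right word on \<open>W\<close>. It is defined on nonassociative polynomials;
  that it kills the identities is shown in \<open>assoc_CR\<close>.\<close>

definition rho :: "nat list => nat list => 'k => 'k => 'k np2 => nat \<times> nat => nat \<times> nat => 'k" where
 "rho V W s s' p x z = lext (*) (%m. case m of None => 0 | Some t =>
   cyc V s (fst (lr t)) (fst x) (fst z) * cyc W s' (snd (lr t)) (snd x) (snd z)) p"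

lemma lin_rho: "lin sc (*) (%p. rho V W s s' p x z)"
 unfolding rho_def by (rule kf.lin_lext)

lemma rho_mon: "rho V W s s' (mon (Some t)) x z =
  cyc V s (fst (lr t)) (fst x) (fst z) * cyc W s' (snd (lr t)) (snd x) (snd z)"
 by (simp add: rho_def)

lemma rho_sub:
 assumes p: "p \<in> One n" and q: "q \<in> One n" and x: "fst x < clen V" "snd x < clen W"
 shows "rho V W s s' (sub q p) x z = (\<Sum>c\<in>{..<clen V} \<times> {..<clen W}. rho V W s s' p x c * rho V W s s' q c z)"
proof -
 let ?I = "{..<clen V} \<times> {..<clen W}"
 have 1: "rho V W s s' (sub (mon (Some t')) (mon (Some t))) x z =
   (\<Sum>c\<in>?I. rho V W s s' (mon (Some t)) x c * rho V W s s' (mon (Some t')) c z)"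
  if t: "mag_deg wy t = 1" "mag_deg wy t' = 1" for t t'
 proof -
  have "(\<Sum>c\<in>?I. rho V W s s' (mon (Some t)) x c * rho V W s s' (mon (Some t')) c z) =
   (\<Sum>c<clen V. \<Sum>c'<clen W. (cyc V s (fst (lr t)) (fst x) c * cyc V s (fst (lr t')) c (fst z)) *
     (cyc W s' (snd (lr t)) (snd x) c' * cyc W s' (snd (lr t')) c' (snd z)))"
   unfolding sum.cartesian_product by (intro sum.cong refl) (auto simp: rho_mon)
  also have "\<dots> = cyc V s (fst (lr t) @ fst (lr t')) (fst x) (fst z) * cyc W s' (snd (lr t) @ snd (lr t')) (snd x) (snd z)"
   unfolding cyc_append[OF x(1)] cyc_append[OF x(2)] by (rule sum_product[symmetric])
  finally show ?thesis using t by (simp add: sub_mon rho_mon lr_sbm)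
 qed
 have 2: "rho V W s s' (sub q (mon (Some t))) x z = (\<Sum>c\<in>?I. rho V W s s' (mon (Some t)) x c * rho V W s s' q c z)"
  if t: "mag_deg wy t = 1" for t
 proof (rule lin_eqI[of "(*)" "%q. rho V W s s' (sub q (mon (Some t))) x z"])
  show "lin sc (*) (%q. rho V W s s' (sub q (mon (Some t))) x z)"
   by (rule lin_comp[OF lin_sub_left lin_rho]) (simp add: t)
  show "lin sc (*) (%q. \<Sum>c\<in>?I. rho V W s s' (mon (Some t)) x c * rho V W s s' q c z)"
   by (rule linI) (simp_all only: lin_add[OF lin_rho] lin_scale[OF lin_rho] sum.distrib[symmetric] sum_distrib_left distrib_left distrib_right mult.assoc mult.left_commute)
  fix m assume "m \<in> ks q"
  then obtain t' where "m = Some t'" "mag_deg wy t' = 1" using One_keys[OF q] by blast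
  thus "rho V W s s' (sub (mon m) (mon (Some t))) x z = (\<Sum>c\<in>?I. rho V W s s' (mon (Some t)) x c * rho V W s s' (mon m) c z)"
   using 1 t by simp
 qed
 show ?thesis
 proof (rule lin_eqI[of "(*)" "%p. rho V W s s' (sub q p) x z"])
  show "lin sc (*) (%p. rho V W s s' (sub q p) x z)" by (rule lin_comp[OF lin_sub lin_rho])
  show "lin sc (*) (%p. \<Sum>c\<in>?I. rho V W s s' p x c * rho V W s s' q c z)"
   by (rule linI) (simp_all only: lin_add[OF lin_rho] lin_scale[OF lin_rho] sum.distrib[symmetric] sum_distrib_left distrib_left distrib_right mult.assoc mult.left_commute)
  fix m assume "m \<in> ks p"
  then obtain t where "m = Some t" "mag_deg wy t = 1" using One_keys[OF p] by blast
  thus "rho V W s s' (sub q (mon m)) x z = (\<Sum>c\<in>?I. rho V W s s' (mon m) x c * rho V W s s' q c z)" using 2 by simp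
 qed
qed

lemma assoc_id: "subst (%i. if i = 0 then f else if i = 1 then g else h)
  ((np_var 0 \<star> np_var 1) \<star> np_var 2 - np_var 0 \<star> (np_var (1::nat) \<star> np_var 2)) = (f \<star> g) \<star> h - f \<star> (g \<star> h)"
 by (simp add: np.ev_diff)

lemma T_assoc:
 assumes "associative_ids <= identities M" "f \<in> PV V" "g \<in> PV V" "h \<in> PV V"
 shows "(f \<star> g) \<star> h - f \<star> (g \<star> h) \<in> T V"
proof -
 have "((np_var 0 \<star> np_var 1) \<star> np_var 2 - np_var 0 \<star> (np_var (1::nat) \<star> np_var 2)) \<in> identities M"
  using assms(1) by (auto simp: associative_ids_def Let_def)
 from T_inst[OF this, of "%i. if i = 0 then f else if i = 1 then g else h" V] show ?thesis
  unfolding assoc_id using assms by auto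
qed

lemma Lw_mag:
 assumes A: "associative_ids <= identities M"
 shows "set_mag t <= V1 n ==> mag_deg wy t = 0 ==> h \<in> PV (V1 n) ==> mon (Some t) \<star> h - Lw (xw t) h \<in> T (V1 n)"
proof (induction t arbitrary: h)
 case (Gen v)
 thus ?case by (cases v) (simp_all add: xw_def np_var_def T_0)
next
 case (Node a b)
 have ab: "set_mag a <= V1 n" "mag_deg wy a = 0" "set_mag b <= V1 n" "mag_deg wy b = 0" using Node.prems by auto
 have P: "mon (Some a) \<in> PV (V1 n)" "mon (Some b) \<in> PV (V1 n)" using ab by auto
 have 1: "mon (Some (Node a b)) \<star> h - mon (Some a) \<star> (mon (Some b) \<star> h) \<in> T (V1 n)"
  using T_assoc[OF A P Node.prems(3)] by simp
 have 2: "mon (Some a) \<star> (mon (Some b) \<star> h) - Lw (xw a) (mon (Some b) \<star> h) \<in> T (V1 n)"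
  by (rule Node.IH(1)[OF ab(1,2)]) (intro PP_mult P Node.prems)
 have 3: "Lw (xw a) (mon (Some b) \<star> h) - Lw (xw a) (Lw (xw b) h) \<in> T (V1 n)"
  unfolding Lw_diff[symmetric] by (intro Lw_T set_xw ab Node.IH Node.prems)
 from T_trans[OF T_trans[OF 1 2] 3] show ?case by (simp add: xw_def Lw_append)
qed

lemma Rw_mag:
 assumes A: "associative_ids <= identities M"
 shows "set_mag t <= V1 n ==> mag_deg wy t = 0 ==> h \<in> PV (V1 n) ==> h \<star> mon (Some t) - Rw (rev (xw t)) h \<in> T (V1 n)"
proof (induction t arbitrary: h)
 case (Gen v)
 thus ?case by (cases v) (simp_all add: xw_def np_var_def T_0)
next
 case (Node a b)
 have ab: "set_mag a <= V1 n" "mag_deg wy a = 0" "set_mag b <= V1 n" "mag_deg wy b = 0" using Node.prems by auto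
 have P: "mon (Some a) \<in> PV (V1 n)" "mon (Some b) \<in> PV (V1 n)" using ab by auto
 have 1: "h \<star> mon (Some (Node a b)) - (h \<star> mon (Some a)) \<star> mon (Some b) \<in> T (V1 n)"
  using T_swap[OF T_assoc[OF A Node.prems(3) P]] by simp
 have 2: "(h \<star> mon (Some a)) \<star> mon (Some b) - Rw (rev (xw b)) (h \<star> mon (Some a)) \<in> T (V1 n)"
  by (rule Node.IH(2)[OF ab(3,4)]) (intro PP_mult P Node.prems)
 have 3: "Rw (rev (xw b)) (h \<star> mon (Some a)) - Rw (rev (xw b)) (Rw (rev (xw a)) h) \<in> T (V1 n)"
  unfolding Rw_diff[symmetric] using set_xw[OF ab(4,3)] by (intro Rw_T Node.IH(1) ab Node.prems) simp
 from T_trans[OF T_trans[OF 1 2] 3] show ?case by (simp add: xw_def Rw_append)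
qed

lemma Rw_Lw:
 assumes A: "associative_ids <= identities M" and w: "set w <= {..<n}"
 shows "set v <= {..<n} ==> h \<in> PV (V1 n) ==> Rw w (Lw v h) - Lw v (Rw w h) \<in> T (V1 n)"
proof (induction v)
 case (Cons i v)
 have x: "xv i \<in> PV (V1 n)" using Cons.prems by (auto simp: V1_def)
 have 1: "Rw w (xv i \<star> h) - xv i \<star> Rw w h \<in> T (V1 n)" if h: "h \<in> PV (V1 n)" for h
  using w
 proof (induction w)
  case (Cons j w)
  have xj: "xv j \<in> PV (V1 n)" using Cons.prems by (auto simp: V1_def)
  have "Rw w (xv i \<star> h) \<star> xv j - (xv i \<star> Rw w h) \<star> xv j \<in> T (V1 n)"
   using T_right[OF Cons.IH xj] Cons.prems by (simp add: mult_simps)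
  from T_trans[OF this T_assoc[OF A x Rw_PV[OF _ h] xj]] show ?case using Cons.prems by simp
 qed (simp add: T_0)
 have "xv i \<star> Rw w (Lw v h) - xv i \<star> Lw v (Rw w h) \<in> T (V1 n)"
  using T_left[OF Cons.IH x] Cons.prems by (simp add: mult_simps)
 from T_trans[OF 1[OF Lw_PV] this] show ?case using Cons.prems by simp
qed (simp add: T_0)

lemma lr_T:
 assumes A: "associative_ids <= identities M"
 shows "set_mag t <= V1 n ==> mag_deg wy t = 1 ==> mon (Some t) - Lw (fst (lr t)) (Rw (snd (lr t)) yv) \<in> T (V1 n)"
proof (induction t)
 case (Gen v)
 thus ?case by (cases v) (auto simp: V1_def np_var_def T_0)
next
 case (Node a b)
 have yP: "yv \<in> PV (V1 n)" by (simp add: V1_def)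
 consider "mag_deg wy a = 0" "mag_deg wy b = 1" | "mag_deg wy a = 1" "mag_deg wy b = 0" using Node.prems by (cases "mag_deg wy a") auto
 thus ?case
 proof cases
  case 1
  let ?v = "fst (lr b)" and ?w = "snd (lr b)"
  have s: "set ?v <= {..<n}" "set ?w <= {..<n}" using set_lr[OF 1(2), of n] Node.prems by auto
  have "mon (Some a) \<star> mon (Some b) - mon (Some a) \<star> Lw ?v (Rw ?w yv) \<in> T (V1 n)"
   using T_left[OF Node.IH(2), of "mon (Some a)"] 1 Node.prems by (simp add: mult_simps)
  moreover have "mon (Some a) \<star> Lw ?v (Rw ?w yv) - Lw (xw a) (Lw ?v (Rw ?w yv)) \<in> T (V1 n)"
   using Node.prems 1 by (intro Lw_mag[OF A] Lw_PV Rw_PV s yP) auto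
  ultimately show ?thesis using T_trans 1 by (fastforce simp: Lw_append)
 next
  case 2
  let ?v = "fst (lr a)" and ?w = "snd (lr a)"
  have s: "set ?v <= {..<n}" "set ?w <= {..<n}" using set_lr[OF 2(1), of n] Node.prems by auto
  have sb: "set (rev (xw b)) <= {..<n}" using set_xw[OF 2(2), of n] Node.prems by auto
  have 1: "mon (Some a) \<star> mon (Some b) - Lw ?v (Rw ?w yv) \<star> mon (Some b) \<in> T (V1 n)"
   using T_right[OF Node.IH(1), of "mon (Some b)"] 2 Node.prems by (simp add: mult_simps)
  have 3: "Lw ?v (Rw ?w yv) \<star> mon (Some b) - Rw (rev (xw b)) (Lw ?v (Rw ?w yv)) \<in> T (V1 n)"
   using Node.prems 2 by (intro Rw_mag[OF A] Lw_PV Rw_PV s yP) auto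
  have 4: "Rw (rev (xw b)) (Lw ?v (Rw ?w yv)) - Lw ?v (Rw (rev (xw b)) (Rw ?w yv)) \<in> T (V1 n)"
   by (intro Rw_Lw[OF A sb] s Rw_PV yP)
  from T_trans[OF T_trans[OF 1 3] 4] show ?thesis using 2 by (simp add: Rw_append)
 qed
qed

lemma assoc_CR:
 assumes I: "identities M = associative_ids" and p: "p \<in> One n" and tr: "alltr n p"
 shows "CR n p"
proof -
 have A: "associative_ids <= identities M" using I by simp
 let ?E = "%v w. Lw v (Rw w yv) :: 'k np2"
 have yP: "yv \<in> PV (V1 n)" by (simp add: V1_def)
 have Em: "?E v w = mon (Some (Lm v (Rm w yg)))" for v w
  unfolding np_var_def Rw_mon Lw_mon ..
 let ?L = "{v. set v <= {..<n}}"
 show ?thesis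
 proof (rule word_system[where E = ?E and LA = ?L and LB = ?L, OF _ _ _ _ _ _ p tr])
  show "?E v w \<in> One n" if "v \<in> ?L" "w \<in> ?L" for v w
   unfolding Em One_mon using that lr_Lm[of v w] by (auto simp: set_Lm set_Rm V1_def)
 next
  fix p assume p: "p \<in> One n"
  let ?l = "%m. lr (the m)"
  \<comment> \<open>Different monomials may have the same pair of words, so their coefficients are
    added up.\<close>
  let ?S = "?l ` ks p" and ?c = "%x. \<Sum>m\<in>{m \<in> ks p. ?l m = x}. lk p m"
  have S: "?S <= ?L \<times> ?L"
  proof (rule image_subsetI)
   fix m assume "m \<in> ks p"
   then obtain t where "m = Some t" "set_mag t <= V1 n" "mag_deg wy t = 1" using One_keys[OF p] by blast
   thus "?l m \<in> ?L \<times> ?L" using set_lr[of t n] by (simp add: mem_Times_iff)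
  qed
  have "(\<Sum>x\<in>?S. sc (?c x) (?E (fst x) (snd x))) = (\<Sum>x\<in>?S. \<Sum>m\<in>{m \<in> ks p. ?l m = x}. sc (lk p m) (?E (fst (?l m)) (snd (?l m))))"
   unfolding np.scale_sum_left by (intro sum.cong refl) auto
  also have "\<dots> = (\<Sum>m\<in>ks p. sc (lk p m) (?E (fst (?l m)) (snd (?l m))))"
   by (rule sum.image_gen[symmetric]) simp
  finally have "p - (\<Sum>x\<in>?S. sc (?c x) (?E (fst x) (snd x))) = (\<Sum>m\<in>ks p. sc (lk p m) (mon m - ?E (fst (?l m)) (snd (?l m))))"
   by (subst np_sum[of p]) (simp add: np.scale_right_diff_distrib sum_subtractf del: map_single)
  moreover have "\<dots> \<in> T (V1 n)"
  proof (intro T_sum T_sc)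
   fix m assume "m \<in> ks p"
   then obtain t where "m = Some t" "set_mag t <= V1 n" "mag_deg wy t = 1" using One_keys[OF p] by blast
   thus "mon m - ?E (fst (?l m)) (snd (?l m)) \<in> T (V1 n)" using lr_T[OF A, of t n] by simp
  qed
  ultimately have "p - (\<Sum>x\<in>?S. sc (?c x) (?E (fst x) (snd x))) \<in> T (V1 n)" by metis
  thus "\<exists>S c. finite S \<and> S <= ?L \<times> ?L \<and> p - (\<Sum>x\<in>S. sc (c x) (?E (fst x) (snd x))) \<in> T (V1 n)"
   using S by (intro exI[of _ ?S] exI[of _ ?c]) auto
 next
  fix V W :: "nat list" and s s' :: 'k
  let ?I = "{..<clen V} \<times> {..<clen W}"
  have kill: "rho V W s s' p x z = 0" if p: "p \<in> One n" "p \<in> T (V1 n)" for p x z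
  proof -
   let ?ev = "ev lsc (*) 1 (%v. Poly_Mapping.single [v] (1::'k)) :: 'k np2 => _"
   interpret la: nalg "lsc :: 'k => ((nat + nat) list \<Rightarrow>\<^sub>0 'k) => _" "(*)" 1 "unital M" by (rule nalg_list)
   have P: "np_var i \<in> PP (unital M) UNIV" for i :: nat by simp
   have "?ev p = 0"
   proof (rule T_eval_0[OF nalg_list _ p(2)])
    fix g and \<zeta> :: "nat => (nat + nat) list \<Rightarrow>\<^sub>0 'k" assume "g \<in> identities M"
    hence g: "g = (np_var 0 \<star> np_var 1) \<star> np_var 2 - np_var 0 \<star> (np_var 1 \<star> np_var 2)"
     using I by (simp add: associative_ids_def Let_def)
    show "ev lsc (*) 1 \<zeta> g = 0"
     unfolding g by (simp add: la.ev_diff la.ev_mult PP_mult P mult.assoc)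
   qed
   \<comment> \<open>\<open>rho\<close> factors through the free associative algebra, where
     identities evaluate to 0. In a word linear in y the letters before y form the left word and
     those after it the reversed right word.\<close>
   define th where "th w = cyc V s (map projl (takeWhile isl w)) (fst x) (fst z) *
     cyc W s' (rev (map projl (tl (dropWhile isl w)))) (snd x) (snd z)" for w :: "(nat + nat) list"
   have lt: "lin sc (*) (%p. lext (*) th (?ev p))"
    by (rule linI) (simp_all add: la.ev_add la.ev_sc kf.lext_add kf.lext_map)
   have "rho V W s s' p x z = lext (*) th (?ev p)"
   proof (rule lin_eqI[OF lin_rho lt])
    fix m assume "m \<in> ks p"
    then obtain t where t: "m = Some t" "set_mag t <= V1 n" "mag_deg wy t = 1" using One_keys[OF p(1)] by blast
    have "?ev (mon m) = Poly_Mapping.single (mwd t) 1" by (simp add: t lalg_mag)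
    moreover have "takeWhile isl (mwd t) = map Inl (fst (lr t))" "tl (dropWhile isl (mwd t)) = map Inl (rev (snd (lr t)))"
     unfolding mwd_lr[OF t(3,2)] by (simp_all add: takeWhile_append dropWhile_append rev_map)
    ultimately show "rho V W s s' (mon m) x z = lext (*) th (?ev (mon m))"
     by (simp add: t(1) rho_mon th_def rev_map[symmetric] comp_def)
   qed
   thus ?thesis using \<open>?ev p = 0\<close> by simp
  qed
  have "rep n ?I (rho V W s s')"
   unfolding rep_def
  proof (intro conjI ballI allI)
   fix p q a b assume pq: "p \<in> One n" "q \<in> One n" and ab: "a \<in> ?I" "b \<in> ?I"
   show "rho V W s s' (p + q) a b = rho V W s s' p a b + rho V W s s' q a b" by (rule lin_add[OF lin_rho])
   show "rho V W s s' (sub q p) a b = (\<Sum>c\<in>?I. rho V W s s' p a c * rho V W s s' q c b)"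
    by (rule rho_sub[OF pq]) (use ab in auto)
  next
   fix a b assume "a \<in> ?I" "b \<in> ?I"
   thus "rho V W s s' yv a b = (if a = b then 1 else 0)"
    by (auto simp: np_var_def rho_mon cyc_Nil split: if_splits)
  qed (auto simp: kill lin_scale[OF lin_rho])
  moreover have "rho V W s s' (?E v w) (a, a') (b, b') = cyc V s v a b * cyc W s' w a' b'" for v w a a' b b'
   unfolding Em rho_mon using lr_Lm[of v w] by simp
  ultimately show "\<exists>ro. rep n ?I ro \<and> (\<forall>v\<in>?L. \<forall>w\<in>?L. \<forall>a<clen V. \<forall>b<clen V. \<forall>a'<clen W. \<forall>b'<clen W.
    ro (?E v w) (a, a') (b, b') = cyc V s v a b * cyc W s' w a' b')" by blast
 next
  fix v v' w w' assume "v \<in> ?L" "v' \<in> ?L" "w \<in> ?L" "w' \<in> ?L"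
  hence l: "set v <= {..<n}" "set v' <= {..<n}" "set w <= {..<n}" "set w' <= {..<n}" by auto
  have "Lw v (Rw w (Lw v' (Rw w' yv))) - Lw v (Lw v' (Rw w (Rw w' yv))) \<in> T (V1 n)"
   unfolding Lw_diff[symmetric] by (intro Lw_T l Rw_Lw[OF A] Rw_PV yP)
  thus "sub (?E v' w') (?E v w) - ?E (v @ v') (w @ w') \<in> T (V1 n)"
   by (simp add: sub_Lw sub_Rw Lw_append Rw_append)
 qed auto
qed

end

section \<open>Commutative and metabelian algebras\<close>

lemma digits_unique:
 fixes f g :: "nat => nat"
 assumes "\<And>i. i < n ==> f i < B" "\<And>i. i < n ==> g i < B" "(\<Sum>i<n. f i * B ^ i) = (\<Sum>i<n. g i * B ^ i)" "i < n"
 shows "f i = g i"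
 using assms
proof (induction n arbitrary: f g i)
 case (Suc n)
 have s: "(\<Sum>i<Suc n. h i * B ^ i) = h 0 + B * (\<Sum>i<n. h (Suc i) * B ^ i)" for h :: "nat => nat"
  unfolding sum.lessThan_Suc_shift sum_distrib_left by (simp add: algebra_simps)
 have e: "f 0 + B * (\<Sum>i<n. f (Suc i) * B ^ i) = g 0 + B * (\<Sum>i<n. g (Suc i) * B ^ i)"
  using Suc.prems(3) unfolding s .
 have b: "f 0 < B" "g 0 < B" using Suc.prems by auto
 have 0: "f 0 = g 0"
 proof -
  have "(f 0 + B * (\<Sum>i<n. f (Suc i) * B ^ i)) mod B = f 0" "(g 0 + B * (\<Sum>i<n. g (Suc i) * B ^ i)) mod B = g 0"
   using b by simp_all
  thus ?thesis using e by metis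
 qed
 hence "(\<Sum>i<n. f (Suc i) * B ^ i) = (\<Sum>i<n. g (Suc i) * B ^ i)" using e b by auto
 hence "f (Suc j) = g (Suc j)" if "j < n" for j
  using Suc.IH[of "%i. f (Suc i)" "%i. g (Suc i)" j] Suc.prems that by simp
 thus ?case using 0 Suc.prems(4) by (cases i) auto
qed simp

text \<open>The point with coordinates \<open>t ^ (B ^ i)\<close> separates words with different letter counts, if \<open>B\<close> exceeds their lengths.\<close>

lemma word_monomials_independent:
 fixes c :: "'i => 'k::field_char_0" and w :: "'i => nat list"
 assumes I: "finite I" and 0: "\<And>\<tau>. (\<Sum>i\<in>I. c i * prod_list (map \<tau> (w i))) = 0"
  and w: "\<And>i. i \<in> I ==> set (w i) <= {..<n}"
 shows "(\<Sum>i\<in>{i \<in> I. mset (w i) = \<mu>}. c i) = 0"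
proof (cases "\<exists>i\<in>I. mset (w i) = \<mu>")
 case True
 then obtain j where j: "j \<in> I" "mset (w j) = \<mu>" by blast
 define B where "B = Suc (Max ((%i. length (w i)) ` I))"
 define N where "N u = sum_list (map (%i. B ^ i) u)" for u
 have N: "N u = (\<Sum>i<n. count (mset u) i * B ^ i)" if "set u <= {..<n}" for u
  using that
 proof (induction u)
  case (Cons a u)
  have "(\<Sum>i<n. count (mset (a # u)) i * B ^ i) = (\<Sum>i<n. count (mset u) i * B ^ i + (if i = a then B ^ a else 0))"
   by (intro sum.cong refl) auto
  also have "\<dots> = (\<Sum>i<n. count (mset u) i * B ^ i) + B ^ a" using Cons.prems by (simp add: sum.distrib)
  finally show ?case using Cons by (simp add: N_def)
 qed (simp add: N_def)
 have lt: "count (mset (w i)) k < B" if "i \<in> I" for i k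
 proof -
  have "count (mset (w i)) k \<le> length (w i)" by (metis count_le_length count_mset)
  also have "\<dots> \<le> Max ((%i. length (w i)) ` I)" using I that by simp
  finally show ?thesis by (simp add: B_def)
 qed
 have inj: "mset (w i) = \<mu> \<longleftrightarrow> N (w i) = N (w j)" if i: "i \<in> I" for i
 proof
  assume "N (w i) = N (w j)"
  hence e: "(\<Sum>k<n. count (mset (w i)) k * B ^ k) = (\<Sum>k<n. count (mset (w j)) k * B ^ k)"
   using N w i j by simp
  have "count (mset (w i)) k = count (mset (w j)) k" for k
  proof (cases "k < n")
   case True
   thus ?thesis using digits_unique[OF lt[OF i] lt[OF j(1)] e] by simp
  next
   case False
   hence "k \<notin> set (w i)" "k \<notin> set (w j)" using w i j by auto
   thus ?thesis by (simp add: count_mset count_list_0_iff)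
  qed
  thus "mset (w i) = \<mu>" using j by (metis multiset_eqI)
 qed (use j in \<open>metis N_def mset_map sum_mset_sum_list\<close>)
 define P where "P = (\<Sum>i\<in>I. monom (c i) (N (w i)))"
 have pw: "prod_list (map (%i. t ^ (B ^ i)) u) = t ^ N u" for t :: 'k and u
  by (induction u) (simp_all add: N_def power_add)
 have "poly P t = 0" for t
  using 0[of "%i. t ^ (B ^ i)"] unfolding P_def pw by (simp add: poly_sum poly_monom)
 hence "P = 0" using poly_all_0_iff_0 by blast
 hence "0 = coeff P (N (w j))" by simp
 also have "\<dots> = (\<Sum>i\<in>I. if N (w i) = N (w j) then c i else 0)" by (simp add: P_def coeff_sum)
 also have "\<dots> = (\<Sum>i\<in>I. if mset (w i) = \<mu> then c i else 0)"
  by (intro sum.cong refl) (simp add: inj)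
 finally show ?thesis using I by (simp add: sum.If_cases Int_def)
next
 case False
 hence "{i \<in> I. mset (w i) = \<mu>} = {}" by auto
 thus ?thesis by (simp only: sum.empty)
qed

text \<open>A two-dimensional algebra: the dual numbers for \<open>ka = 1\<close>, \<open>ka' = 1\<close> and a metabelian Lie algebra
 for \<open>ka = 0\<close>, \<open>ka' = - 1\<close>.\<close>

definition dmu :: "'k::field => 'k => 'k \<times> 'k => 'k \<times> 'k => 'k \<times> 'k" where
 "dmu ka ka' a b = (ka * fst a * fst b, fst a * snd b + ka' * snd a * fst b)"

definition dsc :: "'k::field => 'k \<times> 'k => 'k \<times> 'k" where
 "dsc c a = (c * fst a, c * snd a)"

lemma nalg_dmu: "(u ==> ka = 1 \<and> ka' = 1) ==> nalg (dsc :: 'k::field => _) (dmu ka ka') (1, 0) u"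
proof -
 assume u: "u ==> ka = 1 \<and> ka' = 1"
 have vs: "vector_space (dsc :: 'k => _)"
 proof
  fix a b :: 'k and x y :: "'k \<times> 'k"
  show "dsc a (x + y) = dsc a x + dsc a y" "dsc (a + b) x = dsc a x + dsc b x" "dsc a (dsc b x) = dsc (a * b) x" "dsc 1 x = x"
   by (rule prod_eqI; simp add: dsc_def distrib_left distrib_right mult.assoc)+
 qed
 show ?thesis
 proof (rule nalg.intro[OF vs], unfold_locales)
  show "lin dsc dsc (%a. dmu ka ka' a b)" "lin dsc dsc (%a. dmu ka ka' b a)" for b :: "'k \<times> 'k"
   by (rule linI; rule prod_eqI; simp add: dsc_def dmu_def distrib_left distrib_right mult_ac)+
  show "dmu ka ka' (1, 0) a = a" "dmu ka ka' a (1, 0) = a" if "u" for a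
   using u[OF that] by (auto simp: dmu_def prod_eq_iff)
 qed
qed

abbreviation dval :: "(nat => 'k::field) => nat + nat => 'k \<times> 'k" where
 "dval \<tau> \<equiv> case_sum (%i. (\<tau> i, 0)) (%_. (0, 1))"

lemma dmu_sel: "fst (dmu ka ka' a b) = ka * fst a * fst b" "snd (dmu ka ka' a b) = fst a * snd b + ka' * snd a * fst b"
 and dsc_sel: "fst (dsc c a) = c * fst a" "snd (dsc c a) = c * snd a"
 by (simp_all add: dmu_def dsc_def)

lemma dmu_dsc: "dmu ka ka' (dsc c a) b = dsc c (dmu ka ka' a b)" "dmu ka ka' a (dsc c b) = dsc c (dmu ka ka' a b)"
 by (simp_all add: prod_eq_iff dmu_sel dsc_sel algebra_simps)

lemma dmu_mag:
 "(mag_deg wy t = 0 \<longrightarrow> meval (dmu ka ka') (case_sum (%i. (\<tau> i, 0)) (%_. (0, c))) t = meval (dmu ka ka') (dval \<tau>) t \<and>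
   snd (meval (dmu ka ka') (dval \<tau>) t) = 0) \<and>
  (mag_deg wy t = Suc 0 \<longrightarrow> meval (dmu ka ka') (case_sum (%i. (\<tau> i, 0)) (%_. (0, c))) t = dsc c (meval (dmu ka ka') (dval \<tau>) t) \<and>
   fst (meval (dmu ka ka') (dval \<tau>) t) = 0)"
proof (induction t)
 case (Gen v)
 show ?case by (cases v) (auto simp: dsc_def)
next
 case (Node a b)
 show ?case
 proof (intro conjI[OF impI impI])
  assume "mag_deg wy (Node a b) = Suc 0"
  then consider "mag_deg wy a = Suc 0" "mag_deg wy b = 0" | "mag_deg wy a = 0" "mag_deg wy b = Suc 0"
   by (cases "mag_deg wy a") auto
  thus "meval (dmu ka ka') (case_sum (%i. (\<tau> i, 0)) (%_. (0, c))) (Node a b) = dsc c (meval (dmu ka ka') (dval \<tau>) (Node a b)) \<and>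
   fst (meval (dmu ka ka') (dval \<tau>) (Node a b)) = 0"
   by cases (use Node in \<open>simp_all add: dmu_sel dmu_dsc\<close>)
 next
  assume "mag_deg wy (Node a b) = 0"
  hence "mag_deg wy a = 0" "mag_deg wy b = 0" by simp_all
  thus "meval (dmu ka ka') (case_sum (%i. (\<tau> i, 0)) (%_. (0, c))) (Node a b) = meval (dmu ka ka') (dval \<tau>) (Node a b) \<and>
   snd (meval (dmu ka ka') (dval \<tau>) (Node a b)) = 0"
   using Node by (simp add: dmu_sel)
 qed
qed

section \<open>Characters of the universal enveloping algebra\<close>

context nsvar
begin

text \<open>In the algebra \<open>dmu\<close> the second coordinate is an ideal of dimension one, so
  multiplications act on it by scalars. The result is a character of \<open>U\<close> that sends
  left multiplication by the variable \<open>i\<close> to \<open>\<tau> i\<close>.\<close>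

lemma rep_dval:
 assumes u: "unital M ==> ka = 1 \<and> ka' = 1"
  and id: "\<And>g \<zeta>. g \<in> identities M ==> ev dsc (dmu ka ka') (1, 0) \<zeta> g = 0"
 shows "rep n {(0, 0)} (%p x z. snd (ev dsc (dmu ka ka') (1, 0) (dval \<tau>) p))" (is "rep n _ (%p x z. snd (?ev p))")
proof -
 interpret d: nalg dsc "dmu ka ka'" "(1, 0)" "unital M" by (rule nalg_dmu[OF u])
 have f0: "fst (?ev p) = 0" if p: "p \<in> One n" for p
 proof (rule lin_eqI[of "(*)" "%p. fst (?ev p)" "%p. 0"])
  show "lin sc (*) (%p. fst (?ev p))" by (rule linI) (simp_all add: d.ev_add d.ev_sc dsc_def)
  show "lin sc (*) (%p. 0 :: 'k)" by (rule linI) simp_all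
  fix m assume "m \<in> ks p"
  then obtain t where "m = Some t" "mag_deg wy t = 1" using One_keys[OF p] by blast
  thus "fst (?ev (mon m)) = 0" using dmu_mag[of t ka ka' \<tau> 1] by simp
 qed
 have "?ev (sub q p) = dsc (snd (?ev q)) (?ev p)" if p: "p \<in> One n" and q: "q \<in> One n" for p q
 proof -
  have e: "(%v. ?ev (case_sum xv (%_. q) v)) = case_sum (%i. (\<tau> i, 0)) (%_. (0, snd (?ev q)))"
   using f0[OF q] by (auto simp: fun_eq_iff prod_eq_iff split: sum.split)
  have "?ev (sub q p) = ev dsc (dmu ka ka') (1, 0) (case_sum (%i. (\<tau> i, 0)) (%_. (0, snd (?ev q)))) p"
   unfolding sub_def e[symmetric]
  proof (rule d.ev_subst[OF One_PV[OF p]])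
   show "case_sum xv (%_. q) v \<in> PV UNIV" for v
    using PP_mono[OF One_PV[OF q] subset_UNIV] by (cases v) auto
  qed
  also have "\<dots> = dsc (snd (?ev q)) (?ev p)"
  proof (rule lin_eqI[OF d.lin_ev])
   show "lin sc dsc (%p. dsc (snd (?ev q)) (?ev p))"
    by (rule linI) (simp_all add: d.ev_add d.ev_sc d.scale_right_distrib mult.commute)
   fix m assume "m \<in> ks p"
   then obtain t where "m = Some t" "mag_deg wy t = 1" using One_keys[OF p] by blast
   thus "ev dsc (dmu ka ka') (1, 0) (case_sum (%i. (\<tau> i, 0)) (%_. (0, snd (?ev q)))) (mon m) = dsc (snd (?ev q)) (?ev (mon m))"
    using dmu_mag[of t ka ka' \<tau> "snd (?ev q)"] by simp
  qed
  finally show ?thesis .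
 qed
 moreover have "?ev p = 0" if "p \<in> T (V1 n)" for p by (rule T_eval_0[OF d.nalg_axioms id that])
 ultimately show ?thesis by (simp add: rep_def d.ev_add d.ev_sc dsc_def mult.commute)
qed

definition QN :: "nat => 'k np2 set => 'k np2 set" where
 "QN n N = {f. \<exists>\<nu>\<in>N. f - \<nu> \<in> T (V1 n)}"

lemma subspace_QN: "np.subspace N ==> np.subspace (QN n N)"
proof (rule np.subspaceI)
 assume N: "np.subspace N"
 show "0 \<in> QN n N" unfolding QN_def using np.subspace_0[OF N] T_0 by (auto intro!: bexI[of _ 0])
 show "f + g \<in> QN n N" if "f \<in> QN n N" "g \<in> QN n N" for f g
 proof -
  obtain a b where "a \<in> N" "b \<in> N" "f - a \<in> T (V1 n)" "g - b \<in> T (V1 n)" using \<open>f \<in> QN n N\<close> \<open>g \<in> QN n N\<close> unfolding QN_def by blast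
  hence "a + b \<in> N" "(f + g) - (a + b) \<in> T (V1 n)"
   using np.subspace_add[OF N] T_add[of "f - a" "V1 n" "g - b"] by (simp_all add: algebra_simps)
  thus ?thesis unfolding QN_def by blast
 qed
 show "sc c f \<in> QN n N" if "f \<in> QN n N" for c f
 proof -
  obtain a where "a \<in> N" "f - a \<in> T (V1 n)" using \<open>f \<in> QN n N\<close> unfolding QN_def by blast
  hence "sc c a \<in> N" "sc c f - sc c a \<in> T (V1 n)"
   using np.subspace_scale[OF N] T_sc[of "f - a" "V1 n" c] by (simp_all add: np.scale_right_diff_distrib)
  thus ?thesis unfolding QN_def by blast
 qed
qed

text \<open>Modulo the left ideal \<open>N\<close>, \<open>U\<close> is spanned by words in
  commuting letters, whose classes the characters tell apart. Characters kill \<open>N\<close>,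
  whose elements have square zero. So the coefficients of \<open>p\<close>, collected by letter
  counts, vanish, and \<open>p\<close> lies in \<open>N\<close> up to identities.\<close>

lemma commuting_CR:
 assumes N: "sqz n N"
  and span: "\<And>t. mag_deg wy t = 1 ==> set_mag t <= V1 n ==> \<exists>c w. set w <= {..<n} \<and> mon (Some t) - sc c (Lw w yv) \<in> QN n N"
  and comm: "\<And>i j w. i < n ==> j < n ==> set w <= {..<n} ==> Lw (i # j # w) yv - Lw (j # i # w) yv \<in> QN n N"
  and u: "unital M ==> ka = 1 \<and> ka' = 1"
  and id: "\<And>g \<zeta>. g \<in> identities M ==> ev dsc (dmu ka ka') (1, 0) \<zeta> g = 0"
  and p: "p \<in> One n" and tr: "alltr n p"
 shows "CR n p"
proof -
 have sN: "np.subspace N" and NO: "N <= One n" and Nl: "\<And>a p. a \<in> N ==> p \<in> One n ==> sub a p \<in> N"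
  and N2: "\<And>a b. a \<in> N ==> b \<in> N ==> sub b a \<in> T (V1 n)" using N by (auto simp: sqz_def)
 note Q = subspace_QN[OF sN, of n]
 note Qa = np.subspace_add[OF Q] and Qd = np.subspace_diff[OF Q] and Q0 = np.subspace_0[OF Q]
 have TQ: "f \<in> QN n N" if "f \<in> T (V1 n)" for f using np.subspace_0[OF sN] that by (auto simp: QN_def intro!: bexI[of _ 0])
 have Qtr: "f - h \<in> QN n N" if "f - g \<in> QN n N" "g - h \<in> QN n N" for f g h using Qa[OF that] by simp
 have E1: "Lw w yv \<in> One n" if "set w <= {..<n}" for w
  using that lr_Lm[of w "[]"] by (auto simp: np_var_def Lw_mon One_mon set_Lm V1_def)
 \<comment> \<open>\<open>N\<close> is a left ideal, so a congruence modulo \<open>N\<close> may be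
   multiplied by further letters on the left; this allows exchanges deep inside a word.\<close>
 have QL: "xv i \<star> f \<in> QN n N" if "f \<in> QN n N" "i < n" for f i
 proof -
  obtain a where a: "a \<in> N" "f - a \<in> T (V1 n)" using \<open>f \<in> QN n N\<close> unfolding QN_def by blast
  have "sub a (Lw [i] yv) \<in> N" by (rule Nl[OF a(1) E1]) (use that in auto)
  hence "xv i \<star> a \<in> N" by (simp add: sub_Lw sub_def)
  moreover have "xv i \<star> f - xv i \<star> a \<in> T (V1 n)" using T_left[OF a(2), of "xv i"] that by (simp add: mult_simps V1_def)
  ultimately show ?thesis unfolding QN_def by blast
 qed
 have ins: "Lw (i # w) yv - Lw (insort i w) yv \<in> QN n N" if "i < n" "set w <= {..<n}" for i w
  using that
 proof (induction w)
  case (Cons j w)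
  have "Lw (i # j # w) yv - Lw (j # i # w) yv \<in> QN n N" by (rule comm) (use Cons.prems in auto)
  moreover have "xv j \<star> (Lw (i # w) yv - Lw (insort i w) yv) \<in> QN n N" by (rule QL[OF Cons.IH]) (use Cons.prems in auto)
  hence "Lw (j # i # w) yv - Lw (j # insort i w) yv \<in> QN n N" by (simp add: mult_simps)
  ultimately have "Lw (i # j # w) yv - Lw (j # insort i w) yv \<in> QN n N" by (rule Qtr)
  thus ?case by (simp add: Q0 del: Lw.simps)
 qed (simp add: Q0)
 have srt: "Lw w yv - Lw (sort w) yv \<in> QN n N" if "set w <= {..<n}" for w
  using that
 proof (induction w)
  case (Cons i w)
  have "xv i \<star> (Lw w yv - Lw (sort w) yv) \<in> QN n N" by (rule QL[OF Cons.IH]) (use Cons.prems in auto)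
  hence "Lw (i # w) yv - Lw (i # sort w) yv \<in> QN n N" by (simp add: mult_simps)
  moreover have "Lw (i # sort w) yv - Lw (insort i (sort w)) yv \<in> QN n N" by (rule ins) (use Cons.prems in auto)
  ultimately have "Lw (i # w) yv - Lw (insort i (sort w)) yv \<in> QN n N" by (rule Qtr)
  thus ?case by (simp del: Lw.simps)
 qed (simp add: Q0)
 have "\<forall>m\<in>ks p. \<exists>x. set (snd x) <= {..<n} \<and> mon m - sc (fst x) (Lw (snd x) yv) \<in> QN n N"
 proof
  fix m assume "m \<in> ks p"
  then obtain t where "m = Some t" "set_mag t <= V1 n" "mag_deg wy t = 1" using One_keys[OF p] by blast
  thus "\<exists>x. set (snd x) <= {..<n} \<and> mon m - sc (fst x) (Lw (snd x) yv) \<in> QN n N" using span by fastforce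
 qed
 then obtain x where x: "\<And>m. m \<in> ks p ==> set (snd (x m)) <= {..<n}" "\<And>m. m \<in> ks p ==> mon m - sc (fst (x m)) (Lw (snd (x m)) yv) \<in> QN n N"
  by metis
 define c where "c m = lk p m * fst (x m)" for m
 define w where "w m = snd (x m)" for m
 have pE: "p - (\<Sum>m\<in>ks p. sc (c m) (Lw (w m) yv)) \<in> QN n N"
 proof -
  have "p - (\<Sum>m\<in>ks p. sc (c m) (Lw (w m) yv)) = (\<Sum>m\<in>ks p. sc (lk p m) (mon m - sc (fst (x m)) (Lw (w m) yv)))"
   by (subst np_sum[of p]) (simp add: np.scale_right_diff_distrib sum_subtractf c_def w_def del: map_single)
  thus ?thesis using x(2) by (auto intro!: np.subspace_sum[OF Q] np.subspace_scale[OF Q] simp: w_def)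
 qed
 then obtain \<nu> where \<nu>: "\<nu> \<in> N" "p - (\<Sum>m\<in>ks p. sc (c m) (Lw (w m) yv)) - \<nu> \<in> T (V1 n)" unfolding QN_def by blast
 have vanish: "(\<Sum>m\<in>ks p. c m * prod_list (map \<tau> (w m))) = 0" for \<tau>
 proof -
  let ?ro = "%p x z. snd (ev dsc (dmu ka ka') (1, 0) (dval \<tau>) p)"
  have r: "rep n {(0, 0)} ?ro" by (rule rep_dval[OF u id])
  interpret d: nalg dsc "dmu ka ka'" "(1, 0)" "unital M" by (rule nalg_dmu[OF u])
  let ?x = "(0, 0) :: nat \<times> nat"
  have "?ro \<nu> ?x ?x * ?ro \<nu> ?x ?x = 0"
   using rep_sub[OF r, of \<nu> \<nu> ?x ?x] rep_T[OF r, of "sub \<nu> \<nu>" ?x ?x] N2 \<nu> NO sub_One by auto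
  hence "?ro \<nu> ?x ?x = 0" by simp
  moreover have "?ro (p - (\<Sum>m\<in>ks p. sc (c m) (Lw (w m) yv)) - \<nu>) ?x ?x = 0"
   by (rule rep_T[OF r]) (use \<nu> NO p E1 x w_def in \<open>auto intro!: One_diff One_sum One_sc\<close>)
  moreover have "?ro p ?x ?x = 0" using tr r unfolding alltr_def by fastforce
  moreover have "?ro (Lw u yv) ?x ?x = prod_list (map \<tau> u)" for u
  proof -
   have "meval (dmu ka ka') (dval \<tau>) (Lm u yg) = (0, prod_list (map \<tau> u))"
    by (induction u) (simp_all add: dmu_def)
   thus ?thesis by (simp add: np_var_def Lw_mon)
  qed
  ultimately show ?thesis by (simp add: d.ev_diff d.ev_sum d.ev_sc snd_sum dsc_def)
 qed
 have 0: "(\<Sum>m\<in>{m \<in> ks p. mset (w m) = \<mu>}. c m) = 0" for \<mu>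
  by (rule word_monomials_independent[OF _ vanish, where n = n]) (use x(1) in \<open>simp_all add: w_def\<close>)
 have "(\<Sum>m\<in>ks p. sc (c m) (Lw (sort (w m)) yv)) =
   (\<Sum>u\<in>(%m. sort (w m)) ` ks p. \<Sum>m\<in>{m \<in> ks p. sort (w m) = u}. sc (c m) (Lw (sort (w m)) yv))"
  by (rule sum.image_gen) simp
 also have "\<dots> = (\<Sum>u\<in>(%m. sort (w m)) ` ks p. sc (\<Sum>m\<in>{m \<in> ks p. sort (w m) = u}. c m) (Lw u yv))"
  unfolding np.scale_sum_left by (intro sum.cong refl) auto
 also have "\<dots> = 0"
 proof (rule sum.neutral, rule ballI)
  fix u assume "u \<in> (%m. sort (w m)) ` ks p"
  hence "{m \<in> ks p. sort (w m) = u} = {m \<in> ks p. mset (w m) = mset u}"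
   by (auto dest: arg_cong[where f = mset] intro: properties_for_sort)
  thus "sc (\<Sum>m\<in>{m \<in> ks p. sort (w m) = u}. c m) (Lw u yv) = 0" using 0[of "mset u"] by simp
 qed
 finally have "p - (\<Sum>m\<in>ks p. sc (c m) (Lw (sort (w m)) yv)) = p" by simp
 moreover have "(\<Sum>m\<in>ks p. sc (c m) (Lw (w m) yv)) - (\<Sum>m\<in>ks p. sc (c m) (Lw (sort (w m)) yv)) \<in> QN n N"
  unfolding sum_subtractf[symmetric] np.scale_right_diff_distrib[symmetric]
  using x w_def by (intro np.subspace_sum[OF Q] np.subspace_scale[OF Q] srt) auto
 ultimately have "p \<in> QN n N" using Qa[OF pE, of "(\<Sum>m\<in>ks p. sc (c m) (Lw (w m) yv)) - (\<Sum>m\<in>ks p. sc (c m) (Lw (sort (w m)) yv))"] by (simp del: map_single)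
 then obtain \<nu> where "\<nu> \<in> N" "p - 0 - \<nu> \<in> T (V1 n)" unfolding QN_def by auto
 moreover have "0 \<in> Cm n" by (simp add: Cm_def np.span_zero)
 ultimately show ?thesis unfolding CR_def using N by blast
qed

lemma comm_CR:
 assumes I: "identities M = associative_ids \<union> commutative_ids" and p: "p \<in> One n" and tr: "alltr n p"
 shows "CR n p"
proof -
 have A: "associative_ids <= identities M" using I by simp
 have yP: "yv \<in> PV (V1 n)" by (simp add: V1_def)
 have C: "f \<star> g - g \<star> f \<in> T (V1 n)" if "f \<in> PV (V1 n)" "g \<in> PV (V1 n)" for f g
 proof -
  have "(np_var 0 \<star> np_var (1::nat) - np_var 1 \<star> np_var 0) \<in> identities M"
   using I by (auto simp: commutative_ids_def Let_def)
  from T_inst[OF this, of "%i. if i = 0 then f else g" "V1 n"] that show ?thesis by (auto simp: np.ev_diff)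
 qed
 have N: "sqz n {0}" by (auto simp: sqz_def One_0 T_0 lin_0[OF lin_sub_left[OF One_hom]] )
 have QT: "QN n {0} = T (V1 n)" by (auto simp: QN_def)
 show ?thesis
 proof (rule commuting_CR[OF N _ _ _ _ p tr, of 1 1]; (unfold QT)?)
  fix t assume t: "mag_deg wy t = 1" "set_mag t <= V1 n"
  let ?v = "fst (lr t)" and ?w = "snd (lr t)"
  have s: "set ?v <= {..<n}" "set ?w <= {..<n}" using set_lr[OF t] by auto
  have "Rw w yv - Lw w yv \<in> T (V1 n)" if "set w <= {..<n}" for w
   using that
  proof (induction w)
   case (Cons j w)
   hence x: "xv j \<in> PV (V1 n)" by (auto simp: V1_def)
   have "Rw w yv \<star> xv j - xv j \<star> Rw w yv \<in> T (V1 n)" by (rule C[OF Rw_PV[OF _ yP] x]) (use Cons in auto)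
   moreover have "xv j \<star> Rw w yv - xv j \<star> Lw w yv \<in> T (V1 n)" using T_left[OF Cons.IH x] Cons.prems by (simp add: mult_simps)
   ultimately show ?case using T_trans by auto
  qed (simp add: T_0)
  hence "Lw ?v (Rw ?w yv) - Lw ?v (Lw ?w yv) \<in> T (V1 n)"
   unfolding Lw_diff[symmetric] using s by (intro Lw_T) auto
  hence "mon (Some t) - sc 1 (Lw (?v @ ?w) yv) \<in> T (V1 n)"
   using T_trans[OF lr_T[OF A t(2,1)]] by (simp add: Lw_append)
  thus "\<exists>c w. set w <= {..<n} \<and> mon (Some t) - sc c (Lw w yv) \<in> T (V1 n)"
   using s by (intro exI[of _ 1] exI[of _ "?v @ ?w"]) auto
 next
  fix i j w assume ij: "i < n" "j < n" and w: "set w <= {..<n}"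
  have x: "xv i \<in> PV (V1 n)" "xv j \<in> PV (V1 n)" using ij by (auto simp: V1_def)
  let ?h = "Lw w yv :: 'k np2"
  have h: "?h \<in> PV (V1 n)" by (rule Lw_PV[OF w yP])
  have "xv i \<star> (xv j \<star> ?h) - (xv i \<star> xv j) \<star> ?h \<in> T (V1 n)" by (rule T_swap[OF T_assoc[OF A x h]])
  moreover have "(xv i \<star> xv j) \<star> ?h - (xv j \<star> xv i) \<star> ?h \<in> T (V1 n)"
   using T_right[OF C[OF x] h] by (simp add: mult_simps)
  moreover have "(xv j \<star> xv i) \<star> ?h - xv j \<star> (xv i \<star> ?h) \<in> T (V1 n)" by (rule T_assoc[OF A x(2,1) h])
  ultimately show "Lw (i # j # w) yv - Lw (j # i # w) yv \<in> T (V1 n)" using T_trans by (metis Lw.simps(2))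
 next
  fix g and \<zeta> :: "nat => 'k \<times> 'k" assume g: "g \<in> identities M"
  interpret d: nalg "dsc :: 'k => _" "dmu 1 1" "(1, 0)" "unital M" by (rule nalg_dmu) simp
  have P: "np_var i \<in> PP (unital M) UNIV" for i :: nat by simp
  show "ev dsc (dmu 1 1) (1, 0) \<zeta> g = 0"
   using g unfolding I associative_ids_def commutative_ids_def Let_def
   by (elim UnE insertE emptyE; hypsubst) (simp_all add: d.ev_diff d.ev_mult PP_mult P dmu_def zero_prod_def algebra_simps del: One_nat_def)
 qed simp
qed

text \<open>\<open>N\<close> is the left ideal generated by the multiplications by products
  \<open>z\<close> of monomials in x. The metabelian law makes \<open>z\<close> annihilate all
  products, and elements of \<open>N\<close> are combinations of products; this gives square zero.
  By the Jacobi identity the commutator of the left multiplications by two generators is the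
  multiplication by their product, so letters commute modulo \<open>N\<close>.\<close>

lemma metabelian_CR:
 assumes nu: "\<not> unital M" and I: "identities M = lie_ids \<union> metabelian_ids" and p: "p \<in> One n" and tr: "alltr n p"
 shows "CR n p"
proof -
 let ?V = "V1 n"
 have yP: "yv \<in> PV ?V" by (simp add: V1_def)
 have sq: "f \<star> f \<in> T ?V" if "f \<in> PV ?V" for f
 proof -
  have "(np_var 0 \<star> np_var (0::nat)) \<in> identities M" using I by (auto simp: lie_ids_def Let_def)
  from T_inst[OF this, of "%i. f" ?V] that show ?thesis by auto
 qed
 have anti: "f \<star> g + g \<star> f \<in> T ?V" if "f \<in> PV ?V" "g \<in> PV ?V" for f g
 proof -
  have "(f + g) \<star> (f + g) - f \<star> f - g \<star> g \<in> T ?V" using that by (intro T_diff sq PV_add)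
  thus ?thesis by (simp add: mult_simps algebra_simps)
 qed
 have jac: "(f \<star> g) \<star> h + (g \<star> h) \<star> f + (h \<star> f) \<star> g \<in> T ?V" if "f \<in> PV ?V" "g \<in> PV ?V" "h \<in> PV ?V" for f g h
 proof -
  have "((np_var 0 \<star> np_var 1) \<star> np_var 2 + (np_var 1 \<star> np_var 2) \<star> np_var 0 + (np_var 2 \<star> np_var 0) \<star> np_var (1::nat)) \<in> identities M"
   using I by (auto simp: lie_ids_def Let_def)
  from T_inst[OF this, of "%i. if i = 0 then f else if i = 1 then g else h" ?V] that show ?thesis by (auto simp: np.ev_add)
 qed
 have met: "(f \<star> g) \<star> (h \<star> k) \<in> T ?V" if "f \<in> PV ?V" "g \<in> PV ?V" "h \<in> PV ?V" "k \<in> PV ?V" for f g h k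
 proof -
  have "((np_var 0 \<star> np_var 1) \<star> (np_var 2 \<star> np_var (3::nat))) \<in> identities M"
   using I by (auto simp: metabelian_ids_def Let_def)
  from T_inst[OF this, of "%i. if i = 0 then f else if i = 1 then g else if i = 2 then h else k" ?V] that show ?thesis by auto
 qed
 have sub_free: "sub q (mon (Some z)) = mon (Some z)" if "mag_deg wy z = 0" for z and q :: "'k np2"
 proof -
  have "meval (\<star>) (case_sum xv (%_. q)) z = mon (Some z)"
   using that
  proof (induction z)
   case (Gen v)
   thus ?case by (cases v) (simp_all add: np_var_def)
  qed simp
  thus ?thesis by (simp add: sub_def)
 qed
 define Z :: "'k np2 set" where "Z = {mon (Some (Node a b)) | a b. set_mag (Node a b) <= ?V \<and> mag_deg wy (Node a b) = 0}"
 have ZE: "\<exists>a b. z = mon (Some a) \<star> mon (Some b) \<and> mon (Some a) \<in> PV ?V \<and> mon (Some b) \<in> PV ?V" if "z \<in> Z" for z :: "'k np2"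
  using that by (force simp: Z_def)
 have ZP: "z \<in> PV ?V" if "z \<in> Z" for z :: "'k np2" using that by (auto simp: Z_def)
 have Zy: "z \<star> yv \<in> One n" if "z \<in> Z" for z :: "'k np2"
  using that by (auto simp: Z_def np_var_def One_mon V1_def)
 have Zs: "sub q (z \<star> h) = z \<star> sub q h" if "z \<in> Z" for z q h :: "'k np2"
 proof -
  obtain a b where "z = mon (Some (Node a b))" "mag_deg wy (Node a b) = 0" using \<open>z \<in> Z\<close> unfolding Z_def by blast
  hence "sub q z = z" using sub_free[of "Node a b" q] by simp
  thus ?thesis by (simp add: sub_def)
 qed
 have Zsy: "z \<star> h = sub h (z \<star> yv)" if "z \<in> Z" for z h :: "'k np2"
  using Zs[OF that, of h yv] by (simp add: sub_def)
 have ZT: "z \<star> mon (Some (Node a b)) \<in> T ?V" if z: "z \<in> Z" and ab: "set_mag (Node a b) <= ?V" for z a b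
 proof -
  obtain c d where "z = mon (Some c) \<star> mon (Some d)" "mon (Some c) \<in> PV ?V" "mon (Some d) \<in> PV ?V" using ZE[OF z] by blast
  thus ?thesis using met[of "mon (Some c)" "mon (Some d)" "mon (Some a)" "mon (Some b)"] ab by simp
 qed
 define N where "N = np.span {sub (z \<star> yv) p | z p. z \<in> Z \<and> p \<in> One n}"
 have NI: "sub (z \<star> yv) p \<in> N" if "z \<in> Z" "p \<in> One n" for z p
  unfolding N_def by (rule np.span_base) (use that in blast)
 have sN: "np.subspace N" unfolding N_def by (rule np.subspace_span)
 have NO: "N <= One n" unfolding N_def by (rule np.span_minimal[OF _ subspace_One]) (auto intro!: sub_One Zy)
 have Nl: "sub a p \<in> N" if a: "a \<in> N" and p: "p \<in> One n" for a p
 proof -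
  note l = lin_sub_left[OF One_hom[OF p]]
  have "np.subspace {a. sub a p \<in> N}"
   by (rule np.subspaceI)
    (auto simp: lin_add[OF l] lin_scale[OF l] lin_0[OF l] intro: np.subspace_0[OF sN] np.subspace_add[OF sN] np.subspace_scale[OF sN])
  moreover have "{sub (z \<star> yv) p | z p. z \<in> Z \<and> p \<in> One n} <= {a. sub a p \<in> N}"
  proof clarify
   fix z and q :: "'k np2" assume "z \<in> Z" "q \<in> One n"
   thus "sub (sub (z \<star> yv) q) p \<in> N" unfolding sub_sub[symmetric] by (intro NI sub_One p)
  qed
  ultimately have "N <= {a. sub a p \<in> N}" unfolding N_def by (intro np.span_minimal)
  thus ?thesis using a by blast
 qed
 have zN: "z \<star> b \<in> T ?V" if z: "z \<in> Z" and b: "b \<in> N" for z b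
 proof -
  have "N <= {b. z \<star> b \<in> T ?V}"
   unfolding N_def
  proof (rule np.span_minimal)
   show "np.subspace {b. z \<star> b \<in> T ?V}"
    by (rule np.subspaceI) (auto simp: mult_simps T_0 lin_0[OF lin_mult_right] intro: T_add T_sc)
   show "{sub (z \<star> yv) p | z p. z \<in> Z \<and> p \<in> One n} <= {b. z \<star> b \<in> T ?V}"
   proof clarify
    fix z' and p :: "'k np2" assume z': "z' \<in> Z" and p: "p \<in> One n"
    obtain c d where z'e: "z' = mon (Some (Node c d))" "set_mag (Node c d) <= ?V" using z' unfolding Z_def by auto
    \<comment> \<open>Replacing y by a product leaves no monomial that is a single letter, so the
      metabelian law applies to each of them.\<close>
    have "z \<star> sub (z' \<star> yv) (mon m) \<in> T ?V" if "m \<in> ks p" for m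
    proof -
     obtain t where t: "m = Some t" "set_mag t <= ?V" "mag_deg wy t = 1" using One_keys[OF p \<open>m \<in> ks p\<close>] by blast
     have zy: "z' \<star> yv = mon (Some (Node (Node c d) yg))" by (simp add: z'e np_var_def)
     have "sub (z' \<star> yv) (mon m) \<in> PV ?V"
      unfolding t(1) by (rule sub_PV) (use t Zy[OF z'] One_PV in \<open>auto simp: V1_def\<close>)
     hence s: "set_mag (sbm (Node (Node c d) yg) t) <= ?V" unfolding t(1) zy sub_mon by simp
     obtain a b where "sbm (Node (Node c d) yg) t = Node a b"
      using t(3) by (cases t rule: sbm.cases[of "(yg, t)" for t]) (auto split: sum.splits)
     thus ?thesis using ZT[OF z] s unfolding t(1) zy sub_mon by simp
    qed
    hence "(\<Sum>m\<in>ks p. sc (lk p m) (z \<star> sub (z' \<star> yv) (mon m))) \<in> T ?V" by (intro T_sum T_sc)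
    moreover have "z \<star> sub (z' \<star> yv) p = (\<Sum>m\<in>ks p. sc (lk p m) (z \<star> sub (z' \<star> yv) (mon m)))"
     by (subst np_sum[of p]) (simp add: sub_sum sub_sc lin_sum[OF lin_mult_right] mult_simps del: map_single)
    ultimately show "z \<star> sub (z' \<star> yv) p \<in> T ?V" by metis
   qed
  qed
  thus ?thesis using b by blast
 qed
 have N2: "sub b a \<in> T ?V" if a: "a \<in> N" and b: "b \<in> N" for a b
 proof -
  have "N <= {a. sub b a \<in> T ?V}"
   unfolding N_def
  proof (rule np.span_minimal)
   show "np.subspace {a. sub b a \<in> T ?V}"
    by (rule np.subspaceI) (auto simp: sub_add sub_sc T_0 intro: T_add T_sc)
   show "{sub (z \<star> yv) p | z p. z \<in> Z \<and> p \<in> One n} <= {a. sub b a \<in> T ?V}"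
   proof clarify
    fix z and p :: "'k np2" assume z: "z \<in> Z" and p: "p \<in> One n"
    have "sub (z \<star> b) p \<in> T ?V" by (rule T_sub_right[OF p zN[OF z b]]) (auto simp: V1_def)
    thus "sub b (sub (z \<star> yv) p) \<in> T ?V" by (simp add: sub_sub Zsy[OF z, of b])
   qed
  qed
  thus ?thesis using a by blast
 qed
 have N: "sqz n N" using sN NO Nl N2 by (auto simp: sqz_def)
 note Q = subspace_QN[OF sN, of n]
 have TQ: "f \<in> QN n N" if "f \<in> T ?V" for f using np.subspace_0[OF sN] that by (auto simp: QN_def intro!: bexI[of _ 0])
 have NQ: "f \<in> QN n N" if "f \<in> N" for f using that T_0 by (auto simp: QN_def intro!: bexI[of _ f])
 have zQ: "z \<star> mon (Some t) \<in> QN n N" if z: "z \<in> Z" and t: "set_mag t <= ?V" "mag_deg wy t = 1" for z t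
 proof (cases t)
  case (Gen v)
  hence "mon (Some t) = (yv :: 'k np2)" using t by (cases v) (auto simp: V1_def np_var_def)
  thus ?thesis using NQ[OF NI[OF z yv_One]] by (simp add: sub_def)
 next
  case (Node a b)
  thus ?thesis using ZT[OF z] t TQ by simp
 qed
 show ?thesis
 proof (rule commuting_CR[OF N _ _ _ _ p tr, of 0 "- 1"])
  \<comment> \<open>The factor free of y decides: a generator extends the word by a letter, a
    product yields an element of \<open>N\<close> or an identity.\<close>
  have main: "\<exists>c w. set w <= {..<n} \<and> mon (Some a) \<star> mon (Some b) - sc c (Lw w yv) \<in> QN n N"
   if a: "set_mag a <= ?V" "mag_deg wy a = 0" and b: "set_mag b <= ?V" "mag_deg wy b = 1"
    and IH: "\<exists>c w. set w <= {..<n} \<and> mon (Some b) - sc c (Lw w yv) \<in> QN n N" for a b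
  proof (cases a)
   case (Gen v)
   then obtain i where i: "v = Inl i" "i < n" using a by (cases v) (auto simp: V1_def)
   obtain c w \<nu> where w: "set w <= {..<n}" and \<nu>: "\<nu> \<in> N" "mon (Some b) - sc c (Lw w yv) - \<nu> \<in> T ?V"
    using IH unfolding QN_def by blast
   have "sub \<nu> (xv i \<star> yv) \<in> N" by (rule Nl[OF \<nu>(1)]) (use i in \<open>auto simp: np_var_def One_mon V1_def\<close>)
   hence "xv i \<star> \<nu> \<in> N" by (simp add: sub_def)
   moreover have "xv i \<star> mon (Some b) - sc c (xv i \<star> Lw w yv) - xv i \<star> \<nu> \<in> T ?V"
    using T_left[OF \<nu>(2), of "xv i"] i by (simp add: mult_simps V1_def)
   ultimately have "mon (Some a) \<star> mon (Some b) - sc c (Lw (i # w) yv) \<in> QN n N"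
    unfolding QN_def by (auto simp: Gen i np_var_def)
   thus ?thesis using w i by (intro exI[of _ c] exI[of _ "i # w"]) auto
  next
   case (Node c d)
   hence "mon (Some a) \<in> Z" using a by (auto simp: Z_def)
   from zQ[OF this b] show ?thesis by (intro exI[of _ 0] exI[of _ "[]"]) simp
  qed
  show "\<exists>c w. set w <= {..<n} \<and> mon (Some t) - sc c (Lw w yv) \<in> QN n N" if "mag_deg wy t = 1" "set_mag t <= ?V" for t
   using that
  proof (induction t)
   case (Gen v)
   hence "mon (Some (Gen v)) = (yv :: 'k np2)" by (cases v) (auto simp: V1_def np_var_def)
   thus ?case using np.subspace_0[OF Q] by (intro exI[of _ 1] exI[of _ "[]"]) (simp only: Lw.simps np.scale_one diff_self, simp)
  next
   case (Node a b)
   consider "mag_deg wy a = 0" "mag_deg wy b = 1" | "mag_deg wy a = 1" "mag_deg wy b = 0" using Node.prems by (cases "mag_deg wy a") auto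
   thus ?case
   proof cases
    case 1
    thus ?thesis using main[of a b] Node by simp
   next
    case 2
    obtain c w where w: "set w <= {..<n}" and c: "mon (Some b) \<star> mon (Some a) - sc c (Lw w yv) \<in> QN n N"
     using main[of b a] Node 2 by auto
    have "mon (Some a) \<star> mon (Some b) + mon (Some b) \<star> mon (Some a) \<in> T ?V" using Node.prems by (intro anti) simp_all
    from np.subspace_diff[OF Q TQ[OF this] c] have "mon (Some (Node a b)) - sc (- c) (Lw w yv) \<in> QN n N"
     by (simp add: algebra_simps del: map_single)
    thus ?thesis using w by blast
   qed
  qed
 next
  fix i j w assume ij: "i < n" "j < n" and w: "set w <= {..<n}"
  let ?h = "Lw w yv :: 'k np2"
  let ?x = "xv i :: 'k np2" and ?y = "xv j :: 'k np2"
  have x: "?x \<in> PV ?V" "?y \<in> PV ?V" using ij by (auto simp: V1_def)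
  have h: "?h \<in> PV ?V" by (rule Lw_PV[OF w yP])
  have hm: "?h = mon (Some (Lm w yg))" "set_mag (Lm w yg) <= ?V" "mag_deg wy (Lm w yg) = 1"
   using w lr_Lm[of w "[]"] by (auto simp: np_var_def Lw_mon set_Lm V1_def)
  have z: "(?x \<star> ?y) \<in> Z"
   unfolding Z_def using ij by (intro CollectI exI[of _ "Gen (Inl i)"] exI[of _ "Gen (Inl j)"]) (auto simp: np_var_def V1_def)
  have 1: "(?x \<star> ?y) \<star> ?h \<in> QN n N" unfolding hm(1) by (rule zQ[OF z hm(2,3)])
  have 2: "(?x \<star> ?y) \<star> ?h + (?y \<star> ?h) \<star> ?x + (?h \<star> ?x) \<star> ?y \<in> T ?V" by (rule jac[OF x h])
  have 3: "(?y \<star> ?h) \<star> ?x + ?x \<star> (?y \<star> ?h) \<in> T ?V" by (intro anti PP_mult x h)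
  have 4: "(?h \<star> ?x) \<star> ?y + ?y \<star> (?h \<star> ?x) \<in> T ?V" by (intro anti PP_mult x h)
  have 5: "?y \<star> (?h \<star> ?x + ?x \<star> ?h) \<in> T ?V" by (intro T_left anti x h)
  have e: "Lw (i # j # w) yv - Lw (j # i # w) yv = (?x \<star> ?y) \<star> ?h - ((?x \<star> ?y) \<star> ?h + (?y \<star> ?h) \<star> ?x + (?h \<star> ?x) \<star> ?y)
    + ((?y \<star> ?h) \<star> ?x + ?x \<star> (?y \<star> ?h)) + ((?h \<star> ?x) \<star> ?y + ?y \<star> (?h \<star> ?x)) - ?y \<star> (?h \<star> ?x + ?x \<star> ?h)"
   by (simp add: mult_simps)
  show "Lw (i # j # w) yv - Lw (j # i # w) yv \<in> QN n N"
   unfolding e by (intro np.subspace_diff[OF Q] np.subspace_add[OF Q] 1 TQ[OF 2] TQ[OF 3] TQ[OF 4] TQ[OF 5])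
 next
  fix g and \<zeta> :: "nat => 'k \<times> 'k" assume g: "g \<in> identities M"
  interpret d: nalg "dsc :: 'k => _" "dmu 0 (- 1)" "(1, 0)" "unital M" by (rule nalg_dmu) (use nu in simp)
  have P: "np_var i \<in> PP (unital M) UNIV" for i :: nat by simp
  show "ev dsc (dmu 0 (- 1)) (1, 0) \<zeta> g = 0"
   using g unfolding I lie_ids_def metabelian_ids_def Let_def
   by (elim UnE insertE emptyE; hypsubst)
    (simp_all add: d.ev_add d.ev_mult PP_mult P dmu_def zero_prod_def algebra_simps del: One_nat_def)
 qed (use nu in simp)
qed

end

section \<open>Cosets modulo the identities\<close>

context nsvar
begin

abbreviation A :: "'v set => ('k, ('v, 'k) npoly set) module" where "A V \<equiv> free_alg M V"
abbreviation cl :: "nat => _" where "cl n \<equiv> cls M {..<n}"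
abbreviation Au :: "nat => _" where "Au n \<equiv> alg_Aut (unital M) (Fr M n)"

lemma cls_alt: "cls M V f = {h + f | h. h \<in> T V}"
 by (auto simp: cls_def a_r_coset_def')

lemma cls_eq: "cls M V f = cls M V g \<longleftrightarrow> f - g \<in> T V"
proof
 assume "cls M V f = cls M V g"
 moreover have "0 + f \<in> cls M V f" unfolding cls_alt using T_0 by blast
 ultimately obtain h where "h \<in> T V" "0 + f = h + g" unfolding cls_alt by auto
 thus "f - g \<in> T V" by simp
next
 assume fg: "f - g \<in> T V"
 have "h + f \<in> cls M V g" if "h \<in> T V" for h
  unfolding cls_alt using T_add[OF that fg] by (auto intro!: exI[of _ "h + (f - g)"])
 moreover have "h + g \<in> cls M V f" if "h \<in> T V" for h
  unfolding cls_alt using T_diff[OF that fg] by (auto intro!: exI[of _ "h - (f - g)"])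
 ultimately have "cls M V f <= cls M V g" "cls M V g <= cls M V f" unfolding cls_alt by blast+
 thus "cls M V f = cls M V g" by (rule subset_antisym)
qed

lemma mem_cls: "g \<in> cls M V f \<longleftrightarrow> g - f \<in> T V"
proof
 assume "g - f \<in> T V"
 thus "g \<in> cls M V f" unfolding cls_alt by (auto intro!: exI[of _ "g - f"])
qed (auto simp: cls_alt)

lemma free_carrier: "carrier (A V) = cls M V ` PV V"
 by (auto simp: free_alg_def ring.defs FactRing_def A_RCOSETS_def' cls_def)

lemma free_zero: "\<zero>\<^bsub>A V\<^esub> = cls M V 0"
 by (simp add: free_alg_def ring.defs FactRing_def cls_alt)

lemma free_one: "\<one>\<^bsub>A V\<^esub> = cls M V (mon None)"
 by (simp add: free_alg_def ring.defs FactRing_def cls_def)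

lemma free_add: "cls M V f \<oplus>\<^bsub>A V\<^esub> cls M V g = cls M V (f + g)"
proof -
 have "cls M V f \<oplus>\<^bsub>A V\<^esub> cls M V g = {a + b | a b. a \<in> cls M V f \<and> b \<in> cls M V g}"
  by (auto simp: free_alg_def ring.defs FactRing_def set_add_def')
 also have "\<dots> = cls M V (f + g)"
 proof (rule Set.set_eqI, rule iffI)
  fix x assume "x \<in> {a + b | a b. a \<in> cls M V f \<and> b \<in> cls M V g}"
  then obtain a b where "x = a + b" "a - f \<in> T V" "b - g \<in> T V" by (auto simp: mem_cls)
  thus "x \<in> cls M V (f + g)" using T_add[of "a - f" V "b - g"] by (simp add: mem_cls algebra_simps)
 next
  fix x assume "x \<in> cls M V (f + g)"
  hence "x = (x - g) + g" "x - g \<in> cls M V f" "g \<in> cls M V g" by (simp_all add: mem_cls algebra_simps T_0)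
  thus "x \<in> {a + b | a b. a \<in> cls M V f \<and> b \<in> cls M V g}" by blast
 qed
 finally show ?thesis .
qed

lemma cls_PV: "f \<in> PV V ==> a \<in> cls M V f ==> a \<in> PV V"
 using PV_add[of "a - f" V f] T_PV[of "a - f" V] by (simp add: mem_cls)

lemma free_mult:
 assumes "f \<in> PV V" "g \<in> PV V" shows "cls M V f \<otimes>\<^bsub>A V\<^esub> cls M V g = cls M V (f \<star> g)"
proof -
 have "cls M V f \<otimes>\<^bsub>A V\<^esub> cls M V g = (\<Union>a\<in>cls M V f. \<Union>b\<in>cls M V g. cls M V (a \<star> b))"
  by (simp add: free_alg_def ring.defs FactRing_def rcoset_mult_def cls_def)
 moreover have "cls M V (a \<star> b) = cls M V (f \<star> g)" if "a \<in> cls M V f" "b \<in> cls M V g" for a b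
  unfolding cls_eq by (rule T_mult_diff) (use that assms cls_PV in \<open>auto simp: mem_cls\<close>)
 moreover have "f \<in> cls M V f" "g \<in> cls M V g" by (simp_all add: mem_cls T_0)
 ultimately show ?thesis by blast
qed

lemma free_smult: "c \<odot>\<^bsub>A V\<^esub> cls M V f = cls M V (sc c f)"
proof -
 have "c \<odot>\<^bsub>A V\<^esub> cls M V f = (\<Union>a\<in>cls M V f. cls M V (sc c a))"
  by (simp add: free_alg_def ring.defs module.defs)
 moreover have "cls M V (sc c a) = cls M V (sc c f)" if "a \<in> cls M V f" for a
  using that T_sc[of "a - f" V c] by (simp add: cls_eq mem_cls np.scale_right_diff_distrib)
 moreover have "f \<in> cls M V f" by (simp add: mem_cls T_0)
 ultimately show ?thesis by blast
qed

lemmas free_ops = free_zero free_one free_add free_mult free_smult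

lemma cls_in [simp]: "f \<in> PV V ==> cls M V f \<in> carrier (A V)" by (simp add: free_carrier)

lemma free_group: "comm_group (add_monoid (A V))"
proof (rule comm_groupI)
 fix x assume "x \<in> carrier (add_monoid (A V))"
 then obtain f where f: "f \<in> PV V" "x = cls M V f" by (auto simp: free_carrier)
 have "sc (- 1) f \<in> PV V" using f by (intro PV_sc)
 thus "\<exists>y\<in>carrier (add_monoid (A V)). y \<otimes>\<^bsub>add_monoid (A V)\<^esub> x = \<one>\<^bsub>add_monoid (A V)\<^esub>"
  using f by (intro bexI[of _ "cls M V (sc (- 1) f)"]) (simp_all add: free_ops)
qed (auto simp: free_carrier free_ops PV_0 PV_add algebra_simps)

lemma free_ag: "abelian_group (A V)"
 by (intro abelian_group.intro abelian_monoid.intro abelian_group_axioms.intro free_group comm_group.axioms(1)[OF free_group])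

lemma free_minus:
 assumes "f \<in> PV V" "g \<in> PV V" shows "cls M V f \<ominus>\<^bsub>A V\<^esub> cls M V g = cls M V (f - g)"
proof -
 interpret fr: abelian_group "A V" by (rule free_ag)
 have "cls M V (f - g) \<oplus>\<^bsub>A V\<^esub> cls M V g = cls M V f" by (simp add: free_add)
 thus ?thesis using assms by (metis PV_diff cls_in fr.add.inv_solve_right fr.minus_eq)
qed

lemma free_finsum:
 assumes "finite I" "\<And>i. i \<in> I ==> F i \<in> PV V"
 shows "(\<Oplus>\<^bsub>A V\<^esub>i\<in>I. cls M V (F i)) = cls M V (\<Sum>i\<in>I. F i)"
 using assms
proof (induction I rule: finite_induct)
 case empty
 interpret fr: abelian_group "A V" by (rule free_ag)
 show ?case by (simp add: free_zero)
next
 case (insert i I)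
 interpret fr: abelian_group "A V" by (rule free_ag)
 have "(\<Oplus>\<^bsub>A V\<^esub>i\<in>insert i I. cls M V (F i)) = cls M V (F i) \<oplus>\<^bsub>A V\<^esub> (\<Oplus>\<^bsub>A V\<^esub>i\<in>I. cls M V (F i))"
  using insert by (intro fr.finsum_insert) auto
 thus ?case using insert by (simp add: free_add)
qed

text \<open>The target is restricted to a subset \<open>S\<close> of its carrier in order to cover
  the subalgebras of the Nielsen-Schreier property.\<close>

lemma alg_hom_cls:
 assumes phi: "phi \<in> alg_hom (unital M) (A V) (A V'\<lparr>carrier := S\<rparr>)" and S: "S <= carrier (A V')"
  and Phi: "\<And>v. v \<in> V ==> Phi v \<in> PV V'" "\<And>v. v \<in> V ==> phi (gen M V v) = cls M V' (Phi v)" and f: "f \<in> PV V"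
 shows "phi (cls M V f) = cls M V' (subst Phi f)"
proof -
 have m: "phi (cls M V (f \<star> g)) = phi (cls M V f) \<otimes>\<^bsub>A V'\<^esub> phi (cls M V g)"
  and a: "phi (cls M V (f + g)) = phi (cls M V f) \<oplus>\<^bsub>A V'\<^esub> phi (cls M V g)"
  and s: "phi (cls M V (sc c f)) = c \<odot>\<^bsub>A V'\<^esub> phi (cls M V f)"
  if "f \<in> PV V" "g \<in> PV V" for f g c
  using phi that by (simp_all add: alg_hom_def hom_def free_ops[symmetric])
 have sP: "subst Phi f \<in> PV V'" if "f \<in> PV V" for f using subst_PP[OF that Phi(1)] by simp
 have t: "phi (cls M V (mon (Some t))) = cls M V' (subst Phi (mon (Some t)))" if "set_mag t <= V" for t
  using that
 proof (induction t)
  case (Gen v)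
  thus ?case using Phi(2)[of v] by (simp add: gen_def np_var_def)
 next
  case (Node x y)
  hence P: "mon (Some x) \<in> PV V" "mon (Some y) \<in> PV V" by auto
  have e: "mon (Some (Node x y)) = mon (Some x) \<star> (mon (Some y) :: (_, 'k) npoly)" by simp
  show ?case
   unfolding e subst_mult m[OF P] using Node sP[OF P(1)] sP[OF P(2)] by (simp add: free_mult)
 qed
 have n: "phi (cls M V (mon None)) = cls M V' (mon None)" if "unital M"
  using phi that by (simp add: alg_hom_def free_one)
 have z: "phi (cls M V 0) = cls M V' 0"
 proof -
  interpret fr: abelian_group "A V'" by (rule free_ag)
  have "phi (cls M V 0) \<in> carrier (A V')"
   using phi S cls_in[OF PV_0, of V] by (auto simp: alg_hom_def hom_def Pi_iff)
  then obtain f where "f \<in> PV V'" "phi (cls M V 0) = cls M V' f" by (auto simp: free_carrier)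
  thus ?thesis using s[OF PV_0 PV_0, of 0] by (simp add: free_smult np.scale_zero_left del: map_single)
 qed
 let ?K = "{f \<in> PV V. phi (cls M V f) = cls M V' (subst Phi f)}"
 have "f \<in> ?K"
 proof (rule np_subspaceI)
  show "np.subspace ?K"
   by (rule np.subspaceI) (auto simp: z a s PV_0 PV_add PV_sc np.ev_0 np.ev_add np.ev_sc free_add free_smult)
  fix m assume "m \<in> ks f"
  hence "okm (unital M) V m" using f by (simp add: PP_def)
  thus "mon m \<in> ?K" using t n by (cases m) (auto simp del: subst_mult)
 qed
 thus ?thesis by simp
qed

section \<open>Nielsen-Schreier varieties\<close>

text \<open>The subalgebra generated by the \<open>\<pi> g\<close> is free on some set
  \<open>Y\<close>; lifting its free generators along the projection gives a section
  \<open>s\<close>. The endomorphism \<open>ep\<close> is the projection followed by the section: it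
  does not change values under \<open>\<pi>\<close>, and it kills the kernel.\<close>

lemma NS_section:
 fixes \<pi> :: "'g => ('v::infinite, 'k) npoly"
 assumes NS: "nielsen_schreier TYPE('v) M" and \<pi>: "\<And>g. g \<in> GG ==> \<pi> g \<in> PV V"
 obtains ep where "\<And>g. g \<in> GG ==> ep g \<in> PV GG" "\<And>g. g \<in> GG ==> subst \<pi> (ep g) - \<pi> g \<in> T V"
  "\<And>f. f \<in> PV GG ==> subst \<pi> f \<in> T V ==> subst ep f \<in> T GG"
proof -
 define S where "S = cls M V ` subst \<pi> ` PV GG"
 have P: "subst \<pi> f \<in> PV V" if "f \<in> PV GG" for f using subst_PP[OF that \<pi>] by simp
 have SI: "cls M V (subst \<pi> f) \<in> S" if "f \<in> PV GG" for f using that by (auto simp: S_def)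
 have "subalg (unital M) (A V) S"
  unfolding subalg_def
 proof (intro conjI impI ballI allI)
  show "S <= carrier (A V)" using P by (auto simp: S_def)
  show "\<zero>\<^bsub>A V\<^esub> \<in> S" using SI[OF PV_0] by (simp add: np.ev_0 free_zero)
  show "\<one>\<^bsub>A V\<^esub> \<in> S" if "unital M" using SI[of "mon None"] that by (simp add: free_one)
  fix a b assume "a \<in> S" "b \<in> S"
  then obtain f g where f: "f \<in> PV GG" "a = cls M V (subst \<pi> f)" and g: "g \<in> PV GG" "b = cls M V (subst \<pi> g)" by (auto simp: S_def)
  show "a \<oplus>\<^bsub>A V\<^esub> b \<in> S" using SI[OF PV_add[OF f(1) g(1)]] f g by (simp add: np.ev_add free_add)
  show "a \<otimes>\<^bsub>A V\<^esub> b \<in> S" using SI[OF PP_mult[OF f(1) g(1)]] f g by (simp add: free_mult P)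
  fix c show "c \<odot>\<^bsub>A V\<^esub> a \<in> S" using SI[OF PV_sc[OF f(1)], of c] f by (simp add: np.ev_sc free_smult)
 qed
 hence "free_in M (A V\<lparr>carrier := S\<rparr>)" using NS by (simp add: nielsen_schreier_def)
 then obtain Y phi where Y: "Y <= S" and phi: "phi \<in> alg_hom (unital M) (A Y) (A V\<lparr>carrier := S\<rparr>)"
  and bij: "bij_betw phi (carrier (A Y)) S" and gen: "\<And>y. y \<in> Y ==> phi (gen M Y y) = y"
  unfolding free_in_def by auto
 have "\<forall>y\<in>Y. \<exists>f. f \<in> PV GG \<and> y = cls M V (subst \<pi> f)" using Y by (auto simp: S_def)
 then obtain s where s: "\<And>y. y \<in> Y ==> s y \<in> PV GG" "\<And>y. y \<in> Y ==> y = cls M V (subst \<pi> (s y))" by metis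
 have sP: "subst s h \<in> PV GG" if "h \<in> PV Y" for h using subst_PP[OF that s(1)] by simp
 have phih: "phi (cls M Y h) = cls M V (subst \<pi> (subst s h))" if "h \<in> PV Y" for h
  unfolding subst_subst by (rule alg_hom_cls[OF phi _ _ _ that]) (use gen s P in \<open>auto simp: S_def\<close>)
 have "\<exists>h\<in>PV Y. phi (cls M Y h) = cls M V (\<pi> g)" if g: "g \<in> GG" for g
 proof -
  have "cls M V (\<pi> g) \<in> S" using SI[of "np_var g"] g by simp
  then obtain x where "x \<in> carrier (A Y)" "phi x = cls M V (\<pi> g)" using bij unfolding bij_betw_def by blast
  thus ?thesis by (auto simp: free_carrier)
 qed
 then obtain h where h: "\<And>g. g \<in> GG ==> h g \<in> PV Y" "\<And>g. g \<in> GG ==> phi (cls M Y (h g)) = cls M V (\<pi> g)" by metis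
 show thesis
 proof (rule that[of "%g. subst s (h g)"])
  fix g assume g: "g \<in> GG"
  show "subst s (h g) \<in> PV GG" by (rule sP[OF h(1)[OF g]])
  show "subst \<pi> (subst s (h g)) - \<pi> g \<in> T V" using h(2)[OF g] phih[OF h(1)[OF g]] by (simp add: cls_eq[symmetric])
 next
  fix f assume f: "f \<in> PV GG" "subst \<pi> f \<in> T V"
  have hf: "subst h f \<in> PV Y" using subst_PP[OF f(1) h(1)] by simp
  have "subst \<pi> (subst s (subst h f)) - subst \<pi> f \<in> T V"
   unfolding subst_subst
   by (rule subst_tuple_cong[OF _ _ _ f(1)])
    (use h phih \<pi> sP P in \<open>auto simp: cls_eq[symmetric] subst_subst[symmetric]\<close>)
  hence "subst \<pi> (subst s (subst h f)) \<in> T V" using T_add[OF _ f(2)] by fastforce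
  hence "phi (cls M Y (subst h f)) = phi (cls M Y 0)" using phih[OF hf] phih[OF PV_0] by (simp add: cls_eq np.ev_0)
  hence "cls M Y (subst h f) = cls M Y 0"
   using bij hf PV_0 unfolding bij_betw_def by (meson cls_in inj_onD)
  hence "subst h f \<in> T Y" by (simp add: cls_eq)
  hence "subst s (subst h f) \<in> T GG" by (rule T_subst) (rule s)
  thus "subst (%g. subst s (h g)) f \<in> T GG" by (simp add: subst_subst)
 qed
qed

text \<open>Composing with a section of the projection onto the subalgebra generated by the \<open>\<pi> g\<close> gives
 an endomorphism that kills the kernel of \<open>\<pi>\<close> and is the identity up to higher degrees.\<close>

lemma NS_inj:
 fixes \<pi> :: "'g => 'k np2"
 assumes NS: "nielsen_schreier TYPE('v::infinite) M" and \<pi>: "\<And>g. g \<in> GG ==> \<pi> g \<in> PV V"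
  and lin: "\<And>f j. f \<in> PV GG ==> subst \<pi> f \<in> T V ==> j < 2 ==> cmp d1 j f \<in> T GG"
  and f: "f \<in> PV GG" "subst \<pi> f \<in> T V"
 shows "f \<in> T GG"
proof -
 \<comment> \<open>The hypothesis concerns free generators of type \<open>'v\<close> only, so the
   countably many variables are embedded there.\<close>
 obtain i0 :: "nat => 'v" where i0: "inj i0"
  using infinite_countable_subset[OF infinite_UNIV[where 'a = 'v]] by blast
 have "inj (case_sum (%i. 2 * i) (%i. 2 * i + 1 :: nat))"
  by (rule injI) (auto split: sum.splits, presburger+)
 hence io: "inj (i0 \<circ> case_sum (%i. 2 * i) (%i. 2 * i + 1))" (is "inj ?io") using i0 by (simp add: inj_compose)
 define e' where "e' = ?io"
 have inv: "inv_into UNIV e' (e' v) = v" for v using io unfolding e'_def by (rule inv_f_f)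
 let ?R = "subst (%v. np_var (e' v)) :: 'k np2 => ('v, 'k) npoly"
 let ?R' = "subst (%v. np_var (inv_into UNIV e' v)) :: ('v, 'k) npoly => 'k np2"
 have RR: "?R' (?R p) = p" for p by (simp add: subst_subst inv)
 have RT: "?R p \<in> T (e' ` V) \<longleftrightarrow> p \<in> T V" for p
 proof
  assume "?R p \<in> T (e' ` V)"
  hence "?R' (?R p) \<in> T V" by (rule T_subst) (auto simp: inv)
  thus "p \<in> T V" by (simp only: RR)
 qed (erule T_subst, simp)
 have eq: "subst (%g. ?R (\<pi> g)) h = ?R (subst \<pi> h)" for h by (simp add: subst_subst)
 obtain ep where ep: "\<And>g. g \<in> GG ==> ep g \<in> PV GG" "\<And>g. g \<in> GG ==> subst \<pi> (ep g) - \<pi> g \<in> T V"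
  "\<And>f. f \<in> PV GG ==> subst \<pi> f \<in> T V ==> subst ep f \<in> T GG"
 proof (rule NS_section[OF NS, of GG "%g. ?R (\<pi> g)" "e' ` V"])
  show "?R (\<pi> g) \<in> PV (e' ` V)" if "g \<in> GG" for g by (rule subst_PP[OF \<pi>[OF that]]) simp
  fix ep assume a: "\<And>g. g \<in> GG ==> ep g \<in> PV GG" "\<And>g. g \<in> GG ==> subst (%g. ?R (\<pi> g)) (ep g) - ?R (\<pi> g) \<in> T (e' ` V)"
   "\<And>f. f \<in> PV GG ==> subst (%g. ?R (\<pi> g)) f \<in> T (e' ` V) ==> subst ep f \<in> T GG"
  show thesis
  proof (rule that[of ep])
   show "subst \<pi> (ep g) - \<pi> g \<in> T V" if "g \<in> GG" for g
    using a(2)[OF that] unfolding eq np.ev_diff[symmetric] RT .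
   show "subst ep f \<in> T GG" if "f \<in> PV GG" "subst \<pi> f \<in> T V" for f
    by (rule a(3)[OF that(1)]) (unfold eq RT, rule that(2))
  qed (rule a(1))
 qed
 have e1: "ep g - np_var g \<in> G GG (1 + 1)" if g: "g \<in> GG" for g
 proof -
  have P: "ep g - np_var g \<in> PV GG" using ep(1)[OF g] g by (intro PV_diff) auto
  have "subst \<pi> (ep g - np_var g) \<in> T V" using ep(2)[OF g] by (simp add: np.ev_diff)
  thus ?thesis using lin[OF P] P by (simp add: G_def)
 qed
 have "f \<in> G GG k" for k
 proof (induction k)
  case 0
  thus ?case by (rule PV_G0[OF f(1)])
 next
  case (Suc k)
  have "subst ep f - f \<in> G GG (k + 1)" by (rule subst_G[OF ep(1) e1 Suc])
  moreover have "subst ep f \<in> G GG (k + 1)" by (rule T_G[OF ep(3)[OF f]])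
  moreover have "f = subst ep f - (subst ep f - f)" by simp
  ultimately show ?case by (metis np.subspace_diff[OF subspace_G] Suc_eq_plus1)
 qed
 thus ?thesis by (rule G_all_T[OF f(1)])
qed

section \<open>The augmentation ideal of the enveloping algebra in Nielsen-Schreier
  varieties\<close>

definition OneP :: "nat => 'k np2 set" where
 "OneP n = {p \<in> One n. \<forall>m\<in>ks p. mdeg wx m \<ge> 1}"

text \<open>The square of the augmentation ideal.\<close>

definition D0 :: "nat => 'k np2 set" where
 "D0 n = np.span {sub q p | p q. p \<in> OneP n \<and> q \<in> OneP n}"

lemma subspace_OneP: "np.subspace (OneP n)"
 using np.subspace_inter[OF subspace_One subspace_keys[of "%m. mdeg wx m \<ge> 1"]]
 by (simp add: OneP_def Int_def)

lemma OneP_One: "p \<in> OneP n ==> p \<in> One n" by (simp add: OneP_def)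

lemma OneP_cmp0: "p \<in> OneP n ==> cmp wx 0 p = 0"
 unfolding cmp_def lext_def by (rule sum.neutral) (auto simp: OneP_def)

lemma OneP_mult:
 assumes q: "q \<in> One n" and t: "set_mag t <= Inl ` {..<n}"
 shows "q \<star> mon (Some t) \<in> OneP n" "mon (Some t) \<star> q \<in> OneP n"
proof -
 have tx: "mag_deg wx t \<ge> 1 \<and> mag_deg wy t = 0" if "set_mag t <= Inl ` {..<n}" for t
  using that by (induction t) auto
 let ?S = "{q. q \<star> mon (Some t) \<in> OneP n \<and> mon (Some t) \<star> q \<in> OneP n}"
 have "q \<in> ?S"
 proof (rule np_subspaceI)
  show "np.subspace ?S"
   by (rule np.subspaceI) (auto simp: mult_simps lin_0[OF lin_mult_left] lin_0[OF lin_mult_right]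
    intro: np.subspace_0[OF subspace_OneP] np.subspace_add[OF subspace_OneP] np.subspace_scale[OF subspace_OneP])
  fix m assume "m \<in> ks q"
  then obtain t' where "m = Some t'" "set_mag t' <= V1 n" "mag_deg wy t' = 1" using One_keys[OF q] by blast
  thus "mon m \<in> ?S" using tx[OF t] t by (auto simp: OneP_def One_mon V1_def)
 qed
 thus "q \<star> mon (Some t) \<in> OneP n" "mon (Some t) \<star> q \<in> OneP n" by auto
qed

text \<open>The elements \<open>z\<close>, being polynomials linear in y, generate a subalgebra
  together with the variables x_i. By \<open>NS_inj\<close> there is no relation between these
  generators. A sum of products of \<open>u z\<close> and \<open>z\<close> is an expression linear
  in the generators \<open>z\<close>, so if it vanishes, each \<open>u z\<close> does.\<close>

lemma NS_free:
 assumes NS: "nielsen_schreier TYPE('v::infinite) M" and F: "finite F" "F <= OneP n"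
  and ind: "\<And>c z. (\<Sum>z\<in>F. sc (c z) z) \<in> QN n (D0 n) ==> z \<in> F ==> c z = 0"
  and u: "\<And>z. z \<in> F ==> u z \<in> One n" and 0: "(\<Sum>z\<in>F. sub z (u z)) \<in> T (V1 n)" and z: "z \<in> F"
 shows "u z \<in> T (V1 n)"
proof -
 define GG :: "(nat + 'k np2) set" where "GG = Inl ` {..<n} \<union> Inr ` F"
 define \<pi> :: "nat + 'k np2 => 'k np2" where "\<pi> = case_sum xv id"
 define ga :: "'k np2 => nat + nat => (nat + 'k np2, 'k) npoly"
  where "ga z = case_sum (%i. np_var (Inl i)) (%_. np_var (Inr z))" for z
 have FO: "z \<in> One n" if "z \<in> F" for z using F that OneP_One by blast
 have \<pi>P: "\<pi> g \<in> PV (V1 n)" if "g \<in> GG" for g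
  using that One_PV[OF FO] by (auto simp: GG_def \<pi>_def V1_def)
 have s\<pi>: "subst \<pi> (subst (ga z) p) = sub z p" for z p
  unfolding subst_subst sub_def by (rule arg_cong[where f = "%ro. subst ro p"]) (auto simp: fun_eq_iff ga_def \<pi>_def split: sum.split)
 let ?f = "\<Sum>z\<in>F. subst (ga z) (u z)"
 have "?f \<in> T GG"
 proof (rule NS_inj[OF NS \<pi>P])
  show "?f \<in> PV GG"
   by (intro np.subspace_sum[OF subspace_PP] subst_PP[OF One_PV[OF u]]) (auto simp: V1_def ga_def GG_def)
  show "subst \<pi> ?f \<in> T (V1 n)" using 0 by (simp add: np.ev_sum s\<pi>)
 next
  \<comment> \<open>To exclude linear terms in a relation \<open>f\<close>, its image is
    differentiated in the direction y at y = 0: a generator \<open>z\<close> contributes itself, a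
    longer monomial an element of the square of the augmentation ideal.\<close>
  fix f and j :: nat assume f: "f \<in> PV GG" "subst \<pi> f \<in> T (V1 n)" and j: "j < 2"
  define xi :: "nat + 'k np2 => 'k np2" where "xi = case_sum xv (%_. 0)"
  define L where "L = der xi (case_sum (%_. 0) id)"
  let ?cz = "%h. \<Sum>z\<in>F. sc (lk h (Some (Gen (Inr z)))) z"
  have linc: "lin sc sc (%h. \<Sum>z\<in>F. sc (lk h (Some (Gen (Inr z)))) (w z))" for w :: "_ => ('w, 'k) npoly"
   by (rule linI) (simp_all add: lookup_add np.scale_left_distrib sum.distrib np.scale_sum_right del: map_single)
  have "der (case_sum xv (%_. 0)) (case_sum (%_. 0) (%_. yv)) (subst \<pi> f) \<in> T (V1 n)"
   by (rule T_der[OF f(2)]) (auto simp: V1_def PV_0 split: sum.split)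
  also have "der (case_sum xv (%_. 0)) (case_sum (%_. 0) (%_. yv)) (subst \<pi> f) = L f"
   unfolding der_subst L_def
  proof (rule der_cong[OF f(1)])
   fix v assume "v \<in> GG"
   show "subst (case_sum xv (%_. 0)) (\<pi> v) = xi v"
    using \<open>v \<in> GG\<close> lin_0[OF lin_sub_left[OF One_hom[OF FO]]] by (auto simp: GG_def \<pi>_def xi_def sub_def)
   show "der (case_sum xv (%_. 0)) (case_sum (%_. 0) (%_. yv)) (\<pi> v) = case_sum (%_. 0) id v"
    using \<open>v \<in> GG\<close> sub_der[OF One_hom[OF FO], of _ yv] sub_yv[OF One_PV[OF FO]] by (auto simp: GG_def \<pi>_def)
  qed
  finally have Lf: "L f \<in> T (V1 n)" .
  have xim: "subst xi (mon (Some t)) = 0 \<or> (\<exists>t'. subst xi (mon (Some t)) = mon (Some t') \<and> set_mag t' <= Inl ` {..<n})"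
   if "set_mag t <= GG" for t
   using that
  proof (induction t)
   case (Gen v)
   thus ?case by (auto simp: GG_def xi_def np_var_def)
  next
   case (Node a b)
   have e: "subst xi (mon (Some (Node a b))) = subst xi (mon (Some a)) \<star> subst xi (mon (Some b))" by simp
   show ?case
    unfolding e
   proof -
    consider "subst xi (mon (Some a)) = 0" | "subst xi (mon (Some b)) = 0"
     | a' b' where "subst xi (mon (Some a)) = mon (Some a')" "set_mag a' <= Inl ` {..<n}"
      "subst xi (mon (Some b)) = mon (Some b')" "set_mag b' <= Inl ` {..<n}"
     using Node.IH Node.prems by (metis Un_subset_iff mag.set(2))
    thus "subst xi (mon (Some a)) \<star> subst xi (mon (Some b)) = 0 \<or> (\<exists>t'. subst xi (mon (Some a)) \<star> subst xi (mon (Some b)) = mon (Some t') \<and> set_mag t' <= Inl ` {..<n})"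
    proof cases
     case 3
     thus ?thesis by (intro disjI2 exI[of _ "Node a' b'"]) (simp del: np.ev_mon)
    qed (simp_all add: lin_0[OF lin_mult_left] lin_0[OF lin_mult_right] del: np.ev_mon)
   qed
  qed
  have xifix: "sub q (subst xi h) = subst xi h" for q h
   unfolding sub_def subst_subst by (rule arg_cong[where f = "%ro. subst ro h"]) (auto simp: fun_eq_iff xi_def np.ev_0 split: sum.split)
  have xiO: "q \<star> subst xi (mon (Some t)) \<in> OneP n" "subst xi (mon (Some t)) \<star> q \<in> OneP n" if "q \<in> One n" "set_mag t <= GG" for q t
   using xim[OF that(2)] OneP_mult[OF that(1)] np.subspace_0[OF subspace_OneP]
   by (auto simp: lin_0[OF lin_mult_left] lin_0[OF lin_mult_right] simp del: np.ev_mon)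
  have sD: "np.subspace (D0 n)" unfolding D0_def by (rule np.subspace_span)
  have D0I: "sub q p \<in> D0 n" if "p \<in> OneP n" "q \<in> OneP n" for p q
   unfolding D0_def by (rule np.span_base) (use that in blast)
  have Lm: "L (mon (Some t)) \<in> OneP n \<and> L (mon (Some t)) - ?cz (mon (Some t)) \<in> D0 n" if "set_mag t <= GG" for t
   using that
  proof (induction t)
   case (Gen v)
   show ?case
   proof (cases v)
    case (Inl i)
    hence "L (mon (Some (Gen v))) = 0" "?cz (mon (Some (Gen v))) = 0"
     by (auto simp: L_def lookup_single intro!: sum.neutral)
    thus ?thesis using np.subspace_0[OF subspace_OneP] np.subspace_0[OF sD] by simp
   next
    case (Inr z)
    hence z: "z \<in> F" using Gen by (auto simp: GG_def)
    have "?cz (mon (Some (Gen v))) = (\<Sum>z'\<in>F. if z' = z then z else 0)"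
     by (intro sum.cong refl) (auto simp: Inr lookup_single when_def)
    hence "?cz (mon (Some (Gen v))) = z" using F z by simp
    moreover have "L (mon (Some (Gen v))) = z" by (simp add: L_def Inr)
    ultimately show ?thesis using F z np.subspace_0[OF sD] by auto
   qed
  next
   case (Node a b)
   hence ab: "set_mag a <= GG" "set_mag b <= GG" by auto
   let ?a = "mon (Some a) :: (nat + 'k np2, 'k) npoly" and ?b = "mon (Some b) :: (nat + 'k np2, 'k) npoly"
   have La: "L ?a \<in> OneP n" "L ?b \<in> OneP n" using Node ab by auto
   have c0: "?cz (mon (Some (Node a b))) = 0" by (auto simp: lookup_single intro!: sum.neutral)
   have "L (mon (Some (Node a b))) = L ?a \<star> subst xi ?b + subst xi ?a \<star> L ?b"
    using der_mult[of xi "case_sum (%_. 0) id" ?a ?b] by (simp add: L_def)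
   \<comment> \<open>Each summand is a product of two elements of the augmentation ideal: the
     multiplication by the image of one factor, which involves x only, and the derivative of the
     other factor.\<close>
   also have "\<dots> = sub (L ?a) (yv \<star> subst xi ?b) + sub (L ?b) (subst xi ?a \<star> yv)"
    using xifix[of "L ?a" ?b] xifix[of "L ?b" ?a] by (simp add: sub_def del: np.ev_mon)
   finally have e: "L (mon (Some (Node a b))) = sub (L ?a) (yv \<star> subst xi ?b) + sub (L ?b) (subst xi ?a \<star> yv)" .
   have e': "sub (L ?a) (yv \<star> subst xi ?b) = L ?a \<star> subst xi ?b" "sub (L ?b) (subst xi ?a \<star> yv) = subst xi ?a \<star> L ?b"
    using xifix[of "L ?a" ?b] xifix[of "L ?b" ?a] by (simp_all add: sub_def del: np.ev_mon)
   have "L (mon (Some (Node a b))) \<in> OneP n"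
    unfolding e e' by (intro np.subspace_add[OF subspace_OneP] xiO OneP_One La ab)
   moreover have "L (mon (Some (Node a b))) \<in> D0 n"
    unfolding e by (intro np.subspace_add[OF sD] D0I xiO yv_One La ab)
   ultimately show ?case unfolding c0 by simp
  qed
  have "f \<in> {h. L h - ?cz h \<in> D0 n}"
  proof (rule np_subspaceI)
   have l: "lin sc sc (%h. L h - ?cz h)"
    by (rule linI) (simp_all add: L_def der_add der_sc lookup_add np.scale_left_distrib sum.distrib np.scale_sum_right
     np.scale_right_diff_distrib del: map_single)
   show "np.subspace {h. L h - ?cz h \<in> D0 n}"
    by (rule np.subspaceI) (simp_all only: mem_Collect_eq lin_add[OF l] lin_scale[OF l] lin_0[OF l] np.subspace_0[OF sD] np.subspace_add[OF sD] np.subspace_scale[OF sD])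
   fix m assume "m \<in> ks f"
   hence "okm (unital M) GG m" using f(1) by (simp add: PP_def)
   thus "mon m \<in> {h. L h - ?cz h \<in> D0 n}"
    using Lm np.subspace_0[OF sD] by (cases m) (auto simp: L_def lookup_single)
  qed
  hence "- (L f - ?cz f) \<in> D0 n" using np.subspace_neg[OF sD] by blast
  moreover have "?cz f - - (L f - ?cz f) \<in> T (V1 n)" using Lf by simp
  ultimately have "?cz f \<in> QN n (D0 n)" unfolding QN_def by blast
  hence c0: "lk f (Some (Gen (Inr z))) = 0" if "z \<in> F" for z using ind[of "%z. lk f (Some (Gen (Inr z)))"] that by blast
  \<comment> \<open>Setting y = 0 takes care of the monomials in the x_i alone.\<close>
  define th :: "nat + nat => (nat + 'k np2, 'k) npoly" where "th = case_sum (%i. np_var (Inl i)) (%_. 0)"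
  define ro :: "nat + 'k np2 => (nat + 'k np2, 'k) npoly" where "ro = case_sum (%i. np_var (Inl i)) (%_. 0)"
  have "subst th (subst \<pi> f) \<in> T GG" by (rule T_subst[OF f(2)]) (auto simp: V1_def th_def GG_def PV_0)
  also have "subst th (subst \<pi> f) = subst ro f"
   unfolding subst_subst
  proof (rule np.ev_cong[OF f(1)])
   fix v assume v: "v \<in> GG"
   have "subst th z = 0" if "z \<in> F" for z
   proof -
    have "subst th (sub 0 z) = subst th z"
     unfolding sub_def subst_subst by (rule arg_cong[where f = "%ro. subst ro z"]) (auto simp: fun_eq_iff th_def np.ev_0 split: sum.split)
    thus ?thesis using lin_0[OF lin_sub_left[OF One_hom[OF FO[OF that]]]] by (simp add: np.ev_0)
   qed
   thus "subst th (\<pi> v) = ro v" using v by (auto simp: GG_def \<pi>_def ro_def th_def)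
  qed
  finally have f0: "subst ro f \<in> T GG" .
  let ?c = "%h. if j = 1 then (\<Sum>z\<in>F. sc (lk h (Some (Gen (Inr z)))) (np_var (Inr z))) else (0 :: (nat + 'k np2, 'k) npoly)"
  have rom: "subst ro (mon (Some t)) = 0 \<or> subst ro (mon (Some t)) = mon (Some t)" for t
  proof (induction t)
   case (Gen v)
   thus ?case by (cases v) (auto simp: ro_def np_var_def)
  next
   case (Node a b)
   have e: "subst ro (mon (Some (Node a b))) = subst ro (mon (Some a)) \<star> subst ro (mon (Some b))" by simp
   show ?case unfolding e using Node
    by (elim disjE; simp only: lin_0[OF lin_mult_left] lin_0[OF lin_mult_right]) (simp_all del: np.ev_mon)
  qed
  have "cmp d1 j f - cmp d1 j (subst ro f) = ?c f"
  proof (rule lin_eqI[of sc "%f. cmp d1 j f - cmp d1 j (subst ro f)"])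
   show "lin sc sc (%f. cmp d1 j f - cmp d1 j (subst ro f))"
    by (rule linI) (simp_all add: cmp_add cmp_sc np.ev_add np.ev_sc np.scale_right_diff_distrib)
   show "lin sc sc ?c" using linc[of "%z. np_var (Inr z)"] by (cases "j = 1") (simp_all add: lin_def)
   fix m assume "m \<in> ks f"
   hence m: "okm (unital M) GG m" using f(1) by (simp add: PP_def)
   show "cmp d1 j (mon m) - cmp d1 j (subst ro (mon m)) = ?c (mon m)"
   proof (cases m)
    case None
    thus ?thesis by (simp add: lookup_single)
   next
    case (Some t)
    show ?thesis
    proof (cases t)
     case (Gen v)
     show ?thesis
     proof (cases v)
      case (Inl i)
      thus ?thesis by (simp add: Some Gen ro_def np_var_def lookup_single)
     next
      case (Inr z)
      hence z: "z \<in> F" using m by (auto simp: Some Gen GG_def)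
      have "?c (mon m) = (if j = 1 then \<Sum>z'\<in>F. if z' = z then np_var (Inr z) else 0 else 0)"
       by (auto intro!: sum.cong simp: Some Gen Inr lookup_single when_def)
      also have "\<dots> = (if j = 1 then np_var (Inr z) else 0)" using z F by simp
      finally show ?thesis by (simp add: Some Gen Inr ro_def np_var_def cmp_mon d1_simp)
     qed
    next
     case (Node a b)
     have deg: "mag_deg d1 t \<ge> 1" for t :: "(nat + 'k np2) mag" by (induction t) (auto simp: d1_simp)
     have "mag_deg d1 t \<noteq> j" using deg[of a] deg[of b] j by (simp add: Node)
     hence "cmp d1 j (mon m) = 0" "cmp d1 j (subst ro (mon m)) = 0"
      using rom[of t] by (auto simp: Some cmp_mon simp del: np.ev_mon)
     thus ?thesis by (auto simp: Some Node lookup_single)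
    qed
   qed
  qed
  also have "?c f = 0" using c0 by simp
  finally show "cmp d1 j f \<in> T GG" using T_cmp[OF f0, of d1 j] by simp
 qed
 \<comment> \<open>Sending the generator \<open>z\<close> to y and the other elements of
   \<open>F\<close> to 0 isolates \<open>u z\<close>.\<close>
 define de :: "nat + 'k np2 => 'k np2" where "de = case_sum xv (%z'. if z' = z then yv else 0)"
 have "subst de ?f \<in> T (V1 n)"
  by (rule T_subst[OF \<open>?f \<in> T GG\<close>]) (auto simp: GG_def de_def V1_def PV_0)
 moreover have "subst de (subst (ga z') p) = sub (if z' = z then yv else 0) p" for z' p
  unfolding subst_subst sub_def by (rule arg_cong[where f = "%ro. subst ro p"]) (auto simp: fun_eq_iff ga_def de_def split: sum.split)
 moreover have "(\<Sum>z'\<in>F. sub (if z' = z then yv else 0) (u z')) = (\<Sum>z'\<in>F. if z' = z then u z else 0)"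
  using lin_0[OF lin_sub_left[OF One_hom[OF u]]] sub_yv[OF One_PV[OF u]] by (intro sum.cong refl) auto
 ultimately show ?thesis using F z by (simp add: np.ev_sum)
qed

end

lemma list_mult_expand: "(c :: 'a list \<Rightarrow>\<^sub>0 'k::field) * d = (\<Sum>v\<in>ks c. \<Sum>w\<in>ks d. Poly_Mapping.single (v @ w) (lk c v * lk d w))"
proof -
 have "c * d = (\<Sum>v\<in>ks c. Poly_Mapping.single v (lk c v)) * (\<Sum>w\<in>ks d. Poly_Mapping.single w (lk d w))"
  using pm_sum_single[of c] pm_sum_single[of d] by simp
 thus ?thesis by (simp add: sum_product mult_single plus_list_def)
qed

text \<open>The product of the letters in \<open>U\<close>, where the product of \<open>p\<close>
  and \<open>q\<close> is \<open>sub q p\<close>.\<close>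

primrec zr :: "'k::field np2 list => 'k np2" where
 "zr [] = yv"
| "zr (z # w) = sub (zr w) z"

lemma zr_append: "zr (v @ w) = sub (zr w) (zr v)"
proof (induction v)
 case (Cons z v)
 thus ?case by (simp only: append_Cons zr.simps sub_sub)
qed (simp add: sub_def)

lemma (in vector_space) lin_lext_list: "lin lsc scale (lext scale h)"
 by (rule linI) (simp_all add: lext_add lext_map)

section \<open>Words in free generators as a basis of the enveloping algebra\<close>

context nsvar
begin

lemma zr_One: "set v <= One n ==> zr v \<in> One n"
 by (induction v) (simp_all add: yv_One sub_One)

context
 fixes n :: nat and Z :: "'k np2 set"
 assumes y: "yv \<notin> T (V1 n)" and ZP: "Z <= OneP n"
  and free: "\<And>F u z. finite F ==> F <= Z ==> (\<And>z. z \<in> F ==> u z \<in> One n) ==>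
   (\<Sum>z\<in>F. sub z (u z)) \<in> T (V1 n) ==> z \<in> F ==> u z \<in> T (V1 n)"
  and span: "\<And>p. p \<in> One n ==> \<exists>c. (\<forall>v\<in>ks c. set v <= Z) \<and> p - lext sc zr c \<in> T (V1 n)"
begin

lemma ZO: "set v <= Z ==> zr v \<in> One n"
 using ZP OneP_One by (intro zr_One) blast

text \<open>Grouping words by their last letter leaves a multiple of y and a sum of products of
  \<open>u z\<close> and \<open>z\<close>. The part of degree 0 in x shows that the multiple
  vanishes, since y is not an identity. The premise \<open>free\<close> then gives that each
  \<open>u z\<close> is an identity, and \<open>u z\<close> involves shorter words.\<close>

lemma zr_independent:
 "finite S ==> (\<forall>v\<in>S. set v <= Z \<and> length v < N) ==> (\<Sum>v\<in>S. sc (c v) (zr v)) \<in> T (V1 n) ==> v \<in> S ==> c v = 0"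
proof (induction N arbitrary: S c v)
 case (Suc N)
 define S1 where "S1 = S - {[]}"
 define F where "F = last ` S1"
 define W where "W z = {w. w @ [z] \<in> S1}" for z
 define u where "u z = (\<Sum>w\<in>W z. sc (c (w @ [z])) (zr w))" for z
 have fin: "finite S1" "finite F" using Suc.prems by (auto simp: S1_def F_def)
 have FZ: "F <= Z" using Suc.prems(2) by (auto simp: F_def S1_def) (meson last_in_set subsetD)
 have Wf: "finite (W z)" for z
 proof -
  have "W z <= butlast ` S1" unfolding W_def by (metis (no_types, lifting) butlast_snoc image_eqI mem_Collect_eq subsetI)
  thus ?thesis using fin finite_subset by blast
 qed
 have W: "set w <= Z \<and> length w < N" if "w \<in> W z" for w z
 proof -
  have "set (w @ [z]) <= Z \<and> length (w @ [z]) < Suc N" using that Suc.prems(2) unfolding W_def S1_def by blast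
  thus ?thesis by simp
 qed
 have uO: "u z \<in> One n" for z unfolding u_def by (intro One_sum One_sc ZO) (use W in blast)
 have "(\<Sum>v\<in>S1. sc (c v) (zr v)) = (\<Sum>z\<in>F. \<Sum>v\<in>{v \<in> S1. last v = z}. sc (c v) (zr v))"
  unfolding F_def by (rule sum.image_gen[OF fin(1)])
 also have "\<dots> = (\<Sum>z\<in>F. sub z (u z))"
 proof (rule sum.cong[OF refl])
  fix z assume z: "z \<in> F"
  have "{v \<in> S1. last v = z} = (%w. w @ [z]) ` W z"
   by (auto simp: W_def S1_def image_iff) (metis append_butlast_last_id)
  hence "(\<Sum>v\<in>{v \<in> S1. last v = z}. sc (c v) (zr v)) = (\<Sum>w\<in>W z. sc (c (w @ [z])) (zr (w @ [z])))"
   by (simp add: sum.reindex inj_on_def)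
  also have "\<dots> = (\<Sum>w\<in>W z. sub z (sc (c (w @ [z])) (zr w)))"
  proof -
   have "z \<in> PV (V1 n)" using z FZ ZP OneP_One One_PV by blast
   thus ?thesis by (intro sum.cong refl) (simp add: zr_append sub_sc sub_yv)
  qed
  finally show "(\<Sum>v\<in>{v \<in> S1. last v = z}. sc (c v) (zr v)) = sub z (u z)" by (simp add: u_def sub_sum)
 qed
 finally have s1: "(\<Sum>v\<in>S1. sc (c v) (zr v)) = (\<Sum>z\<in>F. sub z (u z))" .
 let ?c = "if [] \<in> S then c [] else 0"
 have s: "(\<Sum>v\<in>S. sc (c v) (zr v)) = sc ?c yv + (\<Sum>z\<in>F. sub z (u z))"
  using Suc.prems(1) unfolding s1[symmetric] S1_def by (auto simp: sum.remove simp del: map_single)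
 have zP: "z \<in> OneP n" if "z \<in> F" for z using that FZ ZP by blast
 have "cmp wx 0 (sc ?c yv + (\<Sum>z\<in>F. sub z (u z))) = sc ?c yv + (\<Sum>z\<in>F. cmp wx 0 (sub z (u z)))"
  by (simp add: cmp_add cmp_sc cmp_sum cmp_hom del: map_single)
 also have "(\<Sum>z\<in>F. cmp wx 0 (sub z (u z))) = 0"
  using cmp_sub[OF uO OneP_One[OF zP], of _ 0] OneP_cmp0[OF zP] lin_0[OF lin_sub_left[OF One_hom[OF One_cmp[OF uO]]]]
  by (intro sum.neutral) simp
 finally have cy: "sc ?c yv \<in> T (V1 n)" using T_cmp[OF Suc.prems(3), of wx 0] unfolding s by (simp del: map_single)
 have c0: "?c = 0"
 proof (rule ccontr)
  assume "?c \<noteq> 0"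
  thus False using T_sc[OF cy, of "inverse ?c"] y by (simp del: map_single)
 qed
 hence "(\<Sum>z\<in>F. sub z (u z)) \<in> T (V1 n)" using Suc.prems(3) unfolding s by (simp del: map_single)
 hence uT: "u z \<in> T (V1 n)" if "z \<in> F" for z using free[OF fin(2) FZ, of u z] uO that by blast
 show ?case
 proof (cases v rule: rev_cases)
  case Nil
  thus ?thesis using c0 Suc.prems(4) by simp
 next
  case (snoc w z)
  hence "v \<in> S1" using Suc.prems(4) by (simp add: S1_def)
  hence "z \<in> F" "w \<in> W z" by (auto simp: F_def W_def snoc image_iff intro: bexI[of _ v])
  thus ?thesis using Suc.IH[OF Wf, of z "%w. c (w @ [z])" w] W uT[of z] by (auto simp: u_def snoc)
 qed
qed simp

abbreviation "Rz \<equiv> lext sc zr"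

lemmas Rz_lin = np.lin_lext_list[of zr]

text \<open>Coordinates with respect to words. They turn the product of \<open>U\<close> into that
  of the free associative algebra (\<open>co_sub\<close>), from which the cycle representations are
  pulled back.\<close>

definition co :: "'k np2 => 'k np2 list \<Rightarrow>\<^sub>0 'k" where
 "co p = (SOME c. (\<forall>v\<in>ks c. set v <= Z) \<and> p - Rz c \<in> T (V1 n))"

lemma co: "p \<in> One n ==> v \<in> ks (co p) ==> set v <= Z" "p \<in> One n ==> p - Rz (co p) \<in> T (V1 n)"
 using someI_ex[OF span[of p]] unfolding co_def by blast+

lemma co_unique:
 assumes p: "p \<in> One n" and c: "\<And>v. v \<in> ks c ==> set v <= Z" "p - Rz c \<in> T (V1 n)" shows "co p = c"
proof -
 let ?d = "co p - c"
 have "Rz ?d \<in> T (V1 n)"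
  using T_diff[OF c(2) co(2)[OF p]] by (simp add: lin_diff[OF Rz_lin])
 hence d: "(\<Sum>v\<in>ks ?d. sc (lk ?d v) (zr v)) \<in> T (V1 n)" by (simp only: lext_def)
 have k: "\<forall>v\<in>ks ?d. set v <= Z \<and> length v < Suc (Max (length ` ks ?d))"
 proof
  fix v assume v: "v \<in> ks ?d"
  hence "v \<in> ks (co p) \<or> v \<in> ks c" by (metis diff_self in_keys_iff lookup_minus)
  thus "set v <= Z \<and> length v < Suc (Max (length ` ks ?d))" using co(1)[OF p] c(1) v by (auto simp: less_Suc_eq_le)
 qed
 have "lk ?d v = 0" for v using zr_independent[OF finite_keys k d, of v] by (metis in_keys_iff)
 thus ?thesis by (intro poly_mapping_eqI) (simp add: lookup_minus)
qed

lemma co_add: "p \<in> One n ==> q \<in> One n ==> co (p + q) = co p + co q"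
proof (rule co_unique)
 assume pq: "p \<in> One n" "q \<in> One n"
 show "p + q \<in> One n" by (rule One_add[OF pq])
 show "set v <= Z" if "v \<in> ks (co p + co q)" for v using that keys_add[of "co p" "co q"] co(1) pq by blast
 show "p + q - Rz (co p + co q) \<in> T (V1 n)"
  using T_add[OF co(2)[OF pq(1)] co(2)[OF pq(2)]] by (simp add: lin_add[OF Rz_lin] algebra_simps)
qed

lemma co_sc: "p \<in> One n ==> co (sc k p) = lsc k (co p)"
proof (rule co_unique)
 assume p: "p \<in> One n"
 show "sc k p \<in> One n" by (rule One_sc[OF p])
 show "set v <= Z" if "v \<in> ks (lsc k (co p))" for v using that co(1)[OF p, of v] by (auto simp: in_keys_iff lookup_map_mult)
 show "sc k p - Rz (lsc k (co p)) \<in> T (V1 n)"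
  using T_sc[OF co(2)[OF p], of k] by (simp add: lin_scale[OF Rz_lin] np.scale_right_diff_distrib)
qed

lemma co_T: "p \<in> One n ==> p \<in> T (V1 n) ==> co p = 0"
 by (rule co_unique) (simp_all add: lin_0[OF Rz_lin])

lemma co_zr: "set v <= Z ==> co (zr v) = Poly_Mapping.single v 1"
 by (rule co_unique) (auto simp: ZO T_0 del: subsetI split: if_splits)

lemma co_sub: "p \<in> One n ==> q \<in> One n ==> co (sub q p) = co p * co q"
proof (rule co_unique)
 assume p: "p \<in> One n" and q: "q \<in> One n"
 note lp = lin_sub_left[OF One_hom]
 show "sub q p \<in> One n" by (rule sub_One[OF p q])
 show "set v <= Z" if "v \<in> ks (co p * co q)" for v
  using that keys_mult[of "co p" "co q"] co(1)[OF p] co(1)[OF q] by (fastforce simp: plus_list_def)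
 have RO: "Rz (co p) \<in> One n" "Rz (co q) \<in> One n" if "p \<in> One n" "q \<in> One n" for p q
  unfolding lext_def using co(1) that by (auto intro!: One_sum One_sc ZO)
 have e: "Rz (co p * co q) = sub (Rz (co q)) (Rz (co p))"
 proof -
  have "sub (Rz (co q)) (Rz (co p)) = (\<Sum>v\<in>ks (co p). sc (lk (co p) v) (sub (Rz (co q)) (zr v)))"
   by (simp add: lext_def[of sc zr "co p"] sub_sum sub_sc)
  also have "\<dots> = (\<Sum>v\<in>ks (co p). sc (lk (co p) v) (\<Sum>w\<in>ks (co q). sc (lk (co q) w) (zr (v @ w))))"
  proof (intro sum.cong refl arg_cong[where f = "sc _"])
   fix v assume "v \<in> ks (co p)"
   hence l: "lin sc sc (%q. sub q (zr v))" using co(1)[OF p] ZO by (intro lp) blast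
   show "sub (Rz (co q)) (zr v) = (\<Sum>w\<in>ks (co q). sc (lk (co q) w) (zr (v @ w)))"
    unfolding lext_def[of sc zr "co q"] by (simp only: lin_sum[OF l] lin_scale[OF l] zr_append)
  qed
  also have "\<dots> = Rz (co p * co q)"
   unfolding list_mult_expand by (simp add: lin_sum[OF Rz_lin] np.scale_sum_right)
  finally show ?thesis by simp
 qed
 have "sub q p - sub q (Rz (co p)) \<in> T (V1 n)"
  unfolding sub_diff[symmetric] by (rule T_sub[OF co(2)[OF p] One_PV[OF q]]) (auto simp: V1_def)
 moreover have "sub q (Rz (co p)) - sub (Rz (co q)) (Rz (co p)) \<in> T (V1 n)"
  unfolding lin_diff[OF lp[OF RO(1)[OF p q]], symmetric] by (rule T_sub_right[OF RO(1)[OF p q] co(2)[OF q]]) (auto simp: V1_def)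
 ultimately show "sub q p - Rz (co p * co q) \<in> T (V1 n)" unfolding e by (rule T_trans)
qed

text \<open>The empty second cycle has a single position and brings the index set into the shape
  expected by \<open>alltr\<close> and \<open>word_system\<close>.\<close>

lemma zr_rep:
 fixes s :: 'k
 shows "rep n ({..<clen V} \<times> {..<clen ([] :: nat list)}) (%p x z. lext (*) (%v. cyc V s v (fst x) (fst z)) (co p))"
proof -
 note ll = kf.lin_lext_list
 let ?h = "%a b v. cyc V s v a b"
 have m: "lext (*) (?h a b) (c * d) = (\<Sum>r<clen V. lext (*) (?h a r) c * lext (*) (?h r b) d)" if a: "a < clen V" for a b c d
 proof -
  have "lext (*) (?h a b) (c * d) = (\<Sum>v\<in>ks c. \<Sum>w\<in>ks d. lk c v * lk d w * (\<Sum>r<clen V. cyc V s v a r * cyc V s w r b))"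
   unfolding list_mult_expand by (simp add: lin_sum[OF ll] cyc_append[OF a])
  also have "\<dots> = (\<Sum>v\<in>ks c. \<Sum>w\<in>ks d. \<Sum>r<clen V. (lk c v * cyc V s v a r) * (lk d w * cyc V s w r b))"
   unfolding sum_distrib_left by (intro sum.cong refl) (simp add: mult_ac)
  also have "\<dots> = (\<Sum>v\<in>ks c. \<Sum>r<clen V. \<Sum>w\<in>ks d. (lk c v * cyc V s v a r) * (lk d w * cyc V s w r b))"
   by (intro sum.cong refl sum.swap)
  also have "\<dots> = (\<Sum>r<clen V. \<Sum>v\<in>ks c. \<Sum>w\<in>ks d. (lk c v * cyc V s v a r) * (lk d w * cyc V s w r b))"
   by (rule sum.swap)
  also have "\<dots> = (\<Sum>r<clen V. lext (*) (?h a r) c * lext (*) (?h r b) d)"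
   unfolding lext_def sum_product ..
  finally show ?thesis .
 qed
 have sc0: "(\<Sum>c\<in>{..<clen V} \<times> {..<clen ([] :: nat list)}. f (fst c)) = (\<Sum>r<clen V. f r)" for f :: "nat => 'k"
 proof -
  have "(\<Sum>c\<in>{..<clen V} \<times> {..<clen ([] :: nat list)}. f (fst c)) = (\<Sum>r<clen V. \<Sum>j<clen ([] :: nat list). f r)"
   unfolding sum.cartesian_product by (simp add: case_prod_beta)
  thus ?thesis by simp
 qed
 show ?thesis
  unfolding rep_def
 proof (intro conjI ballI allI)
  fix p q a b assume pq: "p \<in> One n" "q \<in> One n" and a: "a \<in> {..<clen V} \<times> {..<clen ([] :: nat list)}"
  show "lext (*) (?h (fst a) (fst b)) (co (p + q)) = lext (*) (?h (fst a) (fst b)) (co p) + lext (*) (?h (fst a) (fst b)) (co q)"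
   by (simp add: co_add pq lin_add[OF ll])
  show "lext (*) (?h (fst a) (fst b)) (co (sub q p)) = (\<Sum>c\<in>{..<clen V} \<times> {..<clen ([] :: nat list)}.
    lext (*) (?h (fst a) (fst c)) (co p) * lext (*) (?h (fst c) (fst b)) (co q))"
   unfolding co_sub[OF pq] sc0[of "%c. lext (*) (?h (fst a) c) (co p) * lext (*) (?h c (fst b)) (co q)"]
   by (rule m) (use a in auto)
 next
  fix p k a b assume "p \<in> One n"
  thus "lext (*) (?h (fst a) (fst b)) (co (sc k p)) = k * lext (*) (?h (fst a) (fst b)) (co p)"
   by (simp add: co_sc lin_scale[OF ll])
 next
  fix a b assume "a \<in> {..<clen V} \<times> {..<clen ([] :: nat list)}" "b \<in> {..<clen V} \<times> {..<clen ([] :: nat list)}"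
  thus "lext (*) (?h (fst a) (fst b)) (co yv) = (if a = b then 1 else 0)"
   using co_zr[of "[]"] by (auto simp: cyc_Nil split: if_splits)
 qed (auto simp: co_T lin_0[OF ll])
qed

lemma free_CR:
 assumes p: "p \<in> One n" and tr: "alltr n p" shows "CR n p"
proof (rule word_system[where E = "%v (w :: nat list). zr v" and LA = "{v. set v <= Z}" and LB = "{[]}", OF _ _ _ _ _ _ p tr])
 show "zr v \<in> One n" if "v \<in> {v. set v <= Z}" for v using ZO that by simp
next
 fix p assume p: "p \<in> One n"
 have "p - (\<Sum>x\<in>(%v. (v, [])) ` ks (co p). sc (lk (co p) (fst x)) (zr (fst x))) \<in> T (V1 n)"
  using co(2)[OF p] by (simp add: lext_def sum.reindex inj_on_def)
 thus "\<exists>S c. finite S \<and> S <= {v. set v <= Z} \<times> {[]} \<and> p - (\<Sum>x\<in>S. sc (c x) (zr (fst x))) \<in> T (V1 n)"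
  using co(1)[OF p] by (intro exI[of _ "(%v. (v, [])) ` ks (co p)"] exI[of _ "%x. lk (co p) (fst x)"]) auto
next
 fix V and W :: "nat list" and s s' :: 'k assume "V \<in> {v. set v <= Z}" "W \<in> {[]}"
 hence W: "W = []" by simp
 show "\<exists>ro. rep n ({..<clen V} \<times> {..<clen W}) ro \<and> (\<forall>v\<in>{v. set v <= Z}. \<forall>w\<in>{[]}. \<forall>a<clen V. \<forall>b<clen V. \<forall>a'<clen W. \<forall>b'<clen W.
   ro (zr v) (a, a') (b, b') = cyc V s v a b * cyc W s' w a' b')"
  unfolding W by (intro exI[of _ "%p x z. lext (*) (%v. cyc V s v (fst x) (fst z)) (co p)"] conjI zr_rep)
   (auto simp: co_zr cyc_Nil)
next
 show "sub (zr v') (zr v) - zr (v @ v') \<in> T (V1 n)" for v v' by (simp add: zr_append T_0)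
qed auto

end

lemma OneP_hom: "p \<in> One n ==> hom_deg wx k p ==> k \<ge> 1 ==> p \<in> OneP n"
 by (auto simp: OneP_def hom_deg_def)

text \<open>\<open>Z\<close> is a homogeneous basis of a complement of the square of the
  augmentation ideal. Independence comes from \<open>NS_free\<close>. Generation is an induction on
  the degree: a homogeneous element is a combination of elements of \<open>Z\<close> and of products
  of elements of lower degree. If y itself is an identity, \<open>U\<close> is zero.\<close>

lemma NS_CR:
 assumes NS: "nielsen_schreier TYPE('v::infinite) M" and p: "p \<in> One n" and tr: "alltr n p"
 shows "CR n p"
proof (cases "yv \<in> T (V1 n)")
 case True
 have "sub yv p \<in> T (V1 n)" by (rule T_sub_right[OF p True]) (auto simp: V1_def)
 hence "p - 0 \<in> T (V1 n)" using sub_yv[OF One_PV[OF p]] by simp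
 thus ?thesis by (rule CR_Cm[rotated]) (simp add: Cm_def np.span_zero)
next
 case y: False
 have sD0: "np.subspace (D0 n)" unfolding D0_def by (rule np.subspace_span)
 let ?D = "QN n (D0 n)"
 note sD = subspace_QN[OF sD0, of n]
 define Hm where "Hm = {p \<in> One n. \<exists>k\<ge>1. hom_deg wx k p}"
 \<comment> \<open>A basis of the square, taken together with the identities, is then extended by
   homogeneous elements only, so that the elements of \<open>Z\<close> have degrees.\<close>
 obtain B0 where B0: "B0 <= ?D" "np.independent B0" "?D <= np.span B0" by (rule np.maximal_independent_subset)
 have "B0 <= ?D \<union> Hm" using B0 by blast
 from np.maximal_independent_subset_extend[OF this B0(2)]
 obtain B where B: "B0 <= B" "B <= ?D \<union> Hm" "np.independent B" "?D \<union> Hm <= np.span B" .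
 define Z where "Z = B - B0"
 have sB0: "np.span B0 <= np.span (B - {z})" if "z \<in> Z" for z
  by (rule np.span_mono) (use that B in \<open>auto simp: Z_def\<close>)
 have nsp: "z \<notin> np.span (B - {z})" if "z \<in> B" for z using B(3) that unfolding np.dependent_def by blast
 have ZH: "Z <= Hm"
 proof
  fix z assume z: "z \<in> Z"
  hence "z \<notin> ?D" using sB0[OF z] nsp[of z] B0(3) by (auto simp: Z_def)
  thus "z \<in> Hm" using z B(2) by (auto simp: Z_def)
 qed
 hence ZP: "Z <= OneP n" using OneP_hom unfolding Hm_def by blast
 have Zind: "c z = 0" if F: "finite F" "F <= Z" and s: "(\<Sum>z\<in>F. sc (c z) z) \<in> ?D" and z: "z \<in> F" for F c z
 proof (rule ccontr)
  assume c: "c z \<noteq> 0"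
  have zZ: "z \<in> Z" using F z by blast
  have 1: "(\<Sum>z\<in>F. sc (c z) z) \<in> np.span (B - {z})" using s B0(3) sB0[OF zZ] by blast
  have 2: "(\<Sum>z\<in>F - {z}. sc (c z) z) \<in> np.span (B - {z})"
   by (intro np.span_sum np.span_scale np.span_base) (use F in \<open>auto simp: Z_def\<close>)
  have 3: "(\<Sum>z\<in>F. sc (c z) z) = sc (c z) z + (\<Sum>z\<in>F - {z}. sc (c z) z)" by (rule sum.remove[OF F(1) z])
  have "sc (c z) z + (\<Sum>z\<in>F - {z}. sc (c z) z) - (\<Sum>z\<in>F - {z}. sc (c z) z) \<in> np.span (B - {z})"
   using np.span_diff[OF 1 2] unfolding 3 .
  hence "sc (c z) z \<in> np.span (B - {z})" by (simp only: add_diff_cancel_right')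
  hence "sc (inverse (c z)) (sc (c z) z) \<in> np.span (B - {z})" by (rule np.span_scale)
  thus False using c nsp[of z] zZ by (auto simp: Z_def)
 qed
 define Sp where "Sp = np.span (zr ` {v. set v <= Z})"
 note sS = np.subspace_span[of "zr ` {v. set v <= Z}", folded Sp_def]
 let ?E = "QN n Sp"
 note sE = subspace_QN[OF sS, of n]
 have TE: "f \<in> ?E" if "f \<in> T (V1 n)" for f
  using that np.subspace_0[OF sS] by (auto simp: QN_def intro!: bexI[of _ 0])
 have zE: "zr v \<in> ?E" if "set v <= Z" for v
  unfolding QN_def Sp_def using that by (auto intro!: bexI[of _ "zr v"] np.span_base simp: T_0)
 have zO: "zr v \<in> One n" if "set v <= Z" for v using that ZP OneP_One by (intro zr_One) blast
 have SpO: "Sp <= One n" unfolding Sp_def by (rule np.span_minimal[OF _ subspace_One]) (use zO in auto)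
 have Ssub: "sub b a \<in> Sp" if a: "a \<in> Sp" and b: "b \<in> Sp" for a b
 proof -
  have 1: "sub b (zr v) \<in> Sp" if v: "set v <= Z" for v
  proof -
   note l = lin_sub_left[OF One_hom[OF zO[OF v]]]
   have "np.subspace {b. sub b (zr v) \<in> Sp}"
    by (rule np.subspaceI) (auto simp: lin_add[OF l] lin_scale[OF l] lin_0[OF l] intro: np.subspace_0[OF sS] np.subspace_add[OF sS] np.subspace_scale[OF sS])
   moreover have "zr ` {v. set v <= Z} <= {b. sub b (zr v) \<in> Sp}"
    using v by (auto simp: zr_append[symmetric] Sp_def intro!: np.span_base)
   ultimately have "Sp <= {b. sub b (zr v) \<in> Sp}" unfolding Sp_def by (intro np.span_minimal)
   thus ?thesis using b by blast
  qed
  have "np.subspace {a. sub b a \<in> Sp}"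
   by (rule np.subspaceI) (auto simp: sub_add sub_sc intro: np.subspace_0[OF sS] np.subspace_add[OF sS] np.subspace_scale[OF sS])
  hence "Sp <= {a. sub b a \<in> Sp}" unfolding Sp_def using 1 by (intro np.span_minimal) (auto simp: Sp_def)
  thus ?thesis using a by blast
 qed
 have Esub: "sub q p \<in> ?E" if p: "p \<in> ?E" "p \<in> One n" and q: "q \<in> ?E" "q \<in> One n" for p q
 proof -
  obtain a b where a: "a \<in> Sp" "p - a \<in> T (V1 n)" and b: "b \<in> Sp" "q - b \<in> T (V1 n)" using p q unfolding QN_def by blast
  have aO: "a \<in> One n" using a SpO by blast
  have "sub q p - sub q a \<in> T (V1 n)"
   unfolding sub_diff[symmetric] by (rule T_sub[OF a(2) One_PV[OF q(2)]]) (auto simp: V1_def)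
  moreover have "sub q a - sub b a \<in> T (V1 n)"
   unfolding lin_diff[OF lin_sub_left[OF One_hom[OF aO]], symmetric] by (rule T_sub_right[OF aO b(2)]) (auto simp: V1_def)
  ultimately have "sub q p - sub b a \<in> T (V1 n)" by (rule T_trans)
  thus ?thesis using Ssub[OF a(1) b(1)] unfolding QN_def by blast
 qed
 have hE: "p \<in> ?E" if "p \<in> One n" "hom_deg wx k p" for p k
  using that
 proof (induction k arbitrary: p rule: less_induct)
  case (less k)
  show ?case
  proof (cases "k = 0")
   case True
   show ?thesis
   proof (rule np_subspaceI[OF sE])
    fix m assume m: "m \<in> ks p"
    then obtain t where t: "m = Some t" "set_mag t <= V1 n" "mag_deg wy t = 1" using One_keys[OF less.prems(1)] by blast
    have d: "mag_deg wx s + mag_deg wy s \<ge> 1" for s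
    proof (induction s)
     case (Gen v)
     thus ?case by (cases v) auto
    qed auto
    have t0: "mag_deg wx t = 0" using less.prems(2) m True by (auto simp: hom_deg_def t(1))
    have "t = Gen (Inr 0)"
    proof (cases t)
     case (Gen v)
     thus ?thesis using t t0 by (cases v) (auto simp: V1_def)
    next
     case (Node a b)
     thus ?thesis using t t0 d[of a] d[of b] by auto
    qed
    thus "mon m \<in> ?E" using zE[of "[]"] by (simp add: t(1) np_var_def)
   qed
  next
   case False
   hence "p \<in> Hm" using less.prems by (auto simp: Hm_def Suc_le_eq)
   hence "p \<in> np.span (B0 \<union> Z)" using B by (auto simp: Z_def Un_absorb1)
   then obtain d e where de: "p = d + e" "d \<in> np.span B0" "e \<in> np.span Z" unfolding np.span_Un by blast
   have "d \<in> ?D" using de(2) np.span_minimal[OF B0(1) sD] by blast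
   then obtain d' where d': "d' \<in> D0 n" "d - d' \<in> T (V1 n)" unfolding QN_def by blast
   have "np.span Z <= {e. cmp wx k e \<in> ?E}"
   proof (rule np.span_minimal)
    show "np.subspace {e. cmp wx k e \<in> ?E}"
     by (rule np.subspaceI) (auto simp: cmp_add cmp_sc intro: np.subspace_0[OF sE] np.subspace_add[OF sE] np.subspace_scale[OF sE])
    show "Z <= {e. cmp wx k e \<in> ?E}"
    proof clarify
     fix z assume z: "z \<in> Z"
     then obtain j where "hom_deg wx j z" "z \<in> One n" using ZH unfolding Hm_def by blast
     moreover have "z \<in> ?E" using zE[of "[z]"] z sub_yv[OF One_PV[OF \<open>z \<in> One n\<close>]] by simp
     ultimately show "cmp wx k z \<in> ?E" using cmp_hom[of wx j z k] np.subspace_0[OF sE] by auto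
    qed
   qed
   hence eE: "cmp wx k e \<in> ?E" using de(3) by blast
   have "D0 n <= {d. cmp wx k d \<in> ?E}"
    unfolding D0_def
   proof (rule np.span_minimal)
    show "np.subspace {e. cmp wx k e \<in> ?E}"
     by (rule np.subspaceI) (auto simp: cmp_add cmp_sc intro: np.subspace_0[OF sE] np.subspace_add[OF sE] np.subspace_scale[OF sE])
    show "{sub q p | p q. p \<in> OneP n \<and> q \<in> OneP n} <= {d. cmp wx k d \<in> ?E}"
    proof clarify
     fix p q assume pq: "p \<in> OneP n" "q \<in> OneP n"
     \<comment> \<open>Elements of the augmentation ideal have no component of degree 0, so in every
       nonzero product both factors have degree below \<open>k\<close>.\<close>
     have "sub (cmp wx (k - i) q) (cmp wx i p) \<in> ?E" if i: "i \<le> k" for i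
     proof -
      note O = One_cmp[OF OneP_One[OF pq(1)], of wx] One_cmp[OF OneP_One[OF pq(2)], of wx]
      consider "i = 0" | "i = k" | "0 < i" "i < k" using i by linarith
      thus ?thesis
      proof cases
       case 1
       thus ?thesis using OneP_cmp0[OF pq(1)] np.subspace_0[OF sE] by simp
      next
       case 2
       thus ?thesis using OneP_cmp0[OF pq(2)] lin_0[OF lin_sub_left[OF One_hom[OF O(1)]]] np.subspace_0[OF sE] by simp
      next
       case 3
       thus ?thesis by (intro Esub[OF less.IH[of i] _ less.IH[of "k - i"]] O hom_cmp) auto
      qed
     qed
     thus "cmp wx k (sub q p) \<in> ?E" unfolding cmp_sub[OF OneP_One[OF pq(1)] OneP_One[OF pq(2)]]
      by (intro np.subspace_sum[OF sE]) auto
    qed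
   qed
   hence "cmp wx k d' \<in> ?E" using d' by blast
   moreover have "cmp wx k (d - d') \<in> ?E" by (rule TE[OF T_cmp[OF d'(2)]])
   ultimately have "cmp wx k (d - d') + cmp wx k d' + cmp wx k e \<in> ?E" using eE by (intro np.subspace_add[OF sE])
   hence "cmp wx k p \<in> ?E" by (simp add: de(1) cmp_diff cmp_add)
   thus ?thesis using cmp_hom[OF less.prems(2), of k] by simp
  qed
 qed
 have EO: "p \<in> ?E" if "p \<in> One n" for p
 proof -
  have "cmp wx k p \<in> ?E" for k by (rule hE[OF One_cmp[OF that] hom_cmp])
  hence "(\<Sum>k<dbound wx p. cmp wx k p) \<in> ?E" by (intro np.subspace_sum[OF sE])
  thus ?thesis by (subst (asm) sum_cmp_dbound) auto
 qed
 have "\<exists>c. (\<forall>v\<in>ks c. set v <= Z) \<and> p - lext sc zr c \<in> T (V1 n)" if p: "p \<in> One n" for p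
 proof -
  obtain a where a: "a \<in> Sp" "p - a \<in> T (V1 n)" using EO[OF p] unfolding QN_def by blast
  have "Sp <= {a. \<exists>c. (\<forall>v\<in>ks c. set v <= Z) \<and> a = lext sc zr c}" (is "_ <= ?K")
   unfolding Sp_def
  proof (rule np.span_minimal)
   note l = np.lin_lext_list[of zr]
   show "np.subspace ?K"
   proof (rule np.subspaceI)
    show "0 \<in> ?K" by (auto intro!: exI[of _ 0] simp: lin_0[OF l])
    fix a b assume "a \<in> ?K" "b \<in> ?K"
    then obtain c d where "\<forall>v\<in>ks c. set v <= Z" "a = lext sc zr c" "\<forall>v\<in>ks d. set v <= Z" "b = lext sc zr d" by blast
    thus "a + b \<in> ?K" using keys_add[of c d] by (auto intro!: exI[of _ "c + d"] simp: lin_add[OF l] del: subsetI)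
   next
    fix k a assume "a \<in> ?K"
    then obtain c where "\<forall>v\<in>ks c. set v <= Z" "a = lext sc zr c" by blast
    thus "sc k a \<in> ?K"
     by (auto intro!: exI[of _ "lsc k c"] simp: lin_scale[OF l] in_keys_iff lookup_map_mult del: subsetI)
   qed
   show "zr ` {v. set v <= Z} <= ?K" by (auto intro!: exI[of _ "Poly_Mapping.single _ 1"] simp del: subsetI)
  qed
  thus ?thesis using a by blast
 qed
 from free_CR[OF y ZP _ this p tr] show ?thesis
 proof this
  fix F u z assume F: "finite F" "F <= Z" and u: "\<And>z. z \<in> F ==> u z \<in> One n"
   and 0: "(\<Sum>z\<in>F. sub z (u z)) \<in> T (V1 n)" and z: "z \<in> F"
  show "u z \<in> T (V1 n)"
  proof (rule NS_free[OF NS F(1) _ _ _ 0 z])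
   show "F <= OneP n" using F ZP by blast
   show "c z = 0" if "(\<Sum>z\<in>F. sc (c z) z) \<in> QN n (D0 n)" "z \<in> F" for c z by (rule Zind[OF F that])
  qed (rule u)
 qed
qed

end

section \<open>Derivations of the free algebra\<close>

definition brk :: "('v => ('v, 'k::field) npoly) => ('v => ('v, 'k) npoly) => 'v => ('v, 'k) npoly" where
 "brk g h = (%l. der np_var g (h l) - der np_var h (g l))"

lemma der_brk: "der np_var g (der np_var h f) - der np_var h (der np_var g f) = der np_var (brk g h) f"
proof (rule lin_mag_eqI[OF _ lin_der PP_True])
 show "lin sc sc (%f. der np_var g (der np_var h f) - der np_var h (der np_var g f))"
  by (rule linI) (simp_all add: der_add der_sc np.scale_right_diff_distrib)
 fix a b
 assume ab: "der np_var g (der np_var h (mon (Some a))) - der np_var h (der np_var g (mon (Some a))) = der np_var (brk g h) (mon (Some a))"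
  "der np_var g (der np_var h (mon (Some b))) - der np_var h (der np_var g (mon (Some b))) = der np_var (brk g h) (mon (Some b))"
 show "der np_var g (der np_var h (mon (Some a) \<star> mon (Some b))) - der np_var h (der np_var g (mon (Some a) \<star> mon (Some b))) =
  der np_var (brk g h) (mon (Some a) \<star> mon (Some b))"
  unfolding der_mult[of np_var "brk g h"] ab[symmetric] der_mult subst_var der_add mult_simps by simp
qed (simp_all add: brk_def der_0)

context nsvar
begin

lemma graded_part_alt: "graded_part M V w I = cls M V ` {f \<in> PV V. \<forall>m\<in>ks f. mdeg w m \<in> I}"
proof -
 let ?B = "{cls M V f | f m. f = mon m \<and> f \<in> PV V \<and> (case m of None => 0 | Some t => mag_deg w t) \<in> I}"
 let ?K = "{f \<in> PV V. \<forall>m\<in>ks f. mdeg w m \<in> I}"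
 have gp: "graded_part M V w I = lin_span (A V) ?B" by (simp only: graded_part_def)
 have sK: "np.subspace ?K"
  using np.subspace_inter[OF subspace_PP[of "unital M" V] subspace_keys[of "%m. mdeg w m \<in> I"]] by (simp add: Int_def)
 have "x \<in> cls M V ` ?K" if "x \<in> lin_span (A V) ?B" for x
  using that
 proof induction
  case zero
  thus ?case using np.subspace_0[OF sK] by (auto simp: free_zero)
 next
  case (base a)
  thus ?case by (auto simp: mdeg_def)
 next
  case (add a b)
  then obtain f g where "f \<in> ?K" "a = cls M V f" "g \<in> ?K" "b = cls M V g" by blast
  thus ?case using np.subspace_add[OF sK, of f g] by (simp only: free_add) blast
 next
  case (scale a c)
  then obtain f where "f \<in> ?K" "a = cls M V f" by blast
  thus ?case using np.subspace_scale[OF sK, of f c] by (simp only: free_smult) blast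
 qed
 moreover have "cls M V f \<in> lin_span (A V) ?B" if f: "f \<in> ?K" for f
 proof -
  have "f \<in> {f. cls M V f \<in> lin_span (A V) ?B}"
  proof (rule np_subspaceI)
   show "np.subspace {f. cls M V f \<in> lin_span (A V) ?B}"
    by (rule np.subspaceI) (auto simp: free_zero[symmetric] free_add[symmetric] free_smult[symmetric] intro: lin_span.intros)
   fix m assume "m \<in> ks f"
   hence "mon m \<in> PV V" "mdeg w m \<in> I" using f PP_mon by auto
   hence "cls M V (mon m) \<in> ?B" unfolding mdeg_def by blast
   thus "mon m \<in> {f. cls M V f \<in> lin_span (A V) ?B}" by (simp add: lin_span.base)
  qed
  thus ?thesis by simp
 qed
 ultimately show ?thesis unfolding gp by blast
qed

lemma homog_alt: "homog M n k = cl n ` {f \<in> PV {..<n}. hom_deg d1 k f}"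
 unfolding homog_def graded_part_alt hom_deg_def d1_def by simp

lemma homog_ge_alt: "f \<in> PV {..<n} ==> cl n f \<in> homog_ge M n k \<longleftrightarrow> f \<in> G {..<n} k"
proof
 assume f: "f \<in> PV {..<n}" and "cl n f \<in> homog_ge M n k"
 then obtain h where h: "h \<in> PV {..<n}" "\<And>m. m \<in> ks h ==> mdeg d1 m \<ge> k" "f - h \<in> T {..<n}"
  unfolding homog_ge_def graded_part_alt d1_def by (auto simp: cls_eq)
 have "cmp d1 j h = 0" if "j < k" for j
  unfolding cmp_def lext_def
 proof (rule sum.neutral, rule ballI)
  fix m assume "m \<in> ks h"
  hence "mdeg d1 m \<noteq> j" using h(2)[of m] that by simp
  thus "sc (lk h m) (if mdeg d1 m = j then mon m else 0) = 0" by simp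
 qed
 hence "h \<in> G {..<n} k" using h by (simp add: G_def T_0)
 from G_add[OF T_G[OF h(3)] this] show "f \<in> G {..<n} k" by simp
next
 assume fP: "f \<in> PV {..<n}" and f: "f \<in> G {..<n} k"
 let ?N = "max k (dbound d1 f)"
 let ?h = "\<Sum>j\<in>{k..<?N}. cmp d1 j f"
 have "f = (\<Sum>j<?N. cmp d1 j f)" by (rule sum_cmp_dbound[symmetric]) simp
 also have "\<dots> = (\<Sum>j<k. cmp d1 j f) + ?h"
  by (subst sum.union_disjoint[symmetric]) (auto intro!: sum.cong)
 finally have e: "f = (\<Sum>j<k. cmp d1 j f) + ?h" .
 have "(\<Sum>j<k. cmp d1 j f) \<in> T {..<n}" using G_cmp[OF f] by (intro T_sum) auto
 hence "f - ?h \<in> T {..<n}" using e by (metis add_diff_cancel_right')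
 moreover have "?h \<in> PV {..<n}" by (intro np.subspace_sum[OF subspace_PP] cmp_PP fP)
 moreover have "?h \<in> {h. \<forall>m\<in>ks h. mdeg d1 m \<ge> k}"
 proof (rule np.subspace_sum[OF subspace_keys])
  fix j assume "j \<in> {k..<?N}"
  thus "cmp d1 j f \<in> {h. \<forall>m\<in>ks h. mdeg d1 m \<ge> k}" using hom_cmp[of d1 j f] by (auto simp: hom_deg_def)
 qed
 ultimately show "cl n f \<in> homog_ge M n k"
  unfolding homog_ge_def graded_part_alt d1_def[symmetric] by (auto simp: cls_eq image_iff)
qed

text \<open>The map on cosets induced by \<open>F\<close>, by way of a chosen representative;
  \<open>lft_cls\<close> removes the choice when \<open>F\<close> respects identities.\<close>

definition lft :: "'v set => 'w set => (('v, 'k) npoly => ('w, 'k) npoly) => ('v, 'k) npoly set => ('w, 'k) npoly set" where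
 "lft V V' F = (\<lambda>x\<in>carrier (A V). cls M V' (F (SOME f. f \<in> PV V \<and> x = cls M V f)))"

lemma lft_ext [simp]: "lft V V' F \<in> extensional (carrier (A V))"
 by (simp add: lft_def)

lemma lft_cls:
 assumes F: "lin sc sc F" "\<And>f. f \<in> T V ==> F f \<in> T V'" and f: "f \<in> PV V"
 shows "lft V V' F (cls M V f) = cls M V' (F f)"
proof -
 let ?f = "SOME g. g \<in> PV V \<and> cls M V f = cls M V g"
 have "?f \<in> PV V \<and> cls M V f = cls M V ?f" by (rule someI[of _ f]) (use f in simp)
 hence "F (f - ?f) \<in> T V'" by (intro F) (simp add: cls_eq)
 hence "cls M V' (F ?f) = cls M V' (F f)" by (simp add: lin_diff[OF F(1)] cls_eq T_swap)
 thus ?thesis using f by (simp add: lft_def)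
qed

lemma free_extI:
 assumes "phi \<in> extensional (carrier (A V))" "psi \<in> extensional (carrier (A V))"
  "\<And>f. f \<in> PV V ==> phi (cls M V f) = psi (cls M V f)" shows "phi = psi"
 using assms by (intro extensionalityI[of phi "carrier (A V)"]) (auto simp: free_carrier)

definition TP :: "nat => (nat => (nat, 'k) npoly) set" where
 "TP n = {g. \<forall>j<n. g j \<in> PV {..<n}}"

lemma TP: "g \<in> TP n ==> j < n ==> g j \<in> PV {..<n}" by (simp add: TP_def)

lemma subspace_TP: "tp.subspace (TP n)"
 by (rule tp.subspaceI) (auto simp: TP_def PV_0 intro: PV_add PV_sc)

lemma der_TP: "g \<in> TP n ==> f \<in> PV {..<n} ==> der np_var g f \<in> PV {..<n}"
 by (rule der_PP) (auto simp: TP_def)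

lemma brk_TP: "g \<in> TP n ==> h \<in> TP n ==> brk g h \<in> TP n"
 by (auto simp: brk_def TP_def intro!: PV_diff der_TP)

definition derF :: "nat => (nat => (nat, 'k) npoly) => (nat, 'k) npoly set => (nat, 'k) npoly set" where
 "derF n g = lft {..<n} {..<n} (der np_var g)"

lemma derF_ext [simp]: "derF n g \<in> extensional (carrier (Fr M n))"
 by (simp add: derF_def)

lemma derF_cls: "g \<in> TP n ==> f \<in> PV {..<n} ==> derF n g (cl n f) = cl n (der np_var g f)"
 unfolding derF_def by (rule lft_cls[OF lin_der]) (auto intro!: T_der simp: TP_def)

lemma derF_gen: "g \<in> TP n ==> j < n ==> derF n g (xgen M n j) = cl n (g j)"
 by (simp add: gen_def derF_cls)

lemma derF_Der: "g \<in> TP n ==> derF n g \<in> carrier (Der (Fr M n))"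
 using derF_ext[of n g, unfolded free_carrier]
 by (auto simp: Der_def hom_def free_carrier free_add free_smult free_mult derF_cls der_TP PV_add PV_sc PP_mult
   der_add der_sc der_mult)

lemma Der_unique:
 assumes d: "d \<in> carrier (Der (Fr M n))" and g: "g \<in> TP n" and dg: "\<And>j. j < n ==> d (xgen M n j) = cl n (g j)"
 shows "d = derF n g"
proof (rule free_extI[where V = "{..<n}"])
 show "d \<in> extensional (carrier (Fr M n))" using d by (simp add: Der_def)
 fix f :: "(nat, 'k) npoly" assume f: "f \<in> PV {..<n}"
 interpret fr: abelian_group "Fr M n" by (rule free_ag)
 have c: "d (cl n f) \<in> carrier (Fr M n)" if "f \<in> PV {..<n}" for f
  using d that by (auto simp: Der_def hom_def free_carrier)
 have m: "d (cl n (f \<star> g)) = (d (cl n f) \<otimes>\<^bsub>Fr M n\<^esub> cl n g) \<oplus>\<^bsub>Fr M n\<^esub> (cl n f \<otimes>\<^bsub>Fr M n\<^esub> d (cl n g))"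
  and a: "d (cl n (f + g)) = d (cl n f) \<oplus>\<^bsub>Fr M n\<^esub> d (cl n g)"
  and s: "d (cl n (sc c f)) = c \<odot>\<^bsub>Fr M n\<^esub> d (cl n f)"
  if "f \<in> PV {..<n}" "g \<in> PV {..<n}" for f g c
  using d that by (simp_all add: Der_def hom_def free_mult[symmetric] free_add[symmetric] free_smult[symmetric])
 have t: "d (cl n (mon (Some t))) = cl n (der np_var g (mon (Some t)))" if "set_mag t <= {..<n}" for t
  using that
 proof (induction t)
  case (Gen v)
  thus ?case using dg[of v] by (simp add: gen_def np_var_def)
 next
  case (Node x y)
  hence P: "mon (Some x) \<in> PV {..<n}" "mon (Some y) \<in> PV {..<n}" by auto
  have e: "mon (Some (Node x y)) = mon (Some x) \<star> (mon (Some y) :: (nat, 'k) npoly)" by simp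
  show ?case
   unfolding e m[OF P] der_mult using Node P der_TP[OF g P(1)] der_TP[OF g P(2)]
   by (simp add: free_mult free_add PP_mult meval_var del: der_mon mon_mult_mon)
 qed
 \<comment> \<open>A derivation kills the identity element, since its value there is twice
   itself.\<close>
 have n: "d (cl n (mon None)) = cl n 0" if "unital M"
 proof -
  have P: "mon None \<in> PV {..<n}" using that by simp
  obtain h where h: "h \<in> PV {..<n}" "d (cl n (mon None)) = cl n h" using c[OF P] by (auto simp: free_carrier)
  have "cl n h = cl n (h + h)" using m[OF P P] h P by (simp add: free_mult free_add)
  thus ?thesis using h(2) T_swap[of h "h + h"] by (simp add: cls_eq)
 qed
 have z: "d (cl n 0) = cl n 0"
 proof -
  obtain h where "d (cl n 0) = cl n h" using c[OF PV_0] by (auto simp: free_carrier)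
  thus ?thesis using s[OF PV_0 PV_0, of 0] by (simp add: free_smult np.scale_zero_left del: map_single)
 qed
 let ?K = "{f \<in> PV {..<n}. d (cl n f) = cl n (der np_var g f)}"
 have "f \<in> ?K"
 proof (rule np_subspaceI)
  show "np.subspace ?K"
   by (rule np.subspaceI) (auto simp: z a s PV_0 PV_add PV_sc der_0 der_add der_sc free_add free_smult)
  fix m assume "m \<in> ks f"
  hence "okm (unital M) {..<n} m" using f by (simp add: PP_def)
  thus "mon m \<in> ?K" using t n by (cases m) (auto simp del: der_mon(2))
 qed
 thus "d (cl n f) = derF n g (cl n f)" using g f by (simp add: derF_cls)
qed simp

lemma Der_cases:
 assumes d: "d \<in> carrier (Der (Fr M n))" and S: "\<And>j. j < n ==> d (xgen M n j) \<in> cl n ` S" "S <= PV {..<n}"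
 obtains g where "\<And>j. j < n ==> g j \<in> S" "g \<in> TP n" "d = derF n g"
proof -
 have "\<forall>j\<in>{..<n}. \<exists>f. f \<in> S \<and> d (xgen M n j) = cl n f" using S by blast
 then obtain g where g: "\<And>j. j < n ==> g j \<in> S" "\<And>j. j < n ==> d (xgen M n j) = cl n (g j)" by (metis lessThan_iff)
 have "g \<in> TP n" using g S by (auto simp: TP_def)
 thus thesis using that[OF g(1) _ Der_unique[OF d _ g(2)]] by blast
qed

lemma derF_eq: "g \<in> TP n ==> h \<in> TP n ==> derF n g = derF n h \<longleftrightarrow> (\<forall>j<n. g j - h j \<in> T {..<n})"
proof
 assume gh: "g \<in> TP n" "h \<in> TP n" and "derF n g = derF n h"
 thus "\<forall>j<n. g j - h j \<in> T {..<n}" using derF_gen[OF gh(1)] derF_gen[OF gh(2)] by (metis cls_eq)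
next
 assume gh: "g \<in> TP n" "h \<in> TP n" and "\<forall>j<n. g j - h j \<in> T {..<n}"
 thus "derF n g = derF n h"
  by (intro Der_unique derF_Der) (auto simp: derF_gen cls_eq)
qed

lemma der_of_eq: "g \<in> TP n ==> (\<And>j. j < n ==> F j = cl n (g j)) ==> der_of M n F = derF n g"
 unfolding der_of_def by (rule the_equality) (auto simp: derF_Der derF_gen intro: Der_unique)

lemma Der_zero: "\<zero>\<^bsub>Der (Fr M n)\<^esub> = derF n (%_. 0)"
proof (rule free_extI[where V = "{..<n}"])
 have "(%_. 0) \<in> TP n" by (simp add: TP_def PV_0)
 thus "\<zero>\<^bsub>Der (Fr M n)\<^esub> (cl n f) = derF n (%_. 0) (cl n f)" if "f \<in> PV {..<n}" for f
  using der_tuple_sc[of np_var 0 "%_. 0" f] that by (simp add: Der_def derF_cls free_zero del: map_single)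
qed (simp_all add: Der_def)

context
 fixes n :: nat and g h :: "nat => (nat, 'k) npoly"
 assumes g: "g \<in> TP n" and h: "h \<in> TP n"
begin

lemma Der_add: "derF n g \<oplus>\<^bsub>Der (Fr M n)\<^esub> derF n h = derF n (%j. g j + h j)"
 and Der_smult: "c \<odot>\<^bsub>Der (Fr M n)\<^esub> derF n g = derF n (%j. sc c (g j))"
 and Der_mult: "derF n g \<otimes>\<^bsub>Der (Fr M n)\<^esub> derF n h = derF n (brk g h)"
proof -
 have 1: "(%j. g j + h j) \<in> TP n" "(%j. sc c (g j)) \<in> TP n" using g h by (auto simp: TP_def PV_add PV_sc)
 show "derF n g \<oplus>\<^bsub>Der (Fr M n)\<^esub> derF n h = derF n (%j. g j + h j)"
  by (rule free_extI[where V = "{..<n}"]) (simp_all add: Der_def derF_cls g h 1 free_add der_tuple_add)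
 show "c \<odot>\<^bsub>Der (Fr M n)\<^esub> derF n g = derF n (%j. sc c (g j))"
  by (rule free_extI[where V = "{..<n}"]) (simp_all add: Der_def derF_cls g h 1 free_smult der_tuple_sc del: map_single)
 show "derF n g \<otimes>\<^bsub>Der (Fr M n)\<^esub> derF n h = derF n (brk g h)"
  by (rule free_extI[where V = "{..<n}"])
   (simp_all add: Der_def derF_cls g h brk_TP free_minus der_TP der_brk)
qed

end

lemma Der_monoid: "comm_monoid (add_monoid (Der (Fr M n)))"
proof -
 have c: "\<exists>g\<in>TP n. d = derF n g" if d: "d \<in> carrier (Der (Fr M n))" for d
 proof (rule Der_cases[OF d, of "PV {..<n}"])
  show "d (xgen M n j) \<in> cl n ` PV {..<n}" if "j < n" for j
   using d that by (auto simp: Der_def hom_def gen_def Pi_iff free_carrier)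
 qed auto
 have z: "(%_. 0) \<in> TP n" by (simp add: TP_def PV_0)
 have a: "(%j. g j + h j) \<in> TP n" if "g \<in> TP n" "h \<in> TP n" for g h using that by (auto simp: TP_def PV_add)
 show ?thesis
  by (rule comm_monoidI) (auto dest!: c simp: Der_zero Der_add a z derF_Der ac_simps)
qed

lemma Der_finsum:
 assumes "finite I" "\<And>i. i \<in> I ==> g i \<in> TP n"
 shows "(\<Oplus>\<^bsub>Der (Fr M n)\<^esub>i\<in>I. derF n (g i)) = derF n (\<Sum>i\<in>I. g i)"
 using assms
proof (induction I rule: finite_induct)
 interpret d: abelian_monoid "Der (Fr M n)" by (rule abelian_monoid.intro[OF Der_monoid])
 case empty
 thus ?case by (simp add: Der_zero zero_fun_def)
next
 interpret d: abelian_monoid "Der (Fr M n)" by (rule abelian_monoid.intro[OF Der_monoid])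
 case (insert i I)
 have "(\<Oplus>\<^bsub>Der (Fr M n)\<^esub>i\<in>insert i I. derF n (g i)) = derF n (g i) \<oplus>\<^bsub>Der (Fr M n)\<^esub> (\<Oplus>\<^bsub>Der (Fr M n)\<^esub>i\<in>I. derF n (g i))"
  using insert derF_Der by (intro d.finsum_insert) auto
 moreover have "(\<Sum>i\<in>I. g i) \<in> TP n" using insert by (intro tp.subspace_sum[OF subspace_TP]) auto
 ultimately show ?case using insert by (simp add: Der_add plus_fun_def)
qed

lemma Lpart_alt: "Lpart M n i = derF n ` {g. \<forall>j<n. g j \<in> PV {..<n} \<and> hom_deg d1 (nat (i + 1)) (g j)}" (is "_ = derF n ` ?S")
proof
 show "Lpart M n i <= derF n ` ?S"
 proof
  fix d assume d: "d \<in> Lpart M n i"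
  hence "d \<in> carrier (Der (Fr M n))" by (simp add: Lpart_def)
  thus "d \<in> derF n ` ?S"
   by (rule Der_cases[of d n "{f \<in> PV {..<n}. hom_deg d1 (nat (i + 1)) f}"]) (use d in \<open>auto simp: Lpart_def homog_alt\<close>)
 qed
 show "derF n ` ?S <= Lpart M n i"
 proof clarify
  fix g :: "nat => (nat, 'k) npoly" assume g: "\<forall>j<n. g j \<in> PV {..<n} \<and> hom_deg d1 (nat (i + 1)) (g j)"
  hence "g \<in> TP n" by (simp add: TP_def)
  thus "derF n g \<in> Lpart M n i" using g by (auto simp: Lpart_def derF_Der derF_gen homog_alt)
 qed
qed

text \<open>Sums of graded pieces become linear spans of tuples. Sums with different upper limits
  are added after padding with zeros.\<close>

lemma graded_sum_alt:
 assumes C: "\<And>i. i \<ge> - 1 ==> C i = derF n ` S i" and S: "\<And>i. i \<ge> - 1 ==> tp.subspace (S i)" "\<And>i. i \<ge> - 1 ==> S i <= TP n"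
 shows "graded_sum M n C = derF n ` tp.span (\<Union>i\<in>{- 1..}. S i)"
proof
 show "graded_sum M n C <= derF n ` tp.span (\<Union>i\<in>{- 1..}. S i)"
 proof
  fix x assume "x \<in> graded_sum M n C"
  then obtain N d where x: "x = (\<Oplus>\<^bsub>Der (Fr M n)\<^esub>i\<in>{- 1..N}. d i)" and d: "\<forall>i\<in>{- 1..N}. d i \<in> C i"
   unfolding graded_sum_def by blast
  have "\<forall>i\<in>{- 1..N}. \<exists>g. g \<in> S i \<and> d i = derF n g" using d C by fastforce
  then obtain g where g: "\<And>i. i \<in> {- 1..N} ==> g i \<in> S i" "\<And>i. i \<in> {- 1..N} ==> d i = derF n (g i)" by metis
  interpret d: abelian_monoid "Der (Fr M n)" by (rule abelian_monoid.intro[OF Der_monoid])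
  have gT: "g i \<in> TP n" if "i \<in> {- 1..N}" for i using g S(2) that by auto
  have "x = (\<Oplus>\<^bsub>Der (Fr M n)\<^esub>i\<in>{- 1..N}. derF n (g i))"
   unfolding x by (rule d.finsum_cong') (use g gT derF_Der in auto)
  also have "\<dots> = derF n (\<Sum>i\<in>{- 1..N}. g i)" by (rule Der_finsum) (use gT in auto)
  finally show "x \<in> derF n ` tp.span (\<Union>i\<in>{- 1..}. S i)"
   using g(1) by (intro image_eqI[of _ _ "\<Sum>i\<in>{- 1..N}. g i"] tp.span_sum tp.span_base) auto
 qed
 let ?K = "{\<Sum>i\<in>{- 1..N}. g i | N g. \<forall>i\<ge>- 1. g i \<in> S i}"
 have Kb: "(\<Sum>i\<in>{- 1..N}. g i) = (\<Sum>i\<in>{- 1..N'}. if i \<le> N then g i else 0)" if "N \<le> N'" for N N' :: int and g :: "int => nat => (nat, 'k) npoly"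
  using that by (intro sum.mono_neutral_cong_left) auto
 have "tp.span (\<Union>i\<in>{- 1..}. S i) <= ?K"
 proof (rule tp.span_minimal)
  show "tp.subspace ?K"
  proof (rule tp.subspaceI)
   show "0 \<in> ?K" using tp.subspace_0[OF S(1)] by (intro CollectI exI[of _ 0] exI[of _ "%_. 0"]) auto
  next
   fix a b assume "a \<in> ?K" "b \<in> ?K"
   then obtain N g N' h where g: "a = (\<Sum>i\<in>{- 1..N}. g i)" "\<forall>i\<ge>- 1. g i \<in> S i" and h: "b = (\<Sum>i\<in>{- 1..N'}. h i)" "\<forall>i\<ge>- 1. h i \<in> S i" by blast
   have "a + b = (\<Sum>i\<in>{- 1..max N N'}. (if i \<le> N then g i else 0) + (if i \<le> N' then h i else 0))"
    unfolding sum.distrib g(1) h(1) by (intro arg_cong2[where f = "(+)"] Kb) auto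
   thus "a + b \<in> ?K"
    using g h tp.subspace_add[OF S(1)] tp.subspace_0[OF S(1)]
    by (intro CollectI exI[of _ "max N N'"] exI[of _ "%i. (if i \<le> N then g i else 0) + (if i \<le> N' then h i else 0)"]) auto
  next
   fix c a assume "a \<in> ?K"
   then obtain N g where g: "a = (\<Sum>i\<in>{- 1..N}. g i)" "\<forall>i\<ge>- 1. g i \<in> S i" by blast
   thus "(%j. sc c (a j)) \<in> ?K"
    using tp.subspace_scale[OF S(1)] tp.scale_sum_right[of c g "{- 1..N}"]
    by (intro CollectI exI[of _ N] exI[of _ "%i j. sc c (g i j)"]) auto
  qed
  show "(\<Union>i\<in>{- 1..}. S i) <= ?K"
  proof clarify
   fix i g assume "- 1 \<le> (i :: int)" and g: "g \<in> S i"
   hence "g = (\<Sum>k\<in>{- 1..i}. if k = i then g else 0)" by simp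
   thus "\<exists>N h. g = (\<Sum>i\<in>{- 1..N}. h i) \<and> (\<forall>i\<ge>- 1. h i \<in> S i)"
    using g tp.subspace_0[OF S(1)] by (intro exI[of _ i] exI[of _ "%k. if k = i then g else 0"]) auto
  qed
 qed
 thus "derF n ` tp.span (\<Union>i\<in>{- 1..}. S i) <= graded_sum M n C"
 proof clarify
  fix x assume sub: "tp.span (\<Union>i\<in>{- 1..}. S i) <= ?K" and "x \<in> tp.span (\<Union>i\<in>{- 1..}. S i)"
  hence "x \<in> ?K" by blast
  then obtain N g where g: "x = (\<Sum>i\<in>{- 1..N}. g i)" "\<forall>i\<ge>- 1. g i \<in> S i" by blast
  have "derF n x = (\<Oplus>\<^bsub>Der (Fr M n)\<^esub>i\<in>{- 1..N}. derF n (g i))"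
   unfolding g(1) by (rule Der_finsum[symmetric]) (use g S(2) in auto)
  thus "derF n x \<in> graded_sum M n C"
   unfolding graded_sum_def using g C by (intro CollectI exI[of _ N] exI[of _ "%i. derF n (g i)"]) auto
 qed
qed

end

section \<open>The universal enveloping algebra\<close>

context nsvar
begin

definition OP :: "nat => 'k np2 set" where
 "OP n = {f \<in> PV (vars2 n). hom_deg wy 1 f}"

abbreviation cl2 :: "nat => 'k np2 => 'k np2 set" where
 "cl2 n \<equiv> cls M (vars2 n)"

lemma Inl_vars2: "Inl ` {..<n} <= vars2 n" by (auto simp: vars2_def)

lemma OP_PV: "f \<in> OP n ==> f \<in> PV (vars2 n)" by (simp add: OP_def)

lemma Omega_alt: "Omega M n = cl2 n ` OP n"
 unfolding Omega_def graded_part_alt OP_def hom_deg_def wy_def[symmetric] by simp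

lemma sub_OP: "p \<in> One n ==> f \<in> OP n ==> sub f p \<in> OP n"
 using sub_PV[OF One_PV _ Inl_vars2] hom_sub_wy[OF One_hom] by (auto simp: OP_def)

definition up :: "nat => 'k np2 => 'k np2 set => 'k np2 set" where
 "up n p = (\<lambda>w\<in>Omega M n. cl2 n (sub (SOME f. f \<in> OP n \<and> w = cl2 n f) p))"

lemma up_ext [simp]: "up n p \<in> extensional (Omega M n)" by (simp add: up_def)

lemma up_cls: "p \<in> One n ==> f \<in> OP n ==> up n p (cl2 n f) = cl2 n (sub f p)"
proof -
 assume p: "p \<in> One n" and f: "f \<in> OP n"
 let ?f = "SOME g. g \<in> OP n \<and> cl2 n f = cl2 n g"
 have "?f \<in> OP n \<and> cl2 n f = cl2 n ?f" by (rule someI[of _ f]) (use f in simp)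
 hence "sub (f - ?f) p \<in> T (vars2 n)" by (intro T_sub_right[OF p _ Inl_vars2]) (simp add: cls_eq)
 hence "cl2 n (sub ?f p) = cl2 n (sub f p)" using lin_diff[OF lin_sub_left[OF One_hom[OF p]]] by (simp add: cls_eq T_swap)
 thus ?thesis using f by (simp add: up_def Omega_alt)
qed

lemma Omega_extI:
 assumes "phi \<in> extensional (Omega M n)" "psi \<in> extensional (Omega M n)"
  "\<And>f. f \<in> OP n ==> phi (cl2 n f) = psi (cl2 n f)" shows "phi = psi"
 using assms by (intro extensionalityI[of phi "Omega M n"]) (auto simp: Omega_alt)

lemma up_ext' [simp]: "up n p \<in> extensional (cl2 n ` OP n)"
 using up_ext[of n p] by (simp only: Omega_alt)

lemma sub_y: "sub f yv = f"
 by (simp add: sub_def)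

lemma up_one: "(\<lambda>w\<in>Omega M n. w) = up n yv"
proof (rule Omega_extI)
 fix f assume f: "f \<in> OP n"
 hence "cl2 n f \<in> Omega M n" by (simp add: Omega_alt)
 thus "(\<lambda>w\<in>Omega M n. w) (cl2 n f) = up n yv (cl2 n f)" using f by (simp only: up_cls yv_One sub_y restrict_apply if_True)
qed simp_all

lemma up_zero: "(\<lambda>w\<in>Omega M n. \<zero>\<^bsub>Fr2 M n\<^esub>) = up n 0"
 by (rule Omega_extI) (auto simp: up_cls One_0 Omega_alt free_zero)

lemma up_add: "p \<in> One n ==> q \<in> One n ==> (\<lambda>w\<in>Omega M n. up n p w \<oplus>\<^bsub>Fr2 M n\<^esub> up n q w) = up n (p + q)"
 by (rule Omega_extI) (auto simp: up_cls One_add Omega_alt free_add sub_add)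

lemma up_scale: "p \<in> One n ==> (\<lambda>w\<in>Omega M n. c \<odot>\<^bsub>Fr2 M n\<^esub> up n p w) = up n (sc c p)"
 by (rule Omega_extI) (auto simp: up_cls One_sc Omega_alt free_smult sub_sc simp del: map_single)

lemma up_mult: "p \<in> One n ==> q \<in> One n ==> compose (Omega M n) (up n p) (up n q) = up n (sub q p)"
 by (rule Omega_extI) (auto simp: up_cls sub_One Omega_alt compose_def sub_sub sub_OP)

text \<open>Applying the operator to the single generator y_0 of \<open>Omega\<close> recovers
  \<open>p\<close>. For \<open>n = 0\<close> there is no y_0 and \<open>Omega\<close> is zero, hence
  the assumption \<open>n > 0\<close>.\<close>

lemma up_eq:
 assumes "n > 0" "p \<in> One n" "q \<in> One n" shows "up n p = up n q \<longleftrightarrow> p - q \<in> T (V1 n)"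
proof
 assume "up n p = up n q"
 moreover have y: "yv \<in> OP n" using assms by (auto simp: OP_def vars2_def)
 ultimately have "cl2 n (sub yv p) = cl2 n (sub yv q)" using assms by (metis up_cls)
 hence "p - q \<in> T (vars2 n)" using assms One_PV by (simp add: cls_eq sub_yv[OF One_PV])
 hence "subst (case_sum xv (%i. if i = 0 then yv else 0)) (p - q) \<in> T (V1 n)"
  by (rule T_subst) (auto simp: vars2_def V1_def PV_0)
 also have "subst (case_sum xv (%i. if i = 0 then yv else 0)) (p - q) = subst np_var (p - q)"
  by (rule np.ev_cong[OF One_PV[OF One_diff[OF assms(2,3)]]]) (auto simp: V1_def)
 finally show "p - q \<in> T (V1 n)" by simp
next
 assume t: "p - q \<in> T (V1 n)"
 show "up n p = up n q"
 proof (rule Omega_extI)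
  fix f assume f: "f \<in> OP n"
  have "sub f p - sub f q \<in> T (vars2 n)" unfolding sub_diff[symmetric] by (rule T_sub[OF t OP_PV[OF f] Inl_vars2])
  thus "up n p (cl2 n f) = up n q (cl2 n f)" using assms f by (simp add: up_cls cls_eq)
 qed simp_all
qed

abbreviation ren :: "(nat, 'k) npoly => 'k np2" where "ren \<equiv> subst xv"

lemma sub_ren: "sub q (ren f) = ren f"
 by (simp add: sub_def subst_subst)

lemma ren_PV: "f \<in> PV {..<n} ==> ren f \<in> PV (vars2 n) \<and> ren f \<in> PV (V1 n) \<and> hom_deg wy 0 (ren f)"
proof (intro conjI)
 assume f: "f \<in> PV {..<n}"
 show "ren f \<in> PV (vars2 n)" "ren f \<in> PV (V1 n)" by (rule subst_PP[OF f], auto simp: vars2_def V1_def)+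
 show "hom_deg wy 0 (ren f)" by (rule hom_subst[OF _ f hom_weight0]) simp
qed

lemma ren_One: "f \<in> PV {..<n} ==> ren f \<star> yv \<in> One n \<and> yv \<star> ren f \<in> One n"
 using ren_PV[of f n] hom_mult[of wy 0 "ren f" 1 yv] hom_mult[of wy 1 yv 0 "ren f"]
 by (auto simp: One_def V1_def intro!: PP_mult)

lemma lft_alg_hom:
 assumes Phi: "\<And>v. v \<in> V ==> Phi v \<in> PV V'" shows "lft V V' (subst Phi) \<in> alg_hom (unital M) (A V) (A V')"
proof -
 have c: "lft V V' (subst Phi) (cls M V f) = cls M V' (subst Phi f)" if "f \<in> PV V" for f
  by (rule lft_cls[OF np.lin_ev _ that]) (rule T_subst[OF _ Phi])
 have P: "subst Phi f \<in> PV V'" if "f \<in> PV V" for f by (rule subst_PP[OF that Phi])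
 show ?thesis
  by (auto simp: alg_hom_def hom_def free_carrier c P free_add free_mult free_smult free_one PV_add PV_sc PP_mult np.ev_add np.ev_sc
    simp del: map_single)
qed

lemma lft_subst_cls:
 assumes "\<And>v. v \<in> V ==> Phi v \<in> PV V'" "f \<in> PV V" shows "lft V V' (subst Phi) (cls M V f) = cls M V' (subst Phi f)"
 by (rule lft_cls[OF np.lin_ev _ assms(2)]) (rule T_subst[OF _ assms(1)])

lemma hom_eq_lft:
 assumes phi: "phi \<in> extensional (carrier (A V))" "phi \<in> alg_hom (unital M) (A V) (A V')"
  and Phi: "\<And>v. v \<in> V ==> Phi v \<in> PV V'" "\<And>v. v \<in> V ==> phi (gen M V v) = cls M V' (Phi v)"
 shows "phi = lft V V' (subst Phi)"
proof (rule free_extI[OF phi(1) lft_ext])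
 fix f assume f: "f \<in> PV V"
 have "phi (cls M V f) = cls M V' (subst Phi f)"
  by (rule alg_hom_cls[of phi V "carrier (A V')" V' Phi f, OF _ subset_refl Phi f]) (use phi(2) in simp)
 thus "phi (cls M V f) = lft V V' (subst Phi) (cls M V f)" using lft_subst_cls[OF Phi(1) f] by simp
qed

lemma emb_cls: "f \<in> PV {..<n} ==> emb M n (cl n f) = cl2 n (ren f)"
proof -
 assume f: "f \<in> PV {..<n}"
 have x: "xv v \<in> PV (vars2 n)" if "v \<in> {..<n}" for v using that by (auto simp: vars2_def)
 have "emb M n = lft {..<n} (vars2 n) ren"
  unfolding emb_def
 proof (rule the_equality)
  show "lft {..<n} (vars2 n) ren \<in> extensional (carrier (Fr M n)) \<inter> alg_hom (unital M) (Fr M n) (Fr2 M n) \<and>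
   (\<forall>i<n. lft {..<n} (vars2 n) ren (xgen M n i) = gen M (vars2 n) (Inl i))"
  proof (intro conjI IntI lft_ext allI impI)
   show "lft {..<n} (vars2 n) ren \<in> alg_hom (unital M) (Fr M n) (Fr2 M n)" by (rule lft_alg_hom[OF x])
   show "lft {..<n} (vars2 n) ren (xgen M n i) = gen M (vars2 n) (Inl i)" if "i < n" for i
    unfolding gen_def by (subst lft_subst_cls[OF x]) (use that in auto)
  qed
  show "phi = lft {..<n} (vars2 n) ren" if "phi \<in> extensional (carrier (Fr M n)) \<inter> alg_hom (unital M) (Fr M n) (Fr2 M n) \<and>
   (\<forall>i<n. phi (xgen M n i) = gen M (vars2 n) (Inl i))" for phi
   by (rule hom_eq_lft) (use that x in \<open>auto simp: gen_def\<close>)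
 qed
 thus ?thesis using lft_subst_cls[OF x f] by simp
qed

lemma op_up:
 assumes f: "f \<in> PV {..<n}"
 shows "op_L M n (cl n f) = up n (ren f \<star> yv)" "op_R M n (cl n f) = up n (yv \<star> ren f)"
proof -
 have "sub w (ren f \<star> yv) = ren f \<star> w" "sub w (yv \<star> ren f) = w \<star> ren f" for w
  using sub_ren[of w f] by (simp_all add: sub_def)
 thus "op_L M n (cl n f) = up n (ren f \<star> yv)" "op_R M n (cl n f) = up n (yv \<star> ren f)"
  using ren_One[OF f] ren_PV[OF f] OP_PV
  by (auto intro!: Omega_extI[of _ n] simp: op_L_def op_R_def up_cls Omega_alt emb_cls[OF f] free_mult)
qed

text \<open>A monomial linear in y is a chain of multiplications by monomials in x applied to y, so
  \<open>op_L\<close> and \<open>op_R\<close> generate the operators of all polynomials in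
  \<open>One n\<close>.\<close>

lemma U_alt: "U_carrier M n = up n ` One n"
proof
 show "U_carrier M n <= up n ` One n"
 proof
  fix u assume "u \<in> U_carrier M n"
  thus "u \<in> up n ` One n"
  proof induction
   case one
   thus ?case using up_one yv_One by blast
  next
   case (left a)
   thus ?case using op_up(1) ren_One by (auto simp: free_carrier)
  next
   case (right a)
   thus ?case using op_up(2) ren_One by (auto simp: free_carrier)
  next
   case (add p q)
   then obtain a b where "a \<in> One n" "b \<in> One n" "p = up n a" "q = up n b" by blast
   thus ?case by (simp only: up_add) (blast intro: One_add)
  next
   case (scale p c)
   then obtain a where "a \<in> One n" "p = up n a" by blast
   thus ?case by (simp only: up_scale) (blast intro: One_sc)
  next
   case (mult p q)
   thus ?case using up_mult sub_One by auto
  qed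
 qed
 show "up n ` One n <= U_carrier M n"
 proof clarify
  fix p assume p: "p \<in> One n"
  have rn: "\<exists>f. f \<in> PV {..<n} \<and> ren f = mon (Some t)" if "set_mag t <= V1 n" "mag_deg wy t = 0" for t
   using that
  proof (induction t)
   case (Gen v)
   then obtain i where "v = Inl i" "i < n" by (cases v) (auto simp: V1_def)
   thus ?case by (intro exI[of _ "np_var i"]) (simp add: np_var_def)
  next
   case (Node a b)
   then obtain f g where "f \<in> PV {..<n}" "ren f = mon (Some a)" "g \<in> PV {..<n}" "ren g = mon (Some b)" by auto
   thus ?case by (intro exI[of _ "f \<star> g"]) (simp add: PP_mult)
  qed
  have t: "up n (mon (Some t)) \<in> U_carrier M n" if "set_mag t <= V1 n" "mag_deg wy t = 1" for t
   using that
  proof (induction t)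
   case (Gen v)
   hence "mon (Some (Gen v)) = (yv :: 'k np2)" by (cases v) (auto simp: V1_def np_var_def)
   thus ?case using U_carrier.one[of M n] by (simp add: up_one)
  next
   case (Node a b)
   consider "mag_deg wy a = 0" "mag_deg wy b = 1" | "mag_deg wy a = 1" "mag_deg wy b = 0" using Node.prems by (cases "mag_deg wy a") auto
   thus ?case
   proof cases
    case 1
    then obtain f where f: "f \<in> PV {..<n}" "ren f = mon (Some a)" using rn[of a] Node.prems by auto
    have b: "mon (Some b) \<in> One n" using 1 Node.prems by (simp add: One_mon)
    have "compose (Omega M n) (op_L M n (cl n f)) (up n (mon (Some b))) \<in> U_carrier M n"
     by (intro U_carrier.mult U_carrier.left) (use f Node 1 in auto)
    also have "compose (Omega M n) (op_L M n (cl n f)) (up n (mon (Some b))) = up n (ren f \<star> mon (Some b))"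
     using up_mult[OF conjunct1[OF ren_One[OF f(1)]] b] sub_ren[of "mon (Some b)" f] by (simp add: op_up[OF f(1)] sub_def)
    finally show ?thesis by (simp add: f)
   next
    case 2
    then obtain f where f: "f \<in> PV {..<n}" "ren f = mon (Some b)" using rn[of b] Node.prems by auto
    have a: "mon (Some a) \<in> One n" using 2 Node.prems by (simp add: One_mon)
    have "compose (Omega M n) (op_R M n (cl n f)) (up n (mon (Some a))) \<in> U_carrier M n"
     by (intro U_carrier.mult U_carrier.right) (use f Node 2 in auto)
    also have "compose (Omega M n) (op_R M n (cl n f)) (up n (mon (Some a))) = up n (mon (Some a) \<star> ren f)"
     using up_mult[OF conjunct2[OF ren_One[OF f(1)]] a] sub_ren[of "mon (Some a)" f] by (simp add: op_up[OF f(1)] sub_def)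
    finally show ?thesis by (simp add: f)
   qed
  qed
  have "p \<in> {p \<in> One n. up n p \<in> U_carrier M n}"
  proof (rule np_subspaceI)
   have "up n (sc 0 yv) \<in> U_carrier M n" using U_carrier.scale[OF U_carrier.one[of M n], of 0] up_scale[OF yv_One] by (simp add: up_one)
   hence "up n 0 \<in> U_carrier M n" by (simp only: np.scale_zero_left)
   thus "np.subspace {p \<in> One n. up n p \<in> U_carrier M n}"
    by (intro np.subspaceI) (auto simp: One_0 One_add One_sc up_add[symmetric] up_scale[symmetric] U_carrier.add U_carrier.scale simp del: map_single)
   fix m assume "m \<in> ks p"
   then obtain s where "m = Some s" "set_mag s <= V1 n" "mag_deg wy s = 1" using One_keys[OF p] by blast
   thus "mon m \<in> {p \<in> One n. up n p \<in> U_carrier M n}" using t by (simp add: One_mon)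
  qed
  thus "up n p \<in> U_carrier M n" by simp
 qed
qed

lemma U_carr: "carrier (Uenv M n) = up n ` One n"
 by (simp add: Uenv_def U_alt)

lemma U_in [simp]: "p \<in> One n ==> up n p \<in> carrier (Uenv M n)"
 by (simp add: U_carr)

lemma U_zero: "\<zero>\<^bsub>Uenv M n\<^esub> = up n 0"
 by (simp add: Uenv_def up_zero)

lemma U_add: "p \<in> One n ==> q \<in> One n ==> up n p \<oplus>\<^bsub>Uenv M n\<^esub> up n q = up n (p + q)"
 and U_mult: "p \<in> One n ==> q \<in> One n ==> up n p \<otimes>\<^bsub>Uenv M n\<^esub> up n q = up n (sub q p)"
 and U_smult: "p \<in> One n ==> c \<odot>\<^bsub>Uenv M n\<^esub> up n p = up n (sc c p)"
 by (simp_all add: Uenv_def up_add up_mult up_scale)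

lemma U_ag: "abelian_group (Uenv M n)"
proof -
 have "comm_group (add_monoid (Uenv M n))"
 proof (rule comm_groupI)
  fix x assume "x \<in> carrier (add_monoid (Uenv M n))"
  then obtain p where p: "p \<in> One n" "x = up n p" by (auto simp: U_carr)
  hence "sc (- 1) p \<in> One n" by (intro One_sc)
  thus "\<exists>y\<in>carrier (add_monoid (Uenv M n)). y \<otimes>\<^bsub>add_monoid (Uenv M n)\<^esub> x = \<one>\<^bsub>add_monoid (Uenv M n)\<^esub>"
   using p by (intro bexI[of _ "up n (sc (- 1) p)"]) (simp_all add: U_add U_zero)
 qed (auto simp: U_carr U_add U_zero One_0 One_add ac_simps)
 thus ?thesis
  by (intro abelian_group.intro abelian_monoid.intro abelian_group_axioms.intro comm_group.axioms(1))
qed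

lemma U_minus: "p \<in> One n ==> q \<in> One n ==> up n p \<ominus>\<^bsub>Uenv M n\<^esub> up n q = up n (p - q)"
proof -
 assume pq: "p \<in> One n" "q \<in> One n"
 interpret u: abelian_group "Uenv M n" by (rule U_ag)
 have "up n (p - q) \<oplus>\<^bsub>Uenv M n\<^esub> up n q = up n p" using pq by (simp add: U_add One_diff)
 thus ?thesis using pq by (metis One_diff U_in u.add.inv_solve_right u.minus_eq)
qed

lemma U_finsum:
 assumes "finite I" "\<And>i. i \<in> I ==> p i \<in> One n"
 shows "(\<Oplus>\<^bsub>Uenv M n\<^esub>i\<in>I. up n (p i)) = up n (\<Sum>i\<in>I. p i)"
 using assms
proof (induction I rule: finite_induct)
 interpret u: abelian_group "Uenv M n" by (rule U_ag)
 case empty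
 thus ?case by (simp add: U_zero)
next
 interpret u: abelian_group "Uenv M n" by (rule U_ag)
 case (insert i I)
 have "(\<Oplus>\<^bsub>Uenv M n\<^esub>i\<in>insert i I. up n (p i)) = up n (p i) \<oplus>\<^bsub>Uenv M n\<^esub> (\<Oplus>\<^bsub>Uenv M n\<^esub>i\<in>I. up n (p i))"
  using insert by (intro u.finsum_insert) auto
 thus ?case using insert by (simp add: U_add One_sum)
qed

section \<open>Fox derivatives and divergence\<close>

definition udf :: "(nat, 'k) npoly => 'k np2" where
 "udf = der xv (%i. np_var (Inr i))"

lemma udf_add: "udf (f + g) = udf f + udf g" and udf_sc: "udf (sc c f) = sc c (udf f)"
 and udf_mult: "udf (f \<star> g) = ren f \<star> udf g + udf f \<star> ren g"
 by (simp_all add: udf_def der_add der_sc der_mult add.commute del: map_single)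

lemma udf_OP: "f \<in> PV {..<n} ==> udf f \<in> OP n"
proof -
 assume f: "f \<in> PV {..<n}"
 have "udf f \<in> PV (vars2 n)" unfolding udf_def by (rule der_PP[OF f]) (auto simp: vars2_def)
 moreover have "hom_deg wy 1 (udf f)"
  unfolding udf_def
  by (rule hom_der[where a = 0 and b = 1 and w = "%_. 0" and k = 0 and V = UNIV and u = True]) (auto simp: hom_weight0)
 ultimately show ?thesis by (simp add: OP_def)
qed

lemma udf_Dx: "f \<in> PV {..<n} ==> udf f = (\<Sum>i<n. sub (np_var (Inr i)) (Dx i f))"
proof -
 assume f: "f \<in> PV {..<n}"
 have s: "sub q (Dx i f) = der xv (%j. if j = i then q else 0) f" for i q
 proof -
  have "(%v. sub q (xv v)) = xv" "(%v. sub q (if v = i then yv else 0)) = (%j. if j = i then q else 0)"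
   by (auto simp: sub_def np.ev_0)
  thus ?thesis unfolding Dx_def sub_def by (simp add: subst_der)
 qed
 have "udf f = der xv (%v. \<Sum>i<n. if v = i then np_var (Inr i) else 0) f"
  unfolding udf_def by (rule der_cong[OF f]) auto
 thus ?thesis unfolding der_tuple_sum s .
qed

lemma univ_der_cls: "f \<in> PV {..<n} ==> univ_der M n (cl n f) = cl2 n (udf f)"
proof -
 assume f: "f \<in> PV {..<n}"
 let ?D = "lft {..<n} (vars2 n) udf"
 have Dc: "?D (cl n f) = cl2 n (udf f)" if "f \<in> PV {..<n}" for f
  by (rule lft_cls[OF _ _ that]) (auto simp: udf_def lin_der vars2_def intro!: T_der)
 have LR: "op_L M n (cl n f) (cl2 n h) = cl2 n (ren f \<star> h)" "op_R M n (cl n f) (cl2 n h) = cl2 n (h \<star> ren f)"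
  if "f \<in> PV {..<n}" "h \<in> OP n" for f h
  using that ren_PV[of f n] OP_PV by (auto simp: op_L_def op_R_def Omega_alt emb_cls free_mult)
 have "univ_der M n = ?D"
  unfolding univ_der_def
 proof (rule the_equality)
  show "?D \<in> extensional (carrier (Fr M n)) \<inter> (carrier (Fr M n) \<rightarrow> Omega M n) \<and>
   ?D \<in> hom (add_monoid (Fr M n)) (add_monoid (Fr2 M n)) \<and>
   (\<forall>c. \<forall>a\<in>carrier (Fr M n). ?D (c \<odot>\<^bsub>Fr M n\<^esub> a) = c \<odot>\<^bsub>Fr2 M n\<^esub> ?D a) \<and>
   (\<forall>i<n. ?D (xgen M n i) = ygen M n i) \<and>
   (\<forall>a\<in>carrier (Fr M n). \<forall>b\<in>carrier (Fr M n).
    ?D (a \<otimes>\<^bsub>Fr M n\<^esub> b) = op_L M n a (?D b) \<oplus>\<^bsub>Fr2 M n\<^esub> op_R M n b (?D a))"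
  proof (intro conjI IntI lft_ext)
   show "?D \<in> carrier (Fr M n) \<rightarrow> Omega M n" by (auto simp: free_carrier Omega_alt Dc udf_OP)
   show "?D \<in> hom (add_monoid (Fr M n)) (add_monoid (Fr2 M n))"
    by (auto simp: hom_def free_carrier Dc udf_OP OP_PV free_add PV_add udf_add)
   show "\<forall>c. \<forall>a\<in>carrier (Fr M n). ?D (c \<odot>\<^bsub>Fr M n\<^esub> a) = c \<odot>\<^bsub>Fr2 M n\<^esub> ?D a"
    by (auto simp: free_carrier Dc free_smult PV_sc udf_sc simp del: map_single)
   show "\<forall>i<n. ?D (xgen M n i) = ygen M n i" by (simp add: gen_def Dc) (simp add: udf_def)
   show "\<forall>a\<in>carrier (Fr M n). \<forall>b\<in>carrier (Fr M n).
    ?D (a \<otimes>\<^bsub>Fr M n\<^esub> b) = op_L M n a (?D b) \<oplus>\<^bsub>Fr2 M n\<^esub> op_R M n b (?D a)"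
    by (auto simp: free_carrier free_mult Dc PP_mult LR udf_OP free_add udf_mult)
  qed
 next
  fix d assume d: "d \<in> extensional (carrier (Fr M n)) \<inter> (carrier (Fr M n) \<rightarrow> Omega M n) \<and>
   d \<in> hom (add_monoid (Fr M n)) (add_monoid (Fr2 M n)) \<and>
   (\<forall>c. \<forall>a\<in>carrier (Fr M n). d (c \<odot>\<^bsub>Fr M n\<^esub> a) = c \<odot>\<^bsub>Fr2 M n\<^esub> d a) \<and>
   (\<forall>i<n. d (xgen M n i) = ygen M n i) \<and>
   (\<forall>a\<in>carrier (Fr M n). \<forall>b\<in>carrier (Fr M n).
    d (a \<otimes>\<^bsub>Fr M n\<^esub> b) = op_L M n a (d b) \<oplus>\<^bsub>Fr2 M n\<^esub> op_R M n b (d a))"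
  show "d = ?D"
  proof (rule free_extI[where V = "{..<n}"])
   show "d \<in> extensional (carrier (Fr M n))" using d by blast
   have c: "d (cl n f) \<in> Omega M n" if "f \<in> PV {..<n}" for f
    using d cls_in[OF that] by blast
   have m: "d (cl n (f \<star> g)) = op_L M n (cl n f) (d (cl n g)) \<oplus>\<^bsub>Fr2 M n\<^esub> op_R M n (cl n g) (d (cl n f))"
    and a: "d (cl n (f + g)) = d (cl n f) \<oplus>\<^bsub>Fr2 M n\<^esub> d (cl n g)"
    and s: "d (cl n (sc c f)) = c \<odot>\<^bsub>Fr2 M n\<^esub> d (cl n f)"
    if "f \<in> PV {..<n}" "g \<in> PV {..<n}" for f g c
    using d that by (simp_all add: hom_def free_mult[symmetric] free_add[symmetric] free_smult[symmetric])
   have t: "d (cl n (mon (Some t))) = cl2 n (udf (mon (Some t)))" if "set_mag t <= {..<n}" for t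
    using that
   proof (induction t)
    case (Gen v)
    thus ?case using d by (simp add: gen_def np_var_def udf_def)
   next
    case (Node x y)
    hence P: "mon (Some x) \<in> PV {..<n}" "mon (Some y) \<in> PV {..<n}" by auto
    have e: "mon (Some (Node x y)) = mon (Some x) \<star> (mon (Some y) :: (nat, 'k) npoly)" by simp
    have e': "udf (mon (Some x) \<star> mon (Some y)) = ren (mon (Some x)) \<star> udf (mon (Some y)) + udf (mon (Some x)) \<star> ren (mon (Some y))"
     unfolding udf_def der_mult by (rule add.commute)
    show ?case
     unfolding e m[OF P] e' using Node P udf_OP[OF P(1)] udf_OP[OF P(2)]
     by (simp add: LR free_add del: der_mon mon_mult_mon np.ev_mon)
   qed
   have n: "d (cl n (mon None)) = cl2 n 0" if "unital M"
   proof -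
    have P: "mon None \<in> PV {..<n}" using that by simp
    obtain h where h: "h \<in> OP n" "d (cl n (mon None)) = cl2 n h" using c[OF P] by (auto simp: Omega_alt)
    have "cl2 n h = cl2 n (h + h)" using m[OF P P] h P by (simp add: LR free_add)
    thus ?thesis using h(2) T_swap[of h "h + h"] by (simp add: cls_eq)
   qed
   have z: "d (cl n 0) = cl2 n 0"
   proof -
    obtain h where "d (cl n 0) = cl2 n h" using c[OF PV_0] by (auto simp: Omega_alt)
    thus ?thesis using s[OF PV_0 PV_0, of 0] by (simp add: free_smult np.scale_zero_left del: map_single)
   qed
   fix f :: "(nat, 'k) npoly" assume f: "f \<in> PV {..<n}"
   let ?K = "{f \<in> PV {..<n}. d (cl n f) = cl2 n (udf f)}"
   have "f \<in> ?K"
   proof (rule np_subspaceI)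
    show "np.subspace ?K"
     by (rule np.subspaceI) (auto simp: z a s PV_0 PV_add PV_sc free_add free_smult, auto simp: udf_def der_0 der_add der_sc)
    fix m assume "m \<in> ks f"
    hence "okm (unital M) {..<n} m" using f by (simp add: PP_def)
    moreover have "udf (mon None) = 0" by (simp add: udf_def)
    ultimately show "mon m \<in> ?K" using t n by (cases m) auto
   qed
   thus "d (cl n f) = ?D (cl n f)" using f by (simp add: Dc)
  qed simp
 qed
 thus ?thesis using Dc[OF f] by simp
qed

lemma fox_cls:
 assumes n: "n > 0" and f: "f \<in> PV {..<n}" and i: "i < n"
 shows "fox M n (cl n f) i = up n (Dx i f)"
proof -
 let ?p = "\<lambda>i\<in>{..<n}. up n (Dx i f)"
 have Y: "np_var (Inr i) \<in> OP n" if "i < n" for i using that by (auto simp: OP_def vars2_def)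
 have S: "(\<Oplus>\<^bsub>Fr2 M n\<^esub>i\<in>{..<n}. p i (ygen M n i)) = cl2 n (\<Sum>i<n. sub (np_var (Inr i)) (q i))"
  if q: "\<And>i. i < n ==> q i \<in> One n \<and> p i = up n (q i)" for p q
 proof -
  interpret fr: abelian_group "Fr2 M n" by (rule free_ag)
  have qP: "sub (np_var (Inr i)) (q i) \<in> PV (vars2 n)" if "i < n" for i
   using sub_OP Y q that OP_PV by blast
  have "(\<Oplus>\<^bsub>Fr2 M n\<^esub>i\<in>{..<n}. p i (ygen M n i)) = (\<Oplus>\<^bsub>Fr2 M n\<^esub>i\<in>{..<n}. cl2 n (sub (np_var (Inr i)) (q i)))"
   by (rule fr.finsum_cong') (use q Y qP in \<open>auto simp: gen_def up_cls\<close>)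
  also have "\<dots> = cl2 n (\<Sum>i<n. sub (np_var (Inr i)) (q i))" by (rule free_finsum) (use qP in auto)
  finally show ?thesis .
 qed
 have "fox M n (cl n f) = ?p"
  unfolding fox_def
 proof (rule the_equality)
  have "univ_der M n (cl n f) = (\<Oplus>\<^bsub>Fr2 M n\<^esub>i\<in>{..<n}. ?p i (ygen M n i))"
   using S[of "%i. Dx i f" ?p] Dx_One[OF f] by (simp add: univ_der_cls[OF f] udf_Dx[OF f])
  thus "?p \<in> {..<n} \<rightarrow>\<^sub>E carrier (Uenv M n) \<and> univ_der M n (cl n f) = (\<Oplus>\<^bsub>Fr2 M n\<^esub>i\<in>{..<n}. ?p i (ygen M n i))"
   using Dx_One[OF f] by auto
 next
  fix p assume p: "p \<in> {..<n} \<rightarrow>\<^sub>E carrier (Uenv M n) \<and> univ_der M n (cl n f) = (\<Oplus>\<^bsub>Fr2 M n\<^esub>i\<in>{..<n}. p i (ygen M n i))"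
  hence "\<forall>i\<in>{..<n}. \<exists>q. q \<in> One n \<and> p i = up n q" by (auto simp: U_carr PiE_def Pi_iff)
  then obtain q where q: "\<And>i. i < n ==> q i \<in> One n \<and> p i = up n (q i)" by (metis lessThan_iff)
  have "(\<Sum>i<n. sub (np_var (Inr i)) (q i)) - (\<Sum>i<n. sub (np_var (Inr i)) (Dx i f)) \<in> T (vars2 n)"
   using p S[of q p] q by (simp add: univ_der_cls[OF f] udf_Dx[OF f] cls_eq[symmetric])
  hence *: "(\<Sum>i<n. sub (np_var (Inr i)) (q i - Dx i f)) \<in> T (vars2 n)" by (simp add: sum_subtractf sub_diff)
  have "p j = up n (Dx j f)" if j: "j < n" for j
  proof -
   \<comment> \<open>Sending y_j to y and the other y_i to 0 isolates the coefficient with index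
     \<open>j\<close>.\<close>
   let ?de = "case_sum xv (%i. if i = j then yv else 0) :: nat + nat => 'k np2"
   have "subst ?de (\<Sum>i<n. sub (np_var (Inr i)) (q i - Dx i f)) \<in> T (V1 n)"
    by (rule T_subst[OF *]) (auto simp: vars2_def V1_def PV_0)
   moreover have "subst ?de (sub (np_var (Inr i)) h) = sub (if i = j then yv else 0) h" for i h
    unfolding sub_def subst_subst by (rule arg_cong[where f = "%ro. subst ro h"]) (auto simp: fun_eq_iff split: sum.split)
   moreover have "(\<Sum>i<n. sub (if i = j then yv else 0) (q i - Dx i f)) = (\<Sum>i<n. if i = j then q j - Dx j f else 0)"
   proof (intro sum.cong refl)
    fix i assume "i \<in> {..<n}"
    hence "q i - Dx i f \<in> One n" using q Dx_One[OF f] One_diff by auto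
    thus "sub (if i = j then yv else 0) (q i - Dx i f) = (if i = j then q j - Dx j f else 0)"
     using lin_0[OF lin_sub_left[OF One_hom]] sub_yv[OF One_PV] by auto
   qed
   ultimately have "q j - Dx j f \<in> T (V1 n)" using j by (simp add: np.ev_sum)
   thus ?thesis using q[OF j] up_eq[OF n _ Dx_One[OF f]] by auto
  qed
  thus "p = ?p" using p by (intro extensionalityI[of p "{..<n}"]) (auto simp: PiE_def)
 qed
 thus ?thesis using i by simp
qed

end

section \<open>Commutators and the Jacobson radical\<close>

context nsvar
begin

lemma left_ideal_sub:
 assumes "left_ideal (Uenv M n) I" "p \<in> One n" "q \<in> One n" "up n q \<in> I" shows "up n (sub q p) \<in> I"
 using assms by (metis U_in U_mult left_ideal_def)

text \<open>Left ideals are additive subgroups by definition; they are subspaces because a scalar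
  \<open>c\<close> acts as multiplication by the element of \<open>U\<close> represented by
  \<open>sc c yv\<close>.\<close>

lemma left_ideal_alt:
 assumes I: "I <= carrier (Uenv M n)"
 shows "left_ideal (Uenv M n) I \<longleftrightarrow> np.subspace {p \<in> One n. up n p \<in> I} \<and>
  (\<forall>p\<in>One n. \<forall>q\<in>One n. up n q \<in> I \<longrightarrow> up n (sub q p) \<in> I)" (is "_ \<longleftrightarrow> ?R")
proof
 interpret u: abelian_group "Uenv M n" by (rule U_ag)
 assume L: "left_ideal (Uenv M n) I"
 then interpret additive_subgroup I "Uenv M n" by (simp add: left_ideal_def)
 have s: "up n (sub q p) \<in> I" if "p \<in> One n" "q \<in> One n" "up n q \<in> I" for p q by (rule left_ideal_sub[OF L that])
 have "np.subspace {p \<in> One n. up n p \<in> I}"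
 proof (rule np.subspaceI)
  show "0 \<in> {p \<in> One n. up n p \<in> I}" using zero_closed by (simp add: One_0 U_zero)
  show "p + q \<in> {p \<in> One n. up n p \<in> I}" if "p \<in> {p \<in> One n. up n p \<in> I}" "q \<in> {p \<in> One n. up n p \<in> I}" for p q
   using that a_closed[of "up n p" "up n q"] by (simp add: One_add U_add)
  show "sc c p \<in> {p \<in> One n. up n p \<in> I}" if "p \<in> {p \<in> One n. up n p \<in> I}" for c p
   using that s[OF One_sc[OF yv_One], of p c] by (simp add: One_sc sub_sc sub_y del: map_single)
 qed
 thus ?R using s by blast
next
 interpret u: abelian_group "Uenv M n" by (rule U_ag)
 assume R: ?R
 hence sp: "np.subspace {p \<in> One n. up n p \<in> I}" by blast
 have c: "\<exists>p\<in>One n. x = up n p" if "x \<in> I" for x using that I by (auto simp: U_carr)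
 have "subgroup I (add_monoid (Uenv M n))"
 proof (rule u.add.subgroupI)
  show "I <= carrier (Uenv M n)" by (rule I)
  show "I \<noteq> {}" using np.subspace_0[OF sp] by auto
 next
  fix x assume x: "x \<in> I"
  then obtain p where p: "p \<in> One n" "x = up n p" using c by blast
  have "sc (- 1) p \<in> {p \<in> One n. up n p \<in> I}" by (rule np.subspace_scale[OF sp]) (use p x in simp)
  hence m: "sc (- 1) p \<in> One n" "up n (sc (- 1) p) \<in> I" by auto
  have "up n (sc (- 1) p) \<oplus>\<^bsub>Uenv M n\<^esub> x = \<zero>\<^bsub>Uenv M n\<^esub>" using p m by (simp add: U_add U_zero)
  hence "\<ominus>\<^bsub>Uenv M n\<^esub> x = up n (sc (- 1) p)" using p m by (intro u.minus_equality) auto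
  thus "\<ominus>\<^bsub>Uenv M n\<^esub> x \<in> I" using m by simp
 next
  fix x y assume xy: "x \<in> I" "y \<in> I"
  then obtain p q where p: "p \<in> One n" "x = up n p" "q \<in> One n" "y = up n q" using c by metis
  have "p + q \<in> {p \<in> One n. up n p \<in> I}" by (rule np.subspace_add[OF sp]) (use p xy in simp_all)
  thus "x \<oplus>\<^bsub>Uenv M n\<^esub> y \<in> I" using p by (simp add: U_add)
 qed
 moreover have "\<forall>r\<in>carrier (Uenv M n). \<forall>a\<in>I. r \<otimes>\<^bsub>Uenv M n\<^esub> a \<in> I"
 proof (intro ballI)
  fix r a assume "r \<in> carrier (Uenv M n)" and a: "a \<in> I"
  then obtain p where p: "p \<in> One n" "r = up n p" by (auto simp: U_carr)
  obtain q where q: "q \<in> One n" "a = up n q" using c[OF a] by blast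
  show "r \<otimes>\<^bsub>Uenv M n\<^esub> a \<in> I" unfolding p q U_mult[OF p(1) q(1)] using R p q a by blast
 qed
 ultimately show "left_ideal (Uenv M n) I" by (simp add: left_ideal_def additive_subgroup_def)
qed

text \<open>If a maximal left ideal \<open>I\<close> missed \<open>a\<close>, then
  \<open>N + I\<close> would be everything and 1 = x + y with x in \<open>N\<close>, y in
  \<open>I\<close>. As x x = 0, multiplication by x from the left gives x = x y, so x and hence 1
  lie in \<open>I\<close>.\<close>

lemma sqz_radical:
 assumes N: "sqz n N" and a: "a \<in> N" shows "up n a \<in> jacobson_radical (Uenv M n)"
proof -
 have sN: "np.subspace N" and NO: "N <= One n" and Nl: "\<And>a p. a \<in> N ==> p \<in> One n ==> sub a p \<in> N"
  and N2: "\<And>a b. a \<in> N ==> b \<in> N ==> sub b a \<in> T (V1 n)" using N by (auto simp: sqz_def)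
 have "up n a \<in> I" if I: "maximal_left_ideal (Uenv M n) I" for I
 proof (rule ccontr)
  assume na: "up n a \<notin> I"
  have LI: "left_ideal (Uenv M n) I" using I by (simp add: maximal_left_ideal_def)
  have IC: "I <= carrier (Uenv M n)"
   using LI subgroup.subset[of I "add_monoid (Uenv M n)"] by (auto simp: left_ideal_def additive_subgroup_def)
  define I' where "I' = {p \<in> One n. up n p \<in> I}"
  have sI: "np.subspace I'" and lI: "\<And>p q. p \<in> One n ==> q \<in> I' ==> sub q p \<in> I'"
   using left_ideal_alt[OF IC] LI unfolding I'_def by (auto intro: sub_One)
  define J' where "J' = {x + y | x y. x \<in> N \<and> y \<in> I'}"
  have sJ: "np.subspace J'" unfolding J'_def by (rule np.subspace_sums[OF sN sI])
  have JO: "J' <= One n" using NO unfolding J'_def I'_def by (auto intro: One_add)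
  have lJ: "sub q p \<in> J'" if p: "p \<in> One n" and q: "q \<in> J'" for p q
  proof -
   obtain x y where "q = x + y" "x \<in> N" "y \<in> I'" using q unfolding J'_def by blast
   thus ?thesis unfolding J'_def using lin_add[OF lin_sub_left[OF One_hom[OF p]], of x y] Nl[OF _ p] lI[OF p] by auto
  qed
  let ?J = "up n ` J'"
  have JC: "?J <= carrier (Uenv M n)" using JO by auto
  have "left_ideal (Uenv M n) ?J"
   unfolding left_ideal_alt[OF JC]
  proof (intro conjI ballI impI)
   show "np.subspace {p \<in> One n. up n p \<in> ?J}"
   proof (rule np.subspaceI)
    show "0 \<in> {p \<in> One n. up n p \<in> ?J}" using np.subspace_0[OF sJ] by (simp add: One_0)
   next
    fix p q assume "p \<in> {p \<in> One n. up n p \<in> ?J}" "q \<in> {p \<in> One n. up n p \<in> ?J}"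
    then obtain p' q' where pq: "p \<in> One n" "q \<in> One n" "p' \<in> J'" "q' \<in> J'" "up n p = up n p'" "up n q = up n q'" by auto
    hence "p' \<in> One n" "q' \<in> One n" using JO by auto
    hence "up n (p + q) = up n (p' + q')" using pq by (simp add: U_add[symmetric])
    thus "p + q \<in> {p \<in> One n. up n p \<in> ?J}" using pq np.subspace_add[OF sJ] by (auto simp: One_add)
   next
    fix c p assume "p \<in> {p \<in> One n. up n p \<in> ?J}"
    then obtain p' where p: "p \<in> One n" "p' \<in> J'" "up n p = up n p'" by auto
    hence "p' \<in> One n" using JO by auto
    hence "up n (sc c p) = up n (sc c p')" using p by (simp add: U_smult[symmetric] del: map_single)
    thus "sc c p \<in> {p \<in> One n. up n p \<in> ?J}" using p np.subspace_scale[OF sJ] by (auto simp: One_sc simp del: map_single)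
   qed
   fix p q assume pq: "p \<in> One n" "q \<in> One n" "up n q \<in> ?J"
   then obtain q' where q': "q' \<in> J'" "up n q = up n q'" by blast
   hence "q' \<in> One n" using JO by auto
   hence "up n (sub q p) = up n (sub q' p)" using pq q' by (simp add: U_mult[symmetric])
   thus "up n (sub q p) \<in> ?J" using lJ[OF pq(1) q'(1)] by blast
  qed
  moreover have "I <= ?J"
  proof
   fix x assume "x \<in> I"
   then obtain p where "p \<in> One n" "x = up n p" "p \<in> I'" using IC by (auto simp: U_carr I'_def)
   thus "x \<in> ?J" using np.subspace_0[OF sN] unfolding J'_def by (intro image_eqI[of _ _ p] CollectI exI[of _ 0] exI[of _ p]) auto
  qed
  moreover have "up n a \<in> ?J" using a np.subspace_0[OF sI] unfolding J'_def by (intro image_eqI[of _ _ a] CollectI exI[of _ a] exI[of _ 0]) auto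
  ultimately have "?J = carrier (Uenv M n)" using I na unfolding maximal_left_ideal_def by blast
  hence "up n yv \<in> ?J" using yv_One by simp
  then obtain x y where xy: "up n yv = up n (x + y)" "x \<in> N" "y \<in> I'" unfolding J'_def by blast
  have yO: "y \<in> One n" "up n y \<in> I" using xy by (auto simp: I'_def)
  have xO: "x \<in> One n" using xy NO by blast
  have "up n x = up n (sub yv x)" using sub_yv[OF One_PV[OF xO]] by simp
  also have "\<dots> = up n (sub (x + y) x)" using U_mult[OF xO yv_One] U_mult[OF xO One_add[OF xO yO(1)]] xy(1) by simp
  also have "\<dots> = up n (sub x x + sub y x)" by (simp add: lin_add[OF lin_sub_left[OF One_hom[OF xO]]])
  also have "\<dots> = up n (sub y x)"
  proof (rule Omega_extI)
   fix f assume f: "f \<in> OP n"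
   have "sub f (sub x x) \<in> T (vars2 n)" by (rule T_sub[OF N2[OF xy(2,2)] OP_PV[OF f] Inl_vars2])
   thus "up n (sub x x + sub y x) (cl2 n f) = up n (sub y x) (cl2 n f)"
    using f xO yO by (simp add: up_cls One_add sub_One cls_eq sub_add)
  qed simp_all
  finally have "up n x \<in> I" using left_ideal_sub[OF LI xO yO] by simp
  hence "x + y \<in> I'" using np.subspace_add[OF sI, of x y] xO xy(3) by (simp add: I'_def)
  hence 1: "up n yv \<in> I" using xy(1) by (simp add: I'_def)
  have "up n p \<in> I" if "p \<in> One n" for p
   using left_ideal_sub[OF LI that yv_One 1] sub_yv[OF One_PV[OF that]] by simp
  thus False using na a NO by blast
 qed
 thus ?thesis using a NO by (auto simp: jacobson_radical_def)
qed

text \<open>Pulls the sum of commutators and radical back to a subspace of polynomials, where it can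
  be compared with \<open>CR\<close>.\<close>

lemma comm_rad_alt: "\<exists>S. np.subspace S \<and> S <= One n \<and> comm_rad M n = up n ` S \<and> (\<forall>p. CR n p \<and> p \<in> One n \<longrightarrow> up n p \<in> up n ` S)"
proof -
 let ?B = "{(p \<otimes>\<^bsub>Uenv M n\<^esub> q) \<ominus>\<^bsub>Uenv M n\<^esub> (q \<otimes>\<^bsub>Uenv M n\<^esub> p) | p q. p \<in> carrier (Uenv M n) \<and> q \<in> carrier (Uenv M n)}"
 let ?C = "lin_span (Uenv M n) ?B" and ?J = "jacobson_radical (Uenv M n)"
 define C' where "C' = {p \<in> One n. up n p \<in> ?C}"
 define J' where "J' = {p \<in> One n. up n p \<in> ?J}"
 have BE: "up n p \<otimes>\<^bsub>Uenv M n\<^esub> up n q \<ominus>\<^bsub>Uenv M n\<^esub> (up n q \<otimes>\<^bsub>Uenv M n\<^esub> up n p) = up n (sub q p - sub p q)"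
  if "p \<in> One n" "q \<in> One n" for p q using that by (simp add: U_mult U_minus sub_One)
 have CO: "x \<in> up n ` One n" if "x \<in> ?C" for x
  using that
 proof induction
  case zero
  thus ?case using One_0 by (auto simp: U_zero)
 next
  case (base a)
  thus ?case using BE by (auto simp: U_carr intro!: imageI One_diff sub_One)
 next
  case (add a b)
  thus ?case by (auto simp: U_add One_add)
 next
  case (scale a c)
  thus ?case by (auto simp: U_smult One_sc simp del: map_single)
 qed
 have sC: "np.subspace C'"
  unfolding C'_def
  by (rule np.subspaceI)
   (auto simp: One_0 One_add One_sc U_zero[symmetric] U_add[symmetric] U_smult[symmetric] intro: lin_span.intros simp del: map_single)
 have JI: "I <= carrier (Uenv M n)" if "maximal_left_ideal (Uenv M n) I" for I
  using that subgroup.subset[of I "add_monoid (Uenv M n)"] by (auto simp: maximal_left_ideal_def left_ideal_def additive_subgroup_def)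
 have sJ: "np.subspace J'"
 proof -
  have i: "np.subspace {p \<in> One n. up n p \<in> I}" if "maximal_left_ideal (Uenv M n) I" for I
   using left_ideal_alt[OF JI[OF that]] that by (auto simp: maximal_left_ideal_def)
  have J: "J' = One n \<inter> (\<Inter>I\<in>{I. maximal_left_ideal (Uenv M n) I}. {p \<in> One n. up n p \<in> I})"
   unfolding J'_def jacobson_radical_def by auto
  show ?thesis
   unfolding J by (intro np.subspace_inter subspace_One np.subspace_Inter) (use i in auto)
 qed
 define S where "S = {x + y | x y. x \<in> C' \<and> y \<in> J'}"
 have sS: "np.subspace S" unfolding S_def by (rule np.subspace_sums[OF sC sJ])
 have SO: "S <= One n" unfolding S_def C'_def J'_def by (auto intro: One_add)
 have "comm_rad M n = {x \<oplus>\<^bsub>Uenv M n\<^esub> y | x y. x \<in> ?C \<and> y \<in> ?J}"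
  unfolding comm_rad_def set_add_def' by blast
 also have "\<dots> = up n ` S"
 proof (intro subset_antisym subsetI)
  fix z assume "z \<in> {x \<oplus>\<^bsub>Uenv M n\<^esub> y | x y. x \<in> ?C \<and> y \<in> ?J}"
  then obtain x y where z: "z = x \<oplus>\<^bsub>Uenv M n\<^esub> y" "x \<in> ?C" "y \<in> ?J" by blast
  obtain p where p: "p \<in> One n" "x = up n p" using CO[OF z(2)] by blast
  obtain q where q: "q \<in> One n" "y = up n q" using z(3) by (auto simp: jacobson_radical_def U_carr)
  have "p \<in> C'" "q \<in> J'" using p q z by (simp_all add: C'_def J'_def)
  hence "p + q \<in> S" unfolding S_def by (intro CollectI exI[of _ p] exI[of _ q] conjI refl)
  thus "z \<in> up n ` S" using p q z by (auto simp: U_add)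
 next
  fix z assume "z \<in> up n ` S"
  then obtain p q where pq: "z = up n (p + q)" "p \<in> C'" "q \<in> J'" unfolding S_def by blast
  hence "z = up n p \<oplus>\<^bsub>Uenv M n\<^esub> up n q" by (simp add: U_add C'_def J'_def)
  moreover have "up n p \<in> ?C" "up n q \<in> ?J" using pq by (simp_all add: C'_def J'_def)
  ultimately show "z \<in> {x \<oplus>\<^bsub>Uenv M n\<^esub> y | x y. x \<in> ?C \<and> y \<in> ?J}" by (intro CollectI exI[of _ "up n p"] exI[of _ "up n q"] conjI)
 qed
 finally have eq: "comm_rad M n = up n ` S" .
 have "up n p \<in> up n ` S" if p: "CR n p" "p \<in> One n" for p
 proof -
  obtain c N \<nu> where c: "c \<in> Cm n" and N: "sqz n N" "\<nu> \<in> N" and t: "p - c - \<nu> \<in> T (V1 n)" using p unfolding CR_def by blast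
  have "Cm n <= C'"
   unfolding Cm_def
  proof (rule np.span_minimal[OF _ sC])
   show "{sub q p - sub p q | p q. p \<in> One n \<and> q \<in> One n} <= C'"
   proof clarify
    fix p q assume pq: "p \<in> One n" "q \<in> One n"
    have "up n (sub q p - sub p q) \<in> ?B" by (intro CollectI exI[of _ "up n p"] exI[of _ "up n q"] conjI U_in pq BE[OF pq, symmetric])
    thus "sub q p - sub p q \<in> C'" unfolding C'_def using pq by (auto intro: lin_span.base One_diff sub_One)
   qed
  qed
  hence cC: "c \<in> C'" using c by blast
  have \<nu>: "\<nu> \<in> J'" using sqz_radical[OF N] N unfolding J'_def sqz_def by auto
  have cn: "c + \<nu> \<in> S" unfolding S_def using cC \<nu> by blast
  \<comment> \<open>Equality is tested on \<open>Omega\<close> directly and not through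
    \<open>up_eq\<close>, which would exclude \<open>n = 0\<close>.\<close>
  have "up n p = up n (c + \<nu>)"
  proof (rule Omega_extI)
   fix f assume f: "f \<in> OP n"
   have "sub f (p - c - \<nu>) \<in> T (vars2 n)" by (rule T_sub[OF t OP_PV[OF f] Inl_vars2])
   thus "up n p (cl2 n f) = up n (c + \<nu>) (cl2 n f)"
    using f p(2) cn SO by (simp add: up_cls cls_eq sub_add sub_diff diff_diff_eq subset_iff)
  qed simp_all
  thus ?thesis using cn by simp
 qed
 thus ?thesis using sS SO eq by blast
qed

lemma divergence_0:
 assumes g: "g \<in> TP n" and tr: "alltr n (\<Sum>i<n. Dx i (g i)) ==> CR n (\<Sum>i<n. Dx i (g i))" "alltr n (\<Sum>i<n. Dx i (g i))"
 shows "divergence M n (derF n g) = comm_rad M n"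
proof -
 from comm_rad_alt[of n] obtain S where "np.subspace S \<and> S <= One n \<and> comm_rad M n = up n ` S \<and>
   (\<forall>p. CR n p \<and> p \<in> One n \<longrightarrow> up n p \<in> up n ` S)" by (rule exE)
 hence S: "np.subspace S" "S <= One n" "comm_rad M n = up n ` S" "\<And>p. CR n p ==> p \<in> One n ==> up n p \<in> up n ` S"
  by simp_all
 have dO: "Dx i (g i) \<in> One n" if "i < n" for i using Dx_One TP[OF g that] by blast
 have "(\<Oplus>\<^bsub>Uenv M n\<^esub>i\<in>{..<n}. fox M n (derF n g (xgen M n i)) i) = up n (\<Sum>i<n. Dx i (g i))"
 proof -
  interpret u: abelian_group "Uenv M n" by (rule U_ag)
  have "(\<Oplus>\<^bsub>Uenv M n\<^esub>i\<in>{..<n}. fox M n (derF n g (xgen M n i)) i) = (\<Oplus>\<^bsub>Uenv M n\<^esub>i\<in>{..<n}. up n (Dx i (g i)))"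
   by (rule u.finsum_cong') (use dO in \<open>auto simp: derF_gen[OF g] fox_cls TP[OF g]\<close>)
  also have "\<dots> = up n (\<Sum>i<n. Dx i (g i))" by (rule U_finsum) (use dO in auto)
  finally show ?thesis .
 qed
 moreover obtain s where s: "s \<in> S" "up n (\<Sum>i<n. Dx i (g i)) = up n s"
  using S(4)[OF tr(1)[OF tr(2)]] One_sum[of "{..<n}" "%i. Dx i (g i)"] dO by auto
 moreover have "comm_rad M n +>\<^bsub>Uenv M n\<^esub> up n s = comm_rad M n"
 proof -
  have "comm_rad M n +>\<^bsub>Uenv M n\<^esub> up n s = {up n a \<oplus>\<^bsub>Uenv M n\<^esub> up n s | a. a \<in> S}"
   unfolding a_r_coset_def' S(3) by blast
  also have "\<dots> = up n ` S"
  proof (intro subset_antisym subsetI)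
   fix x assume "x \<in> {up n a \<oplus>\<^bsub>Uenv M n\<^esub> up n s | a. a \<in> S}"
   then obtain a where a: "a \<in> S" "x = up n a \<oplus>\<^bsub>Uenv M n\<^esub> up n s" by blast
   moreover have "a \<in> One n" "s \<in> One n" using a s S(2) by auto
   ultimately have "x = up n (a + s)" by (simp add: U_add)
   thus "x \<in> up n ` S" using np.subspace_add[OF S(1) a(1) s(1)] by blast
  next
   fix x assume "x \<in> up n ` S"
   then obtain b where b: "b \<in> S" "x = up n b" by blast
   have d: "b - s \<in> S" by (rule np.subspace_diff[OF S(1) b(1) s(1)])
   have "b - s \<in> One n" "s \<in> One n" using d s S(2) by auto
   hence "x = up n (b - s) \<oplus>\<^bsub>Uenv M n\<^esub> up n s" using b by (simp add: U_add)
   thus "x \<in> {up n a \<oplus>\<^bsub>Uenv M n\<^esub> up n s | a. a \<in> S}" using d by blast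
  qed
  finally show ?thesis using S(3) by simp
 qed
 ultimately show ?thesis by (simp add: divergence_def)
qed

end

section \<open>Automorphisms and tangent algebras\<close>

context nsvar
begin

definition autF :: "nat => (nat => (nat, 'k) npoly) => (nat, 'k) npoly set => (nat, 'k) npoly set" where
 "autF n Phi = lft {..<n} {..<n} (subst Phi)"

lemma autF_cls: "Phi \<in> TP n ==> f \<in> PV {..<n} ==> autF n Phi (cl n f) = cl n (subst Phi f)"
 unfolding autF_def by (rule lft_subst_cls) (auto simp: TP_def)

lemma autF_gen: "Phi \<in> TP n ==> j < n ==> autF n Phi (xgen M n j) = cl n (Phi j)"
 by (simp add: gen_def autF_cls)

lemma autF_ext [simp]: "autF n Phi \<in> extensional (carrier (Fr M n))" by (simp add: autF_def)

lemma autF_hom: "Phi \<in> TP n ==> autF n Phi \<in> alg_hom (unital M) (Fr M n) (Fr M n)"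
 unfolding autF_def by (rule lft_alg_hom) (auto simp: TP_def)

lemma subst_TP: "Phi \<in> TP n ==> f \<in> PV {..<n} ==> subst Phi f \<in> PV {..<n}"
 by (rule subst_PP) (auto simp: TP_def)

lemma comp_TP: "Phi \<in> TP n ==> Psi \<in> TP n ==> (%j. subst Phi (Psi j)) \<in> TP n"
 using subst_TP by (auto simp: TP_def)

lemma autF_comp: "Phi \<in> TP n ==> Psi \<in> TP n ==> compose (carrier (Fr M n)) (autF n Phi) (autF n Psi) = autF n (%j. subst Phi (Psi j))"
 by (rule free_extI[where V = "{..<n}"]) (simp_all add: compose_def autF_cls subst_TP comp_TP subst_subst)

lemma autF_eq: "Phi \<in> TP n ==> Psi \<in> TP n ==> autF n Phi = autF n Psi \<longleftrightarrow> (\<forall>j<n. Phi j - Psi j \<in> T {..<n})"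
proof
 assume "Phi \<in> TP n" "Psi \<in> TP n" "autF n Phi = autF n Psi"
 thus "\<forall>j<n. Phi j - Psi j \<in> T {..<n}" using autF_gen by (metis cls_eq)
next
 assume P: "Phi \<in> TP n" "Psi \<in> TP n" and e: "\<forall>j<n. Phi j - Psi j \<in> T {..<n}"
 show "autF n Phi = autF n Psi"
 proof (rule free_extI[where V = "{..<n}"])
  fix f :: "(nat, 'k) npoly" assume f: "f \<in> PV {..<n}"
  have "subst Phi f - subst Psi f \<in> T {..<n}" by (rule subst_tuple_cong[OF _ _ _ f]) (use P e in \<open>auto simp: TP_def\<close>)
  thus "autF n Phi (cl n f) = autF n Psi (cl n f)" using P f by (simp add: autF_cls cls_eq)
 qed simp_all
qed

lemma var_TP: "np_var \<in> TP n" by (simp add: TP_def)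

lemma autF_id: "autF n np_var = (\<lambda>x\<in>carrier (Fr M n). x)"
 by (rule free_extI[where V = "{..<n}"]) (simp_all add: autF_cls var_TP)

lemma hom_autF:
 assumes "phi \<in> extensional (carrier (Fr M n))" "phi \<in> alg_hom (unital M) (Fr M n) (Fr M n)"
 obtains Phi where "Phi \<in> TP n" "phi = autF n Phi"
proof -
 have "\<forall>j\<in>{..<n}. \<exists>f. f \<in> PV {..<n} \<and> phi (xgen M n j) = cl n f"
 proof
  fix j assume "j \<in> {..<n}"
  hence "xgen M n j \<in> carrier (Fr M n)" by (simp add: gen_def)
  moreover have "phi \<in> carrier (Fr M n) \<rightarrow> carrier (Fr M n)" using assms(2) by (simp add: alg_hom_def hom_def)
  ultimately have "phi (xgen M n j) \<in> cl n ` PV {..<n}" unfolding free_carrier[symmetric] by blast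
  thus "\<exists>f. f \<in> PV {..<n} \<and> phi (xgen M n j) = cl n f" by blast
 qed
 then obtain Phi where Phi: "\<And>j. j < n ==> Phi j \<in> PV {..<n}" "\<And>j. j < n ==> phi (xgen M n j) = cl n (Phi j)" by (metis lessThan_iff)
 have "phi = autF n Phi" unfolding autF_def by (rule hom_eq_lft[OF assms]) (use Phi in auto)
 thus thesis using that[of Phi] Phi by (auto simp: TP_def)
qed

definition inv2 :: "nat => (nat => (nat, 'k) npoly) => (nat => (nat, 'k) npoly) => bool" where
 "inv2 n Phi Psi \<longleftrightarrow> (\<forall>j<n. subst Phi (Psi j) - np_var j \<in> T {..<n} \<and> subst Psi (Phi j) - np_var j \<in> T {..<n})"

lemma inv2_comp:
 assumes "Phi \<in> TP n" "Psi \<in> TP n" "inv2 n Phi Psi"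
 shows "compose (carrier (Fr M n)) (autF n Phi) (autF n Psi) = (\<lambda>x\<in>carrier (Fr M n). x)"
  "compose (carrier (Fr M n)) (autF n Psi) (autF n Phi) = (\<lambda>x\<in>carrier (Fr M n). x)"
 using assms by (simp_all add: autF_comp autF_id[symmetric] autF_eq comp_TP var_TP inv2_def)

lemma inv2_Aut:
 assumes P: "Phi \<in> TP n" "Psi \<in> TP n" "inv2 n Phi Psi" shows "autF n Phi \<in> carrier (Au n)"
proof -
 let ?S = "carrier (Fr M n)"
 have c: "autF n Phi x \<in> ?S" "autF n Psi x \<in> ?S" if "x \<in> ?S" for x
  using that P by (auto simp: free_carrier autF_cls subst_TP)
 have "autF n Phi (autF n Psi x) = x" "autF n Psi (autF n Phi x) = x" if x: "x \<in> ?S" for x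
  using inv2_comp(1)[OF P, THEN fun_cong, of x] inv2_comp(2)[OF P, THEN fun_cong, of x] x by (simp_all add: compose_def)
 hence "bij_betw (autF n Phi) ?S ?S"
  using c by (intro bij_betw_byWitness[where f' = "autF n Psi"]) auto
 thus ?thesis using autF_hom[OF P(1)] by (simp add: alg_Aut_def Bij_def)
qed

text \<open>Preimages of the generators provide \<open>Psi\<close> inverse to \<open>Phi\<close> on
  one side; injectivity gives the other side.\<close>

lemma Aut_inv2:
 assumes Phi: "Phi \<in> TP n" and a: "autF n Phi \<in> carrier (Au n)"
 obtains Psi where "Psi \<in> TP n" "inv2 n Phi Psi"
proof -
 let ?S = "carrier (Fr M n)"
 have bij: "bij_betw (autF n Phi) ?S ?S" using a by (simp add: alg_Aut_def Bij_def)
 have "\<forall>j\<in>{..<n}. \<exists>f. f \<in> PV {..<n} \<and> autF n Phi (cl n f) = xgen M n j"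
 proof
  fix j assume "j \<in> {..<n}"
  hence "xgen M n j \<in> ?S" by (simp add: gen_def)
  hence "xgen M n j \<in> autF n Phi ` ?S" using bij by (simp add: bij_betw_def)
  thus "\<exists>f. f \<in> PV {..<n} \<and> autF n Phi (cl n f) = xgen M n j" by (auto simp: free_carrier)
 qed
 then obtain Psi where Psi: "\<And>j. j < n ==> Psi j \<in> PV {..<n}" "\<And>j. j < n ==> autF n Phi (cl n (Psi j)) = xgen M n j" by (metis lessThan_iff)
 have P: "Psi \<in> TP n" using Psi by (simp add: TP_def)
 have 1: "subst Phi (Psi j) - np_var j \<in> T {..<n}" if "j < n" for j
  using Psi(1)[OF that] Psi(2)[OF that] Phi by (simp add: autF_cls gen_def cls_eq)
 have "subst Psi (Phi j) - np_var j \<in> T {..<n}" if j: "j < n" for j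
 proof -
  have p: "Phi j \<in> PV {..<n}" "subst Psi (Phi j) \<in> PV {..<n}" "np_var j \<in> PV {..<n}" using Phi P j subst_TP by (auto simp: TP_def)
  have "subst (%l. subst Phi (Psi l)) (Phi j) - subst np_var (Phi j) \<in> T {..<n}"
   by (rule subst_tuple_cong[OF _ _ _ p(1)]) (use 1 comp_TP[OF Phi P] in \<open>auto simp: TP_def\<close>)
  hence "autF n Phi (cl n (subst Psi (Phi j))) = autF n Phi (cl n (np_var j))"
   using p Phi by (simp add: autF_cls cls_eq subst_subst)
  hence "cl n (subst Psi (Phi j)) = cl n (np_var j)"
   using bij p unfolding bij_betw_def by (meson cls_in inj_onD)
  thus ?thesis by (simp add: cls_eq)
 qed
 thus thesis using that[OF P] 1 by (simp add: inv2_def)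
qed

lemma inv2_sym: "inv2 n Phi Psi ==> inv2 n Psi Phi" by (simp add: inv2_def)

lemma Aut_cases:
 assumes "phi \<in> carrier (Au n)"
 obtains Phi Psi where "Phi \<in> TP n" "Psi \<in> TP n" "inv2 n Phi Psi" "phi = autF n Phi"
proof -
 have "phi \<in> extensional (carrier (Fr M n))" "phi \<in> alg_hom (unital M) (Fr M n) (Fr M n)"
  using assms by (auto simp: alg_Aut_def Bij_def)
 then obtain Phi where "Phi \<in> TP n" "phi = autF n Phi" by (rule hom_autF)
 thus thesis using that assms by (metis Aut_inv2)
qed

lemma Aut_mult:
 assumes "phi \<in> carrier (Au n)" "psi \<in> carrier (Au n)"
 shows "phi \<otimes>\<^bsub>Au n\<^esub> psi = compose (carrier (Fr M n)) phi psi"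
 using assms by (simp add: alg_Aut_def BijGroup_def)

lemma Aut_one: "\<one>\<^bsub>Au n\<^esub> = autF n np_var"
 by (simp add: alg_Aut_def BijGroup_def autF_id)

lemma Aut_group: "group (Au n)"
proof -
 let ?S = "carrier (Fr M n)" and ?K = "alg_hom (unital M) (Fr M n) (Fr M n) \<inter> Bij (carrier (Fr M n))"
 interpret B: group "BijGroup ?S" by (rule group_BijGroup)
 have K: "?K = carrier (Au n)" by (simp add: alg_Aut_def)
 have cB: "carrier (BijGroup ?S) = Bij ?S" by (simp add: BijGroup_def)
 have mB: "phi \<otimes>\<^bsub>BijGroup ?S\<^esub> psi = compose ?S phi psi" if "phi \<in> ?K" "psi \<in> ?K" for phi psi using that by (simp add: BijGroup_def)
 have "subgroup ?K (BijGroup ?S)"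
 proof (rule B.subgroupI)
  show "?K <= carrier (BijGroup ?S)" by (auto simp: cB)
  show "?K \<noteq> {}" unfolding K using inv2_Aut[OF var_TP var_TP] by (auto simp: inv2_def T_0)
 next
  fix phi assume p: "phi \<in> ?K"
  then obtain Phi Psi where P: "Phi \<in> TP n" "Psi \<in> TP n" "inv2 n Phi Psi" "phi = autF n Phi" unfolding K by (rule Aut_cases)
  have q: "autF n Psi \<in> ?K" unfolding K by (rule inv2_Aut[OF P(2,1) inv2_sym[OF P(3)]])
  have "autF n Psi \<otimes>\<^bsub>BijGroup ?S\<^esub> phi = \<one>\<^bsub>BijGroup ?S\<^esub>"
  proof -
   have "autF n Psi \<otimes>\<^bsub>BijGroup ?S\<^esub> phi = compose ?S (autF n Psi) phi" by (rule mB[OF q p])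
   also have "\<dots> = (\<lambda>x\<in>?S. x)" unfolding P(4) by (rule inv2_comp(2)[OF P(1-3)])
   also have "\<dots> = \<one>\<^bsub>BijGroup ?S\<^esub>" by (simp add: BijGroup_def)
   finally show ?thesis .
  qed
  hence "inv\<^bsub>BijGroup ?S\<^esub> phi = autF n Psi" using p q by (intro B.inv_equality) (auto simp: cB)
  thus "inv\<^bsub>BijGroup ?S\<^esub> phi \<in> ?K" using q by simp
 next
  fix phi psi assume pq: "phi \<in> ?K" "psi \<in> ?K"
  obtain Phi Phi' where P: "Phi \<in> TP n" "phi = autF n Phi" using pq(1) unfolding K by (rule Aut_cases)
  obtain Psi Psi' where Q: "Psi \<in> TP n" "psi = autF n Psi" using pq(2) unfolding K by (rule Aut_cases)
  have "compose ?S phi psi \<in> alg_hom (unital M) (Fr M n) (Fr M n)"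
   unfolding P Q autF_comp[OF P(1) Q(1)] by (rule autF_hom[OF comp_TP[OF P(1) Q(1)]])
  moreover have "compose ?S phi psi \<in> Bij ?S" using pq by (intro compose_Bij) auto
  ultimately show "phi \<otimes>\<^bsub>BijGroup ?S\<^esub> psi \<in> ?K" using mB[OF pq] by simp
 qed
 thus ?thesis unfolding alg_Aut_def by (rule subgroup.subgroup_is_group) (rule group_BijGroup)
qed

lemma deg1_split: "(\<forall>m\<in>ks (f :: (nat, 'k) npoly). mdeg d1 m \<le> 1) ==> f = cmp d1 0 f + cmp d1 1 f"
proof -
 assume f: "\<forall>m\<in>ks f. mdeg d1 m \<le> 1"
 have "f \<in> {f. f = cmp d1 0 f + cmp d1 1 f}"
 proof (rule np_subspaceI)
  show "np.subspace {f :: (nat, 'k) npoly. f = cmp d1 0 f + cmp d1 1 f}"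
  proof (rule np.subspaceI)
   fix f g :: "(nat, 'k) npoly" and c
   assume "f \<in> {f. f = cmp d1 0 f + cmp d1 1 f}"
   hence f: "cmp d1 0 f + cmp d1 1 f = f" by simp
   thus "sc c f \<in> {f. f = cmp d1 0 f + cmp d1 1 f}"
    unfolding mem_Collect_eq cmp_sc np.scale_right_distrib[symmetric] by simp
   assume "g \<in> {f. f = cmp d1 0 f + cmp d1 1 f}"
   hence g: "cmp d1 0 g + cmp d1 1 g = g" by simp
   have "cmp d1 0 (f + g) + cmp d1 1 (f + g) = (cmp d1 0 f + cmp d1 1 f) + (cmp d1 0 g + cmp d1 1 g)"
    by (simp add: cmp_add)
   thus "f + g \<in> {f. f = cmp d1 0 f + cmp d1 1 f}" unfolding f g by simp
  qed simp
  fix m assume "m \<in> ks f"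
  hence "mdeg d1 m = 0 \<or> mdeg d1 m = 1" using f by (metis le_neq_implies_less less_one)
  thus "mon m \<in> {f. f = cmp d1 0 f + cmp d1 1 f}" by (auto simp: cmp_mon)
 qed
 thus ?thesis by simp
qed

section \<open>The tangent algebra as a span of homogeneous leading terms\<close>

context
 fixes n :: nat and H :: "((nat, 'k) npoly set => (nat, 'k) npoly set) set"
 assumes H: "subgroup H (Au n)" and Gr: "Gr M n <= H"
begin

definition HH :: "(nat => (nat, 'k) npoly) set" where "HH = {Phi \<in> TP n. autF n Phi \<in> H}"

lemma HA: "phi \<in> H ==> phi \<in> carrier (Au n)"
 using subgroup.subset[OF H] by blast

lemma autgrp_HH: "autgrp M n HH"
proof (unfold_locales)
 show "Phi j \<in> PV {..<n}" if "Phi \<in> HH" "j < n" for Phi j using that by (auto simp: HH_def TP_def)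
next
 fix Phi Psi assume P: "Phi \<in> HH" "Psi \<in> HH"
 hence TP: "Phi \<in> TP n" "Psi \<in> TP n" and h: "autF n Phi \<in> H" "autF n Psi \<in> H" by (auto simp: HH_def)
 have "autF n Phi \<otimes>\<^bsub>Au n\<^esub> autF n Psi \<in> H" by (rule subgroup.m_closed[OF H h])
 thus "(%j. subst Phi (Psi j)) \<in> HH"
  using comp_TP[OF TP] by (simp add: Aut_mult[OF HA[OF h(1)] HA[OF h(2)]] autF_comp[OF TP] HH_def)
next
 fix Phi assume P: "Phi \<in> HH"
 hence TP: "Phi \<in> TP n" and h: "autF n Phi \<in> H" by (auto simp: HH_def)
 interpret Au: group "Au n" by (rule Aut_group)
 obtain Psi where Psi: "Psi \<in> TP n" "inv2 n Phi Psi" by (rule Aut_inv2[OF TP HA[OF h]])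
 have a: "autF n Psi \<in> carrier (Au n)" by (rule inv2_Aut[OF Psi(1) TP inv2_sym[OF Psi(2)]])
 have "autF n Psi \<otimes>\<^bsub>Au n\<^esub> autF n Phi = \<one>\<^bsub>Au n\<^esub>"
  unfolding Aut_mult[OF a HA[OF h]] inv2_comp[OF TP Psi] by (simp add: Aut_one autF_id)
 hence "inv\<^bsub>Au n\<^esub> (autF n Phi) = autF n Psi" using a HA[OF h] by (intro Au.inv_equality) auto
 hence "autF n Psi \<in> H" using subgroup.m_inv_closed[OF H h] by simp
 thus "\<exists>Psi\<in>HH. \<forall>j<n. subst Phi (Psi j) - np_var j \<in> T {..<n} \<and> subst Psi (Phi j) - np_var j \<in> T {..<n}"
  using Psi by (auto simp: HH_def inv2_def)
next
 fix Phi Psi assume P: "Phi \<in> HH" and "\<And>j. j < n ==> Psi j \<in> PV {..<n}" and e: "\<And>j. j < n ==> Psi j - Phi j \<in> T {..<n}"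
 hence TP: "Phi \<in> TP n" "Psi \<in> TP n" by (auto simp: HH_def TP_def)
 have "autF n Psi = autF n Phi" using autF_eq[OF TP(2,1)] e by simp
 thus "Psi \<in> HH" using P TP by (simp add: HH_def)
next
 fix Phi Psi assume P: "\<And>j. j < n ==> Phi j \<in> PV {..<n} \<and> (\<forall>m\<in>ks (Phi j). mdeg d1 m \<le> 1)" "\<And>j. j < n ==> Psi j \<in> PV {..<n}"
  and i: "\<And>j. j < n ==> subst Phi (Psi j) - np_var j \<in> T {..<n} \<and> subst Psi (Phi j) - np_var j \<in> T {..<n}"
 have TP: "Phi \<in> TP n" "Psi \<in> TP n" using P by (auto simp: TP_def)
 have a: "autF n Phi \<in> carrier (Au n)" by (rule inv2_Aut[OF TP]) (use i in \<open>simp add: inv2_def\<close>)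
 have "autF n Phi (xgen M n j) \<in> (if unital M then homog M n 0 <+>\<^bsub>Fr M n\<^esub> homog M n 1 else homog M n 1)" if j: "j < n" for j
 proof -
  have e: "Phi j = cmp d1 0 (Phi j) + cmp d1 1 (Phi j)" using P(1)[OF j] by (intro deg1_split) simp
  have c: "cmp d1 k (Phi j) \<in> PV {..<n}" for k using P(1)[OF j] cmp_PP by blast
  show ?thesis
  proof (cases "unital M")
   case True
   have "cl n (Phi j) = cl n (cmp d1 0 (Phi j)) \<oplus>\<^bsub>Fr M n\<^esub> cl n (cmp d1 1 (Phi j))"
    using e by (simp add: free_add)
   moreover have "cl n (cmp d1 k (Phi j)) \<in> homog M n k" for k using c hom_cmp[of d1 k "Phi j"] by (auto simp: homog_alt)
   ultimately show ?thesis using True j TP by (auto simp: autF_gen set_add_def')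
  next
   case False
   have deg1: "mag_deg d1 t \<ge> 1" for t :: "nat mag" by (induction t) (auto simp: d1_simp)
   have "hom_deg d1 1 (Phi j)"
    unfolding hom_deg_def
   proof
    fix m assume m: "m \<in> ks (Phi j)"
    hence "okm (unital M) {..<n} m" "mdeg d1 m \<le> 1" using P(1)[OF j] by (auto simp: PP_def)
    thus "mdeg d1 m = 1" using False
    proof (cases m)
     case (Some t)
     thus ?thesis using \<open>mdeg d1 m \<le> 1\<close> deg1[of t] by simp
    qed simp
   qed
   thus ?thesis using False j TP P by (auto simp: autF_gen homog_alt)
  qed
 qed
 hence "autF n Phi \<in> Gr M n" using a by (simp add: Gr_def)
 thus "Phi \<in> HH" using Gr TP by (auto simp: HH_def)
qed

interpretation ag: autgrp M n HH by (rule autgrp_HH)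

definition Lt :: "int => (nat => (nat, 'k) npoly) set" where
 "Lt i = {g. \<forall>j<n. g j \<in> PV {..<n} \<and> hom_deg d1 (nat (i + 1)) (g j)}"

text \<open>In positive degrees these are the homogeneous leading terms. \<open>ag.W\<close> also
  contains tuples with terms of higher degree, which the intersection with \<open>Lt\<close>
  removes.\<close>

definition Tt :: "int => (nat => (nat, 'k) npoly) set" where
 "Tt i = (if i \<le> 0 then Lt i else Lt i \<inter> ag.W (nat i))"

lemma Lt_TP: "Lt i <= TP n" by (auto simp: Lt_def TP_def)

lemma subspace_Lt: "tp.subspace (Lt i)"
 by (rule tp.subspaceI)
  (auto simp: Lt_def PV_0 PV_add PV_sc intro: np.subspace_0[OF subspace_hom, unfolded mem_Collect_eq]
   np.subspace_add[OF subspace_hom, unfolded mem_Collect_eq] np.subspace_scale[OF subspace_hom, unfolded mem_Collect_eq])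

lemma subspace_Tt: "tp.subspace (Tt i)"
 unfolding Tt_def using subspace_Lt ag.subspace_W[of "nat i"] by (auto intro: tp.subspace_inter)

lemma Tt_Lt: "Tt i <= Lt i" by (auto simp: Tt_def)

lemma tangent_eq:
 assumes e: "e \<ge> 1" and Phi: "Phi \<in> TP n" and g: "g \<in> Lt (int e)"
  and l: "\<And>j. j < n ==> Phi j - np_var j - g j \<in> G {..<n} (e + 2)"
 shows "tangent M n e (autF n Phi) = derF n g"
proof -
 have gT: "g \<in> TP n" using g Lt_TP by blast
 have ne: "nat (int e + 1) = e + 1" by simp
 show ?thesis
  unfolding tangent_def
 proof (rule der_of_eq[OF gT], rule the_equality)
  fix j assume j: "j < n"
  have gj: "g j \<in> PV {..<n}" "hom_deg d1 (e + 1) (g j)" using g j ne by (auto simp: Lt_def)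
  let ?h = "Phi j - np_var j - g j"
  have hP: "?h \<in> PV {..<n}" using l[OF j] G_PV by blast
  have "cl n ?h \<in> homog_ge M n (e + 2)" using l[OF j] homog_ge_alt[OF hP] by blast
  moreover have "autF n Phi (xgen M n j) = xgen M n j \<oplus>\<^bsub>Fr M n\<^esub> cl n (g j) \<oplus>\<^bsub>Fr M n\<^esub> cl n ?h"
   using j Phi by (simp add: autF_gen) (simp add: gen_def free_add)
  ultimately show "cl n (g j) \<in> homog M n (e + 1) \<and>
   (\<exists>F\<in>homog_ge M n (e + 2). autF n Phi (xgen M n j) = xgen M n j \<oplus>\<^bsub>Fr M n\<^esub> cl n (g j) \<oplus>\<^bsub>Fr M n\<^esub> F)"
   using gj by (auto simp: homog_alt)
  fix x assume x: "x \<in> homog M n (e + 1) \<and>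
   (\<exists>F\<in>homog_ge M n (e + 2). autF n Phi (xgen M n j) = xgen M n j \<oplus>\<^bsub>Fr M n\<^esub> x \<oplus>\<^bsub>Fr M n\<^esub> F)"
  then obtain f F where f: "f \<in> PV {..<n}" "hom_deg d1 (e + 1) f" "x = cl n f"
   and F: "F \<in> homog_ge M n (e + 2)" "autF n Phi (xgen M n j) = xgen M n j \<oplus>\<^bsub>Fr M n\<^esub> x \<oplus>\<^bsub>Fr M n\<^esub> F" by (auto simp: homog_alt)
  obtain h where h: "h \<in> PV {..<n}" "F = cl n h" using F(1) by (auto simp: homog_ge_def graded_part_alt)
  have hG: "h \<in> G {..<n} (e + 2)" using F(1) homog_ge_alt[OF h(1)] h(2) by blast
  have t: "Phi j - (np_var j + f + h) \<in> T {..<n}"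
   using F(2) j Phi unfolding f(3) h(2) by (simp add: autF_gen) (simp add: gen_def free_add cls_eq)
  have "g j - f \<in> G {..<n} (e + 2)"
  proof -
   have "(Phi j - (np_var j + f + h)) + h - ?h \<in> G {..<n} (e + 2)"
    by (intro np.subspace_diff[OF subspace_G] G_add T_G[OF t] hG l[OF j])
   thus ?thesis by simp
  qed
  hence "cmp d1 (e + 1) (g j - f) \<in> T {..<n}" by (rule G_cmp) simp
  hence "f - g j \<in> T {..<n}" using cmp_hom[OF gj(2), of "e + 1"] cmp_hom[OF f(2), of "e + 1"] by (simp add: cmp_diff T_swap)
  thus "x = cl n (g j)" by (simp add: f(3) cls_eq)
 qed
qed

lemma IA_iff:
 assumes "Phi \<in> HH" shows "autF n Phi \<in> IA M n k \<longleftrightarrow> (\<forall>j<n. Phi j - np_var j \<in> G {..<n} (k + 1))"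
proof -
 have TP: "Phi \<in> TP n" "autF n Phi \<in> H" using assms by (auto simp: HH_def)
 have "autF n Phi (xgen M n j) \<ominus>\<^bsub>Fr M n\<^esub> xgen M n j = cl n (Phi j - np_var j)" "Phi j - np_var j \<in> PV {..<n}" if "j < n" for j
  using that TP(1) by (simp_all add: autF_gen) (simp_all add: gen_def free_minus TP_def PV_diff)
 thus ?thesis using HA[OF TP(2)] by (simp add: IA_def homog_ge_alt)
qed

lemma tangent_comp_alt:
 assumes i: "i > 0" shows "tangent_comp M n H (nat i) = derF n ` Tt i"
proof -
 define e where "e = nat i"
 have e: "e \<ge> 1" "int e = i" "nat i = e" using i by (auto simp: e_def)
 have ne: "nat (i + 1) = e + 1" using e by simp
 have T: "Tt i = Lt i \<inter> ag.W e" using i e by (simp add: Tt_def)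
 show ?thesis unfolding e(3)
 proof (intro subset_antisym subsetI)
  fix d assume "d \<in> tangent_comp M n H e"
  then consider "d = \<zero>\<^bsub>Der (Fr M n)\<^esub>" | phi where "phi \<in> H" "phi \<in> IA M n e" "d = tangent M n e phi"
   unfolding tangent_comp_def by blast
  thus "d \<in> derF n ` Tt i"
  proof cases
   case 1
   thus ?thesis using tp.subspace_0[OF subspace_Tt[of i]] by (auto simp: Der_zero zero_fun_def)
  next
   case 2
   obtain Phi Psi where Phi: "Phi \<in> TP n" "phi = autF n Phi" using HA[OF 2(1)] by (rule Aut_cases)
   have HHm: "Phi \<in> HH" using Phi 2 by (simp add: HH_def)
   have gG: "Phi j - np_var j \<in> G {..<n} (e + 1)" if "j < n" for j using 2(2) IA_iff[OF HHm] Phi(2) that by simp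
   define g where "g j = cmp d1 (e + 1) (Phi j - np_var j)" for j
   have gP: "g j \<in> PV {..<n}" if "j < n" for j unfolding g_def by (rule cmp_PP) (use gG[OF that] G_PV in blast)
   have h: "hom_deg d1 (e + 1) (g j)" for j unfolding g_def by (rule hom_cmp)
   have l: "Phi j - np_var j - g j \<in> G {..<n} (e + 2)" if "j < n" for j
    using G_Suc[OF gG[OF that]] by (simp add: g_def)
   have gL: "g \<in> Lt i" using gP h by (simp add: Lt_def ne)
   have "g \<in> ag.W e" unfolding ag.W_def ag.lead_def using HHm l hom_G[OF h gP] by auto
   moreover have "d = derF n g" unfolding 2 Phi by (rule tangent_eq[OF e(1) Phi(1)]) (use gL l e in auto)
   ultimately show ?thesis using gL T by blast
  qed
 next
  fix d assume "d \<in> derF n ` Tt i"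
  then obtain g where g: "g \<in> Lt i" "g \<in> ag.W e" "d = derF n g" unfolding T by blast
  then obtain Phi where Phi: "Phi \<in> HH" "\<And>j. j < n ==> g j \<in> G {..<n} (e + 1)" "\<And>j. j < n ==> Phi j - np_var j - g j \<in> G {..<n} (e + 2)"
   unfolding ag.W_def ag.lead_def by auto
  have TP: "Phi \<in> TP n" "autF n Phi \<in> H" using Phi by (auto simp: HH_def)
  have IAe: "autF n Phi \<in> IA M n e"
   unfolding IA_iff[OF Phi(1)]
  proof (intro allI impI)
   fix j assume j: "j < n"
   have "(Phi j - np_var j - g j) + g j \<in> G {..<n} (e + 1)" by (intro G_add Phi(2)[OF j] G_mono[OF Phi(3)[OF j]]) simp
   thus "Phi j - np_var j \<in> G {..<n} (e + 1)" by simp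
  qed
  have t: "tangent M n e (autF n Phi) = d" unfolding g(3) by (rule tangent_eq[OF e(1) TP(1)]) (use g Phi e in auto)
  show "d \<in> tangent_comp M n H e"
  proof (cases "autF n Phi \<in> IA M n (e + 1)")
   \<comment> \<open>The automorphism may lie deeper in the filtration than \<open>e\<close>. Then
     its leading term consists of identities and \<open>d\<close> is the zero derivation, which
     \<open>tangent_comp\<close> contains by definition.\<close>
   case True
   have "g j - 0 \<in> T {..<n}" if j: "j < n" for j
   proof -
    have "Phi j - np_var j \<in> G {..<n} (e + 1 + 1)" using True IA_iff[OF Phi(1), of "e + 1"] j by blast
    hence "Phi j - np_var j \<in> G {..<n} (e + 2)" by simp
    hence "(Phi j - np_var j) - (Phi j - np_var j - g j) \<in> G {..<n} (e + 2)"
     by (rule np.subspace_diff[OF subspace_G _ Phi(3)[OF j]])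
    hence "cmp d1 (e + 1) (g j) \<in> T {..<n}" by (intro G_cmp[of _ _ "e + 2"]) simp_all
    thus ?thesis using g(1) j cmp_hom[of d1 "e + 1" "g j" "e + 1"] by (simp add: Lt_def ne)
   qed
   moreover have "g \<in> TP n" "(%_. 0) \<in> TP n" using g(1) Lt_TP by (auto simp: TP_def PV_0)
   ultimately have "d = \<zero>\<^bsub>Der (Fr M n)\<^esub>" unfolding g(3) Der_zero using derF_eq by auto
   thus ?thesis by (simp add: tangent_comp_def)
  next
   case False
   thus ?thesis using t IAe TP(2) unfolding tangent_comp_def by blast
  qed
 qed
qed

lemma tangent_comps: "i \<ge> - 1 ==> (if i \<le> 0 then Lpart M n i else tangent_comp M n H (nat i)) = derF n ` Tt i"
 using tangent_comp_alt[of i] by (simp add: Tt_def Lt_def Lpart_alt)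

lemma tangent_alg_alt: "tangent_alg M n H = derF n ` tp.span (\<Union>i\<in>{- 1..}. Tt i)"
 unfolding tangent_alg_def
 by (rule graded_sum_alt[OF tangent_comps subspace_Tt]) (use Tt_Lt Lt_TP in auto)

lemma der_Lt:
 assumes "i \<ge> - 1" "j \<ge> - 1" "g \<in> Lt i" "h \<in> Lt j" "l < n"
 shows "hom_deg d1 (nat (i + j + 1)) (der np_var g (h l))"
proof (cases "j = - 1")
 case True
 hence "hom_deg d1 0 (h l)" using assms by (simp add: Lt_def)
 then obtain c where "h l = sc c (mon None)" using ag.hom0_const by blast
 hence "der np_var g (h l) = 0" by (simp only: der_sc der_mon np.scale_zero_right)
 thus ?thesis by (simp add: hom_deg_def)
next
 case False
 have h: "h l \<in> PV {..<n}" "hom_deg d1 (nat (j + 1)) (h l)" using assms by (auto simp: Lt_def)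
 show ?thesis
 proof (cases "i = - 1")
  case True
  show ?thesis
   by (rule hom_der[OF _ _ h, where a = 1 and b = 0]) (use assms True False in \<open>auto simp: Lt_def d1_simp\<close>)
 next
  case i: False
  show ?thesis
  proof (rule hom_der[OF _ _ h, where a = 0 and b = "nat i"])
   show "\<exists>d. hom_deg d1 d (g v) \<and> d + 0 = d1 v + nat i" if "v \<in> {..<n}" for v
    using assms i that by (intro exI[of _ "nat (i + 1)"]) (auto simp: Lt_def d1_simp)
  qed (use assms False i in \<open>auto simp: d1_simp\<close>)
 qed
qed

lemma brk_Lt:
 assumes "i \<ge> - 1" "j \<ge> - 1" "g \<in> Lt i" "h \<in> Lt j" shows "brk g h \<in> Lt (i + j)"
proof -
 have "brk g h \<in> TP n" using assms Lt_TP by (intro brk_TP) auto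
 moreover have "hom_deg d1 (nat (i + j + 1)) (brk g h l)" if "l < n" for l
  using np.subspace_diff[OF subspace_hom] der_Lt[OF assms that] der_Lt[OF assms(2,1,4,3) that]
  unfolding brk_def by (simp add: add.commute)
 ultimately show ?thesis by (auto simp: Lt_def TP_def)
qed

lemma brk_swap: "brk h g = (%l. sc (- 1) (brk g h l))"
 by (auto simp: brk_def)

lemma brk_Tt_le:
 assumes ij: "- 1 \<le> i" "i \<le> j" and g: "g \<in> Tt i" and h: "h \<in> Tt j" shows "\<exists>k\<ge>- 1. brk g h \<in> Tt k"
proof -
 have L: "g \<in> Lt i" "h \<in> Lt j" using g h Tt_Lt by auto
 have b: "brk g h \<in> Lt (i + j)" using brk_Lt L ij by simp
 consider "i + j \<le> 0" | "i = - 1" "j \<ge> 2" | "i = 0" "j \<ge> 1" | "i \<ge> 1" "j \<ge> 1" using ij by linarith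
 thus ?thesis
 proof cases
  case 1
  show ?thesis
  proof (cases "i + j = - 2")
   case True
   \<comment> \<open>The bracket of two constant derivations. \<open>nat\<close> cuts the degree off
     at 0, so this bracket, which is zero, counts as an element of degree -1.\<close>
   hence "Lt (i + j) = Lt (- 1)" by (simp add: Lt_def)
   thus ?thesis using b by (intro exI[of _ "- 1"]) (simp add: Tt_def)
  next
   case False
   thus ?thesis using 1 b ij by (intro exI[of _ "i + j"]) (simp add: Tt_def)
  qed
 next
  case 2
  have "brk g h \<in> ag.W (nat j - 1)"
   unfolding brk_def by (rule ag.W_Lm1) (use 2 h L in \<open>auto simp: Tt_def Lt_def\<close>)
  moreover have "nat j - 1 = nat (i + j)" using 2 by simp
  ultimately show ?thesis using 2 b by (intro exI[of _ "i + j"]) (simp add: Tt_def)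
 next
  case 3
  have "brk g h \<in> ag.W (nat j)"
   unfolding brk_def by (rule ag.W_L0) (use 3 h L in \<open>auto simp: Tt_def Lt_def\<close>)
  thus ?thesis using 3 b by (intro exI[of _ "i + j"]) (simp add: Tt_def)
 next
  case 4
  have "brk g h \<in> ag.W (nat i + nat j)"
   unfolding brk_def by (rule ag.W_bracket) (use 4 g h in \<open>auto simp: Tt_def\<close>)
  moreover have "nat i + nat j = nat (i + j)" using 4 by simp
  ultimately show ?thesis using 4 b by (intro exI[of _ "i + j"]) (simp add: Tt_def)
 qed
qed

lemma brk_Tt:
 assumes ij: "- 1 \<le> i" "- 1 \<le> j" and g: "g \<in> Tt i" and h: "h \<in> Tt j" shows "\<exists>k\<ge>- 1. brk g h \<in> Tt k"
proof (cases "i \<le> j")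
 case False
 then obtain k where "k \<ge> - 1" "brk h g \<in> Tt k" using brk_Tt_le[OF ij(2) _ h g] by auto
 thus ?thesis using tp.subspace_scale[OF subspace_Tt, of "brk h g" k "- 1"] brk_swap[of g h] by auto
qed (rule brk_Tt_le[OF ij(1) _ g h])

abbreviation "Sp \<equiv> tp.span (\<Union>i\<in>{- 1..}. Tt i)"

lemma Sp_TP: "Sp <= TP n"
 by (rule tp.span_minimal[OF _ subspace_TP]) (use Tt_Lt Lt_TP in blast)

lemma brk_lin: "brk (g + g') h = brk g h + brk g' h" "brk h (g + g') = brk h g + brk h g'"
 "brk (%j. sc c (g j)) h = (%j. sc c (brk g h j))" "brk h (%j. sc c (g j)) = (%j. sc c (brk h g j))"
 by (simp_all add: brk_def plus_fun_def der_tuple_add der_tuple_sc der_add der_sc np.scale_right_diff_distrib fun_eq_iff del: map_single)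

lemma brk_0: "brk 0 h = 0" "brk h 0 = 0"
 using brk_lin(3)[of 0 0 h] brk_lin(4)[of h 0 0] by (simp_all add: zero_fun_def np.scale_zero_left del: map_single)

lemma brk_Sp: "g \<in> Sp ==> h \<in> Sp ==> brk g h \<in> Sp"
proof -
 assume g: "g \<in> Sp" and h: "h \<in> Sp"
 have 1: "brk g h \<in> Sp" if h: "h \<in> Tt j" and j: "j \<ge> - 1" and g: "g \<in> Sp" for g h j
 proof -
  have "Sp <= {g. brk g h \<in> Sp}"
  proof (rule tp.span_minimal)
   show "tp.subspace {g. brk g h \<in> Sp}"
    by (rule tp.subspaceI) (simp_all add: brk_lin brk_0 tp.span_zero tp.span_add tp.span_scale)
   show "(\<Union>i\<in>{- 1..}. Tt i) <= {g. brk g h \<in> Sp}"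
   proof clarify
    fix i g assume "- 1 \<le> (i :: int)" "g \<in> Tt i"
    then obtain k where "k \<ge> - 1" "brk g h \<in> Tt k" using brk_Tt j h by blast
    thus "brk g h \<in> Sp" by (intro tp.span_base) auto
   qed
  qed
  thus ?thesis using g by blast
 qed
 have "Sp <= {h. brk g h \<in> Sp}"
 proof (rule tp.span_minimal)
  show "tp.subspace {h. brk g h \<in> Sp}"
   by (rule tp.subspaceI) (simp_all add: brk_lin brk_0 tp.span_zero tp.span_add tp.span_scale)
  show "(\<Union>i\<in>{- 1..}. Tt i) <= {h. brk g h \<in> Sp}" using 1 g by blast
 qed
 thus ?thesis using h by blast
qed

lemma graded_sum_mono:
 assumes "\<And>i. i \<ge> - 1 ==> C i <= C' i" shows "graded_sum M n C <= graded_sum M n C'"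
proof
 fix x assume "x \<in> graded_sum M n C"
 then obtain N d where d: "x = (\<Oplus>\<^bsub>Der (Fr M n)\<^esub>i\<in>{-1..N}. d i)" "\<forall>i\<in>{-1..N}. d i \<in> C i"
  unfolding graded_sum_def by blast
 have "\<forall>i\<in>{-1..N}. d i \<in> C' i" using d(2) assms by (meson atLeastAtMost_iff subsetD)
 thus "x \<in> graded_sum M n C'" unfolding graded_sum_def using d(1) by blast
qed

text \<open>A leading term comes with an automorphism and its inverse, so all traces of its
  divergence vanish by \<open>trace_Dx_0\<close>. The class of varieties enters through
  \<open>CR\<close> only.\<close>

lemma tangent_subset:
 assumes CR: "\<And>p. p \<in> One n ==> alltr n p ==> CR n p"
 shows "tangent_alg M n H <= SDer_tilde M n"
proof -
 have "(if i \<le> 0 then Lpart M n i else tangent_comp M n H (nat i)) <=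
   (if i \<le> 0 then Lpart M n i else {d \<in> Lpart M n i. divergence M n d = comm_rad M n})" if i: "i \<ge> - 1" for i
 proof (cases "i \<le> 0")
  case False
  have "derF n g \<in> Lpart M n i \<and> divergence M n (derF n g) = comm_rad M n" if g: "g \<in> Tt i" for g
  proof
   have gL: "g \<in> Lt i" using g Tt_Lt by blast
   thus "derF n g \<in> Lpart M n i" unfolding Lpart_alt Lt_def by blast
   have gT: "g \<in> TP n" using gL Lt_TP by blast
   have dO: "Dx j (g j) \<in> One n" if "j < n" for j using Dx_One TP[OF gT that] by blast
   have sO: "(\<Sum>j<n. Dx j (g j)) \<in> One n" using dO by (intro One_sum) auto
   have ni: "nat (i + 1) = nat i + 1" "nat i \<ge> 1" using False by auto
   have "g \<in> ag.W (nat i)" using g False by (simp add: Tt_def)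
   then obtain Phi where Phi: "Phi \<in> HH" "\<And>j. j < n ==> Phi j - np_var j - g j \<in> G {..<n} (nat i + 2)"
    unfolding ag.W_def ag.lead_def by auto
   obtain Psi where Psi: "Psi \<in> HH" "\<And>j. j < n ==> subst Phi (Psi j) - np_var j \<in> T {..<n}" using ag.HH_inv[OF Phi(1)] by blast
   have "alltr n (\<Sum>j<n. Dx j (g j))"
    unfolding alltr_def
   proof (intro allI impI)
    fix I :: "(nat \<times> nat) set" and ro assume r: "rep n I ro"
    have "(\<Sum>a\<in>I. ro (\<Sum>j<n. Dx j (g j)) a a) = (\<Sum>a\<in>I. \<Sum>j<n. ro (Dx j (g j)) a a)"
     by (intro sum.cong refl rep_sum[OF r]) (use dO in auto)
    also have "\<dots> = (\<Sum>j<n. \<Sum>a\<in>I. ro (Dx j (g j)) a a)" by (rule sum.swap)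
    also have "\<dots> = 0"
     by (rule trace_Dx_0[OF r _ _ Psi(2) ni(2) _ Phi(2)])
      (use ag.HH_PV[OF Phi(1)] ag.HH_PV[OF Psi(1)] gL ni in \<open>auto simp: Lt_def\<close>)
    finally show "(\<Sum>a\<in>I. ro (\<Sum>j<n. Dx j (g j)) a a) = 0" .
   qed
   thus "divergence M n (derF n g) = comm_rad M n" by (intro divergence_0[OF gT] CR[OF sO])
  qed
  thus ?thesis using False tangent_comp_alt[of i] by auto
 qed simp
 thus ?thesis unfolding tangent_alg_def SDer_tilde_def by (rule graded_sum_mono)
qed

lemma tangent_subalg:
 assumes "\<And>p. p \<in> One n ==> alltr n p ==> CR n p"
 shows "subalg False (Der (Fr M n) \<lparr>carrier := SDer_tilde M n\<rparr>) (tangent_alg M n H)"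
 unfolding subalg_def
proof (intro conjI ballI allI)
 show "tangent_alg M n H <= carrier (Der (Fr M n) \<lparr>carrier := SDer_tilde M n\<rparr>)"
  using tangent_subset[OF assms] by simp
 show "\<zero>\<^bsub>Der (Fr M n)\<lparr>carrier := SDer_tilde M n\<rparr>\<^esub> \<in> tangent_alg M n H"
  using tp.span_zero[of "\<Union>i\<in>{- 1..}. Tt i"] by (auto simp: tangent_alg_alt Der_zero zero_fun_def)
 fix a b assume "a \<in> tangent_alg M n H" "b \<in> tangent_alg M n H"
 then obtain g h where g: "g \<in> Sp" "a = derF n g" and h: "h \<in> Sp" "b = derF n h" by (auto simp: tangent_alg_alt)
 have TP: "g \<in> TP n" "h \<in> TP n" using g h Sp_TP by auto
 show "a \<oplus>\<^bsub>Der (Fr M n)\<lparr>carrier := SDer_tilde M n\<rparr>\<^esub> b \<in> tangent_alg M n H"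
  using tp.span_add[OF g(1) h(1)] by (simp add: tangent_alg_alt g(2) h(2) Der_add TP plus_fun_def)
 show "a \<otimes>\<^bsub>Der (Fr M n)\<lparr>carrier := SDer_tilde M n\<rparr>\<^esub> b \<in> tangent_alg M n H"
  using brk_Sp[OF g(1) h(1)] by (simp add: tangent_alg_alt g(2) h(2) Der_mult TP)
next
 fix c a assume "a \<in> tangent_alg M n H"
 then obtain g where g: "g \<in> Sp" "a = derF n g" by (auto simp: tangent_alg_alt)
 have TP: "g \<in> TP n" using g Sp_TP by auto
 show "c \<odot>\<^bsub>Der (Fr M n)\<lparr>carrier := SDer_tilde M n\<rparr>\<^esub> a \<in> tangent_alg M n H"
  using tp.span_scale[OF g(1), of c] by (simp add: tangent_alg_alt g(2) Der_smult[OF TP TP])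
qed simp

end

end

theorem theorem2:
  fixes M :: "'k::field_char_0 variety" and n :: nat
    and H :: "((nat, 'k) npoly set \<Rightarrow> (nat, 'k) npoly set) set"
  assumes "is_variety M"
    and "nielsen_schreier TYPE('v::infinite) M
       \<or> identities M = associative_ids
       \<or> identities M = associative_ids \<union> commutative_ids
       \<or> (\<not> unital M \<and> identities M = lie_ids \<union> metabelian_ids)"
    and "subgroup H (alg_Aut (unital M) (Fr M n))"
    and "Gr M n \<subseteq> H"
  shows "subalg False (Der (Fr M n) \<lparr>carrier := SDer_tilde M n\<rparr>) (tangent_alg M n H)"
proof -
 interpret nsvar M by (rule nsvar.intro[OF assms(1)])
 show ?thesis
  using assms(2) by (intro tangent_subalg[OF assms(3,4)]) (auto intro: NS_CR assoc_CR comm_CR metabelian_CR)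
qed

end
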